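(* Let $d\ge 2$, let $\Omega\subset\mathbb{R}^d$ be open and bounded with $C^2$ boundary, let $f\in L^2(\Omega)$, and let the holes $T_\varepsilon$ and the perforated sets $\Omega_\varepsilon=\Omega\setminus T_\varepsilon$ be constructed as in the context. Let $u^\varepsilon\in H_0^1(\Omega_\varepsilon)$ be the solution of $-\Delta u^\varepsilon=f$ in $\Omega_\varepsilon$, extended by zero to an element of $H_0^1(\Omega)$. Then, as $\varepsilon\to0$, $u^\varepsilon$ converges weakly in $H_0^1(\Omega)$ to $u$, where $u\in H_0^1(\Omega)$ solves $$(-\Delta+V)u=f\quad\text{in }\Omega,\qquad V=\mu_d\sum_{k=1}^m\tilde\mu_k N_k 1_{F_k}.$$
   Context: Notation: $|\cdot|$ is Lebesgue measure on $\mathbb{R}^d$; $B(x,R)=\{y\in\mathbb{R}^d : |x-y|<R\}$; $1_E$ is the indicator function of $E$; $\bigsqcup$ denotes a union of pairwise disjoint sets; $S_d$ is the surface area of $\partial B(0,1)$. Equations are understood in the weak (distributional) sense. Class of sets: $\mathcal{J}=\{E\subset\mathbb{R}^d : |\partial E|=0\}$. Construction of the holes: Let $m\in\mathbb{N}$, let $F_1,\dots,F_m\in\mathcal{J}$ be pairwise disjoint, and let $N_1,\dots,N_m$ be positive integers. Let $A\subset\mathbb{R}^d$ be measurable and bounded and $\Lambda\subset\mathbb{R}^d$ countable such that $\mathbb{R}^d=\bigsqcup_{i\in\Lambda}(A+i)$. Let $C>0$ satisfy $|A|>\max_{k\le m}N_k|B(0,C)|$. For $\varepsilon>0$ and $i\in\Lambda$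 put $A_i^\varepsilon=\varepsilon(A+i)=\{\varepsilon x : x\in A+i\}$, and for $E\subset\mathbb{R}^d$ put $\Lambda_\varepsilon^-(E)=\{i\in\Lambda : A_i^\varepsilon\subset E\}$. For each $\varepsilon>0$, $k\le m$ and $i\in\Lambda_\varepsilon^-(F_k)$, points $x_{i,j}^\varepsilon\in\mathbb{R}^d$ ($j=1,\dots,N_k$) are given such that, for all sufficiently small $\varepsilon$, the balls $B(x_{i,j}^\varepsilon,C\varepsilon)$, $j=1,\dots,N_k$, are pairwise disjoint and contained in $A_i^\varepsilon$. The radii $a_{\varepsilon,k}>0$ satisfy $a_{\varepsilon,k}<C\varepsilon$ for all sufficiently small $\varepsilon$ and, for each $1\le k\le m$, as $\varepsilon\to0$, $$\varepsilon^{-2}(-\log a_{\varepsilon,k})^{-1}\to\tilde\mu_k\ \ (d=2),\qquad \varepsilon^{-d}(a_{\varepsilon,k})^{d-2}\to\tilde\mu_k\ \ (d\ge3),$$ with $\tilde\mu_k\in[0,\infty)$. Set $$T_{\varepsilon,k}=\bigsqcup_{i\in\Lambda_\varepsilon^-(F_k),\,j\le N_k}\overline{B(x_{i,j}^\varepsilon,a_{\varepsilon,k})},\quad T_\varepsilon=\bigsqcup_{k=1}^mT_{\varepsilon,k},\quad \Omega_\varepsilon=\Omega\setminus T_\varepsilon.$$ Constant: $\mu_d=\frac{S_d}{|A|}$ if $d=2$ and $\mu_d=\frac{S_d}{|A|}(d-2)$ if $d\ge3$. *)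

theory Defs
  imports "HOL-Analysis.Analysis"
begin

text \<open>Meant for open \<open>U\<close>: the derivatives are taken at points of the full space.\<close>

primrec Ck_on :: "nat \<Rightarrow> 'a::euclidean_space set \<Rightarrow> ('a \<Rightarrow> real) \<Rightarrow> bool" where
  "Ck_on 0 U f \<longleftrightarrow> continuous_on U f"
| "Ck_on (Suc k) U f \<longleftrightarrow>
    (\<exists>f'. (\<forall>x\<in>U. (f has_derivative f' x) (at x)) \<and> (\<forall>v. Ck_on k U (\<lambda>x. f' x v)))"

definition test_functions :: "'a::euclidean_space set \<Rightarrow> ('a \<Rightarrow> real) set" where
  "test_functions U =
    {\<phi>. (\<forall>k. Ck_on k UNIV \<phi>) \<and> compact (closure {x. \<phi> x \<noteq> 0}) \<and> closure {x. \<phi> x \<noteq> 0} \<subseteq> U}"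

definition gradient :: "('a::euclidean_space \<Rightarrow> real) \<Rightarrow> 'a \<Rightarrow> 'a" where
  "gradient \<phi> x = (\<Sum>b\<in>Basis. frechet_derivative \<phi> (at x) b *\<^sub>R b)"

text \<open>
  The boundary is locally the graph of a \<open>C\<^sup>2\<close> function over the hyperplane orthogonal to a unit
  vector \<open>\<nu>\<close>, with \<open>\<Omega>\<close> on one side only. The graph function \<open>\<gamma>\<close> is only evaluated on that
  hyperplane; a \<open>C\<^sup>2\<close> function there extends to the whole space, constantly in direction \<open>\<nu>\<close>.
\<close>

definition C2_boundary :: "'a::euclidean_space set \<Rightarrow> bool" where
  "C2_boundary \<Omega> \<longleftrightarrow>
    (\<forall>p\<in>frontier \<Omega>. \<exists>r>0. \<exists>\<nu> \<gamma>. norm \<nu> = 1 \<and> Ck_on 2 UNIV \<gamma> \<and>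
      \<Omega> \<inter> ball p r = {x \<in> ball p r. x \<bullet> \<nu> > \<gamma> (x - (x \<bullet> \<nu>) *\<^sub>R \<nu>)})"

text \<open>
  Elements of the spaces below are functions on the whole space of which only the values in \<open>U\<close>
  matter, and they are not identified when equal almost everywhere.
\<close>

definition L2 :: "'a::euclidean_space set \<Rightarrow> ('a \<Rightarrow> 'b::euclidean_space) set" where
  "L2 U = {g. g \<in> borel_measurable (lebesgue_on U) \<and> integrable (lebesgue_on U) (\<lambda>x. (norm (g x))\<^sup>2)}"

text \<open>The identity is vector valued: it collects the integrations by parts in all coordinates.\<close>

definition is_weak_gradient ::
  "'a::euclidean_space set \<Rightarrow> ('a \<Rightarrow> real) \<Rightarrow> ('a \<Rightarrow> 'a) \<Rightarrow> bool" where
  "is_weak_gradient U u g \<longleftrightarrow>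
    (\<forall>\<phi>\<in>test_functions U.
      (LINT x|lebesgue_on U. u x *\<^sub>R gradient \<phi> x) = - (LINT x|lebesgue_on U. \<phi> x *\<^sub>R g x))"

definition H1 :: "'a::euclidean_space set \<Rightarrow> ('a \<Rightarrow> real) set" where
  "H1 U = {u \<in> L2 U. \<exists>g\<in>L2 U. is_weak_gradient U u g}"

text \<open>For open \<open>U\<close> and \<open>u \<in> H1 U\<close> the choice is unique up to null sets.\<close>

definition weak_gradient :: "'a::euclidean_space set \<Rightarrow> ('a \<Rightarrow> real) \<Rightarrow> 'a \<Rightarrow> 'a" where
  "weak_gradient U u = (SOME g. g \<in> L2 U \<and> is_weak_gradient U u g)"

definition H1_norm :: "'a::euclidean_space set \<Rightarrow> ('a \<Rightarrow> real) \<Rightarrow> real" where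
  "H1_norm U u =
    sqrt ((LINT x|lebesgue_on U. (u x)\<^sup>2) + (LINT x|lebesgue_on U. (norm (weak_gradient U u x))\<^sup>2))"

definition H10 :: "'a::euclidean_space set \<Rightarrow> ('a \<Rightarrow> real) set" where
  "H10 U = {u \<in> H1 U. \<exists>\<phi>. (\<forall>n::nat. \<phi> n \<in> test_functions U) \<and>
    (\<lambda>n. H1_norm U (\<lambda>x. u x - \<phi> n x)) \<longlonglongrightarrow> 0}"

text \<open>Boundedness makes these functionals invariant under changes on null sets.\<close>

definition H10_dual :: "'a::euclidean_space set \<Rightarrow> (('a \<Rightarrow> real) \<Rightarrow> real) set" where
  "H10_dual U = {l.
    (\<forall>u\<in>H10 U. \<forall>v\<in>H10 U. l (\<lambda>x. u x + v x) = l u + l v) \<and>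
    (\<forall>c. \<forall>u\<in>H10 U. l (\<lambda>x. c * u x) = c * l u) \<and>
    (\<exists>K. \<forall>u\<in>H10 U. \<bar>l u\<bar> \<le> K * H1_norm U u)}"

definition weakly_tends_H10 ::
  "'a::euclidean_space set \<Rightarrow> ('i \<Rightarrow> 'a \<Rightarrow> real) \<Rightarrow> ('a \<Rightarrow> real) \<Rightarrow> 'i filter \<Rightarrow> bool" where
  "weakly_tends_H10 U w u F \<longleftrightarrow>
    (\<forall>\<^sub>F e in F. w e \<in> H10 U) \<and> u \<in> H10 U \<and>
    (\<forall>l\<in>H10_dual U. ((\<lambda>e. l (w e)) \<longlongrightarrow> l u) F)"

definition weak_solution ::
  "'a::euclidean_space set \<Rightarrow> ('a \<Rightarrow> real) \<Rightarrow> ('a \<Rightarrow> real) \<Rightarrow> ('a \<Rightarrow> real) \<Rightarrow> bool" where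
  "weak_solution U V f u \<longleftrightarrow> u \<in> H10 U \<and>
    (\<forall>\<phi>\<in>test_functions U.
      (LINT x|lebesgue_on U. weak_gradient U u x \<bullet> gradient \<phi> x + V x * u x * \<phi> x)
        = (LINT x|lebesgue_on U. f x * \<phi> x))"

definition zero_ext :: "'a set \<Rightarrow> ('a \<Rightarrow> real) \<Rightarrow> 'a \<Rightarrow> real" where
  "zero_ext U u x = (if x \<in> U then u x else 0)"

definition null_boundary_sets :: "'a::euclidean_space set set" where
  "null_boundary_sets = {E. emeasure lebesgue (frontier E) = 0}"

definition cell :: "'a::euclidean_space set \<Rightarrow> real \<Rightarrow> 'a \<Rightarrow> 'a set" where
  "cell A \<epsilon> i = (\<lambda>y. \<epsilon> *\<^sub>R (y + i)) ` A"

definition inner_cells ::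
  "'a::euclidean_space set \<Rightarrow> 'a set \<Rightarrow> real \<Rightarrow> 'a set \<Rightarrow> 'a set" where
  "inner_cells A \<Lambda> \<epsilon> E = {i \<in> \<Lambda>. cell A \<epsilon> i \<subseteq> E}"

text \<open>
  \<open>x \<epsilon> i j\<close> needs no index \<open>k\<close>: for nonempty \<open>A\<close> and disjoint \<open>F k\<close>, each \<open>i\<close> is an inner cell
  of at most one \<open>F k\<close>.
\<close>

definition holes ::
  "'a::euclidean_space set \<Rightarrow> 'a set \<Rightarrow> nat \<Rightarrow> (nat \<Rightarrow> 'a set) \<Rightarrow> (nat \<Rightarrow> nat) \<Rightarrow>
    (real \<Rightarrow> 'a \<Rightarrow> nat \<Rightarrow> 'a) \<Rightarrow> (real \<Rightarrow> nat \<Rightarrow> real) \<Rightarrow> real \<Rightarrow> 'a set" where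
  "holes A \<Lambda> m F N x a \<epsilon> =
    (\<Union>k\<in>{1..m}. \<Union>i\<in>inner_cells A \<Lambda> \<epsilon> (F k). \<Union>j\<in>{1..N k}. cball (x \<epsilon> i j) (a \<epsilon> k))"

text \<open>
  Surface measure on the unit sphere, by the polar coordinates formula: the dimension times the
  volume of the cone over \<open>E\<close> with apex at the origin.
\<close>

definition sphere_area :: "'a::euclidean_space set \<Rightarrow> real" where
  "sphere_area E = real DIM('a) * measure lebesgue {t *\<^sub>R y |t y. 0 < t \<and> t \<le> 1 \<and> y \<in> E}"

definition mu_const :: "'a::euclidean_space set \<Rightarrow> real" where
  "mu_const A =
    (if DIM('a) = 2 then sphere_area (sphere (0::'a) 1) / measure lebesgue A
     else sphere_area (sphere (0::'a) 1) / measure lebesgue A * (real DIM('a) - 2))"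

end

theory Submission
  imports Defs
begin

text \<open>
  Energy method with an explicit oscillating corrector \<open>z\<close>: around each hole of radius \<open>a\<close>, \<open>z\<close> is
  a truncated fundamental solution, cut off smoothly at distance \<open>C\<epsilon>\<close> and scaled to equal \<open>1\<close> on
  the boundary of the hole. For a test function \<open>\<phi>\<close> on \<open>\<Omega>\<close>, the function \<open>(1 - z) \<phi>\<close> vanishes on the
  holes and is admissible in the perforated problem. Integrating by parts moves all derivatives of \<open>z\<close>
  to \<open>\<Delta>z\<close>, which outside the holes is a bounded density carried by the cells. The solution being
  bounded in \<open>H\<^sub>0\<^sup>1\<close>, this density may be replaced, up to \<open>O(\<epsilon>)\<close>, by its cell averages, and these
  converge strongly in \<open>L\<^sup>2\<close> to \<open>V\<close> because the \<open>F\<^sub>k\<close> have null boundaries; moreover \<open>z \<rightarrow> 0\<close> in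
  \<open>L\<^sup>2\<close>. So the bilinear form of the limit problem, applied to the solutions and \<open>\<phi>\<close>, converges
  without any compactness argument. Since bounded functionals on \<open>H\<^sub>0\<^sup>1(\<Omega>)\<close> are represented by that form
  (by minimisation) and test functions are dense, weak convergence follows.
\<close>

section \<open>Smooth functions\<close>

text \<open>The obstacle is that the gradient of \<open>z\<close> does not tend to 0: at the
  critical hole size its energy is in general of order one, and this leaves the potential behind. A
  product of gradient \<open>z\<close> with the gradient of the solution therefore cannot be
  estimated; it has to be removed exactly, by integrating by parts against the solution until
  \<open>z\<close> occurs undifferentiated. The smooth cutoff, instead of a fundamental solution
  stopped at distance \<open>C \<epsilon>\<close>, makes the Laplacian of \<open>z\<close> a bounded
  function and not a surface measure. The constant is a flux balance. With
  \<open>R = C \<epsilon>\<close> and height \<open>b\<close>, one hole carries the total charge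
  \<open>b R^(d-2) S_d\<close>; there are \<open>N_k\<close> holes in a cell of volume
  \<open>\<epsilon>^d |A|\<close>; and \<open>b R^(d-2) / \<epsilon>^d\<close> tends to
  \<open>\<mu>_k\<close> for d = 2 and to \<open>(d-2) \<mu>_k\<close> for d at least 3. A second
  obstacle: \<open>1 - z\<close> vanishes only up to the boundary of the holes, while the weak
  equation admits compactly supported smooth functions only. So neither
  \<open>(1 - z) \<phi>\<close> nor the solution may be inserted directly; both are reached as L2
  limits of test functions together with their gradients.\<close>

lemma Ck_on_continuous: "Ck_on k U f \<Longrightarrow> continuous_on U f"
proof (cases k)
  case (Suc l)
  assume "Ck_on k U f"
  then obtain f' where "\<And>x. x \<in> U \<Longrightarrow> (f has_derivative f' x) (at x)" using Suc by auto
  then show ?thesis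
    by (meson continuous_at_imp_continuous_on has_derivative_continuous)
qed auto

lemma Ck_on_mono_Suc: "Ck_on (Suc k) U f \<Longrightarrow> Ck_on k U f"
proof (induction k arbitrary: f)
  case 0
  then show ?case using Ck_on_continuous[of "Suc 0" U f] by simp
next
  case (Suc k)
  then obtain f' where "\<forall>x\<in>U. (f has_derivative f' x) (at x)" "\<forall>v. Ck_on (Suc k) U (\<lambda>x. f' x v)"
    by (metis Ck_on.simps(2))
  then show ?case using Suc.IH by (metis Ck_on.simps(2))
qed

lemma Ck_on_SucI:
  "(\<And>x. x \<in> U \<Longrightarrow> (f has_derivative f' x) (at x)) \<Longrightarrow> (\<And>v. Ck_on k U (\<lambda>x. f' x v)) \<Longrightarrow> Ck_on (Suc k) U f"
  by auto

lemma Ck_on_cong: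
  assumes "open U" "\<And>x. x \<in> U \<Longrightarrow> f x = g x"
  shows "Ck_on k U f \<longleftrightarrow> Ck_on k U g"
proof -
  have "Ck_on k U g" if "Ck_on k U f" "\<And>x. x \<in> U \<Longrightarrow> f x = g x" for f g
    using that
  proof (cases k)
    case 0
    then show ?thesis using that continuous_on_cong[of U U f g] by simp
  next
    case (Suc l)
    with that(1) obtain f' where f': "\<forall>x\<in>U. (f has_derivative f' x) (at x)" "\<forall>v. Ck_on l U (\<lambda>x. f' x v)"
      by auto
    have "\<forall>x\<in>U. (g has_derivative f' x) (at x)"
      using f'(1) has_derivative_transform_within_open[OF _ assms(1)] that(2) by blast
    with f'(2) Suc show ?thesis by auto
  qed
  then show ?thesis using assms(2) by metis
qed

text \<open>A derivative at a point of the full space is unique, so the existential witness can be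
  replaced by the canonical \<open>frechet_derivative\<close>. Gluing over a union needs this,
  because the witnesses obtained on the two pieces need not agree as total functions.\<close>

lemma Ck_on_Suc_iff:
  assumes "open U"
  shows "Ck_on (Suc k) U f \<longleftrightarrow>
    (\<forall>x\<in>U. f differentiable (at x)) \<and> (\<forall>v. Ck_on k U (\<lambda>x. frechet_derivative f (at x) v))"
proof
  assume "Ck_on (Suc k) U f"
  then obtain f' where f': "\<forall>x\<in>U. (f has_derivative f' x) (at x)" "\<forall>v. Ck_on k U (\<lambda>x. f' x v)"
    by auto
  have "frechet_derivative f (at x) = f' x" if "x \<in> U" for x
    using f'(1) that frechet_derivative_at by metis
  then have "Ck_on k U (\<lambda>x. frechet_derivative f (at x) v)" for v
    using f'(2) Ck_on_cong[OF assms, of "\<lambda>x. frechet_derivative f (at x) v" "\<lambda>x. f' x v"] by auto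
  then show "(\<forall>x\<in>U. f differentiable (at x)) \<and> (\<forall>v. Ck_on k U (\<lambda>x. frechet_derivative f (at x) v))"
    using f'(1) differentiable_def by blast
next
  assume "(\<forall>x\<in>U. f differentiable (at x)) \<and> (\<forall>v. Ck_on k U (\<lambda>x. frechet_derivative f (at x) v))"
  then show "Ck_on (Suc k) U f"
    using frechet_derivative_works by (intro Ck_on_SucI) auto
qed

lemma Ck_on_Un:
  assumes "open U" "open W"
  shows "Ck_on k U f \<Longrightarrow> Ck_on k W f \<Longrightarrow> Ck_on k (U \<union> W) f"
proof (induction k arbitrary: f)
  case 0
  then show ?case using continuous_on_open_Un[OF assms] by auto
next
  case (Suc k)
  then show ?case using assms by (auto simp only: Ck_on_Suc_iff open_Un)
qed

lemma Ck_on_subset: "Ck_on k U f \<Longrightarrow> W \<subseteq> U \<Longrightarrow> Ck_on k W f"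
proof (induction k arbitrary: f)
  case 0
  then show ?case using continuous_on_subset by auto
next
  case (Suc k)
  from Suc.prems obtain f' where f': "\<forall>x\<in>U. (f has_derivative f' x) (at x)" "\<forall>v. Ck_on k U (\<lambda>x. f' x v)"
    by auto
  then show ?case using Suc.IH Suc.prems(2) by (intro Ck_on_SucI) auto
qed

lemma Ck_on_const: "Ck_on k U (\<lambda>x. c)"
proof (induction k arbitrary: c)
  case (Suc k)
  show ?case using Suc by (intro Ck_on_SucI[where f' = "\<lambda>_ _. 0"]) auto
qed auto

lemma Ck_on_linear: "bounded_linear f \<Longrightarrow> Ck_on k U f"
  by (cases k)
    (auto simp: linear_continuous_on Ck_on_const intro!: exI[of _ "\<lambda>_. f"] bounded_linear_imp_has_derivative)

lemma Ck_on_add: "Ck_on k U f \<Longrightarrow> Ck_on k U g \<Longrightarrow> Ck_on k U (\<lambda>x. f x + g x)"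
proof (induction k arbitrary: f g)
  case 0
  then show ?case by (auto intro: continuous_on_add)
next
  case (Suc k)
  obtain f' g' where "\<forall>x\<in>U. (f has_derivative f' x) (at x)" "\<forall>v. Ck_on k U (\<lambda>x. f' x v)"
    "\<forall>x\<in>U. (g has_derivative g' x) (at x)" "\<forall>v. Ck_on k U (\<lambda>x. g' x v)"
    using Suc.prems by auto
  then show ?case using Suc.IH
    by (intro Ck_on_SucI[where f' = "\<lambda>x v. f' x v + g' x v"]) (auto intro: has_derivative_add)
qed

lemma Ck_on_mult: "Ck_on k U f \<Longrightarrow> Ck_on k U g \<Longrightarrow> Ck_on k U (\<lambda>x. f x * g x)"
proof (induction k arbitrary: f g)
  case 0
  then show ?case by (auto intro: continuous_on_mult)
next
  case (Suc k)
  obtain f' g' where "\<forall>x\<in>U. (f has_derivative f' x) (at x)" "\<forall>v. Ck_on k U (\<lambda>x. f' x v)"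
    "\<forall>x\<in>U. (g has_derivative g' x) (at x)" "\<forall>v. Ck_on k U (\<lambda>x. g' x v)"
    using Suc.prems by auto
  moreover have "Ck_on k U f" "Ck_on k U g"
    using Suc.prems Ck_on_mono_Suc by blast+
  ultimately show ?case using Suc.IH
    by (intro Ck_on_SucI[where f' = "\<lambda>x v. f x * g' x v + f' x v * g x"])
      (auto intro!: has_derivative_mult Ck_on_add)
qed

text \<open>The outer function is scalar, so the chain rule produces a product of the inner
  derivative with a scalar function of \<open>f\<close>. The induction over \<open>k\<close> can
  therefore stay within scalar outer functions.\<close>

lemma Ck_on_compose:
  fixes h :: "real \<Rightarrow> real"
  assumes "f ` U \<subseteq> W"
  shows "Ck_on k W h \<Longrightarrow> Ck_on k U f \<Longrightarrow> Ck_on k U (\<lambda>x. h (f x))"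
proof (induction k arbitrary: h)
  case 0
  then show ?case using continuous_on_compose2[of W h U f] assms by auto
next
  case (Suc k)
  obtain f' h' where f': "\<forall>x\<in>U. (f has_derivative f' x) (at x)" "\<forall>v. Ck_on k U (\<lambda>x. f' x v)"
    and h': "\<forall>x\<in>W. (h has_derivative h' x) (at x)" "\<forall>v. Ck_on k W (\<lambda>x. h' x v)"
    using Suc.prems by auto
  have lin: "h' y v = v * h' y 1" if "y \<in> W" for y v
  proof -
    have "linear (h' y)" using h' that has_derivative_linear by blast
    then have "h' y (v *\<^sub>R 1) = v *\<^sub>R h' y 1" by (rule linear_scale)
    then show ?thesis by simp
  qed
  show ?case
  proof (rule Ck_on_SucI[where f' = "\<lambda>x v. f' x v * h' (f x) 1"])
    fix x assume x: "x \<in> U"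
    then have fx: "f x \<in> W" using assms by auto
    have "((\<lambda>x. h (f x)) has_derivative (\<lambda>v. h' (f x) (f' x v))) (at x)"
      using has_derivative_compose[of f "f' x" x UNIV h "h' (f x)"] f' h' x fx by auto
    then show "((\<lambda>x. h (f x)) has_derivative (\<lambda>v. f' x v * h' (f x) 1)) (at x)"
      by (simp only: lin[OF fx, of "f' x _"])
  next
    fix v
    have "Ck_on k U (\<lambda>x. h' (f x) 1)"
      using Suc.IH[of "\<lambda>y. h' y 1"] h' Suc.prems Ck_on_mono_Suc by blast
    then show "Ck_on k U (\<lambda>x. f' x v * h' (f x) 1)"
      using f' by (intro Ck_on_mult) auto
  qed
qed

section \<open>Functions that are smooth of every order\<close>

definition smooth_on :: "'a::euclidean_space set \<Rightarrow> ('a \<Rightarrow> real) \<Rightarrow> bool" where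
  "smooth_on U f \<longleftrightarrow> (\<forall>k. Ck_on k U f)"

lemma smooth_on_const [simp, intro]: "smooth_on U (\<lambda>x. c)"
  by (simp add: smooth_on_def Ck_on_const)

lemma smooth_on_linear: "bounded_linear f \<Longrightarrow> smooth_on U f"
  by (simp add: smooth_on_def Ck_on_linear)

lemma smooth_on_ident [simp, intro]: "smooth_on U (\<lambda>x. x)"
  by (simp add: smooth_on_linear bounded_linear_ident)

lemma smooth_on_add [intro]: "smooth_on U f \<Longrightarrow> smooth_on U g \<Longrightarrow> smooth_on U (\<lambda>x. f x + g x)"
  by (simp add: smooth_on_def Ck_on_add)

lemma smooth_on_mult [intro]: "smooth_on U f \<Longrightarrow> smooth_on U g \<Longrightarrow> smooth_on U (\<lambda>x. f x * g x)"
  by (simp add: smooth_on_def Ck_on_mult)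

lemma smooth_on_minus [intro]: "smooth_on U f \<Longrightarrow> smooth_on U (\<lambda>x. - f x)"
  using smooth_on_mult[of U "\<lambda>_. -1" f] by auto

lemma smooth_on_diff [intro]: "smooth_on U f \<Longrightarrow> smooth_on U g \<Longrightarrow> smooth_on U (\<lambda>x. f x - g x)"
  using smooth_on_add[of U f "\<lambda>x. - g x"] by auto

lemma smooth_on_sum [intro]: "(\<And>i. i \<in> I \<Longrightarrow> smooth_on U (f i)) \<Longrightarrow> smooth_on U (\<lambda>x. \<Sum>i\<in>I. f i x)"
  by (induction I rule: infinite_finite_induct) auto

lemma smooth_on_prod [intro]: "(\<And>i. i \<in> I \<Longrightarrow> smooth_on U (f i)) \<Longrightarrow> smooth_on U (\<lambda>x. \<Prod>i\<in>I. f i x)"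
  by (induction I rule: infinite_finite_induct) auto

lemma smooth_on_power [intro]: "smooth_on U f \<Longrightarrow> smooth_on U (\<lambda>x. f x ^ n)"
  by (induction n) auto

lemma smooth_on_compose: "smooth_on W h \<Longrightarrow> smooth_on U f \<Longrightarrow> f ` U \<subseteq> W \<Longrightarrow> smooth_on U (\<lambda>x. h (f x))"
  by (simp add: smooth_on_def Ck_on_compose)

lemma smooth_on_cong: "open U \<Longrightarrow> (\<And>x. x \<in> U \<Longrightarrow> f x = g x) \<Longrightarrow> smooth_on U f \<longleftrightarrow> smooth_on U g"
  unfolding smooth_on_def using Ck_on_cong[of U f g] by auto

lemma smooth_on_Un: "open U \<Longrightarrow> open W \<Longrightarrow> smooth_on U f \<Longrightarrow> smooth_on W f \<Longrightarrow> smooth_on (U \<union> W) f"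
  by (simp add: smooth_on_def Ck_on_Un)

lemma smooth_on_subset: "smooth_on U f \<Longrightarrow> W \<subseteq> U \<Longrightarrow> smooth_on W f"
  unfolding smooth_on_def using Ck_on_subset by blast

lemma smooth_on_continuous: "smooth_on U f \<Longrightarrow> continuous_on U f"
  unfolding smooth_on_def using Ck_on_continuous by blast

lemma smooth_on_frechet:
  assumes "smooth_on U f" "open U"
  shows "smooth_on U (\<lambda>x. frechet_derivative f (at x) v)"
    "x \<in> U \<Longrightarrow> (f has_derivative frechet_derivative f (at x)) (at x)"
  using assms Ck_on_Suc_iff[OF assms(2), of _ f] frechet_derivative_works unfolding smooth_on_def by blast+

lemma smooth_on_realI:
  fixes f :: "real \<Rightarrow> real"
  assumes "\<And>x. x \<in> U \<Longrightarrow> (f has_real_derivative f' x) (at x)" "smooth_on U f'"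
  shows "smooth_on U f"
  unfolding smooth_on_def
proof
  fix k
  have "Ck_on (Suc k) U f"
    using assms unfolding smooth_on_def
    by (intro Ck_on_SucI[where f' = "\<lambda>x v. f' x * v"] Ck_on_mult)
      (auto simp: has_field_derivative_def Ck_on_const)
  then show "Ck_on k U f" by (rule Ck_on_mono_Suc)
qed

lemma smooth_on_realD:
  fixes f :: "real \<Rightarrow> real"
  assumes "smooth_on U f" "open U"
  shows "\<And>x. x \<in> U \<Longrightarrow> (f has_real_derivative deriv f x) (at x)" "smooth_on U (deriv f)"
proof -
  have d: "(f has_real_derivative deriv f x) (at x)" "deriv f x = frechet_derivative f (at x) 1" if "x \<in> U" for x
  proof -
    have "(f has_derivative frechet_derivative f (at x)) (at x)"
      using smooth_on_frechet[OF assms] that by blast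
    then show "(f has_real_derivative deriv f x) (at x)"
      by (metis DERIV_deriv_iff_real_differentiable differentiableI)
    then have "frechet_derivative f (at x) = (*) (deriv f x)"
      unfolding has_field_derivative_def using frechet_derivative_at by metis
    then show "deriv f x = frechet_derivative f (at x) 1" by simp
  qed
  show "smooth_on U (deriv f)"
    using smooth_on_frechet(1)[OF assms, of 1] smooth_on_cong[OF assms(2), of "deriv f"] d(2) by auto
  show "\<And>x. x \<in> U \<Longrightarrow> (f has_real_derivative deriv f x) (at x)" using d by auto
qed

text \<open>The derivative is again a polynomial in \<open>inverse\<close>, so closure under
  products carries the induction.\<close>

lemma smooth_on_inverse: "smooth_on {0<..} (inverse :: real \<Rightarrow> real)"
  unfolding smooth_on_def
proof
  fix k show "Ck_on k {0<..} (inverse :: real \<Rightarrow> real)"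
  proof (induction k)
    case 0
    show ?case by (auto intro!: continuous_intros)
  next
    case (Suc k)
    show ?case
      using Ck_on_mult[OF Ck_on_mult[OF Suc Suc] Ck_on_const[where c = "- v" for v]]
      by (intro Ck_on_SucI[where f' = "\<lambda>x v. inverse x * inverse x * - v"])
        (auto intro!: derivative_eq_intros simp del: mult_minus_right)
  qed
qed

lemma smooth_on_divide:
  fixes g :: "'a::euclidean_space \<Rightarrow> real"
  assumes "smooth_on U f" "smooth_on U g" "\<And>x. x \<in> U \<Longrightarrow> g x > 0"
  shows "smooth_on U (\<lambda>x. f x / g x)"
  unfolding divide_inverse using assms
  by (intro smooth_on_mult smooth_on_compose[OF smooth_on_inverse assms(2)]) auto

lemma smooth_on_exp: "smooth_on U (exp :: real \<Rightarrow> real)"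
  unfolding smooth_on_def
proof
  fix k show "Ck_on k U (exp :: real \<Rightarrow> real)"
  proof (induction k)
    case 0
    show ?case by (auto intro!: continuous_intros)
  next
    case (Suc k)
    show ?case
      using Ck_on_mult[OF Suc Ck_on_const]
      by (intro Ck_on_SucI[where f' = "\<lambda>x v. exp x * v"])
        (auto intro!: derivative_eq_intros)
  qed
qed

lemma smooth_on_ln: "smooth_on {0<..} (ln :: real \<Rightarrow> real)"
  by (rule smooth_on_realI[OF _ smooth_on_inverse]) (auto intro!: derivative_eq_intros simp: divide_inverse)

lemma smooth_on_powr: "smooth_on {0<..} (\<lambda>x::real. x powr p)"
proof -
  have "smooth_on {0<..} (\<lambda>x::real. exp (p * ln x))"
    by (rule smooth_on_compose[OF smooth_on_exp[of UNIV]]) (auto intro: smooth_on_ln)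
  then show ?thesis
    using smooth_on_cong[of "{0<..}" "\<lambda>x::real. x powr p" "\<lambda>x. exp (p * ln x)"] by (auto simp: powr_def)
qed

section \<open>Flat functions and the smooth step\<close>

definition flat_exp :: "real \<Rightarrow> real" where
  "flat_exp t = (if t > 0 then exp (- inverse t) else 0)"

text \<open>The powers of \<open>inverse t\<close> close the family under differentiation, so all
  orders follow by one induction. At \<open>t = 0\<close> the convention
  \<open>inverse 0 = 0\<close> and \<open>flat_exp 0 = 0\<close> make both sides vanish as
  required.\<close>

lemma flat_exp_deriv:
  "((\<lambda>t. inverse t ^ n * flat_exp t) has_real_derivative
     - real n * (inverse t ^ Suc n * flat_exp t) + inverse t ^ (n + 2) * flat_exp t) (at t)"
proof -
  consider "t > 0" | "t < 0" | "t = 0" by linarith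
  then show ?thesis
  proof cases
    case 1
    have "((\<lambda>t. inverse t ^ n * exp (- inverse t)) has_real_derivative
      - real n * (inverse t ^ Suc n * flat_exp t) + inverse t ^ (n + 2) * flat_exp t) (at t)"
    proof -
      have "((\<lambda>t. inverse t ^ n) has_real_derivative - real n * inverse t ^ Suc n) (at t)"
      proof (cases n)
        case (Suc l)
        have "t \<noteq> 0" using 1 by simp
        then show ?thesis unfolding Suc
          by (intro DERIV_cong[OF DERIV_power[OF DERIV_inverse]]) (simp_all add: algebra_simps)
      qed simp
      moreover have "((\<lambda>t. exp (- inverse t)) has_real_derivative exp (- inverse t) * (inverse t * inverse t)) (at t)"
        using 1 by (auto intro!: derivative_eq_intros)
      ultimately show ?thesis
        by (rule DERIV_cong[OF DERIV_mult]) (use 1 in \<open>simp add: flat_exp_def algebra_simps\<close>)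
    qed
    then show ?thesis
      by (rule has_field_derivative_transform_within_open[where S = "{0<..}"]) (use 1 in \<open>auto simp: flat_exp_def\<close>)
  next
    case 2
    have "((\<lambda>t. 0) has_real_derivative
      - real n * (inverse t ^ Suc n * flat_exp t) + inverse t ^ (n + 2) * flat_exp t) (at t)"
      using 2 by (auto simp: flat_exp_def)
    then show ?thesis
      by (rule has_field_derivative_transform_within_open[where S = "{..<0}"]) (use 2 in \<open>auto simp: flat_exp_def\<close>)
  next
    case 3
    \<comment> \<open>The exponential beats every power, used with x = 1/h. The exponent is n + 1
      because the difference quotient at 0 contributes one more factor 1/h.\<close>
    have "((\<lambda>x. x ^ Suc n / exp x) \<longlongrightarrow> 0) (at_top :: real filter)"
      by (rule tendsto_power_div_exp_0)
    then have "((\<lambda>h. inverse h ^ Suc n / exp (inverse h)) \<longlongrightarrow> 0) (at_right (0::real))"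
      by (rule filterlim_compose) (rule filterlim_inverse_at_top_right)
    moreover have "\<forall>\<^sub>F h in at_right (0::real). inverse h ^ Suc n / exp (inverse h) = inverse h ^ Suc n * flat_exp h"
      by (auto simp: eventually_at_filter flat_exp_def exp_minus divide_inverse)
    ultimately have "((\<lambda>h. inverse h ^ Suc n * flat_exp h) \<longlongrightarrow> 0) (at_right (0::real))"
      using tendsto_cong by fast
    moreover have "((\<lambda>h. inverse h ^ Suc n * flat_exp h) \<longlongrightarrow> 0) (at_left (0::real))"
      by (rule tendsto_eventually) (auto simp: eventually_at_filter flat_exp_def)
    ultimately have "((\<lambda>h. inverse h ^ Suc n * flat_exp h) \<longlongrightarrow> 0) (at (0::real))"
      by (simp add: filterlim_split_at)
    then have "((\<lambda>h. (inverse h ^ n * flat_exp h - 0) / h) \<longlongrightarrow> 0) (at (0::real))"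
      by (simp add: field_simps)
    then show ?thesis
      using 3 by (simp add: has_field_derivative_iff flat_exp_def)
  qed
qed

lemma smooth_on_flat_exp: "smooth_on UNIV flat_exp"
proof -
  have "Ck_on k UNIV (\<lambda>t. inverse t ^ n * flat_exp t)" for k n
  proof (induction k arbitrary: n)
    case 0
    have "isCont (\<lambda>t. inverse t ^ n * flat_exp t) x" for x
      using flat_exp_deriv DERIV_isCont by blast
    then show ?case by (simp add: continuous_on_eq_continuous_at)
  next
    case (Suc k)
    show ?case
    proof (rule Ck_on_SucI)
      show "((\<lambda>t. inverse t ^ n * flat_exp t) has_derivative
        (\<lambda>v. (- real n * (inverse t ^ Suc n * flat_exp t) + inverse t ^ (n + 2) * flat_exp t) * v)) (at t)" for t
        using flat_exp_deriv[of n t] unfolding has_field_derivative_def .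
      show "Ck_on k UNIV (\<lambda>t. (- real n * (inverse t ^ Suc n * flat_exp t) + inverse t ^ (n + 2) * flat_exp t) * v)" for v
        by (intro Ck_on_mult Ck_on_add Ck_on_const Suc)
    qed
  qed
  from this[of _ 0] show ?thesis by (simp add: smooth_on_def)
qed

text \<open>A smooth transition from 0 to 1 over the unit interval. The denominator is positive
  because t and 1 - t are never both nonpositive.\<close>

definition smooth_step :: "real \<Rightarrow> real" where
  "smooth_step t = flat_exp t / (flat_exp t + flat_exp (1 - t))"

lemma flat_exp_nonneg: "flat_exp t \<ge> 0" by (simp add: flat_exp_def)

lemma flat_exp_sum_pos: "flat_exp t + flat_exp (1 - t) > 0"
  by (auto simp: flat_exp_def add_pos_pos)

lemma smooth_on_smooth_step: "smooth_on UNIV smooth_step"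
proof -
  have "smooth_on UNIV (\<lambda>t. flat_exp (1 - t))"
    by (rule smooth_on_compose[OF smooth_on_flat_exp]) auto
  then have "smooth_on UNIV (\<lambda>t. flat_exp t / (flat_exp t + flat_exp (1 - t)))"
    using smooth_on_flat_exp flat_exp_sum_pos by (intro smooth_on_divide smooth_on_add) auto
  then show ?thesis unfolding smooth_step_def .
qed

lemma smooth_step_0: "t \<le> 0 \<Longrightarrow> smooth_step t = 0"
  and smooth_step_1: "t \<ge> 1 \<Longrightarrow> smooth_step t = 1"
  by (auto simp: smooth_step_def flat_exp_def)

lemma smooth_step_nonneg: "0 \<le> smooth_step t"
  and smooth_step_le_1: "smooth_step t \<le> 1"
  using flat_exp_nonneg[of t] flat_exp_nonneg[of "1 - t"] flat_exp_sum_pos[of t]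
  by (auto simp: smooth_step_def divide_simps)

section \<open>Square integrable functions\<close>

text \<open>Formulated for an arbitrary measure and for vector values, so that functions and
  gradients share one calculus. Functions equal almost everywhere are not identified, hence
  \<open>nrm2\<close> is only a seminorm.\<close>

definition sqi :: "'a measure \<Rightarrow> ('a \<Rightarrow> 'b::euclidean_space) \<Rightarrow> bool" where
  "sqi M f \<longleftrightarrow> f \<in> borel_measurable M \<and> integrable M (\<lambda>x. (norm (f x))\<^sup>2)"

definition nrm2 :: "'a measure \<Rightarrow> ('a \<Rightarrow> 'b::euclidean_space) \<Rightarrow> real" where
  "nrm2 M f = sqrt (LINT x|M. (norm (f x))\<^sup>2)"

lemma L2_iff_sqi: "f \<in> L2 U \<longleftrightarrow> sqi (lebesgue_on U) f"
  by (simp add: L2_def sqi_def)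

lemma sqi_measurable [measurable_dest]: "sqi M f \<Longrightarrow> f \<in> borel_measurable M"
  by (simp add: sqi_def)

lemma sqi_dominated:
  fixes f :: "'a \<Rightarrow> 'b::euclidean_space" and g :: "'a \<Rightarrow> 'c::euclidean_space"
  assumes "sqi M g" "f \<in> borel_measurable M" "AE x in M. norm (f x) \<le> K * norm (g x)"
  shows "sqi M f"
proof -
  note [measurable] = assms(2) sqi_measurable[OF assms(1)]
  have "integrable M (\<lambda>x. K\<^sup>2 * (norm (g x))\<^sup>2)" using assms(1) by (simp add: sqi_def)
  then have "integrable M (\<lambda>x. (norm (f x))\<^sup>2)"
  proof (rule Bochner_Integration.integrable_bound)
    show "AE x in M. norm ((norm (f x))\<^sup>2) \<le> norm (K\<^sup>2 * (norm (g x))\<^sup>2)"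
      using assms(3)
    proof eventually_elim
      case (elim x)
      then show ?case using power_mono[OF elim, of 2] by (simp add: power_mult_distrib)
    qed
  qed measurable
  then show ?thesis using assms(2) by (simp add: sqi_def)
qed

lemma nrm2_nonneg [simp]: "nrm2 M f \<ge> 0"
  by (simp add: nrm2_def)

lemma nrm2_power2: "(nrm2 M f)\<^sup>2 = (LINT x|M. (norm (f x))\<^sup>2)"
  by (simp add: nrm2_def)

lemma nrm2_mono:
  fixes f :: "'a \<Rightarrow> 'b::euclidean_space" and g :: "'a \<Rightarrow> 'c::euclidean_space"
  assumes "sqi M g" "f \<in> borel_measurable M" "AE x in M. norm (f x) \<le> K * norm (g x)" "K \<ge> 0"
  shows "nrm2 M f \<le> K * nrm2 M g"
proof -
  have "sqi M f" using sqi_dominated assms by blast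
  have "(nrm2 M f)\<^sup>2 \<le> (K * nrm2 M g)\<^sup>2"
    unfolding power_mult_distrib nrm2_power2 integral_mult_right_zero[symmetric]
  proof (rule integral_mono_AE)
    show "AE x in M. (norm (f x))\<^sup>2 \<le> K\<^sup>2 * (norm (g x))\<^sup>2"
      using assms(3)
    proof eventually_elim
      case (elim x)
      then show ?case using power_mono[OF elim, of 2] by (simp add: power_mult_distrib)
    qed
  qed (use \<open>sqi M f\<close> assms(1) in \<open>auto simp: sqi_def\<close>)
  then show ?thesis by (rule power2_le_imp_le) (use assms(4) in simp)
qed

lemma sqi_inner_norm:
  fixes f :: "'a \<Rightarrow> 'b::euclidean_space" and g :: "'a \<Rightarrow> 'c::euclidean_space"
  assumes f: "sqi M f" and g: "sqi M g"
  shows "integrable M (\<lambda>x. norm (f x) * norm (g x))"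
proof -
  note [measurable] = sqi_measurable[OF f] sqi_measurable[OF g]
  have "integrable M (\<lambda>x. (norm (f x))\<^sup>2 + (norm (g x))\<^sup>2)"
    using assms by (simp add: sqi_def)
  then show ?thesis
  proof (rule Bochner_Integration.integrable_bound)
    have "norm (f x) * norm (g x) \<le> (norm (f x))\<^sup>2 + (norm (g x))\<^sup>2" for x
      using sum_squares_bound[of "norm (f x)" "norm (g x)"]
        mult_nonneg_nonneg[of "norm (f x)" "norm (g x)"] norm_ge_zero[of "f x"] norm_ge_zero[of "g x"]
      by linarith
    then show "AE x in M. norm (norm (f x) * norm (g x)) \<le> norm ((norm (f x))\<^sup>2 + (norm (g x))\<^sup>2)"
      by (intro AE_I2) (simp add: abs_mult)
  qed measurable
qed

lemma sqi_inner:
  fixes f g :: "'a \<Rightarrow> 'b::euclidean_space"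
  assumes f: "sqi M f" and g: "sqi M g"
  shows "integrable M (\<lambda>x. f x \<bullet> g x)"
  by (rule Bochner_Integration.integrable_bound[OF sqi_inner_norm[OF assms]])
    (use assms in \<open>auto simp: Cauchy_Schwarz_ineq2 sqi_measurable\<close>)

lemma sqi_mult:
  fixes f g :: "'a \<Rightarrow> real"
  shows "sqi M f \<Longrightarrow> sqi M g \<Longrightarrow> integrable M (\<lambda>x. f x * g x)"
  using sqi_inner[of M f g] by simp

text \<open>Includes the degenerate case \<open>c = 0\<close>. It serves twice: for the
  Cauchy-Schwarz inequality, and with \<open>a = 0\<close> to extract the Euler-Lagrange equation of
  a minimiser.\<close>

lemma quadratic_nonneg_discriminant:
  fixes a b c :: real
  assumes "\<And>t. 0 \<le> a - 2 * t * b + t\<^sup>2 * c" "c \<ge> 0"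
  shows "b\<^sup>2 \<le> a * c"
proof (cases "c = 0")
  case True
  have "b = 0"
  proof (rule ccontr)
    assume "b \<noteq> 0"
    \<comment> \<open>With this t the affine expression equals a - (a + 1) = -1.\<close>
    with assms(1)[of "(a + 1) / (2 * b)"] True show False by (simp add: field_simps)
  qed
  then show ?thesis using True by simp
next
  case False
  have "0 \<le> (a - 2 * (b / c) * b + (b / c)\<^sup>2 * c) * c"
    using assms(1)[of "b / c"] assms(2) by (intro mult_nonneg_nonneg) auto
  also have "(a - 2 * (b / c) * b + (b / c)\<^sup>2 * c) * c = a * c - b\<^sup>2"
    using False by (simp add: field_simps power2_eq_square)
  finally show ?thesis by simp
qed

text \<open>Working with products of norms lets the two factors have different codomains, as in
  products of a function with a gradient.\<close>

lemma nrm2_Cauchy_Schwarz_norm: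
  fixes f :: "'a \<Rightarrow> 'b::euclidean_space" and g :: "'a \<Rightarrow> 'c::euclidean_space"
  assumes f: "sqi M f" and g: "sqi M g"
  shows "(LINT x|M. norm (f x) * norm (g x)) \<le> nrm2 M f * nrm2 M g"
proof -
  let ?I = "LINT x|M. norm (f x) * norm (g x)"
  have i: "integrable M (\<lambda>x. (norm (f x))\<^sup>2)" "integrable M (\<lambda>x. (norm (g x))\<^sup>2)"
    "integrable M (\<lambda>x. norm (f x) * norm (g x))"
    using assms sqi_inner_norm by (auto simp: sqi_def)
  have "?I\<^sup>2 \<le> (nrm2 M f)\<^sup>2 * (nrm2 M g)\<^sup>2"
  proof (rule quadratic_nonneg_discriminant)
    fix t :: real
    have "0 \<le> (LINT x|M. (norm (f x) - t * norm (g x))\<^sup>2)" by simp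
    also have "(LINT x|M. (norm (f x) - t * norm (g x))\<^sup>2) =
      (LINT x|M. (norm (f x))\<^sup>2 - 2 * t * (norm (f x) * norm (g x)) + t\<^sup>2 * (norm (g x))\<^sup>2)"
      by (intro Bochner_Integration.integral_cong) (auto simp: power2_eq_square algebra_simps)
    also have "\<dots> = (nrm2 M f)\<^sup>2 - 2 * t * ?I + t\<^sup>2 * (nrm2 M g)\<^sup>2"
      using i by (simp add: nrm2_power2)
    finally show "0 \<le> (nrm2 M f)\<^sup>2 - 2 * t * ?I + t\<^sup>2 * (nrm2 M g)\<^sup>2" .
  qed auto
  then have "?I\<^sup>2 \<le> (nrm2 M f * nrm2 M g)\<^sup>2" by (simp add: power_mult_distrib)
  then show ?thesis by (rule power2_le_imp_le) simp
qed

lemma nrm2_Cauchy_Schwarz: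
  fixes f g :: "'a \<Rightarrow> 'b::euclidean_space"
  assumes f: "sqi M f" and g: "sqi M g"
  shows "\<bar>LINT x|M. f x \<bullet> g x\<bar> \<le> nrm2 M f * nrm2 M g"
proof -
  have "\<bar>LINT x|M. f x \<bullet> g x\<bar> \<le> (LINT x|M. \<bar>f x \<bullet> g x\<bar>)" by simp
  also have "\<dots> \<le> (LINT x|M. norm (f x) * norm (g x))"
    using sqi_inner[OF assms] sqi_inner_norm[OF assms]
    by (intro integral_mono) (auto simp: Cauchy_Schwarz_ineq2)
  also have "\<dots> \<le> nrm2 M f * nrm2 M g" by (rule nrm2_Cauchy_Schwarz_norm[OF assms])
  finally show ?thesis .
qed

lemma nrm2_Cauchy_Schwarz_real:
  fixes f g :: "'a \<Rightarrow> real"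
  shows "sqi M f \<Longrightarrow> sqi M g \<Longrightarrow> \<bar>LINT x|M. f x * g x\<bar> \<le> nrm2 M f * nrm2 M g"
  using nrm2_Cauchy_Schwarz[of M f g] by simp

lemma sqi_add:
  assumes f: "sqi M f" and g: "sqi M g"
  shows "sqi M (\<lambda>x. f x + g x)"
proof -
  note [measurable] = sqi_measurable[OF f] sqi_measurable[OF g]
  have "integrable M (\<lambda>x. (norm (f x))\<^sup>2 + 2 * (f x \<bullet> g x) + (norm (g x))\<^sup>2)"
    using assms sqi_inner[OF f g] by (simp add: sqi_def)
  also have "(\<lambda>x. (norm (f x))\<^sup>2 + 2 * (f x \<bullet> g x) + (norm (g x))\<^sup>2) = (\<lambda>x. (norm (f x + g x))\<^sup>2)"
    by (auto simp: power2_norm_eq_inner inner_add inner_commute)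
  finally show ?thesis by (simp add: sqi_def)
qed

lemma sqi_uminus: "sqi M f \<Longrightarrow> sqi M (\<lambda>x. - f x)"
  by (auto simp: sqi_def)

lemma nrm2_uminus: "nrm2 M (\<lambda>x. - f x) = nrm2 M f"
  by (simp add: nrm2_def)

lemma sqi_diff: "sqi M f \<Longrightarrow> sqi M g \<Longrightarrow> sqi M (\<lambda>x. f x - g x)"
  using sqi_add[of M f "\<lambda>x. - g x"] sqi_uminus[of M g] by simp

lemma nrm2_diff_commute: "nrm2 M (\<lambda>x. f x - g x) = nrm2 M (\<lambda>x. g x - f x)"
  by (simp add: nrm2_def norm_minus_commute)

lemma sqi_zero [simp, intro]: "sqi M (\<lambda>x. 0)"
  by (simp add: sqi_def)

lemma nrm2_zero [simp]: "nrm2 M (\<lambda>x. 0) = 0"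
  by (simp add: nrm2_def)

lemma nrm2_triangle:
  assumes f: "sqi M f" and g: "sqi M g"
  shows "nrm2 M (\<lambda>x. f x + g x) \<le> nrm2 M f + nrm2 M g"
proof -
  have "(nrm2 M (\<lambda>x. f x + g x))\<^sup>2 = (LINT x|M. (norm (f x))\<^sup>2 + 2 * (f x \<bullet> g x) + (norm (g x))\<^sup>2)"
    unfolding nrm2_power2
    by (intro Bochner_Integration.integral_cong) (auto simp: power2_norm_eq_inner inner_add inner_commute)
  also have "\<dots> = (nrm2 M f)\<^sup>2 + 2 * (LINT x|M. f x \<bullet> g x) + (nrm2 M g)\<^sup>2"
    using assms sqi_inner[OF f g] by (simp add: nrm2_power2 sqi_def)
  also have "\<dots> \<le> (nrm2 M f + nrm2 M g)\<^sup>2"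
    using nrm2_Cauchy_Schwarz[OF f g] by (simp add: power2_sum)
  finally show ?thesis by (rule power2_le_imp_le) simp
qed

lemma nrm2_triangle_diff:
  assumes f: "sqi M f" and g: "sqi M g"
  shows "nrm2 M (\<lambda>x. f x - g x) \<le> nrm2 M f + nrm2 M g"
  using nrm2_triangle[OF f sqi_uminus[OF g]] by (simp add: nrm2_uminus)

lemma nrm2_diff_bound:
  assumes f: "sqi M f" and g: "sqi M g"
  shows "\<bar>nrm2 M f - nrm2 M g\<bar> \<le> nrm2 M (\<lambda>x. f x - g x)"
  using nrm2_triangle[OF sqi_diff[OF f g] g] nrm2_triangle[OF sqi_diff[OF g f] f]
  by (simp add: nrm2_diff_commute[of M g f])

lemma nrm2_limit_inner:
  fixes f :: "'i \<Rightarrow> 'a \<Rightarrow> 'b::euclidean_space"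
  assumes "\<And>n. sqi M (f n)" "sqi M l" "sqi M g" "((\<lambda>n. nrm2 M (\<lambda>x. l x - f n x)) \<longlongrightarrow> 0) G"
  shows "((\<lambda>n. LINT x|M. f n x \<bullet> g x) \<longlongrightarrow> (LINT x|M. l x \<bullet> g x)) G"
proof (rule Lim_transform)
  show "((\<lambda>n. LINT x|M. l x \<bullet> g x) \<longlongrightarrow> (LINT x|M. l x \<bullet> g x)) G" by simp
  show "((\<lambda>n. (LINT x|M. f n x \<bullet> g x) - (LINT x|M. l x \<bullet> g x)) \<longlongrightarrow> 0) G"
  proof (rule Lim_null_comparison)
    show "((\<lambda>n. nrm2 M (\<lambda>x. l x - f n x) * nrm2 M g) \<longlongrightarrow> 0) G"
      using tendsto_mult_left_zero[OF assms(4)] .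
    have "norm ((LINT x|M. f n x \<bullet> g x) - (LINT x|M. l x \<bullet> g x)) \<le> nrm2 M (\<lambda>x. l x - f n x) * nrm2 M g" for n
      using nrm2_Cauchy_Schwarz[OF sqi_diff[OF assms(2) assms(1)] assms(3), of n]
        Bochner_Integration.integral_diff[OF sqi_inner[OF assms(2,3)] sqi_inner[OF assms(1) assms(3)], of n]
      by (simp add: inner_diff_left abs_minus_commute)
    then show "\<forall>\<^sub>F n in G. norm ((LINT x|M. f n x \<bullet> g x) - (LINT x|M. l x \<bullet> g x)) \<le> nrm2 M (\<lambda>x. l x - f n x) * nrm2 M g"
      by simp
  qed
qed

lemma nrm2_limit_nrm2:
  assumes "\<And>n. sqi M (f n)" "sqi M l" "((\<lambda>n. nrm2 M (\<lambda>x. l x - f n x)) \<longlongrightarrow> 0) G"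
  shows "((\<lambda>n. nrm2 M (f n)) \<longlongrightarrow> nrm2 M l) G"
proof (rule Lim_transform)
  show "((\<lambda>n. nrm2 M l) \<longlongrightarrow> nrm2 M l) G" by simp
  show "((\<lambda>n. nrm2 M (f n) - nrm2 M l) \<longlongrightarrow> 0) G"
  proof (rule Lim_null_comparison[OF _ assms(3)])
    have "norm (nrm2 M (f n) - nrm2 M l) \<le> nrm2 M (\<lambda>x. l x - f n x)" for n
      using nrm2_diff_bound[OF assms(2,1), of n] by (simp add: abs_minus_commute)
    then show "\<forall>\<^sub>F n in G. norm (nrm2 M (f n) - nrm2 M l) \<le> nrm2 M (\<lambda>x. l x - f n x)" by simp
  qed
qed

lemma nrm2_cong_AE:
  assumes "f \<in> borel_measurable M" "g \<in> borel_measurable M" "AE x in M. f x = g x"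
  shows "nrm2 M f = nrm2 M g"
  unfolding nrm2_def using assms
  by (intro arg_cong[where f = sqrt] integral_cong_AE) auto

text \<open>The squared error is at most \<open>4 * (norm (w x))\<^sup>2\<close>, so the L1 theorem
  applies to it.\<close>

lemma nrm2_dominated_convergence:
  fixes f :: "'a \<Rightarrow> 'b::euclidean_space"
  assumes "f \<in> borel_measurable M" "\<And>n. s n \<in> borel_measurable M" "sqi M w"
    "AE x in M. (\<lambda>n. s n x) \<longlonglongrightarrow> f x"
    "\<And>n. AE x in M. norm (s n x) \<le> norm (w x)" "AE x in M. norm (f x) \<le> norm (w x)"
  shows "(\<lambda>n. nrm2 M (\<lambda>x. f x - s n x)) \<longlonglongrightarrow> 0"
proof -
  note [measurable] = assms(1,2) sqi_measurable[OF assms(3)]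
  have "(\<lambda>n. LINT x|M. (norm (f x - s n x))\<^sup>2) \<longlonglongrightarrow> (LINT x|M. 0)"
  proof (rule integral_dominated_convergence)
    show "integrable M (\<lambda>x. 4 * (norm (w x))\<^sup>2)" using assms(3) by (simp add: sqi_def)
    show "AE x in M. (\<lambda>n. (norm (f x - s n x))\<^sup>2) \<longlonglongrightarrow> 0"
      using assms(4)
    proof eventually_elim
      case (elim x)
      have "(\<lambda>n. f x - s n x) \<longlonglongrightarrow> f x - f x" using elim by (intro tendsto_intros)
      then show ?case by (intro tendsto_null_power tendsto_norm_zero) simp_all
    qed
    show "AE x in M. norm ((norm (f x - s n x))\<^sup>2) \<le> 4 * (norm (w x))\<^sup>2" for n
      using assms(5)[of n] assms(6)
    proof eventually_elim
      case (elim x)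
      have "norm (f x - s n x) \<le> 2 * norm (w x)" using elim norm_triangle_ineq4[of "f x" "s n x"] by linarith
      then have "(norm (f x - s n x))\<^sup>2 \<le> (2 * norm (w x))\<^sup>2" by (intro power_mono) auto
      then show ?case by (simp add: power_mult_distrib)
    qed
  qed measurable
  then have "(\<lambda>n. sqrt (LINT x|M. (norm (f x - s n x))\<^sup>2)) \<longlonglongrightarrow> sqrt 0"
    by (intro tendsto_real_sqrt) simp
  then show ?thesis by (simp add: nrm2_def)
qed

text \<open>Riesz-Fischer: a rapidly convergent subsequence converges almost everywhere, and Fatou's
  lemma transfers the Cauchy estimates of the full sequence to its limit.\<close>

lemma sqi_complete:
  fixes f :: "nat \<Rightarrow> 'a \<Rightarrow> 'b::euclidean_space"
  assumes f: "\<And>n. sqi M (f n)"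
    and Cauchy: "\<And>e. e > 0 \<Longrightarrow> \<exists>N. \<forall>m\<ge>N. \<forall>n\<ge>N. nrm2 M (\<lambda>x. f m x - f n x) < e"
  shows "\<exists>l. sqi M l \<and> (\<lambda>n. nrm2 M (\<lambda>x. l x - f n x)) \<longlonglongrightarrow> 0"
proof -
  note [measurable] = sqi_measurable[OF f]
  have nn: "(\<integral>\<^sup>+x. ennreal ((norm (f m x - f n x))\<^sup>2) \<partial>M) = ennreal ((nrm2 M (\<lambda>x. f m x - f n x))\<^sup>2)" for m n
    unfolding nrm2_power2 using sqi_diff[OF f f, of m n]
    by (intro nn_integral_eq_integral) (auto simp: sqi_def)
  define N where "N k = (SOME N. \<forall>m\<ge>N. \<forall>n\<ge>N. nrm2 M (\<lambda>x. f m x - f n x) < (1/2) ^ k)" for k :: nat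
  have N: "nrm2 M (\<lambda>x. f m x - f n x) < (1/2) ^ k" if "m \<ge> N k" "n \<ge> N k" for m n k
    using someI_ex[OF Cauchy[of "(1/2) ^ k"]] that unfolding N_def by auto
  \<comment> \<open>The maximum over all earlier thresholds makes \<open>r k\<close> usable with
    every \<open>N j\<close>, \<open>j \<le> k\<close>, although \<open>N\<close> itself need not be
    monotone.\<close>
  define r where "r k = k + Max (N ` {..k})" for k
  have rN: "r k \<ge> N j" if "j \<le> k" for k j
    unfolding r_def using that by (intro trans_le_add2 Max_ge) auto
  have r_ge: "r k \<ge> k" for k by (simp add: r_def)
  define h where "h k x = f (r (Suc k)) x - f (r k) x" for k x
  have [measurable]: "h k \<in> borel_measurable M" for k unfolding h_def by measurable
  \<comment> \<open>The squared increments decay like 4^(-k). Spending a weight 2^k keeps the sum of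
    integrals finite, and finiteness of the weighted pointwise series then forces geometric decay of
    the increments at almost every point.\<close>
  have h_small: "(\<integral>\<^sup>+x. ennreal (2 ^ k * (norm (h k x))\<^sup>2) \<partial>M) \<le> ennreal ((1/2) ^ k)" for k
  proof -
    have "(\<integral>\<^sup>+x. ennreal (2 ^ k * (norm (h k x))\<^sup>2) \<partial>M) = (\<integral>\<^sup>+x. ennreal (2 ^ k) * ennreal ((norm (h k x))\<^sup>2) \<partial>M)"
      by (simp add: ennreal_mult)
    also have "\<dots> = ennreal (2 ^ k) * ennreal ((nrm2 M (h k))\<^sup>2)"
      unfolding nn[symmetric] h_def by (subst nn_integral_cmult) (auto simp: nn[symmetric])
    also have "\<dots> = ennreal (2 ^ k * (nrm2 M (h k))\<^sup>2)" by (simp add: ennreal_mult)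
    also have "\<dots> \<le> ennreal ((1/2) ^ k)"
    proof (rule ennreal_leI)
      have "nrm2 M (h k) \<le> (1/2) ^ k"
        unfolding h_def using N[OF rN rN, of k "Suc k" k] by simp
      then have "(nrm2 M (h k))\<^sup>2 \<le> ((1/2) ^ k)\<^sup>2" by (intro power_mono) auto
      then have "2 ^ k * (nrm2 M (h k))\<^sup>2 \<le> 2 ^ k * ((1/2) ^ k)\<^sup>2" by simp
      also have "\<dots> = (1/2) ^ k" by (simp add: power2_eq_square power_divide)
      finally show "2 ^ k * (nrm2 M (h k))\<^sup>2 \<le> (1/2) ^ k" .
    qed
    finally show ?thesis .
  qed
  have "(\<integral>\<^sup>+x. (\<Sum>k. ennreal (2 ^ k * (norm (h k x))\<^sup>2)) \<partial>M) = (\<Sum>k. \<integral>\<^sup>+x. ennreal (2 ^ k * (norm (h k x))\<^sup>2) \<partial>M)"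
    by (rule nn_integral_suminf) measurable
  also have "\<dots> \<le> (\<Sum>k. ennreal ((1/2) ^ k))"
    by (intro suminf_le h_small) auto
  also have "\<dots> = ennreal (\<Sum>k. (1/2) ^ k)"
    by (intro suminf_ennreal2) (auto simp: summable_geometric)
  also have "\<dots> < \<infinity>" by simp
  finally have "(\<integral>\<^sup>+x. (\<Sum>k. ennreal (2 ^ k * (norm (h k x))\<^sup>2)) \<partial>M) \<noteq> \<infinity>" by simp
  then have fin: "AE x in M. (\<Sum>k. ennreal (2 ^ k * (norm (h k x))\<^sup>2)) \<noteq> \<infinity>"
    by (intro nn_integral_PInf_AE) measurable
  have conv: "AE x in M. convergent (\<lambda>k. f (r k) x)"
    using fin
  proof (rule AE_mp, intro AE_I2 impI)
    fix x
    define t where "t k = 2 ^ k * (norm (h k x))\<^sup>2" for k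
    define T where "T = (\<Sum>k. ennreal (t k))"
    assume "(\<Sum>k. ennreal (2 ^ k * (norm (h k x))\<^sup>2)) \<noteq> \<infinity>"
    then have "T \<noteq> top" by (simp add: T_def t_def)
    then obtain S where S: "T = ennreal S" "S \<ge> 0" by (cases T) auto
    have "norm (h k x) \<le> sqrt S * (sqrt (1/2)) ^ k" for k
    proof -
      have "ennreal (t k) \<le> T"
        unfolding T_def using sum_le_suminf[of "\<lambda>k. ennreal (t k)" "{k}"] by simp
      then have "t k \<le> S" using S by (simp add: ennreal_le_iff)
      then have "2 ^ k * (norm (h k x))\<^sup>2 \<le> S" by (simp add: t_def)
      then have "(norm (h k x))\<^sup>2 \<le> S * (1/2) ^ k" by (simp add: field_simps power_divide)
      then have "sqrt ((norm (h k x))\<^sup>2) \<le> sqrt (S * (1/2) ^ k)" by (rule real_sqrt_le_mono)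
      then show ?thesis by (simp add: real_sqrt_mult real_sqrt_power)
    qed
    moreover have "summable (\<lambda>k. sqrt S * (sqrt (1/2)) ^ k)"
      by (rule summable_mult[OF summable_geometric]) (simp add: real_sqrt_divide)
    ultimately have "summable (\<lambda>k. h k x)"
      by (rule summable_comparison_test'[rotated])
    then have "convergent (\<lambda>n. \<Sum>k<n. h k x)" by (simp add: summable_iff_convergent)
    then have "convergent (\<lambda>n. f (r n) x - f (r 0) x)"
      unfolding h_def using sum_lessThan_telescope[of "\<lambda>n. f (r n) x"] by simp
    then have "convergent (\<lambda>n. (f (r n) x - f (r 0) x) + f (r 0) x)"
      by (intro convergent_add convergent_const)
    then show "convergent (\<lambda>k. f (r k) x)" by simp
  qed
  define l where "l x = lim (\<lambda>k. f (r k) x)" for x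
  have [measurable]: "l \<in> borel_measurable M"
    unfolding l_def by (rule borel_measurable_lim_metric) measurable
  \<comment> \<open>Fatou along the subsequence, with the index n of the full sequence held
    fixed.\<close>
  have est: "(\<integral>\<^sup>+x. ennreal ((norm (l x - f n x))\<^sup>2) \<partial>M) \<le> ennreal (((1/2) ^ j)\<^sup>2)" if "n \<ge> N j" for n j
  proof -
    have "(\<integral>\<^sup>+x. ennreal ((norm (l x - f n x))\<^sup>2) \<partial>M) = (\<integral>\<^sup>+x. liminf (\<lambda>k. ennreal ((norm (f (r k) x - f n x))\<^sup>2)) \<partial>M)"
    proof (rule nn_integral_cong_AE)
      show "AE x in M. ennreal ((norm (l x - f n x))\<^sup>2) = liminf (\<lambda>k. ennreal ((norm (f (r k) x - f n x))\<^sup>2))"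
        using conv
      proof eventually_elim
        case (elim x)
        then have "(\<lambda>k. f (r k) x) \<longlonglongrightarrow> l x" unfolding l_def by (simp add: convergent_LIMSEQ_iff)
        then have "(\<lambda>k. ennreal ((norm (f (r k) x - f n x))\<^sup>2)) \<longlonglongrightarrow> ennreal ((norm (l x - f n x))\<^sup>2)"
          by (intro tendsto_intros)
        then show ?case using lim_imp_Liminf[OF sequentially_bot] by metis
      qed
    qed
    also have "\<dots> \<le> liminf (\<lambda>k. \<integral>\<^sup>+x. ennreal ((norm (f (r k) x - f n x))\<^sup>2) \<partial>M)"
      by (rule nn_integral_liminf) measurable
    also have "\<dots> \<le> ennreal (((1/2) ^ j)\<^sup>2)"
    proof (rule Liminf_le)
      show "\<forall>\<^sub>F k in sequentially. (\<integral>\<^sup>+x. ennreal ((norm (f (r k) x - f n x))\<^sup>2) \<partial>M) \<le> ennreal (((1/2) ^ j)\<^sup>2)"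
        using eventually_ge_at_top[of j]
      proof eventually_elim
        case (elim k)
        have "nrm2 M (\<lambda>x. f (r k) x - f n x) \<le> (1/2) ^ j" using N[OF rN[OF elim] that] by simp
        then show ?case unfolding nn by (intro ennreal_leI power_mono) auto
      qed
    qed simp
    finally show ?thesis .
  qed
  have sq: "sqi M (\<lambda>x. l x - f n x)" if "n \<ge> N j" for n j
    unfolding sqi_def
  proof (safe intro!: integrableI_bounded)
    show "(\<integral>\<^sup>+x. ennreal (norm ((norm (l x - f n x))\<^sup>2)) \<partial>M) < \<infinity>"
      using est[OF that] by (simp add: order.strict_trans1)
  qed measurable
  have "sqi M l" using sqi_add[OF sq[of 0 "N 0"] f[of "N 0"]] by simp
  moreover have "(\<lambda>n. nrm2 M (\<lambda>x. l x - f n x)) \<longlonglongrightarrow> 0"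
  proof (rule LIMSEQ_I)
    fix e :: real assume "e > 0"
    then obtain j where j: "(1/2) ^ j < e" using real_arch_pow_inv[of e "1/2"] by auto
    have "nrm2 M (\<lambda>x. l x - f n x) < e" if "n \<ge> N j" for n
    proof -
      have "ennreal (LINT x|M. (norm (l x - f n x))\<^sup>2) \<le> ennreal (((1/2) ^ j)\<^sup>2)"
        using est[OF that] sq[OF that] by (subst nn_integral_eq_integral[symmetric]) (auto simp: sqi_def)
      then have "(nrm2 M (\<lambda>x. l x - f n x))\<^sup>2 \<le> ((1/2) ^ j)\<^sup>2"
        unfolding nrm2_power2 by (subst (asm) ennreal_le_iff) auto
      then have "nrm2 M (\<lambda>x. l x - f n x) \<le> (1/2) ^ j" by (rule power2_le_imp_le) simp
      then show ?thesis using j by simp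
    qed
    then show "\<exists>no. \<forall>n\<ge>no. norm (nrm2 M (\<lambda>x. l x - f n x) - 0) < e" by auto
  qed
  ultimately show ?thesis by blast
qed

section \<open>Gradients and test functions\<close>

lemma gradient_inner:
  assumes "\<phi> differentiable (at x)"
  shows "gradient \<phi> x \<bullet> v = frechet_derivative \<phi> (at x) v"
proof -
  have lin: "linear (frechet_derivative \<phi> (at x))" using assms by (rule linear_frechet_derivative)
  have "frechet_derivative \<phi> (at x) v = frechet_derivative \<phi> (at x) (\<Sum>b\<in>Basis. (v \<bullet> b) *\<^sub>R b)"
    by (simp add: euclidean_representation)
  also have "\<dots> = (\<Sum>b\<in>Basis. (v \<bullet> b) * frechet_derivative \<phi> (at x) b)"
    using lin by (simp add: linear_sum linear_scale)
  finally show ?thesis by (simp add: gradient_def inner_sum_left inner_commute[of v] mult.commute)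
qed

lemma has_derivative_gradient:
  "\<phi> differentiable (at x) \<Longrightarrow> (\<phi> has_derivative (\<lambda>v. gradient \<phi> x \<bullet> v)) (at x)"
  by (simp add: gradient_inner frechet_derivative_works flip: ext)

lemma gradient_eqI:
  assumes "(\<phi> has_derivative (\<lambda>v. g \<bullet> v)) (at x)"
  shows "gradient \<phi> x = g"
proof (rule euclidean_eqI)
  fix b :: 'a
  have "gradient \<phi> x \<bullet> b = frechet_derivative \<phi> (at x) b"
    using assms gradient_inner differentiableI by blast
  also have "\<dots> = g \<bullet> b"
    using frechet_derivative_at[OF assms] by metis
  finally show "gradient \<phi> x \<bullet> b = g \<bullet> b" .
qed

lemma gradient_const [simp]: "gradient (\<lambda>x. c) x = 0"
  by (rule gradient_eqI) simp

lemma gradient_add: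
  assumes "f differentiable (at x)" "g differentiable (at x)"
  shows "gradient (\<lambda>x. f x + g x) x = gradient f x + gradient g x"
  by (rule gradient_eqI, rule has_derivative_eq_rhs[OF has_derivative_add[OF assms[THEN has_derivative_gradient]]])
    (simp add: inner_add_left)

lemma gradient_diff:
  assumes "f differentiable (at x)" "g differentiable (at x)"
  shows "gradient (\<lambda>x. f x - g x) x = gradient f x - gradient g x"
  by (rule gradient_eqI, rule has_derivative_eq_rhs[OF has_derivative_diff[OF assms[THEN has_derivative_gradient]]])
    (simp add: inner_diff_left)

lemma gradient_mult:
  assumes "f differentiable (at x)" "g differentiable (at x)"
  shows "gradient (\<lambda>x. f x * g x) x = f x *\<^sub>R gradient g x + g x *\<^sub>R gradient f x"
  by (rule gradient_eqI, rule has_derivative_eq_rhs[OF has_derivative_mult[OF assms[THEN has_derivative_gradient]]])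
    (auto simp: inner_add_left mult.commute)

lemma gradient_cmult:
  assumes "f differentiable (at x)"
  shows "gradient (\<lambda>x. c * f x) x = c *\<^sub>R gradient f x"
  using gradient_mult[of "\<lambda>_. c" x f] assms by simp

lemma gradient_cong:
  assumes "open S" "x \<in> S" "\<And>y. y \<in> S \<Longrightarrow> f y = g y"
  shows "gradient f x = gradient g x"
proof -
  have "(f has_derivative D) (at x) \<longleftrightarrow> (g has_derivative D) (at x)" for D
    using has_derivative_transform_within_open[OF _ assms(1,2)] assms(3) by metis
  then have "frechet_derivative f (at x) = frechet_derivative g (at x)"
    by (simp add: frechet_derivative_def)
  then show ?thesis by (simp add: gradient_def)
qed

lemma smooth_on_differentiable: "smooth_on U f \<Longrightarrow> open U \<Longrightarrow> x \<in> U \<Longrightarrow> f differentiable (at x)"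
  using smooth_on_frechet(2) differentiableI by blast

lemma smooth_on_gradient:
  assumes "smooth_on U f" "open U"
  shows "smooth_on U (\<lambda>x. gradient f x \<bullet> v)"
  using smooth_on_frechet(1)[OF assms, of v]
    smooth_on_cong[OF assms(2), of "\<lambda>x. gradient f x \<bullet> v" "\<lambda>x. frechet_derivative f (at x) v"]
    gradient_inner[OF smooth_on_differentiable[OF assms]] by auto

lemma continuous_on_gradient:
  fixes f :: "'a::euclidean_space \<Rightarrow> real"
  assumes "smooth_on U f" "open U"
  shows "continuous_on U (gradient f)"
  using smooth_on_continuous[OF smooth_on_gradient[OF assms]]
  by (simp add: continuous_on_componentwise[of U "gradient f"])

section \<open>Test functions\<close>

lemma test_functions_iff:
  "\<phi> \<in> test_functions U \<longleftrightarrow>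
    smooth_on UNIV \<phi> \<and> compact (closure {x. \<phi> x \<noteq> 0}) \<and> closure {x. \<phi> x \<noteq> 0} \<subseteq> U"
  by (simp add: test_functions_def smooth_on_def)

text \<open>Any compact set outside which the function vanishes will do, so the exact support never
  has to be determined.\<close>

lemma test_functionsI:
  assumes "smooth_on UNIV \<phi>" "compact K" "K \<subseteq> U" "\<And>x. x \<notin> K \<Longrightarrow> \<phi> x = 0"
  shows "\<phi> \<in> test_functions U"
proof -
  have "closure {x. \<phi> x \<noteq> 0} \<subseteq> K"
    using assms by (intro closure_minimal) (auto simp: compact_imp_closed)
  moreover from this have "K \<inter> closure {x. \<phi> x \<noteq> 0} = closure {x. \<phi> x \<noteq> 0}" by blast
  then have "compact (closure {x. \<phi> x \<noteq> 0})"
    using compact_Int_closed[OF assms(2) closed_closure, of "{x. \<phi> x \<noteq> 0}"] by simp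
  ultimately show ?thesis
    using assms unfolding test_functions_iff by blast
qed

lemma test_functionsE:
  assumes "\<phi> \<in> test_functions U"
  obtains K where "compact K" "K \<subseteq> U" "smooth_on UNIV \<phi>" "\<And>x. x \<notin> K \<Longrightarrow> \<phi> x = 0"
proof
  show "compact (closure {x. \<phi> x \<noteq> 0})" "closure {x. \<phi> x \<noteq> 0} \<subseteq> U" "smooth_on UNIV \<phi>"
    using assms test_functions_iff by auto
  show "\<And>x. x \<notin> closure {x. \<phi> x \<noteq> 0} \<Longrightarrow> \<phi> x = 0" using closure_subset[of "{x. \<phi> x \<noteq> 0}"] by auto
qed

lemma test_smooth: "\<phi> \<in> test_functions U \<Longrightarrow> smooth_on UNIV \<phi>"
  by (simp add: test_functions_iff)

lemma test_mono: "\<phi> \<in> test_functions U \<Longrightarrow> U \<subseteq> W \<Longrightarrow> \<phi> \<in> test_functions W"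
  by (auto simp: test_functions_iff)

lemma test_outside: "\<phi> \<in> test_functions U \<Longrightarrow> x \<notin> U \<Longrightarrow> \<phi> x = 0"
  by (metis test_functionsE subsetD)

lemma test_zero: "(\<lambda>x. 0) \<in> test_functions U"
  by (rule test_functionsI[where K = "{}"]) auto

lemma test_mult:
  assumes "\<phi> \<in> test_functions U" "smooth_on UNIV h"
  shows "(\<lambda>x. h x * \<phi> x) \<in> test_functions U"
proof -
  obtain K where "compact K" "K \<subseteq> U" "\<And>x. x \<notin> K \<Longrightarrow> \<phi> x = 0"
    using assms(1) test_functionsE by metis
  then show ?thesis
    using assms test_smooth[OF assms(1)] by (intro test_functionsI[of _ K]) auto
qed

lemma test_add:
  assumes "\<phi> \<in> test_functions U" "\<psi> \<in> test_functions U"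
  shows "(\<lambda>x. \<phi> x + \<psi> x) \<in> test_functions U"
proof -
  obtain K where "compact K" "K \<subseteq> U" "\<And>x. x \<notin> K \<Longrightarrow> \<phi> x = 0"
    using assms(1) test_functionsE by metis
  moreover obtain L where "compact L" "L \<subseteq> U" "\<And>x. x \<notin> L \<Longrightarrow> \<psi> x = 0"
    using assms(2) test_functionsE by metis
  ultimately show ?thesis
    using assms[THEN test_smooth] by (intro test_functionsI[of _ "K \<union> L"]) auto
qed

lemma test_cmult: "\<phi> \<in> test_functions U \<Longrightarrow> (\<lambda>x. c * \<phi> x) \<in> test_functions U"
  by (rule test_mult) auto

lemma test_diff:
  "\<phi> \<in> test_functions U \<Longrightarrow> \<psi> \<in> test_functions U \<Longrightarrow> (\<lambda>x. \<phi> x - \<psi> x) \<in> test_functions U"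
  using test_add[of \<phi> U "\<lambda>x. -1 * \<psi> x"] test_cmult[of \<psi> U "-1"] by simp

lemma gradient_eq_0_outside:
  assumes "closed K" "\<And>x. x \<notin> K \<Longrightarrow> \<phi> x = 0" "x \<notin> K"
  shows "gradient \<phi> x = 0"
  using gradient_cong[of "- K" x \<phi> "\<lambda>_. 0"] assms by auto

lemma test_gradient:
  assumes "\<phi> \<in> test_functions U"
  shows "(\<lambda>x. gradient \<phi> x \<bullet> v) \<in> test_functions U"
proof -
  obtain K where K: "compact K" "K \<subseteq> U" "\<And>x. x \<notin> K \<Longrightarrow> \<phi> x = 0"
    using assms test_functionsE by metis
  then show ?thesis
    using smooth_on_gradient[OF test_smooth[OF assms]] gradient_eq_0_outside[OF compact_imp_closed[OF K(1)] K(3)]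
    by (intro test_functionsI[of _ K]) auto
qed

lemma test_gradient_outside: "\<phi> \<in> test_functions U \<Longrightarrow> x \<notin> U \<Longrightarrow> gradient \<phi> x = 0"
  using test_outside[OF test_gradient, of \<phi> U x "gradient \<phi> x"] by simp

lemma test_differentiable: "\<phi> \<in> test_functions U \<Longrightarrow> \<phi> differentiable (at x)"
  using smooth_on_differentiable test_smooth by blast

lemma compact_support_bounded:
  fixes f :: "'a::topological_space \<Rightarrow> 'b::real_normed_vector"
  assumes "continuous_on UNIV f" "compact K" "\<And>x. x \<notin> K \<Longrightarrow> f x = 0"
  obtains B where "B > 0" "\<And>x. norm (f x) \<le> B"
proof -
  have "bounded (f ` K)"
    using compact_imp_bounded[OF compact_continuous_image[OF continuous_on_subset[OF assms(1)] assms(2)]] by simp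
  then obtain B where B: "B > 0" "\<And>y. y \<in> f ` K \<Longrightarrow> norm y \<le> B" by (auto simp: bounded_pos)
  have "norm (f x) \<le> B" for x using B assms(3)[of x] by (cases "x \<in> K") auto
  with B show ?thesis using that by blast
qed

lemma compact_support_integrable:
  fixes f :: "'a::euclidean_space \<Rightarrow> 'b::euclidean_space"
  assumes "continuous_on UNIV f" "compact K" "\<And>x. x \<notin> K \<Longrightarrow> f x = 0"
  shows "integrable lborel f"
proof -
  have "integrable lborel (\<lambda>x. indicator K x *\<^sub>R f x)"
    using assms by (intro borel_integrable_compact) (auto intro: continuous_on_subset)
  also have "(\<lambda>x. indicator K x *\<^sub>R f x) = f" using assms(3) by (auto simp: indicator_def)
  finally show ?thesis .
qed

lemma test_continuous: "\<phi> \<in> test_functions U \<Longrightarrow> continuous_on S \<phi>"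
  using smooth_on_continuous[OF test_smooth] continuous_on_subset by blast

lemma test_continuous_gradient: "\<phi> \<in> test_functions U \<Longrightarrow> continuous_on S (gradient \<phi>)"
  using continuous_on_gradient[OF test_smooth] continuous_on_subset open_UNIV by blast

lemma test_measurable: "\<phi> \<in> test_functions U \<Longrightarrow> \<phi> \<in> borel_measurable borel"
  by (simp add: borel_measurable_continuous_onI test_continuous)

lemma test_gradient_measurable: "\<phi> \<in> test_functions U \<Longrightarrow> gradient \<phi> \<in> borel_measurable borel"
  by (simp add: borel_measurable_continuous_onI test_continuous_gradient)

lemma borel_imp_lebesgue_on: "f \<in> borel_measurable borel \<Longrightarrow> f \<in> borel_measurable (lebesgue_on U)"
  by (simp add: measurable_completion measurable_restrict_space1)

lemma test_bounded:
  assumes "\<phi> \<in> test_functions U"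
  obtains B where "B > 0" "\<And>x. \<bar>\<phi> x\<bar> \<le> B" "\<And>x. norm (gradient \<phi> x) \<le> B"
proof -
  obtain K where K: "compact K" "\<And>x. x \<notin> K \<Longrightarrow> \<phi> x = 0"
    using assms test_functionsE by metis
  note K' = gradient_eq_0_outside[OF compact_imp_closed[OF K(1)] K(2)]
  obtain B1 where "B1 > 0" "\<And>x. norm (\<phi> x) \<le> B1"
    by (rule compact_support_bounded[OF test_continuous[OF assms] K]) blast+
  moreover obtain B2 where "B2 > 0" "\<And>x. norm (gradient \<phi> x) \<le> B2"
    by (rule compact_support_bounded[OF test_continuous_gradient[OF assms] K(1) K']) blast+
  ultimately show ?thesis
    using that[of "max B1 B2"] by (auto simp: le_max_iff_disj)
qed

text \<open>Functions vanishing outside U can be integrated over the whole space against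
  \<open>lborel\<close>, where translation invariance and Fubini are available.\<close>

lemma
  fixes f :: "'a::euclidean_space \<Rightarrow> 'b::euclidean_space"
  assumes "U \<in> sets lebesgue" "f \<in> borel_measurable borel" "\<And>x. x \<notin> U \<Longrightarrow> f x = 0"
  shows integral_lebesgue_on_lborel: "(LINT x|lebesgue_on U. f x) = (LINT x|lborel. f x)"
    and integrable_lebesgue_on_lborel: "integrable (lebesgue_on U) f \<longleftrightarrow> integrable lborel f"
proof -
  have eq: "(\<lambda>x. indicator U x *\<^sub>R f x) = f" using assms(3) by (auto simp: indicator_def)
  show "(LINT x|lebesgue_on U. f x) = (LINT x|lborel. f x)"
    using assms by (simp add: integral_restrict_space eq integral_completion)
  show "integrable (lebesgue_on U) f \<longleftrightarrow> integrable lborel f"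
    using assms by (simp add: integrable_restrict_space eq integrable_completion)
qed

lemma compact_support_sqi:
  fixes f :: "'a::euclidean_space \<Rightarrow> 'b::euclidean_space"
  assumes "continuous_on UNIV f" "compact K" "\<And>x. x \<notin> K \<Longrightarrow> f x = 0" "U \<in> sets lebesgue"
  shows "sqi (lebesgue_on U) f"
  unfolding sqi_def
proof
  show "f \<in> borel_measurable (lebesgue_on U)"
    using assms(1) by (intro borel_imp_lebesgue_on borel_measurable_continuous_onI)
  have "integrable lborel (\<lambda>x. (norm (f x))\<^sup>2)"
    using assms by (intro compact_support_integrable[of _ K]) (auto intro!: continuous_intros)
  then have "integrable lebesgue (\<lambda>x. (norm (f x))\<^sup>2)"
    using assms(1) by (subst integrable_completion) (auto intro!: borel_measurable_continuous_onI continuous_intros)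
  then show "integrable (lebesgue_on U) (\<lambda>x. (norm (f x))\<^sup>2)"
    using assms(4) integrable_mult_indicator[OF assms(4), of "\<lambda>x. (norm (f x))\<^sup>2"]
    by (subst integrable_restrict_space) auto
qed

lemma test_sqi:
  assumes "\<phi> \<in> test_functions W" "U \<in> sets lebesgue"
  shows "sqi (lebesgue_on U) \<phi>" "sqi (lebesgue_on U) (gradient \<phi>)"
proof -
  obtain K where K: "compact K" "\<And>x. x \<notin> K \<Longrightarrow> \<phi> x = 0"
    using assms test_functionsE by metis
  show "sqi (lebesgue_on U) \<phi>"
    using compact_support_sqi[OF test_continuous[OF assms(1)] K assms(2)] .
  show "sqi (lebesgue_on U) (gradient \<phi>)"
    by (rule compact_support_sqi[OF test_continuous_gradient[OF assms(1)] K(1) _ assms(2)])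
      (rule gradient_eq_0_outside[OF compact_imp_closed[OF K(1)] K(2)])
qed

section \<open>Integration by parts\<close>

lemma integral_lborel_translation:
  fixes f :: "'a::euclidean_space \<Rightarrow> 'b::euclidean_space"
  assumes "f \<in> borel_measurable borel"
  shows "(LINT x|lborel. f (x + c)) = (LINT x|lborel. f x)"
    and "integrable lborel (\<lambda>x. f (x + c)) \<longleftrightarrow> integrable lborel f"
proof -
  have "(LINT x|lborel. f x) = (LINT x|distr lborel borel ((+) c). f x)" by (simp add: lborel_distr_plus)
  also have "\<dots> = (LINT x|lborel. f (c + x))" using assms by (intro integral_distr) auto
  finally show "(LINT x|lborel. f (x + c)) = (LINT x|lborel. f x)" by (simp add: add.commute)
  have "integrable lborel f \<longleftrightarrow> integrable (distr lborel borel ((+) c)) f" by (simp add: lborel_distr_plus)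
  also have "\<dots> \<longleftrightarrow> integrable lborel (\<lambda>x. f (c + x))" using assms by (intro integrable_distr_eq) auto
  finally show "integrable lborel (\<lambda>x. f (x + c)) \<longleftrightarrow> integrable lborel f" by (simp add: add.commute)
qed

text \<open>The difference quotients integrate to zero by translation invariance.\<close>

lemma integral_directional_derivative_eq_0:
  fixes F F' :: "'a::euclidean_space \<Rightarrow> real"
  assumes [measurable]: "F' \<in> borel_measurable borel"
    and int: "integrable lborel F"
    and supp: "\<And>x. norm x > r \<Longrightarrow> F x = 0"
    and Lip: "\<And>x h. \<bar>h\<bar> \<le> 1 \<Longrightarrow> \<bar>F (x + h *\<^sub>R b) - F x\<bar> \<le> L * \<bar>h\<bar>"
    and deriv: "AE x in lborel. ((\<lambda>h. F (x + h *\<^sub>R b)) has_real_derivative F' x) (at 0)"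
  shows "(LINT x|lborel. F' x) = 0"
proof -
  have [measurable]: "F \<in> borel_measurable borel" using int by auto
  define t where "t n = inverse (real (Suc n))" for n
  have t: "t n > 0" "t n \<le> 1" for n by (auto simp: t_def field_simps)
  have t0: "t \<longlonglongrightarrow> 0" unfolding t_def by (rule LIMSEQ_inverse_real_of_nat)
  define s where "s n x = (F (x + t n *\<^sub>R b) - F x) / t n" for n x
  have [measurable]: "s n \<in> borel_measurable borel" for n unfolding s_def by measurable
  have s_int: "(LINT x|lborel. s n x) = 0" for n
    unfolding s_def using integral_lborel_translation[of F "t n *\<^sub>R b"] int by simp
  have "(\<lambda>n. LINT x|lborel. s n x) \<longlonglongrightarrow> (LINT x|lborel. F' x)"
  proof (rule integral_dominated_convergence)
    \<comment> \<open>Since \<open>t n \<le> 1\<close>, both x and the shifted point lie outside the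
      ball of radius r once \<open>norm x\<close> exceeds \<open>r + norm b\<close>; all difference
      quotients thus live on one ball.\<close>
    show "integrable lborel (\<lambda>x. L * indicator (cball 0 (r + norm b)) x :: real)"
      by (intro integrable_mult_right integrable_real_indicator) (auto simp: emeasure_lborel_cball_finite[unfolded infinity_ennreal_def])
    show "AE x in lborel. (\<lambda>n. s n x) \<longlonglongrightarrow> F' x"
      using deriv
    proof eventually_elim
      case (elim x)
      then have "((\<lambda>h. (F (x + h *\<^sub>R b) - F x) / h) \<longlongrightarrow> F' x) (at 0)"
        by (simp add: has_field_derivative_iff)
      then show ?case unfolding s_def
        by (rule filterlim_compose) (use t0 t in \<open>auto simp: filterlim_at intro!: always_eventually less_imp_neq[symmetric]\<close>)
    qed
    show "AE x in lborel. norm (s n x) \<le> L * indicator (cball 0 (r + norm b)) x" for n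
    proof (rule AE_I2)
      fix x
      have b: "\<bar>s n x\<bar> \<le> L"
        using Lip[of "t n" x] t[of n] by (simp add: s_def field_simps)
      show "norm (s n x) \<le> L * indicator (cball 0 (r + norm b)) x"
      proof (cases "norm x \<le> r + norm b")
        case False
        have "norm (t n *\<^sub>R b) \<le> norm b" using t[of n] by (simp add: mult_left_le_one_le)
        then have "norm (x + t n *\<^sub>R b) > r"
          using False norm_triangle_ineq4[of "x + t n *\<^sub>R b" "t n *\<^sub>R b"] by simp
        moreover have "norm x > r" using False norm_ge_zero[of b] by linarith
        ultimately show ?thesis using False by (simp add: s_def supp)
      qed (use b in auto)
    qed
  qed measurable
  then show ?thesis using s_int by (simp add: LIMSEQ_const_iff)
qed

lemma gradient_Lipschitz:
  assumes "\<And>x. f differentiable (at x)" "\<And>x. norm (gradient f x) \<le> B"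
  shows "\<bar>f x - f y\<bar> \<le> B * norm (x - y)"
proof -
  have "norm (f x - f y) \<le> B * norm (x - y)"
  proof (rule differentiable_bound[OF convex_UNIV])
    show "(f has_derivative (\<lambda>v. gradient f z \<bullet> v)) (at z)" for z
      using has_derivative_gradient assms(1) by blast
    show "onorm (\<lambda>v. gradient f z \<bullet> v) \<le> B" for z
    proof (rule onorm_le)
      fix v
      have "norm (gradient f z \<bullet> v) \<le> norm (gradient f z) * norm v" by (simp add: Cauchy_Schwarz_ineq2)
      also have "\<dots> \<le> B * norm v" using assms(2) by (simp add: mult_right_mono)
      finally show "norm (gradient f z \<bullet> v) \<le> B * norm v" .
    qed
  qed auto
  then show ?thesis by simp
qed

lemma has_derivative_directional:
  assumes "f differentiable (at x)"
  shows "((\<lambda>h. f (x + h *\<^sub>R b)) has_real_derivative gradient f x \<bullet> b) (at 0)"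
proof -
  have "((\<lambda>h. f (x + h *\<^sub>R b)) has_derivative (\<lambda>h. gradient f x \<bullet> (h *\<^sub>R b))) (at 0)"
    by (rule has_derivative_compose[of "\<lambda>h. x + h *\<^sub>R b"])
      (use has_derivative_gradient[OF assms] in \<open>auto intro!: derivative_eq_intros\<close>)
  then show ?thesis unfolding has_field_derivative_def
    by (rule has_derivative_eq_rhs) (auto simp: mult.commute)
qed

lemma integral_test_gradient:
  assumes "\<phi> \<in> test_functions U"
  shows "(LINT x|lborel. gradient \<phi> x \<bullet> b) = 0"
proof -
  obtain K where K: "compact K" "\<And>x. x \<notin> K \<Longrightarrow> \<phi> x = 0"
    using assms test_functionsE by metis
  obtain r where r: "\<And>x. x \<in> K \<Longrightarrow> norm x \<le> r" using compact_imp_bounded[OF K(1)] by (auto simp: bounded_iff)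
  obtain B where B: "\<And>x. norm (gradient \<phi> x) \<le> B" "B > 0" using test_bounded[OF assms] by metis
  note [measurable] = test_gradient_measurable[OF assms]
  show ?thesis
  proof (rule integral_directional_derivative_eq_0[where F = \<phi> and r = r and L = "B * norm b" and b = b])
    show "integrable lborel \<phi>" using compact_support_integrable[OF test_continuous[OF assms] K] .
    show "\<phi> x = 0" if "norm x > r" for x using K(2) r that by fastforce
    show "\<bar>\<phi> (x + h *\<^sub>R b) - \<phi> x\<bar> \<le> B * norm b * \<bar>h\<bar>" for x h
      using gradient_Lipschitz[OF test_differentiable[OF assms] B(1), of "x + h *\<^sub>R b" x]
      by (simp add: algebra_simps)
    show "AE x in lborel. ((\<lambda>h. \<phi> (x + h *\<^sub>R b)) has_real_derivative gradient \<phi> x \<bullet> b) (at 0)"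
      using has_derivative_directional[OF test_differentiable[OF assms]] by simp
  qed measurable
qed

text \<open>The product of \<open>h\<close> and \<open>\<phi>\<close> is a test function, so its
  partial derivatives integrate to zero. No regularity of U enters, because everything vanishes
  outside U.\<close>

lemma integration_by_parts:
  assumes \<phi>: "\<phi> \<in> test_functions U" and h: "smooth_on UNIV h" and U: "U \<in> sets lebesgue"
  shows "(LINT x|lebesgue_on U. h x * (gradient \<phi> x \<bullet> b)) = - (LINT x|lebesgue_on U. \<phi> x * (gradient h x \<bullet> b))"
    "integrable (lebesgue_on U) (\<lambda>x. h x * (gradient \<phi> x \<bullet> b))"
    "integrable (lebesgue_on U) (\<lambda>x. \<phi> x * (gradient h x \<bullet> b))"
proof -
  have hd: "h differentiable (at x)" for x using h smooth_on_differentiable by blast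
  have t: "(\<lambda>x. h x * (gradient \<phi> x \<bullet> b)) \<in> test_functions U" "(\<lambda>x. (gradient h x \<bullet> b) * \<phi> x) \<in> test_functions U"
    using test_mult[OF test_gradient[OF \<phi>] h] test_mult[OF \<phi> smooth_on_gradient[OF h open_UNIV]] by auto
  have i: "integrable (lebesgue_on U) \<psi>" "(LINT x|lebesgue_on U. \<psi> x) = (LINT x|lborel. \<psi> x)" if \<psi>: "\<psi> \<in> test_functions U" for \<psi>
  proof -
    obtain K where K: "compact K" "\<And>x. x \<notin> K \<Longrightarrow> \<psi> x = 0" using \<psi> test_functionsE by metis
    have "integrable lborel \<psi>" using compact_support_integrable[OF test_continuous[OF \<psi>] K] .
    then show "integrable (lebesgue_on U) \<psi>"
      using integrable_lebesgue_on_lborel[OF U test_measurable[OF \<psi>]] test_outside[OF \<psi>] by blast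
    show "(LINT x|lebesgue_on U. \<psi> x) = (LINT x|lborel. \<psi> x)"
      using integral_lebesgue_on_lborel[OF U test_measurable[OF \<psi>]] test_outside[OF \<psi>] by blast
  qed
  show 1: "integrable (lebesgue_on U) (\<lambda>x. h x * (gradient \<phi> x \<bullet> b))"
    and 2: "integrable (lebesgue_on U) (\<lambda>x. \<phi> x * (gradient h x \<bullet> b))"
    using i(1)[OF t(1)] i(1)[OF t(2)] by (auto simp: mult.commute)
  have "0 = (LINT x|lborel. gradient (\<lambda>x. h x * \<phi> x) x \<bullet> b)"
    using integral_test_gradient[OF test_mult[OF \<phi> h]] by simp
  also have "\<dots> = (LINT x|lborel. h x * (gradient \<phi> x \<bullet> b) + (gradient h x \<bullet> b) * \<phi> x)"
    by (simp add: gradient_mult hd test_differentiable[OF \<phi>] inner_add_left mult.commute add.commute)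
  also have "\<dots> = (LINT x|lebesgue_on U. h x * (gradient \<phi> x \<bullet> b) + (gradient h x \<bullet> b) * \<phi> x)"
    using i(2)[OF test_add[OF t]] by simp
  also have "\<dots> = (LINT x|lebesgue_on U. h x * (gradient \<phi> x \<bullet> b)) + (LINT x|lebesgue_on U. \<phi> x * (gradient h x \<bullet> b))"
    using 1 2 by (simp add: mult.commute)
  finally show "(LINT x|lebesgue_on U. h x * (gradient \<phi> x \<bullet> b)) = - (LINT x|lebesgue_on U. \<phi> x * (gradient h x \<bullet> b))"
    by simp
qed

section \<open>Uniqueness of weak gradients\<close>

lemma smooth_on_inner: "smooth_on U (\<lambda>x. x \<bullet> b)"
  by (rule smooth_on_linear[OF bounded_linear_inner_left])

text \<open>Approximation from inside, so that the approximants are test functions of the open box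
  itself and are dominated by its indicator.\<close>

lemma box_indicator_limit:
  fixes l u :: "'a::euclidean_space"
  obtains \<phi> :: "nat \<Rightarrow> 'a \<Rightarrow> real" where
    "\<And>n. \<phi> n \<in> test_functions (box l u)" "\<And>n x. \<bar>\<phi> n x\<bar> \<le> indicator (box l u) x"
    "\<And>x. (\<lambda>n. \<phi> n x) \<longlonglongrightarrow> indicator (box l u) x"
proof
  \<comment> \<open>The factor for direction b vanishes within distance 1/n of the two faces
    orthogonal to b and equals 1 beyond distance 2/n. For n = 0 every factor is 0, which yields the
    zero function.\<close>
  define p where "p n b x = smooth_step (real n * ((x - l) \<bullet> b) - 1) * smooth_step (real n * ((u - x) \<bullet> b) - 1)"
    for n b and x :: 'a
  define \<phi> where "\<phi> n x = (\<Prod>b\<in>Basis. p n b x)" for n and x :: 'a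
  have p01: "0 \<le> p n b x" "p n b x \<le> 1" for n b x
    unfolding p_def by (auto intro!: mult_nonneg_nonneg mult_le_one smooth_step_nonneg smooth_step_le_1)
  have \<phi>01: "0 \<le> \<phi> n x" "\<phi> n x \<le> 1" for n x
    unfolding \<phi>_def using p01 by (auto intro!: prod_nonneg prod_le_1)
  have nz: "1 / real n \<le> (x - l) \<bullet> b \<and> 1 / real n \<le> (u - x) \<bullet> b \<and> n > 0" if "p n b x \<noteq> 0" for n b x
  proof -
    have "real n * ((x - l) \<bullet> b) - 1 > 0" "real n * ((u - x) \<bullet> b) - 1 > 0"
      using that smooth_step_0 unfolding p_def by (metis mult_zero_left mult_zero_right not_le)+
    moreover from this have "n > 0" by (cases n) auto
    ultimately show ?thesis by (simp add: field_simps)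
  qed
  show mem: "\<phi> n \<in> test_functions (box l u)" for n
  proof (cases "n = 0")
    case True
    then have "p n b x = 0" for b x using nz[of n b x] by auto
    then have "\<phi> n = (\<lambda>x. 0)" by (auto simp: \<phi>_def)
    then show ?thesis by (simp add: test_zero)
  next
    case False
    define l' u' where "l' = l + (\<Sum>b\<in>Basis. (1 / real n) *\<^sub>R b)" and "u' = u - (\<Sum>b\<in>Basis. (1 / real n) *\<^sub>R b)"
    have l'u': "l' \<bullet> b = l \<bullet> b + 1 / n" "u' \<bullet> b = u \<bullet> b - 1 / n" if "b \<in> Basis" for b
      using that by (simp_all add: l'_def u'_def inner_add_left inner_diff_left inner_sum_left inner_Basis if_distrib cong: if_cong)
    show ?thesis
    proof (rule test_functionsI[of _ "cbox l' u'"])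
      have "smooth_on UNIV (\<lambda>x. smooth_step (real n * ((x - l) \<bullet> b) - 1))" for b
        by (rule smooth_on_compose[OF smooth_on_smooth_step])
          (auto simp: inner_diff_left intro!: smooth_on_diff smooth_on_mult smooth_on_inner)
      moreover have "smooth_on UNIV (\<lambda>x. smooth_step (real n * ((u - x) \<bullet> b) - 1))" for b
        by (rule smooth_on_compose[OF smooth_on_smooth_step])
          (auto simp: inner_diff_left intro!: smooth_on_diff smooth_on_mult smooth_on_inner)
      ultimately show "smooth_on UNIV (\<phi> n)"
        unfolding \<phi>_def p_def by (intro smooth_on_prod smooth_on_mult)
      show "cbox l' u' \<subseteq> box l u"
      proof
        fix x assume "x \<in> cbox l' u'"
        then have "l \<bullet> b + 1 / n \<le> x \<bullet> b \<and> x \<bullet> b \<le> u \<bullet> b - 1 / n" if "b \<in> Basis" for b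
          using that l'u'[OF that] by (auto simp: mem_box)
        moreover have "1 / real n > 0" using False by simp
        ultimately show "x \<in> box l u" unfolding mem_box by (smt (verit))
      qed
      show "\<phi> n x = 0" if x: "x \<notin> cbox l' u'" for x
      proof (rule ccontr)
        assume "\<phi> n x \<noteq> 0"
        then have "p n b x \<noteq> 0" if "b \<in> Basis" for b
          using that unfolding \<phi>_def by auto
        then have "x \<in> cbox l' u'"
          unfolding mem_box using nz l'u' by (smt (verit) inner_diff_left)
        then show False using x by simp
      qed
    qed simp
  qed
  show "\<bar>\<phi> n x\<bar> \<le> indicator (box l u) x" for n x
    using \<phi>01[of n x] test_outside[OF mem, of x n] by (auto simp: indicator_def)
  show "(\<lambda>n. \<phi> n x) \<longlonglongrightarrow> indicator (box l u) x" for x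
  proof (cases "x \<in> box l u")
    case False
    then show ?thesis using test_outside[OF mem] by simp
  next
    case True
    have "\<forall>\<^sub>F n in sequentially. p n b x = 1" if b: "b \<in> Basis" for b
    proof -
      have pos: "(x - l) \<bullet> b > 0" "(u - x) \<bullet> b > 0"
        using True b by (auto simp: mem_box inner_diff_left)
      have "\<forall>\<^sub>F n in sequentially. real n * y \<ge> 2" if "y > 0" for y
      proof -
        have "\<forall>\<^sub>F n in sequentially. real n \<ge> 2 / y"
          using filterlim_real_sequentially filterlim_at_top by blast
        then show ?thesis by eventually_elim (use that in \<open>simp add: field_simps\<close>)
      qed
      from this[OF pos(1)] this[OF pos(2)] show ?thesis
        by eventually_elim (auto simp: p_def smooth_step_1)
    qed
    then have "\<forall>\<^sub>F n in sequentially. \<forall>b\<in>Basis. p n b x = 1"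
      by (simp add: eventually_ball_finite)
    then have "\<forall>\<^sub>F n in sequentially. \<phi> n x = 1"
      by eventually_elim (simp add: \<phi>_def)
    then show ?thesis using True by (simp add: tendsto_eventually)
  qed
qed

text \<open>Boxes form an intersection-stable generator of the Borel sets, so vanishing over boxes
  extends to vanishing over all Borel sets, and an integrable density with this property is zero
  almost everywhere.\<close>

lemma integral_boxes_eq_0_imp_AE:
  fixes H :: "'a::euclidean_space \<Rightarrow> real"
  assumes int: "integrable lebesgue H" and K: "\<And>x. x \<notin> box l u \<Longrightarrow> H x = 0"
    and zero: "\<And>c d. box c d \<subseteq> box l u \<Longrightarrow> (LINT x|lebesgue. indicator (box c d) x * H x) = 0"
  shows "AE x in lebesgue. H x = 0"
proof -
  have [measurable]: "H \<in> borel_measurable lebesgue" "box c d \<in> sets lebesgue" for c d using int by auto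
  \<comment> \<open>The generator argument reaches Borel sets only, hence the passage to a Borel
    representative of \<open>H\<close>.\<close>
  then obtain H' where H': "H' \<in> borel_measurable lborel" "AE x in lborel. H x = H' x"
    using completion_ex_borel_measurable_real by blast
  have [measurable]: "H' \<in> borel_measurable borel" using H' by simp
  have HH': "AE x in lebesgue. H x = H' x" using H'(2) by (simp add: AE_completion)
  have int': "integrable lborel H'"
  proof -
    have "integrable lebesgue H'"
      by (rule integrable_cong_AE_imp[OF int]) (use HH' in \<open>auto simp: measurable_completion\<close>)
    then show ?thesis by (simp add: integrable_completion)
  qed
  have z: "(LINT x:A|lborel. H' x) = 0" if "A \<in> sets borel" for A
  proof -
    have "A \<in> sigma_sets UNIV (range (\<lambda>(a, b). box a b :: 'a set))"
      using that by (subst (asm) borel_eq_box) (auto simp: sets_measure_of)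
    then show ?thesis
    proof (induction rule: sigma_sets_induct_disjoint[rotated 2, consumes 1, case_names basic empty compl union])
      case (basic A)
      then obtain c d where A: "A = box c d" by auto
      \<comment> \<open>\<open>H\<close> lives in \<open>box l u\<close>, so an arbitrary box may be
        replaced by its intersection with it, for which the hypothesis is available.\<close>
      obtain c' d' where c'd': "box c d \<inter> box l u = box c' d'" using box_Int_box by blast
      have mH' [measurable]: "H' \<in> borel_measurable lebesgue" by (simp add: measurable_completion)
      have "(LINT x:A|lborel. H' x) = (LINT x|lebesgue. indicator A x * H' x)"
        unfolding set_lebesgue_integral_def A by (simp add: integral_completion)
      also have "\<dots> = (LINT x|lebesgue. indicator A x * H x)"
      proof (rule integral_cong_AE)
        show "AE x in lebesgue. indicator A x * H' x = indicator A x * H x"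
          using HH' by eventually_elim simp
      qed (unfold A, measurable)
      also have "\<dots> = (LINT x|lebesgue. indicator (box c' d') x * H x)"
        unfolding A c'd'[symmetric] using K
        by (intro Bochner_Integration.integral_cong) (auto simp: indicator_def)
      also have "\<dots> = 0" using zero[of c' d'] c'd' by blast
      finally show ?case .
    next
      case empty
      show ?case by (simp add: set_lebesgue_integral_def)
    next
      case (compl A)
      then have A: "A \<in> sets borel" by (subst borel_eq_box) (auto simp: sets_measure_of)
      have tot: "(LINT x|lborel. H' x) = 0"
      proof -
        have "(LINT x|lborel. H' x) = (LINT x|lebesgue. H' x)" by (simp add: integral_completion)
        also have "\<dots> = (LINT x|lebesgue. indicator (box l u) x * H x)"
        proof (rule integral_cong_AE)
          show "AE x in lebesgue. H' x = indicator (box l u) x * H x"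
            using HH' by eventually_elim (use K in \<open>auto simp: indicator_def\<close>)
        qed (simp add: measurable_completion, measurable)
        also have "\<dots> = 0" by (rule zero) simp
        finally show ?thesis .
      qed
      have i: "set_integrable lborel A H'"
        unfolding set_integrable_def using A int' integrable_mult_indicator[of A lborel H'] by simp
      have "(LINT x:(UNIV - A)|lborel. H' x) = (LINT x|lborel. H' x - indicator A x *\<^sub>R H' x)"
        unfolding set_lebesgue_integral_def
        by (intro Bochner_Integration.integral_cong) (auto simp: indicator_def)
      also have "\<dots> = 0"
        using int' i compl tot unfolding set_integrable_def set_lebesgue_integral_def by simp
      finally show ?case .
    next
      case (union A)
      then have A: "A i \<in> sets borel" for i by (subst borel_eq_box) (auto simp: sets_measure_of)
      have "(LINT x:(\<Union>i. A i)|lborel. H' x) = (\<Sum>i. LINT x:A i|lborel. H' x)"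
      proof (rule lebesgue_integral_countable_add)
        show "\<And>i j. i \<noteq> j \<Longrightarrow> A i \<inter> A j = {}"
          using union by (auto simp: disjoint_family_on_def)
        show "set_integrable lborel (\<Union>i. A i) H'"
          unfolding set_integrable_def using A int' integrable_mult_indicator[of "\<Union>i. A i" lborel H'] by simp
      qed (use A in auto)
      then show ?case using union by simp
    next
      show "Int_stable (range (\<lambda>(a, b). box a b :: 'a set))"
      proof -
        have "box a b \<inter> box c d \<in> range (\<lambda>(a, b). box a b :: 'a set)" for a b c d :: 'a
          unfolding box_Int_box by (rule range_eqI[where x = "(p, q)" for p q]) simp
        then show ?thesis unfolding Int_stable_def by auto
      qed
    qed simp
  qed
  have "AE x in lborel. H' x = 0"
    by (rule density_unique_real[OF int']) (use z in \<open>auto simp: set_lebesgue_integral_def\<close>)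
  then have "AE x in lebesgue. H' x = 0" by (simp add: AE_completion)
  with HH' show ?thesis by eventually_elim simp
qed

text \<open>An open set is a countable union of open boxes, and countably many null sets have a null
  union.\<close>

lemma AE_lebesgue_on_open:
  assumes "open U" "\<And>l u. box l u \<subseteq> U \<Longrightarrow> AE x in lebesgue. x \<in> box l u \<longrightarrow> P x"
  shows "AE x in lebesgue_on U. P x"
proof -
  obtain D where D: "countable D" "D \<subseteq> Pow U" "\<And>X. X \<in> D \<Longrightarrow> \<exists>a b. X = box a b" "\<Union>D = U"
    by (rule open_countable_Union_open_box[OF assms(1)]) blast
  have "AE x in lebesgue. \<forall>X\<in>D. x \<in> X \<longrightarrow> P x"
    unfolding AE_ball_countable[OF D(1)]
  proof
    fix X assume X: "X \<in> D"
    then obtain a b where "X = box a b" using D(3) by blast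
    then show "AE x in lebesgue. x \<in> X \<longrightarrow> P x" using X D(2) assms(2)[of a b] by blast
  qed
  then have "AE x in lebesgue. x \<in> U \<longrightarrow> P x"
    by eventually_elim (use D in auto)
  then show ?thesis
    using assms(1) by (subst AE_restrict_space_iff) auto
qed

lemma indicator_sqi:
  assumes "U \<in> sets lebesgue" "B \<in> sets lebesgue" "emeasure lebesgue B < \<infinity>"
  shows "sqi (lebesgue_on U) (indicator B :: 'a::euclidean_space \<Rightarrow> real)"
proof -
  have i: "integrable lebesgue (\<lambda>x. indicator U x * indicator B x :: real)"
    using integrable_mult_indicator[OF assms(1) integrable_real_indicator[OF assms(2,3)]] by simp
  have "(norm (indicator B x :: real))\<^sup>2 = indicator B x" for x :: 'a by (simp add: indicator_def)
  then show ?thesis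
    using assms i by (auto simp: sqi_def integrable_restrict_space measurable_restrict_space1)
qed

text \<open>Test functions converge boundedly to indicators of boxes, which reduces the claim to
  vanishing integrals over boxes. Localising to one box first turns square integrability into
  integrability.\<close>

lemma fundamental_lemma_variations:
  fixes h :: "'a::euclidean_space \<Rightarrow> real"
  assumes U: "open U" and h: "sqi (lebesgue_on U) h"
    and zero: "\<And>\<phi>. \<phi> \<in> test_functions U \<Longrightarrow> (LINT x|lebesgue_on U. \<phi> x * h x) = 0"
  shows "AE x in lebesgue_on U. h x = 0"
proof (rule AE_lebesgue_on_open[OF U])
  fix l u assume lu: "box l u \<subseteq> U"
  have [simp]: "U \<in> sets lebesgue" using U by auto
  have fin: "emeasure lebesgue (box c d) < \<infinity>" for c d :: 'a by (simp add: emeasure_lborel_box_finite[unfolded infinity_ennreal_def])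
  define H where "H x = indicator (box l u) x * h x" for x
  have z: "(LINT x|lebesgue_on U. indicator (box c d) x * h x) = 0" if cd: "box c d \<subseteq> U" for c d
  proof -
    obtain \<phi> where \<phi>: "\<And>n. \<phi> n \<in> test_functions (box c d)" "\<And>n x. \<bar>\<phi> n x\<bar> \<le> indicator (box c d) x"
      "\<And>x. (\<lambda>n. \<phi> n x) \<longlonglongrightarrow> indicator (box c d) x"
      by (rule box_indicator_limit[of c d]) blast
    have [measurable]: "\<phi> n \<in> borel_measurable (lebesgue_on U)" for n
      by (rule borel_imp_lebesgue_on[OF test_measurable[OF \<phi>(1)]])
    note [measurable] = sqi_measurable[OF h]
    have is0: "sqi (lebesgue_on U) (indicator (box c d) :: 'a \<Rightarrow> real)"
      by (rule indicator_sqi) (use fin in auto)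
    have "(\<lambda>n. LINT x|lebesgue_on U. \<phi> n x * h x) \<longlonglongrightarrow> (LINT x|lebesgue_on U. indicator (box c d) x * h x)"
    proof (rule integral_dominated_convergence)
      show "integrable (lebesgue_on U) (\<lambda>x. norm (indicator (box c d) x :: real) * norm (h x))"
        by (rule sqi_inner_norm[OF is0 h])
      show "AE x in lebesgue_on U. (\<lambda>n. \<phi> n x * h x) \<longlonglongrightarrow> indicator (box c d) x * h x"
        using \<phi>(3) by (intro AE_I2 tendsto_mult tendsto_const)
      show "AE x in lebesgue_on U. norm (\<phi> n x * h x) \<le> norm (indicator (box c d) x :: real) * norm (h x)" for n
        using \<phi>(2)[of n] by (intro AE_I2) (simp add: abs_mult mult_right_mono)
    qed (use is0 in measurable)
    moreover have "(LINT x|lebesgue_on U. \<phi> n x * h x) = 0" for n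
      using zero test_mono[OF \<phi>(1) cd] by blast
    ultimately show ?thesis by (simp add: LIMSEQ_const_iff)
  qed
  have "AE x in lebesgue. H x = 0"
  proof (rule integral_boxes_eq_0_imp_AE)
    have "integrable (lebesgue_on U) H"
      unfolding H_def by (rule sqi_mult[OF indicator_sqi h]) (use fin in auto)
    then have "integrable lebesgue (\<lambda>x. indicator U x *\<^sub>R H x)" by (simp add: integrable_restrict_space)
    also have "(\<lambda>x. indicator U x *\<^sub>R H x) = H" by (rule ext) (use lu in \<open>auto simp: H_def indicator_def\<close>)
    finally show "integrable lebesgue H" .
    show "\<And>x. x \<notin> box l u \<Longrightarrow> H x = 0" by (simp add: H_def)
    fix c d assume cd: "box c d \<subseteq> box l u"
    have "(LINT x|lebesgue. indicator (box c d) x * H x) = (LINT x|lebesgue. indicator U x *\<^sub>R (indicator (box c d) x * h x))"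
      using cd lu by (intro Bochner_Integration.integral_cong) (auto simp: H_def indicator_def)
    also have "\<dots> = (LINT x|lebesgue_on U. indicator (box c d) x * h x)"
      by (simp add: integral_restrict_space)
    also have "\<dots> = 0" using z cd lu by blast
    finally show "(LINT x|lebesgue. indicator (box c d) x * H x) = 0" .
  qed
  then show "AE x in lebesgue. x \<in> box l u \<longrightarrow> h x = 0"
    by eventually_elim (auto simp: H_def indicator_def)
qed

lemma sqi_inner_const:
  assumes "sqi M g"
  shows "sqi M (\<lambda>x. g x \<bullet> b)"
proof (rule sqi_dominated[OF assms])
  show "AE x in M. norm (g x \<bullet> b) \<le> norm b * norm (g x)"
  proof (rule AE_I2)
    fix x show "norm (g x \<bullet> b) \<le> norm b * norm (g x)"
      using Cauchy_Schwarz_ineq2[of "g x" b] by (simp add: mult.commute)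
  qed
qed (use assms in measurable)

text \<open>Taking components commutes with the Bochner integral only for integrable integrands,
  since the integral of any other function is 0 by convention. Square integrability of
  \<open>u\<close> and \<open>g\<close> provides this.\<close>

lemma is_weak_gradient_component:
  assumes U: "U \<in> sets lebesgue" and u: "sqi (lebesgue_on U) u" and g: "sqi (lebesgue_on U) g"
  shows "is_weak_gradient U u g \<longleftrightarrow> (\<forall>\<phi>\<in>test_functions U. \<forall>b\<in>Basis.
    (LINT x|lebesgue_on U. u x * (gradient \<phi> x \<bullet> b)) = - (LINT x|lebesgue_on U. \<phi> x * (g x \<bullet> b)))"
  unfolding is_weak_gradient_def
proof (intro ball_cong refl)
  fix \<phi> assume \<phi>: "\<phi> \<in> test_functions U"
  have i: "integrable (lebesgue_on U) (\<lambda>x. u x *\<^sub>R gradient \<phi> x)" "integrable (lebesgue_on U) (\<lambda>x. \<phi> x *\<^sub>R g x)"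
  proof -
    note [measurable] = sqi_measurable[OF u] sqi_measurable[OF g] borel_imp_lebesgue_on[OF test_measurable[OF \<phi>]]
      borel_imp_lebesgue_on[OF test_gradient_measurable[OF \<phi>]]
    show "integrable (lebesgue_on U) (\<lambda>x. u x *\<^sub>R gradient \<phi> x)"
      by (rule Bochner_Integration.integrable_bound[OF sqi_inner_norm[OF u test_sqi(2)[OF \<phi> U]]]) auto
    show "integrable (lebesgue_on U) (\<lambda>x. \<phi> x *\<^sub>R g x)"
      by (rule Bochner_Integration.integrable_bound[OF sqi_inner_norm[OF test_sqi(1)[OF \<phi> U] g]]) auto
  qed
  have "(LINT x|lebesgue_on U. u x *\<^sub>R gradient \<phi> x) \<bullet> b = (LINT x|lebesgue_on U. u x * (gradient \<phi> x \<bullet> b))"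
    "(LINT x|lebesgue_on U. \<phi> x *\<^sub>R g x) \<bullet> b = (LINT x|lebesgue_on U. \<phi> x * (g x \<bullet> b))" for b
    using i by (simp_all flip: integral_inner_left)
  then show "(LINT x|lebesgue_on U. u x *\<^sub>R gradient \<phi> x) = - (LINT x|lebesgue_on U. \<phi> x *\<^sub>R g x) \<longleftrightarrow>
    (\<forall>b\<in>Basis. (LINT x|lebesgue_on U. u x * (gradient \<phi> x \<bullet> b)) = - (LINT x|lebesgue_on U. \<phi> x * (g x \<bullet> b)))"
    by (simp add: euclidean_eq_iff[of "LINT x|lebesgue_on U. u x *\<^sub>R gradient \<phi> x"])
qed

lemma weak_gradient_unique:
  fixes g1 g2 :: "'a::euclidean_space \<Rightarrow> 'a"
  assumes U: "open U" and u: "sqi (lebesgue_on U) u" and g: "sqi (lebesgue_on U) g1" "sqi (lebesgue_on U) g2"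
    and w: "is_weak_gradient U u g1" "is_weak_gradient U u g2"
  shows "AE x in lebesgue_on U. g1 x = g2 x"
proof -
  have U': "U \<in> sets lebesgue" using U by auto
  have "AE x in lebesgue_on U. (g1 x - g2 x) \<bullet> b = 0" if b: "b \<in> Basis" for b
  proof (rule fundamental_lemma_variations[OF U])
    show "sqi (lebesgue_on U) (\<lambda>x. (g1 x - g2 x) \<bullet> b)"
      by (intro sqi_inner_const sqi_diff g)
    fix \<phi> assume \<phi>: "\<phi> \<in> test_functions U"
    have i: "integrable (lebesgue_on U) (\<lambda>x. \<phi> x * (g x \<bullet> b))" if "sqi (lebesgue_on U) g" for g :: "'a \<Rightarrow> 'a"
      by (rule sqi_mult[OF test_sqi(1)[OF \<phi> U'] sqi_inner_const[OF that]])
    have "(LINT x|lebesgue_on U. \<phi> x * (g1 x \<bullet> b)) = (LINT x|lebesgue_on U. \<phi> x * (g2 x \<bullet> b))"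
      using w(1)[unfolded is_weak_gradient_component[OF U' u g(1)], rule_format, OF \<phi> b]
        w(2)[unfolded is_weak_gradient_component[OF U' u g(2)], rule_format, OF \<phi> b] by simp
    then show "(LINT x|lebesgue_on U. \<phi> x * ((g1 x - g2 x) \<bullet> b)) = 0"
      using i[OF g(1)] i[OF g(2)] by (simp add: inner_diff_left right_diff_distrib)
  qed
  then have "AE x in lebesgue_on U. \<forall>b\<in>Basis. (g1 x - g2 x) \<bullet> b = 0"
    by (simp add: AE_finite_all)
  then show ?thesis
    by eventually_elim (auto simp: euclidean_eq_iff[of "g1 _"] inner_diff_left)
qed

section \<open>Limits of test functions\<close>

text \<open>The closure in L2 x L2 of the pairs of a test function and its gradient. Carrying the
  gradient along avoids the choice in \<open>weak_gradient\<close>, and every continuous identity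
  for test functions extends to such pairs.\<close>

definition H10_pair :: "'a::euclidean_space set \<Rightarrow> ('a \<Rightarrow> real) \<Rightarrow> ('a \<Rightarrow> 'a) \<Rightarrow> bool" where
  "H10_pair U u g \<longleftrightarrow> sqi (lebesgue_on U) u \<and> sqi (lebesgue_on U) g \<and>
    (\<exists>\<phi>. (\<forall>n::nat. \<phi> n \<in> test_functions U) \<and>
      (\<lambda>n. nrm2 (lebesgue_on U) (\<lambda>x. u x - \<phi> n x)) \<longlonglongrightarrow> 0 \<and>
      (\<lambda>n. nrm2 (lebesgue_on U) (\<lambda>x. g x - gradient (\<phi> n) x)) \<longlonglongrightarrow> 0)"

lemma H10_pairE:
  assumes "H10_pair U u g"
  obtains \<phi> :: "nat \<Rightarrow> 'a::euclidean_space \<Rightarrow> real" where "\<And>n. \<phi> n \<in> test_functions U"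
    "(\<lambda>n. nrm2 (lebesgue_on U) (\<lambda>x. u x - \<phi> n x)) \<longlonglongrightarrow> 0"
    "(\<lambda>n. nrm2 (lebesgue_on U) (\<lambda>x. g x - gradient (\<phi> n) x)) \<longlonglongrightarrow> 0"
  using assms unfolding H10_pair_def by blast

lemma H10_pair_sqi:
  assumes "H10_pair U u g"
  shows "sqi (lebesgue_on U) u" "sqi (lebesgue_on U) g"
  using assms unfolding H10_pair_def by auto

lemma H10_pair_limit_inner:
  fixes h :: "'a::euclidean_space \<Rightarrow> 'a"
  assumes U: "U \<in> sets lebesgue" and p: "H10_pair U u g"
    and \<phi>: "\<And>n. \<phi> n \<in> test_functions U"
    "(\<lambda>n. nrm2 (lebesgue_on U) (\<lambda>x. u x - \<phi> n x)) \<longlonglongrightarrow> 0"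
    "(\<lambda>n. nrm2 (lebesgue_on U) (\<lambda>x. g x - gradient (\<phi> n) x)) \<longlonglongrightarrow> 0"
  shows "sqi (lebesgue_on U) v \<Longrightarrow> (\<lambda>n. LINT x|lebesgue_on U. \<phi> n x * v x) \<longlonglongrightarrow> (LINT x|lebesgue_on U. u x * v x)"
    and "sqi (lebesgue_on U) h \<Longrightarrow> (\<lambda>n. LINT x|lebesgue_on U. gradient (\<phi> n) x \<bullet> h x) \<longlonglongrightarrow> (LINT x|lebesgue_on U. g x \<bullet> h x)"
proof -
  assume "sqi (lebesgue_on U) v"
  then show "(\<lambda>n. LINT x|lebesgue_on U. \<phi> n x * v x) \<longlonglongrightarrow> (LINT x|lebesgue_on U. u x * v x)"
    using nrm2_limit_inner[OF test_sqi(1)[OF \<phi>(1) U] H10_pair_sqi(1)[OF p] _ \<phi>(2), of v] by simp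
next
  assume "sqi (lebesgue_on U) h"
  then show "(\<lambda>n. LINT x|lebesgue_on U. gradient (\<phi> n) x \<bullet> h x) \<longlonglongrightarrow> (LINT x|lebesgue_on U. g x \<bullet> h x)"
    using nrm2_limit_inner[OF test_sqi(2)[OF \<phi>(1) U] H10_pair_sqi(2)[OF p] _ \<phi>(3), of h] by simp
qed

lemma H10_pair_test:
  assumes "U \<in> sets lebesgue" "\<phi> \<in> test_functions U"
  shows "H10_pair U \<phi> (gradient \<phi>)"
  unfolding H10_pair_def using assms test_sqi by (auto intro!: exI[of _ "\<lambda>_. \<phi>"])

lemma sqi_bounded_mult:
  fixes f :: "'a \<Rightarrow> 'b::euclidean_space" and h :: "'a \<Rightarrow> real"
  assumes "sqi M f" "h \<in> borel_measurable M" "\<And>x. \<bar>h x\<bar> \<le> K"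
  shows "sqi M (\<lambda>x. h x *\<^sub>R f x)" "nrm2 M (\<lambda>x. h x *\<^sub>R f x) \<le> K * nrm2 M f"
proof -
  note [measurable] = sqi_measurable[OF assms(1)] assms(2)
  have b: "AE x in M. norm (h x *\<^sub>R f x) \<le> K * norm (f x)"
    using assms(3) by (intro AE_I2) (simp add: mult_right_mono)
  show "sqi M (\<lambda>x. h x *\<^sub>R f x)" by (rule sqi_dominated[OF assms(1) _ b]) measurable
  have "0 \<le> K" using assms(3)[of undefined] by linarith
  then show "nrm2 M (\<lambda>x. h x *\<^sub>R f x) \<le> K * nrm2 M f"
    by (intro nrm2_mono[OF assms(1) _ b]) measurable
qed

lemma sqi_bounded_mult_real:
  fixes f h :: "'a \<Rightarrow> real"
  assumes "sqi M f" "h \<in> borel_measurable M" "\<And>x. \<bar>h x\<bar> \<le> K"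
  shows "sqi M (\<lambda>x. h x * f x)" "nrm2 M (\<lambda>x. h x * f x) \<le> K * nrm2 M f"
  using sqi_bounded_mult[OF assms] by simp_all

lemma is_weak_gradient_test:
  assumes "U \<in> sets lebesgue" "\<psi> \<in> test_functions U"
  shows "is_weak_gradient U \<psi> (gradient \<psi>)"
  unfolding is_weak_gradient_component[OF assms(1) test_sqi[OF assms(2,1)]]
  using integration_by_parts(1)[OF _ test_smooth[OF assms(2)] assms(1)] by blast

text \<open>Integration by parts holds for the approximating test functions, and both of its sides
  are L2 continuous.\<close>

lemma H10_pair_weak_gradient:
  assumes U: "U \<in> sets lebesgue" and p: "H10_pair U u g"
  shows "is_weak_gradient U u g"
  unfolding is_weak_gradient_component[OF U H10_pair_sqi[OF p]]
proof (intro ballI)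
  fix \<phi> and b :: 'a assume \<phi>: "\<phi> \<in> test_functions U" and b: "b \<in> Basis"
  obtain \<psi> where \<psi>: "\<And>n. \<psi> n \<in> test_functions U"
    "(\<lambda>n. nrm2 (lebesgue_on U) (\<lambda>x. u x - \<psi> n x)) \<longlonglongrightarrow> 0"
    "(\<lambda>n. nrm2 (lebesgue_on U) (\<lambda>x. g x - gradient (\<psi> n) x)) \<longlonglongrightarrow> 0"
    using H10_pairE[OF p] by blast
  note lim = H10_pair_limit_inner[OF U p \<psi>]
  have "sqi (lebesgue_on U) (\<lambda>x. \<phi> x *\<^sub>R b)"
  proof (rule sqi_dominated[OF test_sqi(1)[OF \<phi> U]])
    show "AE x in lebesgue_on U. norm (\<phi> x *\<^sub>R b) \<le> norm b * norm (\<phi> x)" by simp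
  qed (use borel_imp_lebesgue_on[OF test_measurable[OF \<phi>]] in measurable)
  from lim(2)[OF this] have a: "(\<lambda>n. LINT x|lebesgue_on U. \<phi> x * (gradient (\<psi> n) x \<bullet> b)) \<longlonglongrightarrow> (LINT x|lebesgue_on U. \<phi> x * (g x \<bullet> b))"
    by simp
  have c: "(\<lambda>n. LINT x|lebesgue_on U. \<psi> n x * (gradient \<phi> x \<bullet> b)) \<longlonglongrightarrow> (LINT x|lebesgue_on U. u x * (gradient \<phi> x \<bullet> b))"
    by (rule lim(1)[OF sqi_inner_const[OF test_sqi(2)[OF \<phi> U]]])
  have d: "(LINT x|lebesgue_on U. \<psi> n x * (gradient \<phi> x \<bullet> b)) = - (LINT x|lebesgue_on U. \<phi> x * (gradient (\<psi> n) x \<bullet> b))" for n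
    by (rule integration_by_parts(1)[OF \<phi> test_smooth[OF \<psi>(1)] U])
  show "(LINT x|lebesgue_on U. u x * (gradient \<phi> x \<bullet> b)) = - (LINT x|lebesgue_on U. \<phi> x * (g x \<bullet> b))"
    by (rule LIMSEQ_unique[OF c[unfolded d] tendsto_minus[OF a]])
qed

lemma weak_gradient_spec:
  assumes "u \<in> H1 U"
  shows "sqi (lebesgue_on U) (weak_gradient U u)" "is_weak_gradient U u (weak_gradient U u)"
    "sqi (lebesgue_on U) u"
proof -
  have "\<exists>g. g \<in> L2 U \<and> is_weak_gradient U u g" using assms by (auto simp: H1_def)
  from someI_ex[OF this] show "sqi (lebesgue_on U) (weak_gradient U u)" "is_weak_gradient U u (weak_gradient U u)"
    unfolding weak_gradient_def L2_iff_sqi by auto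
  show "sqi (lebesgue_on U) u" using assms by (auto simp: H1_def L2_iff_sqi)
qed

lemma weak_gradient_eq:
  assumes "open U" "sqi (lebesgue_on U) u" "sqi (lebesgue_on U) g" "is_weak_gradient U u g"
  shows "u \<in> H1 U" "AE x in lebesgue_on U. weak_gradient U u x = g x"
    "H1_norm U u = sqrt ((nrm2 (lebesgue_on U) u)\<^sup>2 + (nrm2 (lebesgue_on U) g)\<^sup>2)"
proof -
  show H1: "u \<in> H1 U" using assms by (auto simp: H1_def L2_iff_sqi)
  note w = weak_gradient_spec[OF H1]
  show AE: "AE x in lebesgue_on U. weak_gradient U u x = g x"
    by (rule weak_gradient_unique[OF assms(1,2) w(1) assms(3) w(2) assms(4)])
  have "nrm2 (lebesgue_on U) (weak_gradient U u) = nrm2 (lebesgue_on U) g"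
    by (rule nrm2_cong_AE[OF _ _ AE]) (use w assms sqi_measurable in blast)+
  then show "H1_norm U u = sqrt ((nrm2 (lebesgue_on U) u)\<^sup>2 + (nrm2 (lebesgue_on U) g)\<^sup>2)"
    unfolding H1_norm_def nrm2_power2[symmetric] by (simp add: nrm2_power2)
qed

lemma is_weak_gradient_diff:
  assumes U: "U \<in> sets lebesgue"
    and u: "sqi (lebesgue_on U) u" "sqi (lebesgue_on U) v"
    and g: "sqi (lebesgue_on U) g" "sqi (lebesgue_on U) h"
    and w: "is_weak_gradient U u g" "is_weak_gradient U v h"
  shows "is_weak_gradient U (\<lambda>x. u x - v x) (\<lambda>x. g x - h x)"
  unfolding is_weak_gradient_component[OF U sqi_diff[OF u] sqi_diff[OF g]]
proof (intro ballI)
  fix \<phi> and b :: 'a assume \<phi>: "\<phi> \<in> test_functions U" and b: "b \<in> Basis"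
  note sqi_mult[OF u(1) sqi_inner_const[OF test_sqi(2)[OF \<phi> U]]] sqi_mult[OF u(2) sqi_inner_const[OF test_sqi(2)[OF \<phi> U]]]
    sqi_mult[OF test_sqi(1)[OF \<phi> U] sqi_inner_const[OF g(1)]] sqi_mult[OF test_sqi(1)[OF \<phi> U] sqi_inner_const[OF g(2)]]
  then show "(LINT x|lebesgue_on U. (u x - v x) * (gradient \<phi> x \<bullet> b)) = - (LINT x|lebesgue_on U. \<phi> x * ((g x - h x) \<bullet> b))"
    using w(1)[unfolded is_weak_gradient_component[OF U u(1) g(1)], rule_format, OF \<phi> b]
      w(2)[unfolded is_weak_gradient_component[OF U u(2) g(2)], rule_format, OF \<phi> b]
    by (simp add: inner_diff_left left_diff_distrib right_diff_distrib)
qed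

text \<open>The bridge between the given definition, which selects some weak gradient, and the
  pairs. By uniqueness the selected gradient is \<open>g\<close> almost everywhere, so the norm of a
  difference splits into two L2 norms.\<close>

lemma H10_iff:
  assumes U: "open U"
  shows "u \<in> H10 U \<Longrightarrow> H10_pair U u (weak_gradient U u)"
    and "H10_pair U u g \<Longrightarrow> u \<in> H10 U"
    and "H10_pair U u g \<Longrightarrow> AE x in lebesgue_on U. weak_gradient U u x = g x"
proof -
  have U': "U \<in> sets lebesgue" using U by auto
  let ?M = "lebesgue_on U"
  have norm_diff: "H1_norm U (\<lambda>x. u x - \<phi> x) = sqrt ((nrm2 ?M (\<lambda>x. u x - \<phi> x))\<^sup>2 + (nrm2 ?M (\<lambda>x. g x - gradient \<phi> x))\<^sup>2)"
    if "sqi ?M u" "sqi ?M g" "is_weak_gradient U u g" "\<phi> \<in> test_functions U" for g \<phi>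
    by (rule weak_gradient_eq(3)[OF U])
      (intro sqi_diff that test_sqi[OF that(4) U'] is_weak_gradient_diff[OF U'] is_weak_gradient_test[OF U' that(4)])+
  {
    assume "u \<in> H10 U"
    then obtain \<phi> where u: "u \<in> H1 U" and \<phi>: "\<And>n::nat. \<phi> n \<in> test_functions U"
      "(\<lambda>n. H1_norm U (\<lambda>x. u x - \<phi> n x)) \<longlonglongrightarrow> 0"
      by (auto simp: H10_def)
    note w = weak_gradient_spec[OF u]
    have le: "nrm2 ?M (\<lambda>x. u x - \<phi> n x) \<le> H1_norm U (\<lambda>x. u x - \<phi> n x)"
      "nrm2 ?M (\<lambda>x. weak_gradient U u x - gradient (\<phi> n) x) \<le> H1_norm U (\<lambda>x. u x - \<phi> n x)" for n
      unfolding norm_diff[OF w(3,1,2) \<phi>(1)] by (auto intro: real_le_rsqrt)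
    show "H10_pair U u (weak_gradient U u)"
      unfolding H10_pair_def
    proof (intro conjI exI[of _ \<phi>] allI)
      show "(\<lambda>n. nrm2 ?M (\<lambda>x. u x - \<phi> n x)) \<longlonglongrightarrow> 0"
        by (rule tendsto_sandwich[OF _ _ tendsto_const \<phi>(2)]) (use le in auto)
      show "(\<lambda>n. nrm2 ?M (\<lambda>x. weak_gradient U u x - gradient (\<phi> n) x)) \<longlonglongrightarrow> 0"
        by (rule tendsto_sandwich[OF _ _ tendsto_const \<phi>(2)]) (use le in auto)
    qed (use w \<phi> in auto)
  }
  {
    assume p: "H10_pair U u g"
    note s = H10_pair_sqi[OF p] H10_pair_weak_gradient[OF U' p]
    obtain \<phi> where \<phi>: "\<And>n::nat. \<phi> n \<in> test_functions U"
      "(\<lambda>n. nrm2 ?M (\<lambda>x. u x - \<phi> n x)) \<longlonglongrightarrow> 0"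
      "(\<lambda>n. nrm2 ?M (\<lambda>x. g x - gradient (\<phi> n) x)) \<longlonglongrightarrow> 0"
      using H10_pairE[OF p] by blast
    have "(\<lambda>n. H1_norm U (\<lambda>x. u x - \<phi> n x)) \<longlonglongrightarrow> 0"
      unfolding norm_diff[OF s \<phi>(1)]
      using tendsto_real_sqrt[OF tendsto_add[OF tendsto_power[OF \<phi>(2), of 2] tendsto_power[OF \<phi>(3), of 2]]] by simp
    then show "u \<in> H10 U"
      using weak_gradient_eq(1)[OF U s] \<phi>(1) by (auto simp: H10_def)
    show "AE x in lebesgue_on U. weak_gradient U u x = g x"
      by (rule weak_gradient_eq(2)[OF U s])
  }
qed

lemma H10_pair_diff:
  assumes U: "U \<in> sets lebesgue" and p: "H10_pair U u g" "H10_pair U v h"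
  shows "H10_pair U (\<lambda>x. u x - v x) (\<lambda>x. g x - h x)"
proof -
  let ?M = "lebesgue_on U"
  obtain \<phi> where \<phi>: "\<And>n::nat. \<phi> n \<in> test_functions U"
    "(\<lambda>n. nrm2 ?M (\<lambda>x. u x - \<phi> n x)) \<longlonglongrightarrow> 0" "(\<lambda>n. nrm2 ?M (\<lambda>x. g x - gradient (\<phi> n) x)) \<longlonglongrightarrow> 0"
    using H10_pairE[OF p(1)] by blast
  obtain \<psi> where \<psi>: "\<And>n::nat. \<psi> n \<in> test_functions U"
    "(\<lambda>n. nrm2 ?M (\<lambda>x. v x - \<psi> n x)) \<longlonglongrightarrow> 0" "(\<lambda>n. nrm2 ?M (\<lambda>x. h x - gradient (\<psi> n) x)) \<longlonglongrightarrow> 0"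
    using H10_pairE[OF p(2)] by blast
  note s = H10_pair_sqi[OF p(1)] H10_pair_sqi[OF p(2)]
  show ?thesis
    unfolding H10_pair_def
  proof (intro conjI exI[of _ "\<lambda>n x. \<phi> n x - \<psi> n x"] allI)
    show "(\<lambda>x. \<phi> n x - \<psi> n x) \<in> test_functions U" for n by (rule test_diff[OF \<phi>(1) \<psi>(1)])
    have "nrm2 ?M (\<lambda>x. u x - v x - (\<phi> n x - \<psi> n x)) \<le> nrm2 ?M (\<lambda>x. u x - \<phi> n x) + nrm2 ?M (\<lambda>x. v x - \<psi> n x)" for n
      using nrm2_triangle_diff[OF sqi_diff[OF s(1) test_sqi(1)[OF \<phi>(1) U]] sqi_diff[OF s(3) test_sqi(1)[OF \<psi>(1) U]], of n n]
      by (simp add: algebra_simps)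
    then show "(\<lambda>n. nrm2 ?M (\<lambda>x. u x - v x - (\<phi> n x - \<psi> n x))) \<longlonglongrightarrow> 0"
      by (intro tendsto_sandwich[OF _ _ tendsto_const tendsto_add_zero[OF \<phi>(2) \<psi>(2)]] always_eventually allI) auto
    have "nrm2 ?M (\<lambda>x. g x - h x - gradient (\<lambda>x. \<phi> n x - \<psi> n x) x) \<le> nrm2 ?M (\<lambda>x. g x - gradient (\<phi> n) x) + nrm2 ?M (\<lambda>x. h x - gradient (\<psi> n) x)" for n
      using nrm2_triangle_diff[OF sqi_diff[OF s(2) test_sqi(2)[OF \<phi>(1) U]] sqi_diff[OF s(4) test_sqi(2)[OF \<psi>(1) U]], of n n]
      by (simp add: algebra_simps gradient_diff[OF test_differentiable[OF \<phi>(1)] test_differentiable[OF \<psi>(1)]])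
    then show "(\<lambda>n. nrm2 ?M (\<lambda>x. g x - h x - gradient (\<lambda>x. \<phi> n x - \<psi> n x) x)) \<longlonglongrightarrow> 0"
      by (intro tendsto_sandwich[OF _ _ tendsto_const tendsto_add_zero[OF \<phi>(3) \<psi>(3)]] always_eventually allI) auto
  qed (intro sqi_diff s)+
qed

lemma zero_ext_sqi:
  fixes f :: "'a::euclidean_space \<Rightarrow> 'b::euclidean_space"
  assumes U: "U \<in> sets lebesgue" "W \<in> sets lebesgue" "U \<subseteq> W"
    and f0: "\<And>x. x \<notin> U \<Longrightarrow> f0 x = 0" "\<And>x. x \<in> U \<Longrightarrow> f0 x = f x"
  shows "nrm2 (lebesgue_on W) f0 = nrm2 (lebesgue_on U) f" "sqi (lebesgue_on U) f \<Longrightarrow> sqi (lebesgue_on W) f0"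
proof -
  have eq: "indicator W x *\<^sub>R (norm (f0 x))\<^sup>2 = indicator U x *\<^sub>R (norm (f x))\<^sup>2" for x
    using f0 U(3) by (auto simp: indicator_def)
  show "nrm2 (lebesgue_on W) f0 = nrm2 (lebesgue_on U) f"
    unfolding nrm2_def using U by (simp add: integral_restrict_space eq del: real_scaleR_def)
  assume f: "sqi (lebesgue_on U) f"
  have "f0 = (\<lambda>x. if x \<in> U then f x else 0)" using f0 by auto
  then have "f0 \<in> borel_measurable lebesgue"
    using borel_measurable_if[OF U(1), of f] sqi_measurable[OF f] by simp
  moreover have "integrable (lebesgue_on W) (\<lambda>x. (norm (f0 x))\<^sup>2)"
    using f U unfolding sqi_def by (simp add: integrable_restrict_space eq del: real_scaleR_def)
  ultimately show "sqi (lebesgue_on W) f0"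
    by (simp add: sqi_def measurable_restrict_space1)
qed

text \<open>The same approximating sequence works on the larger set: test functions of U and their
  gradients vanish outside U, so no norm changes under extension.\<close>

lemma H10_pair_zero_ext:
  assumes U: "U \<in> sets lebesgue" "W \<in> sets lebesgue" "U \<subseteq> W" and p: "H10_pair U u g"
  shows "H10_pair W (zero_ext U u) (\<lambda>x. if x \<in> U then g x else 0)"
proof -
  obtain \<phi> where \<phi>: "\<And>n::nat. \<phi> n \<in> test_functions U"
    "(\<lambda>n. nrm2 (lebesgue_on U) (\<lambda>x. u x - \<phi> n x)) \<longlonglongrightarrow> 0"
    "(\<lambda>n. nrm2 (lebesgue_on U) (\<lambda>x. g x - gradient (\<phi> n) x)) \<longlonglongrightarrow> 0"
    using H10_pairE[OF p] by blast
  show ?thesis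
    unfolding H10_pair_def
  proof (intro conjI exI[of _ \<phi>] allI)
    show "sqi (lebesgue_on W) (zero_ext U u)"
      by (rule zero_ext_sqi(2)[OF U _ _ H10_pair_sqi(1)[OF p]]) (auto simp: zero_ext_def)
    show "sqi (lebesgue_on W) (\<lambda>x. if x \<in> U then g x else 0)"
      by (rule zero_ext_sqi(2)[OF U _ _ H10_pair_sqi(2)[OF p]]) auto
    have "nrm2 (lebesgue_on W) (\<lambda>x. zero_ext U u x - \<phi> n x) = nrm2 (lebesgue_on U) (\<lambda>x. u x - \<phi> n x)" for n
      by (rule zero_ext_sqi(1)[OF U]) (auto simp: zero_ext_def test_outside[OF \<phi>(1)])
    then show "(\<lambda>n. nrm2 (lebesgue_on W) (\<lambda>x. zero_ext U u x - \<phi> n x)) \<longlonglongrightarrow> 0"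
      using \<phi>(2) by simp
    have "nrm2 (lebesgue_on W) (\<lambda>x. (if x \<in> U then g x else 0) - gradient (\<phi> n) x) = nrm2 (lebesgue_on U) (\<lambda>x. g x - gradient (\<phi> n) x)" for n
      by (rule zero_ext_sqi(1)[OF U]) (auto simp: test_gradient_outside[OF \<phi>(1)])
    then show "(\<lambda>n. nrm2 (lebesgue_on W) (\<lambda>x. (if x \<in> U then g x else 0) - gradient (\<phi> n) x)) \<longlonglongrightarrow> 0"
      using \<phi>(3) by simp
    show "\<phi> n \<in> test_functions W" for n by (rule test_mono[OF \<phi>(1) U(3)])
  qed
qed

text \<open>The coordinate \<open>x \<bullet> b\<close> has derivative 1 in direction b. Integrating
  the square of \<open>\<psi>\<close> by parts against it leaves twice the integral of
  \<open>\<psi>\<close> times its derivative times a coordinate bounded by r, hence the constant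
  \<open>2 * r\<close>.\<close>

lemma Poincare_test:
  assumes U: "U \<in> sets lebesgue" "U \<subseteq> cball 0 r" and r: "r \<ge> 0" and \<psi>: "\<psi> \<in> test_functions U"
  shows "nrm2 (lebesgue_on U) \<psi> \<le> 2 * r * nrm2 (lebesgue_on U) (gradient \<psi>)"
proof -
  let ?M = "lebesgue_on U"
  obtain b :: 'a where b: "b \<in> Basis" using nonempty_Basis by blast
  note s = test_sqi[OF \<psi> U(1)]
  note sm = test_smooth[OF \<psi>]
  define h where "h x = \<psi> x * (x \<bullet> b)" for x
  have xb: "smooth_on UNIV (\<lambda>x. x \<bullet> b)" by (rule smooth_on_inner)
  have h: "smooth_on UNIV h" unfolding h_def by (intro smooth_on_mult sm xb)
  have gx: "gradient (\<lambda>x. x \<bullet> b) x = b" for x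
    by (rule gradient_eqI) (auto intro!: derivative_eq_intros simp: inner_commute)
  have gh: "gradient h x \<bullet> b = \<psi> x + (x \<bullet> b) * (gradient \<psi> x \<bullet> b)" for x
    unfolding h_def using gradient_mult[OF test_differentiable[OF \<psi>] smooth_on_differentiable[OF xb open_UNIV UNIV_I], of x]
    by (simp add: gx inner_add_left b)
  note ibp = integration_by_parts[OF \<psi> h U(1), of b]
  let ?I = "LINT x|?M. h x * (gradient \<psi> x \<bullet> b)"
  have "?I = - (LINT x|?M. (norm (\<psi> x))\<^sup>2 + h x * (gradient \<psi> x \<bullet> b))"
    unfolding ibp(1)
    by (intro arg_cong[where f = uminus] Bochner_Integration.integral_cong)
      (auto simp: gh h_def algebra_simps power2_eq_square)
  also have "\<dots> = - ((nrm2 ?M \<psi>)\<^sup>2 + ?I)"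
    using s(1) ibp(2) by (simp add: nrm2_power2 sqi_def)
  finally have eq: "(nrm2 ?M \<psi>)\<^sup>2 = - 2 * ?I" by simp
  have "\<bar>?I\<bar> \<le> (LINT x|?M. \<bar>h x * (gradient \<psi> x \<bullet> b)\<bar>)" by simp
  also have "\<dots> \<le> (LINT x|?M. r * (norm (\<psi> x) * norm (gradient \<psi> x)))"
  proof (rule integral_mono_AE)
    show "integrable ?M (\<lambda>x. \<bar>h x * (gradient \<psi> x \<bullet> b)\<bar>)" using ibp(2) by simp
    show "integrable ?M (\<lambda>x. r * (norm (\<psi> x) * norm (gradient \<psi> x)))"
      using sqi_inner_norm[OF s] by simp
    have "\<bar>h x * (gradient \<psi> x \<bullet> b)\<bar> \<le> r * (norm (\<psi> x) * norm (gradient \<psi> x))" if "x \<in> U" for x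
    proof -
      have "\<bar>x \<bullet> b\<bar> \<le> r" using that U(2) Cauchy_Schwarz_ineq2[of x b] b by (auto simp: norm_Basis dest!: subsetD)
      moreover have "\<bar>gradient \<psi> x \<bullet> b\<bar> \<le> norm (gradient \<psi> x)" by (rule Basis_le_norm[OF b])
      ultimately have "\<bar>x \<bullet> b\<bar> * \<bar>gradient \<psi> x \<bullet> b\<bar> * \<bar>\<psi> x\<bar> \<le> r * norm (gradient \<psi> x) * \<bar>\<psi> x\<bar>"
        using r by (intro mult_right_mono mult_mono) auto
      then show ?thesis by (simp add: h_def abs_mult algebra_simps)
    qed
    then show "AE x in ?M. \<bar>h x * (gradient \<psi> x \<bullet> b)\<bar> \<le> r * (norm (\<psi> x) * norm (gradient \<psi> x))"
      by (intro AE_I2) auto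
  qed
  also have "\<dots> \<le> r * (nrm2 ?M \<psi> * nrm2 ?M (gradient \<psi>))"
    using nrm2_Cauchy_Schwarz_norm[OF s] r by (simp add: mult_left_mono)
  finally have "\<bar>?I\<bar> \<le> r * (nrm2 ?M \<psi> * nrm2 ?M (gradient \<psi>))" .
  then have "(nrm2 ?M \<psi>)\<^sup>2 \<le> 2 * (r * (nrm2 ?M \<psi> * nrm2 ?M (gradient \<psi>)))"
    using eq by linarith
  also have "\<dots> = nrm2 ?M \<psi> * (2 * r * nrm2 ?M (gradient \<psi>))" by simp
  finally have le: "(nrm2 ?M \<psi>)\<^sup>2 \<le> nrm2 ?M \<psi> * (2 * r * nrm2 ?M (gradient \<psi>))" .
  show ?thesis
  proof (cases "nrm2 ?M \<psi> = 0")
    case True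
    then show ?thesis using r by simp
  next
    case False
    then have "nrm2 ?M \<psi> > 0" using nrm2_nonneg[of ?M \<psi>] by linarith
    then show ?thesis using le by (simp add: power2_eq_square)
  qed
qed

lemma Poincare:
  assumes U: "U \<in> sets lebesgue" "U \<subseteq> cball 0 r" and r: "r \<ge> 0" and p: "H10_pair U u g"
  shows "nrm2 (lebesgue_on U) u \<le> 2 * r * nrm2 (lebesgue_on U) g"
proof -
  obtain \<phi> where \<phi>: "\<And>n::nat. \<phi> n \<in> test_functions U"
    "(\<lambda>n. nrm2 (lebesgue_on U) (\<lambda>x. u x - \<phi> n x)) \<longlonglongrightarrow> 0"
    "(\<lambda>n. nrm2 (lebesgue_on U) (\<lambda>x. g x - gradient (\<phi> n) x)) \<longlonglongrightarrow> 0"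
    using H10_pairE[OF p] by blast
  note s = H10_pair_sqi[OF p]
  have "(\<lambda>n. nrm2 (lebesgue_on U) (\<phi> n)) \<longlonglongrightarrow> nrm2 (lebesgue_on U) u"
    by (rule nrm2_limit_nrm2[OF test_sqi(1)[OF \<phi>(1) U(1)] s(1) \<phi>(2)])
  moreover have "(\<lambda>n. 2 * r * nrm2 (lebesgue_on U) (gradient (\<phi> n))) \<longlonglongrightarrow> 2 * r * nrm2 (lebesgue_on U) g"
    by (intro tendsto_mult_left nrm2_limit_nrm2[OF test_sqi(2)[OF \<phi>(1) U(1)] s(2) \<phi>(3)])
  ultimately show ?thesis
    by (rule LIMSEQ_le) (use Poincare_test[OF U r \<phi>(1)] in blast)
qed

section \<open>Riesz representation for the energy form\<close>

text \<open>A nonnegative potential leaves the form coercive through the gradient alone, the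
  enclosing ball supplies the Poincare constant, and the upper bound makes the form
  continuous.\<close>

locale bounded_potential =
  fixes U :: "'a::euclidean_space set" and V :: "'a \<Rightarrow> real" and KV r :: real
  assumes open_U: "open U" and U_ball: "U \<subseteq> cball 0 r" and r_nonneg: "r \<ge> 0"
    and V_measurable [measurable]: "V \<in> borel_measurable (lebesgue_on U)"
    and V_nonneg: "\<And>x. 0 \<le> V x" and V_le: "\<And>x. V x \<le> KV"
begin

abbreviation "M \<equiv> lebesgue_on U"

lemma U_lebesgue [simp]: "U \<in> sets lebesgue" using open_U by auto

lemma KV_nonneg: "0 \<le> KV" using V_nonneg[of undefined] V_le[of undefined] by linarith

lemma sqi_V:
  assumes "sqi M u"
  shows "sqi M (\<lambda>x. V x * u x)" "nrm2 M (\<lambda>x. V x * u x) \<le> KV * nrm2 M u"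
proof -
  have "\<bar>V x\<bar> \<le> KV" for x using V_nonneg[of x] V_le[of x] by linarith
  from sqi_bounded_mult_real[OF assms V_measurable this]
  show "sqi M (\<lambda>x. V x * u x)" "nrm2 M (\<lambda>x. V x * u x) \<le> KV * nrm2 M u" .
qed

text \<open>The gradients are separate arguments so that the form acts on pairs in the sense of
  \<open>H10_pair\<close>, independently of any selected weak gradient.\<close>

definition bform :: "('a \<Rightarrow> real) \<Rightarrow> ('a \<Rightarrow> 'a) \<Rightarrow> ('a \<Rightarrow> real) \<Rightarrow> ('a \<Rightarrow> 'a) \<Rightarrow> real" where
  "bform u g v h = (LINT x|M. g x \<bullet> h x) + (LINT x|M. V x * u x * v x)"

lemma bform_commute: "bform u g v h = bform v h u g"
  by (simp add: bform_def inner_commute ac_simps)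

lemma bform_integrable:
  assumes "sqi M u" "sqi M g" "sqi M v" "sqi M h"
  shows "integrable M (\<lambda>x. g x \<bullet> h x :: real)" "integrable M (\<lambda>x. V x * u x * v x)"
  using sqi_inner assms sqi_mult[OF sqi_V(1)[OF assms(1)] assms(3)] by auto

lemma bform_diff_left:
  assumes "sqi M u" "sqi M g" "sqi M u'" "sqi M g'" "sqi M v" "sqi M h"
  shows "bform (\<lambda>x. u x - u' x) (\<lambda>x. g x - g' x) v h = bform u g v h - bform u' g' v h"
  using bform_integrable[of u g v h] bform_integrable[of u' g' v h] assms
  unfolding bform_def by (simp add: inner_diff_left left_diff_distrib right_diff_distrib)

lemma bform_add_left:
  assumes "sqi M u" "sqi M g" "sqi M u'" "sqi M g'" "sqi M v" "sqi M h"
  shows "bform (\<lambda>x. u x + u' x) (\<lambda>x. g x + g' x) v h = bform u g v h + bform u' g' v h"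
  using bform_integrable[of u g v h] bform_integrable[of u' g' v h] assms
  unfolding bform_def by (simp add: inner_add_left distrib_left distrib_right)

lemma bform_cmult_left:
  shows "bform (\<lambda>x. c * u x) (\<lambda>x. c *\<^sub>R g x) v h = c * bform u g v h"
proof -
  have "(LINT x|M. V x * (c * u x) * v x) = (LINT x|M. c * (V x * u x * v x))"
    by (simp add: ac_simps)
  then show ?thesis unfolding bform_def by (simp add: distrib_left)
qed

lemma bform_bound:
  assumes "sqi M u" "sqi M g" "sqi M v" "sqi M h"
  shows "\<bar>bform u g v h\<bar> \<le> nrm2 M g * nrm2 M h + KV * nrm2 M u * nrm2 M v"
proof -
  have "\<bar>LINT x|M. V x * u x * v x\<bar> \<le> nrm2 M (\<lambda>x. V x * u x) * nrm2 M v"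
    using nrm2_Cauchy_Schwarz_real[OF sqi_V(1)[OF assms(1)] assms(3)] by simp
  also have "\<dots> \<le> KV * nrm2 M u * nrm2 M v"
    using sqi_V(2)[OF assms(1)] by (simp add: mult_right_mono)
  finally show ?thesis
    using nrm2_Cauchy_Schwarz[OF assms(2,4)] unfolding bform_def by linarith
qed

lemma bform_limit:
  assumes "H10_pair U u g" "\<And>n. \<phi> n \<in> test_functions U"
    "(\<lambda>n. nrm2 M (\<lambda>x. u x - \<phi> n x)) \<longlonglongrightarrow> 0"
    "(\<lambda>n. nrm2 M (\<lambda>x. g x - gradient (\<phi> n) x)) \<longlonglongrightarrow> 0"
    "sqi M v" "sqi M h"
  shows "(\<lambda>n. bform (\<phi> n) (gradient (\<phi> n)) v h) \<longlonglongrightarrow> bform u g v h"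
proof -
  note l = H10_pair_limit_inner[OF U_lebesgue assms(1-4)]
  have "(\<lambda>n. LINT x|M. V x * \<phi> n x * v x) \<longlonglongrightarrow> (LINT x|M. V x * u x * v x)"
    using l(1)[OF sqi_V(1)[OF assms(5)]] by (simp add: ac_simps)
  then show ?thesis unfolding bform_def by (intro tendsto_add l(2) assms)
qed

abbreviation "bt \<phi> \<psi> \<equiv> bform \<phi> (gradient \<phi>) \<psi> (gradient \<psi>)"

lemma bt_add:
  assumes "\<phi> \<in> test_functions U" "\<psi> \<in> test_functions U" "\<eta> \<in> test_functions U"
  shows "bt (\<lambda>x. \<phi> x + \<psi> x) \<eta> = bt \<phi> \<eta> + bt \<psi> \<eta>"
proof -
  have "gradient (\<lambda>x. \<phi> x + \<psi> x) = (\<lambda>x. gradient \<phi> x + gradient \<psi> x)"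
    using gradient_add assms test_differentiable by (intro ext) blast
  then show ?thesis using bform_add_left[OF test_sqi[OF assms(1)] test_sqi[OF assms(2)] test_sqi[OF assms(3)]] by simp
qed

lemma bt_cmult:
  assumes "\<phi> \<in> test_functions U"
  shows "bt (\<lambda>x. c * \<phi> x) \<eta> = c * bt \<phi> \<eta>"
proof -
  have "gradient (\<lambda>x. c * \<phi> x) = (\<lambda>x. c *\<^sub>R gradient \<phi> x)"
    using gradient_cmult assms test_differentiable by (intro ext) blast
  then show ?thesis using bform_cmult_left by simp
qed

lemma bt_square:
  assumes "\<phi> \<in> test_functions U" "\<psi> \<in> test_functions U"
  shows "bt (\<lambda>x. \<phi> x + t * \<psi> x) (\<lambda>x. \<phi> x + t * \<psi> x) = bt \<phi> \<phi> + 2 * t * bt \<phi> \<psi> + t\<^sup>2 * bt \<psi> \<psi>"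
proof -
  let ?\<eta> = "\<lambda>x. \<phi> x + t * \<psi> x"
  have t\<psi>: "(\<lambda>x. t * \<psi> x) \<in> test_functions U" by (rule test_cmult[OF assms(2)])
  have \<eta>: "?\<eta> \<in> test_functions U" by (rule test_add[OF assms(1) t\<psi>])
  have "bt ?\<eta> ?\<eta> = bt \<phi> ?\<eta> + t * bt \<psi> ?\<eta>"
    using bt_add[OF assms(1) t\<psi> \<eta>] bt_cmult[OF assms(2), of t ?\<eta>] by simp
  moreover have "bt \<eta> ?\<eta> = bt \<eta> \<phi> + t * bt \<eta> \<psi>" if "\<eta> \<in> test_functions U" for \<eta>
    using bt_add[OF assms(1) t\<psi> that] bt_cmult[OF assms(2), of t \<eta>]
    by (simp add: bform_commute[of \<eta>])
  ultimately show ?thesis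
    using assms bform_commute[of \<psi> "gradient \<psi>" \<phi>] by (simp add: algebra_simps power2_eq_square)
qed

lemma bt_ge:
  assumes "\<phi> \<in> test_functions U"
  shows "(nrm2 M (gradient \<phi>))\<^sup>2 \<le> bt \<phi> \<phi>"
proof -
  have "0 \<le> (LINT x|M. V x * \<phi> x * \<phi> x)"
    using V_nonneg by (intro integral_nonneg_AE AE_I2) (simp add: mult.assoc)
  then show ?thesis unfolding bform_def nrm2_power2 by (simp add: power2_norm_eq_inner)
qed

text \<open>Direct method: half of the functional \<open>J\<close> is the energy minus
  \<open>l\<close>. The parallelogram identity makes the gradients of a minimising sequence Cauchy,
  Poincare does the same for the functions, and L2 completeness gives the limit pair. Minimality
  against all multiples of a test function yields the equation.\<close>

lemma Riesz_test:
  assumes add: "\<And>\<phi> \<psi>. \<phi> \<in> test_functions U \<Longrightarrow> \<psi> \<in> test_functions U \<Longrightarrow> l (\<lambda>x. \<phi> x + \<psi> x) = l \<phi> + l \<psi>"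
    and cmult: "\<And>c \<phi>. \<phi> \<in> test_functions U \<Longrightarrow> l (\<lambda>x. c * \<phi> x) = c * l \<phi>"
    and bound: "\<And>\<phi>. \<phi> \<in> test_functions U \<Longrightarrow> \<bar>l \<phi>\<bar> \<le> C * nrm2 M (gradient \<phi>)"
  shows "\<exists>u g. H10_pair U u g \<and> (\<forall>\<phi>\<in>test_functions U. bform u g \<phi> (gradient \<phi>) = l \<phi>)"
proof -
  let ?T = "test_functions U"
  define J where "J \<phi> = bt \<phi> \<phi> - 2 * l \<phi>" for \<phi>
  \<comment> \<open>Completing the square in the norm of the gradient.\<close>
  have J_below: "- C\<^sup>2 \<le> J \<phi>" if "\<phi> \<in> ?T" for \<phi>
  proof -
    let ?a = "nrm2 M (gradient \<phi>)"
    have "l \<phi> \<le> C * ?a" using bound[OF that] by linarith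
    then have "?a\<^sup>2 - 2 * (C * ?a) \<le> J \<phi>" using bt_ge[OF that] unfolding J_def by linarith
    moreover have "0 \<le> ?a\<^sup>2 + C\<^sup>2 - 2 * (C * ?a)"
      using zero_le_power2[of "?a - C"] by (simp add: power2_diff algebra_simps)
    ultimately show ?thesis by linarith
  qed
  define m where "m = Inf (J ` ?T)"
  have bdd: "bdd_below (J ` ?T)" using J_below by (auto simp: bdd_below_def)
  have m_le: "m \<le> J \<phi>" if "\<phi> \<in> ?T" for \<phi>
    unfolding m_def using bdd that by (intro cInf_lower) auto
  have "\<exists>\<phi>\<in>?T. J \<phi> < m + 1 / real (Suc n)" for n
  proof -
    have lt: "Inf (J ` ?T) < m + 1 / real (Suc n)" by (simp add: m_def)
    have "J ` ?T \<noteq> {}" using test_zero by blast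
    from cInf_lessD[OF this lt] show ?thesis by auto
  qed
  then obtain \<phi> where \<phi>: "\<And>n. \<phi> n \<in> ?T" "\<And>n. J (\<phi> n) < m + 1 / real (Suc n)"
    by metis
  have par: "(nrm2 M (\<lambda>x. gradient \<psi> x - gradient \<eta> x))\<^sup>2 \<le> 2 * (J \<psi> - m) + 2 * (J \<eta> - m)"
    if \<psi>: "\<psi> \<in> ?T" and \<eta>: "\<eta> \<in> ?T" for \<psi> \<eta>
  proof -
    \<comment> \<open>Written as \<open>\<psi> + t \<eta>\<close> with t = -1 and t = 1 so that both
      are instances of \<open>bt_square\<close>. Half of the sum is the midpoint, whose value of
      \<open>J\<close> is at least the infimum.\<close>
    let ?d = "\<lambda>x. \<psi> x + (-1) * \<eta> x" and ?s = "\<lambda>x. \<psi> x + 1 * \<eta> x"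
    have d: "?d \<in> ?T" and s: "?s \<in> ?T" using test_add[OF \<psi> test_cmult[OF \<eta>]] by blast+
    let ?h = "\<lambda>x. (1/2) * ?s x"
    have h: "?h \<in> ?T" by (rule test_cmult[OF s])
    have bh: "bt ?h ?h = bt ?s ?s / 4"
    proof -
      have "bt ?h ?h = 1/2 * bt ?s ?h" by (rule bt_cmult[OF s])
      also have "bt ?s ?h = bt ?h ?s" by (rule bform_commute)
      also have "bt ?h ?s = 1/2 * bt ?s ?s" by (rule bt_cmult[OF s])
      finally show ?thesis by argo
    qed
    have lh: "l ?h = (l \<psi> + l \<eta>) / 2"
      using cmult[OF s, of "1/2"] add[OF \<psi> \<eta>] by simp
    have "m \<le> bt ?s ?s / 4 - (l \<psi> + l \<eta>)"
      using m_le[OF h] unfolding J_def bh lh by argo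
    moreover have "bt ?d ?d + bt ?s ?s = 2 * bt \<psi> \<psi> + 2 * bt \<eta> \<eta>"
      unfolding bt_square[OF \<psi> \<eta>] by simp
    ultimately have "bt ?d ?d \<le> 2 * (J \<psi> - m) + 2 * (J \<eta> - m)"
      unfolding J_def by argo
    moreover have "(nrm2 M (gradient ?d))\<^sup>2 \<le> bt ?d ?d" by (rule bt_ge[OF d])
    moreover have "gradient ?d = (\<lambda>x. gradient \<psi> x - gradient \<eta> x)"
      using gradient_diff[OF test_differentiable[OF \<psi>] test_differentiable[OF \<eta>]] by auto
    ultimately show ?thesis by simp
  qed
  have gC: "\<exists>N. \<forall>p\<ge>N. \<forall>q\<ge>N. nrm2 M (\<lambda>x. gradient (\<phi> p) x - gradient (\<phi> q) x) < e" if e: "e > 0" for e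
  proof -
    obtain N where N: "4 / e\<^sup>2 < real N" using reals_Archimedean2 by blast
    have "nrm2 M (\<lambda>x. gradient (\<phi> p) x - gradient (\<phi> q) x) < e" if "p \<ge> N" "q \<ge> N" for p q
    proof -
      have small: "1 / real (Suc n) < e\<^sup>2 / 4" if "n \<ge> N" for n
      proof -
        have "4 / e\<^sup>2 < real (Suc n)" using N that by linarith
        then show ?thesis using e by (simp add: field_simps)
      qed
      have "J (\<phi> n) < m + e\<^sup>2 / 4" if "n \<ge> N" for n
        using order.strict_trans[OF \<phi>(2)[of n] add_strict_left_mono[OF small[OF that], of m]] .
      note small' = this[OF that(1)] this[OF that(2)]
      have "c < d" if "a < m + d / 4" "b < m + d / 4" "c \<le> 2 * (a - m) + 2 * (b - m)" for a b c d :: real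
        using that by argo
      from this[OF small' par[OF \<phi>(1,1)]]
      have "(nrm2 M (\<lambda>x. gradient (\<phi> p) x - gradient (\<phi> q) x))\<^sup>2 < e\<^sup>2" .
      then show ?thesis using e power2_less_imp_less by fastforce
    qed
    then show ?thesis by blast
  qed
  have P: "nrm2 M (\<lambda>x. \<phi> p x - \<phi> q x) \<le> 2 * r * nrm2 M (\<lambda>x. gradient (\<phi> p) x - gradient (\<phi> q) x)" for p q
  proof -
    have "gradient (\<lambda>x. \<phi> p x - \<phi> q x) = (\<lambda>x. gradient (\<phi> p) x - gradient (\<phi> q) x)"
      by (rule ext) (rule gradient_diff[OF test_differentiable[OF \<phi>(1)] test_differentiable[OF \<phi>(1)]])
    then show ?thesis
      using Poincare_test[OF U_lebesgue U_ball r_nonneg test_diff[OF \<phi>(1,1), of p q]] by simp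
  qed
  obtain g where g: "sqi M g" "(\<lambda>n. nrm2 M (\<lambda>x. g x - gradient (\<phi> n) x)) \<longlonglongrightarrow> 0"
    using sqi_complete[of M "\<lambda>n. gradient (\<phi> n)", OF test_sqi(2)[OF \<phi>(1) U_lebesgue] gC] by blast
  have uC: "\<exists>N. \<forall>p\<ge>N. \<forall>q\<ge>N. nrm2 M (\<lambda>x. \<phi> p x - \<phi> q x) < e" if e: "e > 0" for e
  proof -
    \<comment> \<open>The summand 1 allows division also when r = 0.\<close>
    have pos: "2 * r + 1 > 0" using r_nonneg by linarith
    then obtain N where N: "\<And>p q. p \<ge> N \<Longrightarrow> q \<ge> N \<Longrightarrow> nrm2 M (\<lambda>x. gradient (\<phi> p) x - gradient (\<phi> q) x) < e / (2 * r + 1)"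
      using gC[of "e / (2 * r + 1)"] e by auto
    have "nrm2 M (\<lambda>x. \<phi> p x - \<phi> q x) < e" if "p \<ge> N" "q \<ge> N" for p q
    proof -
      let ?n = "nrm2 M (\<lambda>x. gradient (\<phi> p) x - gradient (\<phi> q) x)"
      have "0 \<le> ?n" by (rule nrm2_nonneg)
      then have "nrm2 M (\<lambda>x. \<phi> p x - \<phi> q x) \<le> 2 * r * ?n + ?n"
        using P[of p q] by linarith
      also have "\<dots> = (2 * r + 1) * ?n" by (simp only: distrib_right mult_1)
      also have "\<dots> < e" using N[OF that] pos by (simp add: field_simps)
      finally show ?thesis .
    qed
    then show ?thesis by blast
  qed
  obtain u where u: "sqi M u" "(\<lambda>n. nrm2 M (\<lambda>x. u x - \<phi> n x)) \<longlonglongrightarrow> 0"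
    using sqi_complete[of M \<phi>, OF test_sqi(1)[OF \<phi>(1) U_lebesgue] uC] by blast
  have pair: "H10_pair U u g"
    unfolding H10_pair_def using u g \<phi>(1) by blast
  have "bform u g \<psi> (gradient \<psi>) = l \<psi>" if \<psi>: "\<psi> \<in> ?T" for \<psi>
  proof -
    let ?b = "bform u g \<psi> (gradient \<psi>)"
    \<comment> \<open>The constant term, the distance of \<open>J (\<phi> n)\<close> to the infimum,
      disappears in the limit. A quadratic in t that is nonnegative with constant term 0 has
      vanishing linear coefficient.\<close>
    have "0 \<le> 0 - 2 * t * (l \<psi> - ?b) + t\<^sup>2 * bt \<psi> \<psi>" for t
    proof (rule LIMSEQ_le_const)
      have "(\<lambda>n. 1 / real (Suc n) - 2 * t * (l \<psi> - bt (\<phi> n) \<psi>) + t\<^sup>2 * bt \<psi> \<psi>) \<longlonglongrightarrow> 0 - 2 * t * (l \<psi> - ?b) + t\<^sup>2 * bt \<psi> \<psi>"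
        by (intro tendsto_intros bform_limit[OF pair \<phi>(1) u(2) g(2)] test_sqi[OF \<psi>] U_lebesgue
            LIMSEQ_inverse_real_of_nat[unfolded inverse_eq_divide])
      then show "(\<lambda>n. 1 / real (Suc n) - 2 * t * (l \<psi> - bt (\<phi> n) \<psi>) + t\<^sup>2 * bt \<psi> \<psi>) \<longlonglongrightarrow> 0 - 2 * t * (l \<psi> - ?b) + t\<^sup>2 * bt \<psi> \<psi>" .
      have "0 \<le> 1 / real (Suc n) - 2 * t * (l \<psi> - bt (\<phi> n) \<psi>) + t\<^sup>2 * bt \<psi> \<psi>" for n
      proof -
        have t\<psi>: "(\<lambda>x. t * \<psi> x) \<in> ?T" by (rule test_cmult[OF \<psi>])
        have "m \<le> J (\<lambda>x. \<phi> n x + t * \<psi> x)" by (rule m_le[OF test_add[OF \<phi>(1) t\<psi>]])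
        also have "\<dots> = J (\<phi> n) - 2 * t * (l \<psi> - bt (\<phi> n) \<psi>) + t\<^sup>2 * bt \<psi> \<psi>"
          unfolding J_def bt_square[OF \<phi>(1) \<psi>] add[OF \<phi>(1) t\<psi>] cmult[OF \<psi>] by (simp add: algebra_simps)
        finally show ?thesis using \<phi>(2)[of n] by linarith
      qed
      then show "\<exists>N. \<forall>n\<ge>N. 0 \<le> 1 / real (Suc n) - 2 * t * (l \<psi> - bt (\<phi> n) \<psi>) + t\<^sup>2 * bt \<psi> \<psi>" by blast
    qed
    moreover have "0 \<le> bt \<psi> \<psi>" using bt_ge[OF \<psi>] by (meson order.trans zero_le_power2)
    ultimately have "(l \<psi> - ?b)\<^sup>2 \<le> 0 * bt \<psi> \<psi>" by (rule quadratic_nonneg_discriminant)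
    then show ?thesis by simp
  qed
  with pair show ?thesis by blast
qed

section \<open>Bounded functionals and weak convergence\<close>

lemma H1_norm_pair:
  assumes "H10_pair U u g"
  shows "H1_norm U u = sqrt ((nrm2 M u)\<^sup>2 + (nrm2 M g)\<^sup>2)"
  by (rule weak_gradient_eq(3)[OF open_U H10_pair_sqi[OF assms] H10_pair_weak_gradient[OF U_lebesgue assms]])

lemma H1_norm_le:
  assumes "H10_pair U u g"
  shows "H1_norm U u \<le> nrm2 M u + nrm2 M g" "H1_norm U u \<le> (2 * r + 1) * nrm2 M g"
proof -
  show "H1_norm U u \<le> nrm2 M u + nrm2 M g"
    unfolding H1_norm_pair[OF assms] using sqrt_add_le_add_sqrt[of "(nrm2 M u)\<^sup>2" "(nrm2 M g)\<^sup>2"] by simp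
  then show "H1_norm U u \<le> (2 * r + 1) * nrm2 M g"
    using Poincare[OF U_lebesgue U_ball r_nonneg assms] by (simp add: distrib_right)
qed

text \<open>The functional is represented on test functions and the representation extends by
  continuity. The representing pair (v, h) depends on the potential, which is harmless because only
  the full dual space matters.\<close>

lemma Riesz_dual:
  assumes l: "l \<in> H10_dual U"
  shows "\<exists>v h. H10_pair U v h \<and> (\<forall>u g. H10_pair U u g \<longrightarrow> l u = bform u g v h)"
proof -
  have T: "\<phi> \<in> H10 U" if "\<phi> \<in> test_functions U" for \<phi>
    by (rule H10_iff(2)[OF open_U H10_pair_test[OF U_lebesgue that]])
  have add: "l (\<lambda>x. u x + v x) = l u + l v" if "u \<in> H10 U" "v \<in> H10 U" for u v
    using l that by (auto simp: H10_dual_def)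
  have cmult: "l (\<lambda>x. c * u x) = c * l u" if "u \<in> H10 U" for c u
    using l that by (auto simp: H10_dual_def)
  obtain K0 where K0: "\<And>u. u \<in> H10 U \<Longrightarrow> \<bar>l u\<bar> \<le> K0 * H1_norm U u"
    using l unfolding H10_dual_def by blast
  have K: "\<bar>l u\<bar> \<le> \<bar>K0\<bar> * (nrm2 M u + nrm2 M g)" if "H10_pair U u g" for u g
  proof -
    \<comment> \<open>The bound \<open>K0\<close> carries no sign, hence the passage to its absolute
      value.\<close>
    have "\<bar>l u\<bar> \<le> K0 * H1_norm U u" using K0[OF H10_iff(2)[OF open_U that]] .
    also have "\<dots> \<le> \<bar>K0\<bar> * H1_norm U u"
      by (intro mult_right_mono) (auto simp: H1_norm_pair[OF that])
    also have "\<dots> \<le> \<bar>K0\<bar> * (nrm2 M u + nrm2 M g)"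
      using H1_norm_le(1)[OF that] by (intro mult_left_mono) auto
    finally show ?thesis .
  qed
  have "\<exists>v h. H10_pair U v h \<and> (\<forall>\<phi>\<in>test_functions U. bform v h \<phi> (gradient \<phi>) = l \<phi>)"
  proof (rule Riesz_test)
    show "\<bar>l \<phi>\<bar> \<le> (\<bar>K0\<bar> * (2 * r + 1)) * nrm2 M (gradient \<phi>)" if "\<phi> \<in> test_functions U" for \<phi>
    proof -
      note p = H10_pair_test[OF U_lebesgue that]
      have "\<bar>l \<phi>\<bar> \<le> \<bar>K0\<bar> * (nrm2 M \<phi> + nrm2 M (gradient \<phi>))" by (rule K[OF p])
      also have "\<dots> \<le> \<bar>K0\<bar> * ((2 * r + 1) * nrm2 M (gradient \<phi>))"
        using Poincare[OF U_lebesgue U_ball r_nonneg p] by (intro mult_left_mono) (auto simp: distrib_right)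
      finally show ?thesis by (simp add: mult.assoc)
    qed
  qed (use add cmult T in auto)
  then obtain v h where vh: "H10_pair U v h" "\<And>\<phi>. \<phi> \<in> test_functions U \<Longrightarrow> bform v h \<phi> (gradient \<phi>) = l \<phi>"
    by blast
  have "l u = bform u g v h" if p: "H10_pair U u g" for u g
  proof -
    obtain \<phi> where \<phi>: "\<And>n::nat. \<phi> n \<in> test_functions U"
      "(\<lambda>n. nrm2 M (\<lambda>x. u x - \<phi> n x)) \<longlonglongrightarrow> 0" "(\<lambda>n. nrm2 M (\<lambda>x. g x - gradient (\<phi> n) x)) \<longlonglongrightarrow> 0"
      using H10_pairE[OF p] by blast
    have "(\<lambda>n. l (\<phi> n)) \<longlonglongrightarrow> bform u g v h"
      using bform_limit[OF p \<phi> H10_pair_sqi[OF vh(1)]] by (simp add: bform_commute[of _ _ v] vh(2) \<phi>(1))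
    moreover have "(\<lambda>n. l (\<phi> n)) \<longlonglongrightarrow> l u"
    proof (rule Lim_transform[OF tendsto_const])
      show "(\<lambda>n. l (\<phi> n) - l u) \<longlonglongrightarrow> 0"
      proof (rule Lim_null_comparison)
        show "(\<lambda>n. \<bar>K0\<bar> * (nrm2 M (\<lambda>x. u x - \<phi> n x) + nrm2 M (\<lambda>x. g x - gradient (\<phi> n) x))) \<longlonglongrightarrow> 0"
          using tendsto_mult_left[OF tendsto_add[OF \<phi>(2,3)], of "\<bar>K0\<bar>"] by simp
        have "norm (l (\<phi> n) - l u) \<le> \<bar>K0\<bar> * (nrm2 M (\<lambda>x. u x - \<phi> n x) + nrm2 M (\<lambda>x. g x - gradient (\<phi> n) x))" for n
        proof -
          have pd: "H10_pair U (\<lambda>x. u x - \<phi> n x) (\<lambda>x. g x - gradient (\<phi> n) x)"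
            by (rule H10_pair_diff[OF U_lebesgue p H10_pair_test[OF U_lebesgue \<phi>(1)]])
          have "l u = l (\<lambda>x. u x - \<phi> n x) + l (\<phi> n)"
            using add[OF H10_iff(2)[OF open_U pd] T[OF \<phi>(1)[of n]]] by simp
          then show ?thesis using K[OF pd] by simp
        qed
        then show "\<forall>\<^sub>F n in sequentially. norm (l (\<phi> n) - l u) \<le> \<bar>K0\<bar> * (nrm2 M (\<lambda>x. u x - \<phi> n x) + nrm2 M (\<lambda>x. g x - gradient (\<phi> n) x))"
          by simp
      qed
    qed
    ultimately show ?thesis using LIMSEQ_unique by blast
  qed
  with vh(1) show ?thesis by blast
qed

text \<open>Boundedness reduces weak convergence to testing the energy form against test functions.\<close>

lemma weakly_tends_H10I:
  assumes w: "\<forall>\<^sub>F e in F. H10_pair U (w e) (G e) \<and> nrm2 M (G e) \<le> C"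
    and p: "H10_pair U u g"
    and conv: "\<And>\<phi>. \<phi> \<in> test_functions U \<Longrightarrow>
      ((\<lambda>e. bform (w e) (G e) \<phi> (gradient \<phi>)) \<longlongrightarrow> bform u g \<phi> (gradient \<phi>)) F"
  shows "weakly_tends_H10 U w u F"
  unfolding weakly_tends_H10_def
proof (intro conjI ballI)
  show "\<forall>\<^sub>F e in F. w e \<in> H10 U"
    using w by eventually_elim (use H10_iff(2)[OF open_U] in blast)
  show "u \<in> H10 U" by (rule H10_iff(2)[OF open_U p])
  fix l assume "l \<in> H10_dual U"
  then obtain v h where vh: "H10_pair U v h" "\<And>u g. H10_pair U u g \<Longrightarrow> l u = bform u g v h"
    using Riesz_dual by blast
  note svh = H10_pair_sqi[OF vh(1)]
  obtain \<phi> where \<phi>: "\<And>n::nat. \<phi> n \<in> test_functions U"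
    "(\<lambda>n. nrm2 M (\<lambda>x. v x - \<phi> n x)) \<longlonglongrightarrow> 0" "(\<lambda>n. nrm2 M (\<lambda>x. h x - gradient (\<phi> n) x)) \<longlonglongrightarrow> 0"
    using H10_pairE[OF vh(1)] by blast
  \<comment> \<open>One constant that bounds the gradients of the family and of the limit, so that
    \<open>bd\<close> covers both.\<close>
  define C' where "C' = max C (nrm2 M g)"
  define \<delta> where "\<delta> n = C' * nrm2 M (\<lambda>x. h x - gradient (\<phi> n) x) + KV * (2 * r * C') * nrm2 M (\<lambda>x. v x - \<phi> n x)" for n
  have "\<delta> \<longlonglongrightarrow> C' * 0 + KV * (2 * r * C') * 0"
    unfolding \<delta>_def by (intro tendsto_intros \<phi>)
  then have \<delta>0: "\<delta> \<longlonglongrightarrow> 0" by simp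
  \<comment> \<open>The error of replacing (v, h) by a test function is uniform over all pairs with
    gradient bounded by \<open>C'\<close>. This permits fixing n before passing to the limit in the
    family.\<close>
  have bd: "\<bar>bform u' g' v h - bform u' g' (\<phi> n) (gradient (\<phi> n))\<bar> \<le> \<delta> n"
    if p': "H10_pair U u' g'" and "nrm2 M g' \<le> C'" for u' g' n
  proof -
    note s = H10_pair_sqi[OF p'] and t = test_sqi[OF \<phi>(1)[of n] U_lebesgue]
    have u': "nrm2 M u' \<le> 2 * r * C'"
      using Poincare[OF U_lebesgue U_ball r_nonneg p'] that(2) r_nonneg
      by (meson mult_left_mono mult_nonneg_nonneg order.trans zero_le_numeral)
    have "bform u' g' v h - bform u' g' (\<phi> n) (gradient (\<phi> n)) = bform u' g' (\<lambda>x. v x - \<phi> n x) (\<lambda>x. h x - gradient (\<phi> n) x)"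
      using bform_diff_left[OF svh t s] by (simp add: bform_commute[of u' g'])
    also have "\<bar>\<dots>\<bar> \<le> nrm2 M g' * nrm2 M (\<lambda>x. h x - gradient (\<phi> n) x) + KV * nrm2 M u' * nrm2 M (\<lambda>x. v x - \<phi> n x)"
      by (intro bform_bound s sqi_diff svh t)
    also have "\<dots> \<le> \<delta> n"
      unfolding \<delta>_def using that(2) u' KV_nonneg
      by (intro add_mono mult_right_mono mult_left_mono) auto
    finally show ?thesis .
  qed
  show "((\<lambda>e. l (w e)) \<longlongrightarrow> l u) F"
  proof (rule tendstoI)
    fix e :: real assume e: "e > 0"
    then have "\<forall>\<^sub>F n in sequentially. \<delta> n < e / 3"
      using order_tendstoD(2)[OF \<delta>0, of "e / 3"] by simp
    then obtain n where n: "\<delta> n < e / 3" by (auto simp: eventually_sequentially)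
    have "\<forall>\<^sub>F x in F. dist (bform (w x) (G x) (\<phi> n) (gradient (\<phi> n))) (bform u g (\<phi> n) (gradient (\<phi> n))) < e / 3"
      using tendstoD[OF conv[OF \<phi>(1)[of n]], of "e / 3"] e by simp
    with w show "\<forall>\<^sub>F x in F. dist (l (w x)) (l u) < e"
    proof eventually_elim
      case (elim x)
      then have "\<bar>l (w x) - bform (w x) (G x) (\<phi> n) (gradient (\<phi> n))\<bar> \<le> \<delta> n"
        using bd[of "w x" "G x" n] vh(2) by (auto simp: C'_def)
      moreover have "\<bar>l u - bform u g (\<phi> n) (gradient (\<phi> n))\<bar> \<le> \<delta> n"
        using bd[OF p, of n] vh(2)[OF p] by (auto simp: C'_def)
      ultimately show ?case using elim n unfolding dist_real_def by linarith
    qed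
  qed
qed

end

section \<open>The radial profile of the corrector\<close>

text \<open>In terms of the squared radius, normalised so that its gradient has inward flux \<open>S\<^sub>d\<close> through spheres.\<close>

definition fund_sol :: "nat \<Rightarrow> real \<Rightarrow> real" where
  "fund_sol d s = (if d = 2 then - ln s / 2 else s powr (1 - real d / 2) / (real d - 2))"

text \<open>The cutoff is inactive for \<open>s \<le> 1/4\<close> and complete for
  \<open>s \<ge> 1/2\<close>, well inside the rescaled ball \<open>s < 1\<close>, so contributions
  of disjoint balls do not interact. Subtracting the value at 1 makes the uncut function positive
  where the cutoff acts.\<close>

definition profile :: "nat \<Rightarrow> real \<Rightarrow> real" where
  "profile d s = (1 - smooth_step (4 * s - 1)) * (fund_sol d s - fund_sol d 1)"

abbreviation "profile' d \<equiv> deriv (profile d)"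
abbreviation "profile'' d \<equiv> deriv (deriv (profile d))"

text \<open>For p = \<open>profile d\<close> and s the squared distance to a point, the chain rule
  gives the Laplacian \<open>4 s p'' + 2 d p'\<close>. The value 0 for \<open>s \<le> 0\<close>
  continues the vanishing near the singularity, where p is harmonic.\<close>

definition profile_laplacian :: "nat \<Rightarrow> real \<Rightarrow> real" where
  "profile_laplacian d s = (if s > 0 then 4 * s * profile'' d s + 2 * real d * profile' d s else 0)"

text \<open>Both branches have the same derivative, so the computations with the profile need no
  distinction of dimensions. As a function of \<open>(norm x)\<^sup>2\<close> the gradient becomes
  minus x divided by the d-th power of its norm, which has flux \<open>S_d\<close>.\<close>

lemma fund_sol_deriv:
  assumes "d \<ge> 2" "s > 0"
  shows "(fund_sol d has_real_derivative - (1/2) * s powr (- (real d / 2))) (at s)"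
proof (cases "d = 2")
  case True
  have "((\<lambda>s. - ln s / 2) has_real_derivative - (1 / s) / 2) (at s)"
    using assms(2) by (auto intro!: derivative_eq_intros)
  moreover have "s powr (- 1) = 1 / s" using assms(2) by (simp add: powr_minus_divide)
  then have "- (1 / s) / 2 = - (1/2) * s powr (- (real d / 2))" using True by simp
  ultimately have "((\<lambda>s. - ln s / 2) has_real_derivative - (1/2) * s powr (- (real d / 2))) (at s)"
    by (rule DERIV_cong)
  then show ?thesis using True by (simp add: fund_sol_def[abs_def])
next
  case False
  then have d: "real d - 2 > 0" using assms by simp
  have "((\<lambda>s. s powr (1 - real d / 2)) has_real_derivative (1 - real d / 2) * s powr (1 - real d / 2 - 1)) (at s)"
    using assms(2) by (rule has_real_derivative_powr)
  from DERIV_cdivide[OF this, of "real d - 2"]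
  have "((\<lambda>s. s powr (1 - real d / 2) / (real d - 2)) has_real_derivative (1 - real d / 2) * s powr (1 - real d / 2 - 1) / (real d - 2)) (at s)" .
  moreover have "(1 - real d / 2) * s powr (1 - real d / 2 - 1) / (real d - 2) = - (1/2) * s powr (- (real d / 2))"
    using d by (simp add: field_simps)
  ultimately show ?thesis using False by (simp add: fund_sol_def[abs_def])
qed

lemma smooth_on_fund_sol: "smooth_on {0<..} (fund_sol d)"
proof (cases "d = 2")
  case True
  have "smooth_on {0<..} (\<lambda>s::real. (- 1/2) * ln s)" by (intro smooth_on_mult smooth_on_ln smooth_on_const)
  then show ?thesis using True by (simp add: fund_sol_def[abs_def])
next
  case False
  have "fund_sol d = (\<lambda>s. s powr (1 - real d / 2) * inverse (real d - 2))"
    by (rule ext) (use False in \<open>simp only: fund_sol_def divide_inverse if_False\<close>)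
  moreover have "smooth_on {0<..} (\<lambda>s::real. s powr (1 - real d / 2) * inverse (real d - 2))"
    by (intro smooth_on_mult smooth_on_powr smooth_on_const)
  ultimately show ?thesis by simp
qed

lemma fund_sol_strict_antimono:
  assumes "d \<ge> 2" "0 < s" "s < t"
  shows "fund_sol d t < fund_sol d s"
proof (rule DERIV_neg_imp_decreasing[OF assms(3)])
  fix y assume "s \<le> y" "y \<le> t"
  then have "y > 0" using assms by simp
  moreover have "- (1/2) * y powr (- (real d / 2)) < 0" using \<open>y > 0\<close> by simp
  ultimately show "\<exists>D. (fund_sol d has_real_derivative D) (at y) \<and> D < 0"
    using fund_sol_deriv[OF assms(1)] by blast
qed

lemma smooth_on_profile: "smooth_on {0<..} (profile d)"
proof -
  have "smooth_on {0<..} (\<lambda>s. smooth_step (4 * s - 1))"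
    by (rule smooth_on_compose[OF smooth_on_smooth_step]) (auto intro!: smooth_on_diff smooth_on_mult)
  then show ?thesis
    unfolding profile_def[abs_def] by (intro smooth_on_mult smooth_on_diff smooth_on_const smooth_on_fund_sol)
qed

lemma profile_0: "s \<ge> 1/2 \<Longrightarrow> profile d s = 0"
  by (simp add: profile_def smooth_step_1)

lemma profile_small: "s \<le> 1/4 \<Longrightarrow> profile d s = fund_sol d s - fund_sol d 1"
  by (simp add: profile_def smooth_step_0)

lemma
  assumes "d \<ge> 2" "s > 0"
  shows profile_nonneg: "0 \<le> profile d s"
    and profile_le: "s < 1 \<Longrightarrow> profile d s \<le> fund_sol d s - fund_sol d 1"
proof -
  have le: "fund_sol d s - fund_sol d 1 \<ge> 0" if "s < 1"
    using fund_sol_strict_antimono[OF assms that] by simp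
  show "0 \<le> profile d s"
  proof (cases "s < 1/2")
    case True
    then show ?thesis unfolding profile_def using le smooth_step_le_1 by (intro mult_nonneg_nonneg) auto
  qed (simp add: profile_0)
  assume "s < 1"
  then show "profile d s \<le> fund_sol d s - fund_sol d 1"
    unfolding profile_def using le smooth_step_nonneg smooth_step_le_1 by (intro mult_left_le_one_le) auto
qed

lemma profile_pos: "d \<ge> 2 \<Longrightarrow> 0 < s \<Longrightarrow> s \<le> 1/4 \<Longrightarrow> 0 < profile d s"
  using fund_sol_strict_antimono[of d s 1] by (simp add: profile_small)

text \<open>Monotonicity through the cutoff is avoided: for s below 1/2 the profile is dominated by
  the decreasing uncut function, which agrees with the profile at \<open>\<alpha>\<close>; beyond
  1/2 it is 0.\<close>

lemma profile_less:
  assumes "d \<ge> 2" "0 < \<alpha>" "\<alpha> \<le> 1/4" "\<alpha> < s"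
  shows "profile d s < profile d \<alpha>"
proof (cases "s < 1/2")
  case True
  then have "profile d s \<le> fund_sol d s - fund_sol d 1" using assms by (intro profile_le) auto
  also have "\<dots> < fund_sol d \<alpha> - fund_sol d 1" using fund_sol_strict_antimono[OF assms(1,2,4)] by simp
  finally show ?thesis using assms by (simp add: profile_small)
next
  case False
  then show ?thesis using profile_pos[OF assms(1-3)] by (simp add: profile_0)
qed

lemma profile_deriv: "s > 0 \<Longrightarrow> (profile d has_real_derivative profile' d s) (at s)"
  and smooth_on_profile': "smooth_on {0<..} (profile' d)"
  using smooth_on_realD[OF smooth_on_profile] by auto

lemma profile'_deriv: "s > 0 \<Longrightarrow> (profile' d has_real_derivative profile'' d s) (at s)"
  and smooth_on_profile'': "smooth_on {0<..} (profile'' d)"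
  using smooth_on_realD[OF smooth_on_profile'] by auto

lemma profile'_0: assumes "s > 1/2" shows "profile' d s = 0"
proof -
  have "((\<lambda>_. 0) has_real_derivative 0) (at s)" by simp
  then have "(profile d has_real_derivative 0) (at s)"
    by (rule has_field_derivative_transform_within_open[of _ _ _ "{1/2<..}"]) (use assms in \<open>auto simp: profile_0\<close>)
  then show ?thesis by (rule DERIV_imp_deriv)
qed

lemma profile''_0: assumes "s > 1/2" shows "profile'' d s = 0"
proof -
  have "((\<lambda>_. 0) has_real_derivative 0) (at s)" by simp
  then have "(profile' d has_real_derivative 0) (at s)"
    by (rule has_field_derivative_transform_within_open[of _ _ _ "{1/2<..}"]) (use assms in \<open>auto simp: profile'_0\<close>)
  then show ?thesis by (rule DERIV_imp_deriv)
qed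

lemma profile'_small:
  assumes "d \<ge> 2" "0 < s" "s < 1/4"
  shows "profile' d s = - (1/2) * s powr (- (real d / 2))"
proof -
  have "((\<lambda>s. fund_sol d s - fund_sol d 1) has_real_derivative - (1/2) * s powr (- (real d / 2)) - 0) (at s)"
    by (intro DERIV_diff fund_sol_deriv DERIV_const assms)
  then have "(profile d has_real_derivative - (1/2) * s powr (- (real d / 2)) - 0) (at s)"
    by (rule has_field_derivative_transform_within_open[of _ _ _ "{0<..<1/4}"])
      (use assms in \<open>auto simp: profile_small\<close>)
  then show ?thesis using DERIV_imp_deriv by fastforce
qed

lemma profile''_small:
  assumes "d \<ge> 2" "0 < s" "s < 1/4"
  shows "profile'' d s = real d / 4 * s powr (- (real d / 2) - 1)"
proof -
  have "((\<lambda>s. - (1/2) * s powr (- (real d / 2))) has_real_derivative - (1/2) * (- (real d / 2) * s powr (- (real d / 2) - 1))) (at s)"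
    by (intro DERIV_cmult has_real_derivative_powr assms)
  then have "(profile' d has_real_derivative - (1/2) * (- (real d / 2) * s powr (- (real d / 2) - 1))) (at s)"
    by (rule has_field_derivative_transform_within_open[of _ _ _ "{0<..<1/4}"])
      (use assms in \<open>auto simp: profile'_small\<close>)
  then show ?thesis using DERIV_imp_deriv by fastforce
qed

lemma profile_laplacian_0:
  assumes "d \<ge> 2" "s < 1/4 \<or> s > 1/2"
  shows "profile_laplacian d s = 0"
proof (cases "s > 1/2 \<or> s \<le> 0")
  case True
  then show ?thesis by (auto simp: profile_laplacian_def profile'_0 profile''_0)
next
  case False
  then have s: "0 < s" "s < 1/4" using assms by auto
  have "s * s powr (- (real d / 2) - 1) = s powr (- (real d / 2))"
    using s by (simp add: powr_diff)
  then show ?thesis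
    using s by (simp add: profile_laplacian_def profile'_small[OF assms(1) s] profile''_small[OF assms(1) s])
qed

text \<open>On positive arguments it is built from smooth functions, below 1/4 it is 0, and these
  two open sets cover the line.\<close>

lemma continuous_profile_laplacian:
  assumes "d \<ge> 2"
  shows "continuous_on UNIV (profile_laplacian d)"
proof -
  have "continuous_on {0<..} (\<lambda>s. 4 * s * profile'' d s + 2 * real d * profile' d s)"
    by (intro continuous_intros smooth_on_continuous[OF smooth_on_profile'] smooth_on_continuous[OF smooth_on_profile''])
  then have "continuous_on {0<..} (profile_laplacian d)"
    by (rule continuous_on_eq) (simp add: profile_laplacian_def)
  moreover have "continuous_on {..<1/4} (profile_laplacian d)"
    by (rule continuous_on_eq[where f = "\<lambda>_. 0"]) (use profile_laplacian_0[OF assms] in auto)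
  moreover have "UNIV = {0<..} \<union> {..<1/4::real}" by auto
  ultimately show ?thesis
    using continuous_on_open_Un[of "{0<..}" "{..<1/4::real}" "profile_laplacian d"] by simp
qed

lemma profile_laplacian_bounded:
  assumes "d \<ge> 2"
  obtains B where "B > 0" "\<And>s. \<bar>profile_laplacian d s\<bar> \<le> B"
  using compact_support_bounded[OF continuous_profile_laplacian[OF assms], of "{1/4..1/2}"]
    profile_laplacian_0[OF assms] by (metis atLeastAtMost_iff compact_Icc not_le real_norm_def)

lemma bounded_beyond:
  fixes f :: "real \<Rightarrow> real"
  assumes "smooth_on {0<..} f" "\<And>s. s > 1/2 \<Longrightarrow> f s = 0" "\<alpha> > 0"
  obtains B where "B > 0" "\<And>s. s \<ge> \<alpha> \<Longrightarrow> \<bar>f s\<bar> \<le> B"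
proof -
  have "compact (f ` {\<alpha>..1/2})"
    using smooth_on_continuous[OF assms(1)] assms(3)
    by (intro compact_continuous_image) (auto intro: continuous_on_subset)
  then obtain B where B: "B > 0" "\<And>y. y \<in> f ` {\<alpha>..1/2} \<Longrightarrow> norm y \<le> B"
    using compact_imp_bounded bounded_pos by metis
  have "\<bar>f s\<bar> \<le> B" if "s \<ge> \<alpha>" for s
    using that B assms(2)[of s] by (cases "s \<le> 1/2") auto
  with B(1) that show ?thesis by blast
qed

text \<open>A flux computation by the divergence theorem for compactly supported Lipschitz fields.
  The field \<open>2 p'(s) (x - c)\<close> is singular at the centre; it is replaced near the centre
  by a linear one, whose divergence is constant. The integral of the Laplacian must then compensate
  that constant times the volume of a small ball, and this is independent of the cutoff.\<close>

lemma integral_profile_laplacian: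
  fixes c :: "'a::euclidean_space"
  assumes d: "DIM('a) \<ge> 2" and R: "R > 0"
  shows "integrable lborel (\<lambda>x. profile_laplacian DIM('a) ((norm (x - c))\<^sup>2 / R\<^sup>2))"
    and "(LINT x|lborel. profile_laplacian DIM('a) ((norm (x - c))\<^sup>2 / R\<^sup>2)) =
      R ^ DIM('a) * (DIM('a) * measure lborel (ball (0::'a) 1))"
proof -
  let ?d = "DIM('a)"
  define s where "s x = (norm (x - c))\<^sup>2 / R\<^sup>2" for x
  have s_cont: "continuous_on S s" for S unfolding s_def using R by (intro continuous_intros) auto
  have s_ge: "s x \<ge> 1 \<longleftrightarrow> R \<le> norm (x - c)" for x
    unfolding s_def using R by (simp add: le_divide_eq abs_le_square_iff[symmetric])
  have m_cont: "continuous_on UNIV (\<lambda>x. profile_laplacian ?d (s x))"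
    using continuous_on_compose2[OF continuous_profile_laplacian[OF d] s_cont] by simp
  have m_int: "integrable lborel (\<lambda>x. profile_laplacian ?d (s x))"
  proof (rule compact_support_integrable[OF m_cont, of "cball c R"])
    fix x assume "x \<notin> cball c R"
    then have "s x \<ge> 1" using s_ge[of x] by (simp add: dist_norm norm_minus_commute[of c])
    then show "profile_laplacian ?d (s x) = 0" by (intro profile_laplacian_0[OF d]) simp
  qed simp
  then show "integrable lborel (\<lambda>x. profile_laplacian DIM('a) ((norm (x - c))\<^sup>2 / R\<^sup>2))" by (simp add: s_def)
  \<comment> \<open>Freezing the derivative below 1/8 removes the singularity. The threshold lies
    below 1/4, where the profile is the fundamental solution and its derivative is explicit. The
    corner at 1/8 is why differentiability holds only almost everywhere.\<close>
  define k where "k t = profile' ?d (max t (1/8))" for t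
  define k' where "k' t = (if t > 1/8 then profile'' ?d (max t (1/8)) else 0)" for t
  have k0: "k t = 0" "k' t = 0" if "t > 1/2" for t
    using that by (auto simp: k_def k'_def profile'_0 profile''_0)
  obtain K where K: "K > 0" "\<And>t. \<bar>k t\<bar> \<le> K"
    using bounded_beyond[OF smooth_on_profile'[of ?d] profile'_0, of "1/8"] unfolding k_def
    by (metis max.cobounded2 zero_less_divide_1_iff zero_less_numeral)
  obtain L where L: "L > 0" "\<And>t. t \<ge> 1/8 \<Longrightarrow> \<bar>profile'' ?d t\<bar> \<le> L"
    using bounded_beyond[OF smooth_on_profile''[of ?d] profile''_0, of "1/8"]
    by (metis zero_less_divide_1_iff zero_less_numeral)
  have k_Lip: "\<bar>k t - k u\<bar> \<le> L * \<bar>t - u\<bar>" for t u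
  proof -
    have "norm (profile' ?d (max t (1/8)) - profile' ?d (max u (1/8))) \<le> L * norm (max t (1/8) - max u (1/8))"
    proof (rule field_differentiable_bound[where S = "{1/8..}"])
      show "(profile' ?d has_field_derivative profile'' ?d z) (at z within {1/8..})" if "z \<in> {1/8..}" for z
        using that by (intro has_field_derivative_at_within[OF profile'_deriv]) auto
    qed (use L in auto)
    also have "\<dots> \<le> L * \<bar>t - u\<bar>" using L(1) by (intro mult_left_mono) auto
    finally show ?thesis by (simp add: k_def)
  qed
  have k_cont: "continuous_on UNIV k" "continuous_on UNIV (\<lambda>t. profile'' ?d (max t (1/8)))"
    unfolding k_def
    by (auto intro!: continuous_on_compose2[OF smooth_on_continuous[OF smooth_on_profile']]
        continuous_on_compose2[OF smooth_on_continuous[OF smooth_on_profile'']] continuous_intros)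
  have [measurable]: "k \<in> borel_measurable borel" "s \<in> borel_measurable borel"
    "(\<lambda>t. profile'' ?d (max t (1/8))) \<in> borel_measurable borel"
    using borel_measurable_continuous_onI[OF k_cont(1)] borel_measurable_continuous_onI[OF k_cont(2)]
      borel_measurable_continuous_onI[OF s_cont] by simp_all
  have [measurable]: "k' \<in> borel_measurable borel" unfolding k'_def[abs_def] by measurable
  \<comment> \<open>The corner of \<open>k\<close> is seen only on a sphere, which is a null
    set.\<close>
  have "{x. s x = 1/8} = sphere c (R * sqrt (1/8))"
  proof -
    have "s x = 1/8 \<longleftrightarrow> (norm (x - c))\<^sup>2 = (R * sqrt (1/8))\<^sup>2" for x
      unfolding s_def using R by (auto simp: power_mult_distrib field_simps)
    then have *: "s x = 1/8 \<longleftrightarrow> norm (x - c) = R * sqrt (1/8)" for x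
      using R by (simp add: power2_eq_iff_nonneg)
    show ?thesis
    proof (rule set_eqI)
      fix x
      show "x \<in> {x. s x = 1/8} \<longleftrightarrow> x \<in> sphere c (R * sqrt (1/8))"
        unfolding mem_Collect_eq mem_sphere dist_norm *[of x] by (simp only: norm_minus_commute[of c x])
    qed
  qed
  then have "{x. s x = 1/8} \<in> null_sets lebesgue"
    using negligible_sphere[of c "R * sqrt (1/8)"] by (simp add: negligible_iff_null_sets)
  then have "AE x in lebesgue. s x \<noteq> 1/8" by (intro AE_I') auto
  then have s_AE: "AE x in lborel. s x \<noteq> 1/8" by (simp add: AE_completion_iff)
  \<comment> \<open>The component in direction b of the regularised field, and its derivative in
    that direction; the sum of \<open>F' b\<close> over the basis is the divergence.\<close>
  define F where "F b x = 2 * k (s x) * ((x - c) \<bullet> b)" for b x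
  define F' where "F' b x = 4 * k' (s x) * ((x - c) \<bullet> b)\<^sup>2 / R\<^sup>2 + 2 * k (s x) * (b \<bullet> b)" for b x
  have [measurable]: "F' b \<in> borel_measurable borel" for b unfolding F'_def by measurable
  have F'_int: "integrable lborel (F' b)" for b
  proof (rule Bochner_Integration.integrable_bound)
    show "integrable lborel (\<lambda>x. (4 * L * (norm b)\<^sup>2 + 2 * K * (norm b)\<^sup>2) * indicator (cball c R) x)"
      by (intro integrable_mult_right integrable_real_indicator) (auto simp: emeasure_lborel_cball_finite[unfolded infinity_ennreal_def])
    show "AE x in lborel. norm (F' b x) \<le> norm ((4 * L * (norm b)\<^sup>2 + 2 * K * (norm b)\<^sup>2) * indicator (cball c R) x)"
    proof (rule AE_I2)
      fix x
      show "norm (F' b x) \<le> norm ((4 * L * (norm b)\<^sup>2 + 2 * K * (norm b)\<^sup>2) * indicator (cball c R) x)"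
      proof (cases "norm (x - c) \<le> R")
        case False
        then have "s x \<ge> 1" using s_ge[of x] by simp
        then show ?thesis by (simp add: F'_def k0)
      next
        case True
        have "\<bar>(x - c) \<bullet> b\<bar> \<le> R * norm b"
          using Cauchy_Schwarz_ineq2[of "x - c" b] mult_right_mono[OF True norm_ge_zero[of b]] by linarith
        then have "((x - c) \<bullet> b)\<^sup>2 \<le> (R * norm b)\<^sup>2" by (rule power2_le_iff_abs_le[THEN iffD2, rotated]) (use R in simp)
        then have "((x - c) \<bullet> b)\<^sup>2 / R\<^sup>2 \<le> (norm b)\<^sup>2" using R by (simp add: divide_le_eq power_mult_distrib mult.commute)
        moreover have "\<bar>k' (s x)\<bar> \<le> L" using L(2)[of "s x"] L(1) by (auto simp: k'_def)
        ultimately have "\<bar>k' (s x)\<bar> * (((x - c) \<bullet> b)\<^sup>2 / R\<^sup>2) \<le> L * (norm b)\<^sup>2"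
          using L(1) by (intro mult_mono) auto
        moreover have "\<bar>k (s x)\<bar> * (norm b)\<^sup>2 \<le> K * (norm b)\<^sup>2" using K by (intro mult_right_mono) auto
        moreover have "\<bar>F' b x\<bar> \<le> 4 * (\<bar>k' (s x)\<bar> * (((x - c) \<bullet> b)\<^sup>2 / R\<^sup>2)) + 2 * (\<bar>k (s x)\<bar> * (norm b)\<^sup>2)"
          unfolding F'_def using abs_triangle_ineq[of "4 * k' (s x) * ((x - c) \<bullet> b)\<^sup>2 / R\<^sup>2" "2 * k (s x) * (b \<bullet> b)"]
          by (simp add: abs_mult power2_norm_eq_inner mult.assoc)
        ultimately have "\<bar>F' b x\<bar> \<le> 4 * (L * (norm b)\<^sup>2) + 2 * (K * (norm b)\<^sup>2)" by linarith
        then show ?thesis using True L(1) K(1) by (simp add: dist_norm norm_minus_commute[of c] mult.assoc)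
      qed
    qed
  qed measurable
  have F'_0: "(LINT x|lborel. F' b x) = 0" if b: "b \<in> Basis" for b
  proof (rule integral_directional_derivative_eq_0[where F = "F b" and b = b and r = "R + norm c"
        and L = "2 * (L * (2 * (R + 1) / R\<^sup>2) * (R + 1) + K)"])
    have F0: "F b x = 0" if "norm (x - c) \<ge> R" for x
      using that s_ge[of x] by (simp add: F_def k0)
    show "integrable lborel (F b)"
    proof (rule compact_support_integrable[of _ "cball c R"])
      show "continuous_on UNIV (F b)"
        unfolding F_def by (intro continuous_intros continuous_on_compose2[OF k_cont(1) s_cont]) auto
    qed (use F0 in \<open>auto simp: dist_norm norm_minus_commute[of c]\<close>)
    show "F b x = 0" if "norm x > R + norm c" for x
      using that norm_triangle_ineq[of "x - c" c] by (intro F0) simp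
    \<comment> \<open>If one of the two points is farther than R + 1 from c, both are at distance at
      least R and both values vanish. Otherwise the difference of squares gives the factor
      \<open>2 * (R + 1) / R\<^sup>2\<close> for s.\<close>
    show "\<bar>F b (x + h *\<^sub>R b) - F b x\<bar> \<le> 2 * (L * (2 * (R + 1) / R\<^sup>2) * (R + 1) + K) * \<bar>h\<bar>" if h: "\<bar>h\<bar> \<le> 1" for x h
    proof -
      define y where "y = x + h *\<^sub>R b"
      have nb: "norm b = 1" using b by simp
      have xy: "\<bar>norm (y - c) - norm (x - c)\<bar> \<le> \<bar>h\<bar>"
        using norm_triangle_ineq3[of "y - c" "x - c"] by (simp add: y_def nb)
      show ?thesis
      proof (cases "norm (x - c) > R + 1 \<or> norm (y - c) > R + 1")
        case True
        then have "norm (x - c) \<ge> R" "norm (y - c) \<ge> R" using xy h by linarith+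
        then show ?thesis using F0[of x] F0[of y] L(1) K(1) R by (simp add: y_def)
      next
        case False
        then have le: "norm (x - c) \<le> R + 1" "norm (y - c) \<le> R + 1" by auto
        have "s y - s x = (norm (y - c) + norm (x - c)) * (norm (y - c) - norm (x - c)) / R\<^sup>2"
          unfolding s_def by (simp add: diff_divide_distrib[symmetric] power2_eq_square algebra_simps)
        then have "\<bar>s y - s x\<bar> = (norm (y - c) + norm (x - c)) * \<bar>norm (y - c) - norm (x - c)\<bar> / R\<^sup>2"
          by (simp add: abs_mult)
        also have "\<dots> \<le> (2 * (R + 1)) * \<bar>h\<bar> / R\<^sup>2"
          using le xy R by (intro divide_right_mono mult_mono) auto
        finally have "L * \<bar>s y - s x\<bar> \<le> L * ((2 * (R + 1)) * \<bar>h\<bar> / R\<^sup>2)"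
          using L(1) by (intro mult_left_mono) auto
        then have "\<bar>k (s y) - k (s x)\<bar> \<le> L * ((2 * (R + 1)) * \<bar>h\<bar> / R\<^sup>2)"
          using k_Lip[of "s y" "s x"] by linarith
        moreover have "\<bar>(y - c) \<bullet> b\<bar> \<le> R + 1" using Basis_le_norm[OF b, of "y - c"] le by linarith
        ultimately have 1: "\<bar>k (s y) - k (s x)\<bar> * \<bar>(y - c) \<bullet> b\<bar> \<le> L * ((2 * (R + 1)) * \<bar>h\<bar> / R\<^sup>2) * (R + 1)"
          using L(1) R by (intro mult_mono) auto
        have 2: "\<bar>k (s x)\<bar> * \<bar>h\<bar> \<le> K * \<bar>h\<bar>" using K by (intro mult_right_mono) auto
        have "(y - c) \<bullet> b = (x - c) \<bullet> b + h" using b by (simp add: y_def inner_add_left inner_diff_left)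
        then have "F b y - F b x = 2 * ((k (s y) - k (s x)) * ((y - c) \<bullet> b) + k (s x) * h)"
          unfolding F_def by (simp add: algebra_simps)
        then have "\<bar>F b y - F b x\<bar> \<le> 2 * (\<bar>k (s y) - k (s x)\<bar> * \<bar>(y - c) \<bullet> b\<bar> + \<bar>k (s x)\<bar> * \<bar>h\<bar>)"
          by (simp add: abs_mult[symmetric] abs_triangle_ineq)
        also have "\<dots> \<le> 2 * (L * ((2 * (R + 1)) * \<bar>h\<bar> / R\<^sup>2) * (R + 1) + K * \<bar>h\<bar>)" using 1 2 by simp
        also have "\<dots> = 2 * (L * (2 * (R + 1) / R\<^sup>2) * (R + 1) + K) * \<bar>h\<bar>" by (simp add: algebra_simps)
        finally show ?thesis by (simp add: y_def)
      qed
    qed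
    have deriv: "((\<lambda>h. F b (x + h *\<^sub>R b)) has_real_derivative F' b x) (at 0)" if x: "s x \<noteq> 1/8" for x
    proof -
      have ds: "((\<lambda>h. s (x + h *\<^sub>R b)) has_real_derivative 2 * ((x - c) \<bullet> b) / R\<^sup>2) (at 0)"
      proof -
        have "s (x + h *\<^sub>R b) = ((norm (x - c))\<^sup>2 + 2 * h * ((x - c) \<bullet> b) + h\<^sup>2) / R\<^sup>2" for h
        proof -
          have "(norm (u + h *\<^sub>R b))\<^sup>2 = (norm u)\<^sup>2 + 2 * h * (u \<bullet> b) + h\<^sup>2" for u
            unfolding power2_norm_eq_inner unfolding power2_eq_square using b
            by (simp add: inner_add_left inner_add_right inner_commute[of b u] distrib_left)
          from this[of "x - c"] show ?thesis by (simp add: s_def add_diff_eq diff_add_eq)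
        qed
        moreover have "((\<lambda>h. ((norm (x - c))\<^sup>2 + 2 * h * ((x - c) \<bullet> b) + h\<^sup>2) / R\<^sup>2) has_real_derivative 2 * ((x - c) \<bullet> b) / R\<^sup>2) (at 0)"
          by (rule DERIV_cdivide) (auto intro!: derivative_eq_intros)
        ultimately show ?thesis by simp
      qed
      have dk: "(k has_real_derivative k' (s x)) (at (s x))"
      proof (cases "s x > 1/8")
        case True
        have "(k has_real_derivative profile'' ?d (s x)) (at (s x))"
          by (rule has_field_derivative_transform_within_open[of _ _ _ "{1/8<..}", OF profile'_deriv])
            (use True in \<open>auto simp: k_def max_def\<close>)
        then show ?thesis using True by (simp add: k'_def max_def)
      next
        case False
        then have "s x < 1/8" using x by simp
        have "(k has_real_derivative 0) (at (s x))"
          by (rule has_field_derivative_transform_within_open[of "\<lambda>_. profile' ?d (1/8)" _ _ "{..<1/8}"])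
            (use \<open>s x < 1/8\<close> in \<open>auto simp: k_def max_def\<close>)
        then show ?thesis using False by (simp add: k'_def)
      qed
      have dks: "((\<lambda>h. k (s (x + h *\<^sub>R b))) has_real_derivative k' (s x) * (2 * ((x - c) \<bullet> b) / R\<^sup>2)) (at 0)"
        using DERIV_chain2[of k "k' (s x)" "\<lambda>h. s (x + h *\<^sub>R b)" 0, OF _ ds] dk by simp
      have dl: "((\<lambda>h. (x + h *\<^sub>R b - c) \<bullet> b) has_real_derivative b \<bullet> b) (at 0)"
        by (auto intro!: derivative_eq_intros simp: has_field_derivative_def inner_add_left inner_diff_left)
      have "((\<lambda>h. 2 * (k (s (x + h *\<^sub>R b)) * ((x + h *\<^sub>R b - c) \<bullet> b))) has_real_derivative
        2 * (k' (s x) * (2 * ((x - c) \<bullet> b) / R\<^sup>2) * ((x + 0 *\<^sub>R b - c) \<bullet> b) + b \<bullet> b * k (s (x + 0 *\<^sub>R b)))) (at 0)"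
        by (intro DERIV_cmult DERIV_mult dks dl)
      then show ?thesis
        unfolding F_def F'_def by (simp add: mult.assoc power2_eq_square algebra_simps)
    qed
    show "AE x in lborel. ((\<lambda>h. F b (x + h *\<^sub>R b)) has_real_derivative F' b x) (at 0)"
      using s_AE by eventually_elim (rule deriv)
  qed measurable
  \<comment> \<open>The region where the field is frozen. There its divergence is the constant
    \<open>- \<kappa>\<close>; elsewhere it is the Laplacian of the profile, which in turn vanishes
    in D.\<close>
  define D where "D = ball c (R * sqrt (1/8))"
  have D: "x \<in> D \<longleftrightarrow> s x < 1/8" for x
  proof -
    have "s x < 1/8 \<longleftrightarrow> (norm (x - c))\<^sup>2 < (R * sqrt (1/8))\<^sup>2"
      unfolding s_def using R by (simp add: power_mult_distrib field_simps)
    also have "\<dots> \<longleftrightarrow> norm (x - c) < R * sqrt (1/8)"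
      using R by (auto intro: power_strict_mono dest: power2_less_imp_less)
    finally show ?thesis by (simp add: D_def dist_norm norm_minus_commute[of c])
  qed
  define \<kappa> where "\<kappa> = real ?d * (1/8) powr (- (real ?d / 2))"
  have k8: "2 * k t * real ?d = - \<kappa>" if "t \<le> 1/8" for t
    using that profile'_small[OF d, of "1/8"] by (simp add: k_def max_def \<kappa>_def)
  have sum_F': "(\<Sum>b\<in>Basis. F' b x) = profile_laplacian ?d (s x) - \<kappa> * indicator D x" if "s x \<noteq> 1/8" for x
  proof -
    have "(\<Sum>b\<in>Basis. ((x - c) \<bullet> b)\<^sup>2) = (norm (x - c))\<^sup>2"
    proof -
      have "(\<Sum>b\<in>Basis. ((x - c) \<bullet> b)\<^sup>2) = (x - c) \<bullet> (x - c)"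
        by (simp only: euclidean_inner[of "x - c" "x - c"] power2_eq_square)
      then show ?thesis by (simp only: power2_norm_eq_inner)
    qed
    then have "(\<Sum>b\<in>Basis. F' b x) = 4 * k' (s x) * s x + 2 * k (s x) * real ?d"
      unfolding F'_def
      by (simp add: sum.distrib sum_distrib_left[symmetric] sum_divide_distrib[symmetric] s_def)
    moreover have "4 * k' (s x) * s x + 2 * k (s x) * real ?d = profile_laplacian ?d (s x) - \<kappa> * indicator D x"
    proof (cases "s x < 1/8")
      case True
      then show ?thesis using D[of x] k8[of "s x"] profile_laplacian_0[OF d, of "s x"] by (simp add: k'_def)
    next
      case False
      then have "s x > 1/8" using that by simp
      then show ?thesis using D[of x] by (simp add: k'_def k_def max_def profile_laplacian_def)
    qed
    ultimately show ?thesis by simp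
  qed
  have "0 = (\<Sum>b\<in>(Basis::'a set). LINT x|lborel. F' b x)" using F'_0 by simp
  also have "\<dots> = (LINT x|lborel. (\<Sum>b\<in>Basis. F' b x))" using F'_int by simp
  also have "\<dots> = (LINT x|lborel. profile_laplacian ?d (s x) - \<kappa> * indicator D x)"
  proof (rule integral_cong_AE)
    show "AE x in lborel. (\<Sum>b\<in>Basis. F' b x) = profile_laplacian ?d (s x) - \<kappa> * indicator D x"
      using s_AE by eventually_elim (rule sum_F')
  qed (use borel_measurable_integrable[OF m_int] in \<open>measurable, simp add: D_def\<close>)
  also have "\<dots> = (LINT x|lborel. profile_laplacian ?d (s x)) - \<kappa> * measure lborel D"
    using m_int unfolding D_def by (simp add: emeasure_lborel_ball_finite[unfolded infinity_ennreal_def])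
  finally have "(LINT x|lborel. profile_laplacian ?d (s x)) = \<kappa> * measure lborel D" by simp
  also have "measure lborel D = (R * sqrt (1/8)) ^ ?d * measure lborel (ball (0::'a) 1)"
    using content_ball_conv_unit_ball[of "R * sqrt (1/8)" c] R unfolding D_def by simp
  also have "\<kappa> * \<dots> = R ^ ?d * (?d * measure lborel (ball (0::'a) 1))"
  proof -
    have "sqrt (1/8::real) ^ ?d = (1/8) powr (real ?d / 2)"
      by (simp add: powr_half_sqrt[symmetric] powr_realpow[symmetric] powr_powr)
    then have "(1/8) powr (- (real ?d / 2)) * sqrt (1/8::real) ^ ?d = 1"
      by (simp add: powr_add[symmetric])
    then show ?thesis unfolding \<kappa>_def by (simp add: power_mult_distrib algebra_simps)
  qed
  finally show "(LINT x|lborel. profile_laplacian DIM('a) ((norm (x - c))\<^sup>2 / R\<^sup>2)) =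
      R ^ DIM('a) * (DIM('a) * measure lborel (ball (0::'a) 1))" by (simp add: s_def)
qed

section \<open>The corrector of a finite family of holes\<close>

lemma gradient_sum:
  assumes "\<And>i. i \<in> I \<Longrightarrow> f i differentiable (at x)"
  shows "gradient (\<lambda>x. \<Sum>i\<in>I. f i x) x = (\<Sum>i\<in>I. gradient (f i) x)"
proof (rule gradient_eqI)
  have "((\<lambda>x. \<Sum>i\<in>I. f i x) has_derivative (\<lambda>v. \<Sum>i\<in>I. gradient (f i) x \<bullet> v)) (at x)"
    using assms by (intro has_derivative_sum has_derivative_gradient)
  then show "((\<lambda>x. \<Sum>i\<in>I. f i x) has_derivative (\<lambda>v. (\<Sum>i\<in>I. gradient (f i) x) \<bullet> v)) (at x)"
    by (simp add: inner_sum_left)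
qed

lemma gradient_compose:
  assumes "(h has_real_derivative D) (at (f x))" "f differentiable (at x)"
  shows "gradient (\<lambda>x. h (f x)) x = D *\<^sub>R gradient f x"
proof (rule gradient_eqI)
  have "((\<lambda>x. h (f x)) has_derivative (\<lambda>v. D * (gradient f x \<bullet> v))) (at x)"
    using assms by (intro has_derivative_compose[of f _ x UNIV h] has_derivative_gradient) (auto simp: has_field_derivative_def)
  then show "((\<lambda>x. h (f x)) has_derivative (\<lambda>v. (D *\<^sub>R gradient f x) \<bullet> v)) (at x)" by simp
qed

lemma sqi_bounded:
  fixes f :: "'a::euclidean_space \<Rightarrow> 'b::euclidean_space"
  assumes "U \<in> sets lebesgue" "bounded U" "f \<in> borel_measurable (lebesgue_on U)" "\<And>x. x \<in> U \<Longrightarrow> norm (f x) \<le> B"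
  shows "sqi (lebesgue_on U) f"
proof -
  have "emeasure lebesgue U < \<infinity>"
    using assms(1,2) bounded_set_imp_lmeasurable fmeasurableD2 by (fastforce simp: top.not_eq_extremum)
  then have s: "sqi (lebesgue_on U) (indicator U :: 'a \<Rightarrow> real)" by (intro indicator_sqi assms(1))
  show ?thesis
    by (rule sqi_dominated[OF s assms(3), where K = B]) (use assms(4) in \<open>auto intro!: AE_I2\<close>)
qed

text \<open>Smooth approximations of the identity that vanish for \<open>t \<le> 1/n\<close> and
  agree with t for \<open>t \<ge> 2/n\<close>. Composed with \<open>1 - z\<close> they detach the
  support from the boundaries of the holes.\<close>

definition smooth_cut :: "nat \<Rightarrow> real \<Rightarrow> real" where
  "smooth_cut n t = t * smooth_step (real n * t - 1)"

lemma smooth_on_affine_step: "smooth_on UNIV (\<lambda>t::real. smooth_step (c * t - 1))"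
  by (rule smooth_on_compose[OF smooth_on_smooth_step]) (auto intro!: smooth_on_diff smooth_on_mult)

lemma smooth_on_smooth_cut: "smooth_on UNIV (smooth_cut n)"
  unfolding smooth_cut_def[abs_def] by (intro smooth_on_mult smooth_on_ident smooth_on_affine_step)

lemma smooth_step_deriv: "(smooth_step has_real_derivative deriv smooth_step t) (at t)"
  using smooth_on_realD(1)[OF smooth_on_smooth_step] by simp

lemma smooth_step_deriv_0:
  assumes "t < 0 \<or> t > 1"
  shows "deriv smooth_step t = 0"
proof -
  have "(smooth_step has_real_derivative 0) (at t)"
    using assms
  proof
    assume "t < 0"
    have "((\<lambda>_. 0) has_real_derivative 0) (at t)" by simp
    then show ?thesis
      by (rule has_field_derivative_transform_within_open[of _ _ _ "{..<0}"]) (use \<open>t < 0\<close> in \<open>auto simp: smooth_step_0\<close>)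
  next
    assume "t > 1"
    have "((\<lambda>_. 1) has_real_derivative 0) (at t)" by simp
    then show ?thesis
      by (rule has_field_derivative_transform_within_open[of _ _ _ "{1<..}"]) (use \<open>t > 1\<close> in \<open>auto simp: smooth_step_1\<close>)
  qed
  then show ?thesis by (rule DERIV_imp_deriv)
qed

lemma smooth_step_deriv_bounded:
  obtains B where "B > 0" "\<And>t. \<bar>deriv smooth_step t\<bar> \<le> B"
proof -
  have "continuous_on UNIV (deriv smooth_step)"
    using smooth_on_continuous[OF smooth_on_realD(2)[OF smooth_on_smooth_step open_UNIV]] .
  from compact_support_bounded[OF this, of "{0..1}"] smooth_step_deriv_0
  obtain B where "B > 0" "\<And>t. norm (deriv smooth_step t) \<le> B"
    by (metis atLeastAtMost_iff compact_Icc not_le)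
  then show ?thesis using that by simp
qed

lemma smooth_cut_deriv:
  "(smooth_cut n has_real_derivative smooth_step (real n * t - 1) + t * (real n * deriv smooth_step (real n * t - 1))) (at t)"
proof -
  have "((\<lambda>t. real n * t - 1) has_real_derivative real n) (at t)" by (auto intro!: derivative_eq_intros)
  from DERIV_chain2[OF smooth_step_deriv this]
  have "((\<lambda>t. smooth_step (real n * t - 1)) has_real_derivative deriv smooth_step (real n * t - 1) * real n) (at t)" .
  from DERIV_mult[OF DERIV_ident this] show ?thesis
    unfolding smooth_cut_def[abs_def] by (rule DERIV_cong) (simp add: algebra_simps)
qed

text \<open>The derivatives are bounded uniformly in n, which is what makes dominated convergence of
  the gradients possible. The index \<open>Suc n\<close> avoids a division by zero.\<close>

lemma smooth_cut_props:
  obtains B where "B > 0" "\<And>n t. \<bar>deriv (smooth_cut n) t\<bar> \<le> B"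
    "\<And>n t. \<bar>smooth_cut n t\<bar> \<le> \<bar>t\<bar>" "\<And>n t. t < 1 / real (Suc n) \<Longrightarrow> smooth_cut (Suc n) t = 0"
    "\<And>t. t > 0 \<Longrightarrow> \<forall>\<^sub>F n in sequentially. smooth_cut (Suc n) t = t \<and> deriv (smooth_cut (Suc n)) t = 1"
proof -
  obtain B where B: "B > 0" "\<And>t. \<bar>deriv smooth_step t\<bar> \<le> B" by (rule smooth_step_deriv_bounded) blast
  have dc: "deriv (smooth_cut n) t = smooth_step (real n * t - 1) + t * (real n * deriv smooth_step (real n * t - 1))" for n t
    by (rule DERIV_imp_deriv[OF smooth_cut_deriv])
  show ?thesis
  proof (rule that)
    show "1 + 2 * B > 0" using B by simp
    show "\<bar>deriv (smooth_cut n) t\<bar> \<le> 1 + 2 * B" for n t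
    proof -
      \<comment> \<open>The derivative of the step is nonzero only for n t between 1 and 2, which
        compensates the growing factor n.\<close>
      have "\<bar>(t * real n) * deriv smooth_step (real n * t - 1)\<bar> \<le> 2 * B"
      proof (cases "0 \<le> real n * t - 1 \<and> real n * t - 1 \<le> 1")
        case True
        then have "\<bar>t * real n\<bar> \<le> 2" by (simp add: mult.commute)
        then show ?thesis unfolding abs_mult using B by (intro mult_mono) auto
      next
        case False
        then show ?thesis using B(1) smooth_step_deriv_0[of "real n * t - 1"] by auto
      qed
      moreover have "\<bar>smooth_step (real n * t - 1)\<bar> \<le> 1"
        using smooth_step_nonneg smooth_step_le_1 by (simp add: abs_le_iff order.trans[OF _ smooth_step_nonneg])
      ultimately show ?thesis unfolding dc by (simp only: mult.assoc)
    qed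
    show "\<bar>smooth_cut n t\<bar> \<le> \<bar>t\<bar>" for n t
      unfolding smooth_cut_def abs_mult using smooth_step_nonneg smooth_step_le_1 by (intro mult_right_le_one_le) auto
    show "smooth_cut (Suc n) t = 0" if "t < 1 / real (Suc n)" for n t
    proof -
      have "real (Suc n) * t - 1 \<le> 0" using that by (simp add: field_simps)
      then show ?thesis by (simp add: smooth_cut_def smooth_step_0)
    qed
    show "\<forall>\<^sub>F n in sequentially. smooth_cut (Suc n) t = t \<and> deriv (smooth_cut (Suc n)) t = 1" if "t > 0" for t
    proof -
      obtain N where N: "2 / t < real N" using reals_Archimedean2 by blast
      show ?thesis
        using eventually_ge_at_top[of N]
      proof eventually_elim
        case (elim n)
        then have "2 / t < real (Suc n)" using N by simp
        then have "real (Suc n) * t - 1 > 1" using that by (simp add: field_simps)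
        then show ?case unfolding dc unfolding smooth_cut_def
          using smooth_step_deriv_0[of "real (Suc n) * t - 1"] smooth_step_1[of "real (Suc n) * t - 1"] by simp
      qed
    qed
  qed
qed

definition laplacian :: "('a::euclidean_space \<Rightarrow> real) \<Rightarrow> 'a \<Rightarrow> real" where
  "laplacian \<phi> x = (\<Sum>b\<in>Basis. gradient (\<lambda>y. gradient \<phi> y \<bullet> b) x \<bullet> b)"

lemma test_sum: "(\<And>i. i \<in> I \<Longrightarrow> f i \<in> test_functions U) \<Longrightarrow> (\<lambda>x. \<Sum>i\<in>I. f i x) \<in> test_functions U"
  by (induction I rule: infinite_finite_induct) (auto intro: test_zero test_add)

lemma test_laplacian: "\<phi> \<in> test_functions U \<Longrightarrow> laplacian \<phi> \<in> test_functions U"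
  unfolding laplacian_def[abs_def] by (intro test_sum test_gradient)

text \<open>The geometry at one fixed scale, where \<open>R\<close> is the common cutoff radius. The
  bound \<open>a j \<le> R / 2\<close> puts the boundary of each hole into the range
  \<open>s \<le> 1/4\<close>, where the profile is not cut off and is positive.\<close>

locale hole_family =
  fixes \<Omega> :: "'a::euclidean_space set" and J :: "'j set" and c :: "'j \<Rightarrow> 'a" and a :: "'j \<Rightarrow> real" and R r :: real
  assumes dim: "DIM('a) \<ge> 2" and open_\<Omega>: "open \<Omega>" and \<Omega>_ball: "\<Omega> \<subseteq> cball 0 r" and r_nonneg: "r \<ge> 0"
    and fin: "finite J" and R_pos: "R > 0"
    and a_pos: "\<And>j. j \<in> J \<Longrightarrow> 0 < a j" and a_le: "\<And>j. j \<in> J \<Longrightarrow> a j \<le> R / 2"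
    and disj: "\<And>j k. j \<in> J \<Longrightarrow> k \<in> J \<Longrightarrow> j \<noteq> k \<Longrightarrow> ball (c j) R \<inter> ball (c k) R = {}"
begin

definition \<sigma> :: "'j \<Rightarrow> 'a \<Rightarrow> real" where "\<sigma> j x = (norm (x - c j))\<^sup>2 / R\<^sup>2"
definition \<alpha> :: "'j \<Rightarrow> real" where "\<alpha> j = (a j)\<^sup>2 / R\<^sup>2"
definition b :: "'j \<Rightarrow> real" where "b j = 1 / profile DIM('a) (\<alpha> j)"
definition z :: "'a \<Rightarrow> real" where "z x = (\<Sum>j\<in>J. b j * profile DIM('a) (\<sigma> j x))"
text \<open>The gradient of \<open>z\<close> on \<open>W\<close>, given by a formula that stays
  continuous on \<open>E\<close>, that is, up to the boundaries of the holes. This continuity yields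
  bounds on all of \<open>U\<close>.\<close>

definition G :: "'a \<Rightarrow> 'a" where "G x = (\<Sum>j\<in>J. (2 * b j / R\<^sup>2 * profile' DIM('a) (\<sigma> j x)) *\<^sub>R (x - c j))"
definition \<rho> :: "'a \<Rightarrow> real" where "\<rho> x = (\<Sum>j\<in>J. b j / R\<^sup>2 * profile_laplacian DIM('a) (\<sigma> j x))"
text \<open>The complement of the holes in a closed version, suited to compactness, and with
  \<open>W\<close> below in an open version, suited to differentiation.\<close>

definition E :: "'a set" where "E = {x. \<forall>j\<in>J. a j \<le> norm (x - c j)}"
definition W :: "'a set" where "W = {x. \<forall>j\<in>J. a j < norm (x - c j)}"
definition U :: "'a set" where "U = \<Omega> - (\<Union>j\<in>J. cball (c j) (a j))"

lemma U_eq: "U = \<Omega> \<inter> W"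
  unfolding U_def W_def by (auto simp: dist_norm norm_minus_commute not_le)

lemma closed_E: "closed E"
proof -
  have "E = (\<Inter>j\<in>J. {x. a j \<le> norm (x - c j)})" by (auto simp: E_def)
  then show ?thesis by (auto intro!: closed_INT closed_Collect_le continuous_intros)
qed

lemma open_W: "open W"
proof -
  have "W = (\<Inter>j\<in>J. {x. a j < norm (x - c j)})" by (auto simp: W_def)
  then show ?thesis using fin by (auto intro!: open_INT open_Collect_less continuous_intros)
qed

lemma open_U: "open U" unfolding U_eq using open_\<Omega> open_W by blast

lemma U_sets [simp]: "U \<in> sets lebesgue" "\<Omega> \<in> sets lebesgue" using open_U open_\<Omega> by auto

lemma U_sub: "U \<subseteq> \<Omega>" "U \<subseteq> W" "W \<subseteq> E" unfolding U_eq by (auto simp: W_def E_def)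

lemma bounded_U: "bounded U" "bounded \<Omega>"
  using bounded_subset[OF bounded_cball \<Omega>_ball] bounded_subset[OF bounded_cball, of U 0 r] U_sub \<Omega>_ball by auto

lemma \<alpha>_bounds: assumes "j \<in> J" shows "0 < \<alpha> j" "\<alpha> j \<le> 1/4"
proof -
  show "0 < \<alpha> j" unfolding \<alpha>_def using a_pos[OF assms] R_pos by simp
  have "(a j)\<^sup>2 \<le> (R / 2)\<^sup>2" using a_pos[OF assms] a_le[OF assms] by (intro power_mono) auto
  then show "\<alpha> j \<le> 1/4" unfolding \<alpha>_def using R_pos by (simp add: field_simps power2_eq_square)
qed

lemma b_pos: assumes "j \<in> J" shows "b j > 0" "b j * profile DIM('a) (\<alpha> j) = 1"
  using profile_pos[OF dim \<alpha>_bounds[OF assms]] by (auto simp: b_def)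

lemma \<sigma>_ge: assumes "j \<in> J" shows "x \<in> E \<Longrightarrow> \<alpha> j \<le> \<sigma> j x" "x \<in> W \<Longrightarrow> \<alpha> j < \<sigma> j x"
proof -
  show "x \<in> E \<Longrightarrow> \<alpha> j \<le> \<sigma> j x"
    unfolding \<alpha>_def \<sigma>_def E_def using assms a_pos[OF assms] R_pos
    by (intro divide_right_mono power_mono) auto
  show "x \<in> W \<Longrightarrow> \<alpha> j < \<sigma> j x"
    unfolding \<alpha>_def \<sigma>_def W_def using assms a_pos[OF assms] R_pos
    by (intro divide_strict_right_mono power_strict_mono) auto
qed

lemma \<sigma>_pos: "j \<in> J \<Longrightarrow> x \<in> E \<Longrightarrow> \<sigma> j x > 0"
  using \<sigma>_ge \<alpha>_bounds by fastforce

lemma \<sigma>_less_1: "\<sigma> j x < 1 \<longleftrightarrow> x \<in> ball (c j) R"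
proof -
  have "\<sigma> j x < 1 \<longleftrightarrow> (norm (x - c j))\<^sup>2 < R\<^sup>2" unfolding \<sigma>_def using R_pos by simp
  also have "\<dots> \<longleftrightarrow> norm (x - c j) < R" using R_pos by (auto intro: power_strict_mono dest: power2_less_imp_less)
  finally show ?thesis by (simp add: dist_norm norm_minus_commute)
qed

lemma smooth_\<sigma>: "smooth_on S (\<sigma> j)"
proof -
  have "\<sigma> j = (\<lambda>x. (1 / R\<^sup>2) * (\<Sum>i\<in>Basis. (x \<bullet> i - c j \<bullet> i)\<^sup>2))"
  proof
    fix x
    have "(norm (x - c j))\<^sup>2 = (\<Sum>i\<in>Basis. ((x - c j) \<bullet> i) * ((x - c j) \<bullet> i))"
      unfolding power2_norm_eq_inner by (rule euclidean_inner)
    then show "\<sigma> j x = (1 / R\<^sup>2) * (\<Sum>i\<in>Basis. (x \<bullet> i - c j \<bullet> i)\<^sup>2)"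
      by (simp add: \<sigma>_def inner_diff_left power2_eq_square)
  qed
  moreover have "smooth_on S (\<lambda>x. (1 / R\<^sup>2) * (\<Sum>i\<in>Basis. (x \<bullet> i - c j \<bullet> i)\<^sup>2))"
    by (intro smooth_on_mult smooth_on_sum smooth_on_power smooth_on_diff smooth_on_inner smooth_on_const)
  ultimately show ?thesis by simp
qed

lemma gradient_\<sigma>: "gradient (\<sigma> j) x = (2 / R\<^sup>2) *\<^sub>R (x - c j)"
proof (rule gradient_eqI)
  have "((\<lambda>x. (x - c j) \<bullet> (x - c j)) has_derivative (\<lambda>v. (x - c j) \<bullet> v + v \<bullet> (x - c j))) (at x)"
    by (intro has_derivative_inner) (auto intro!: derivative_eq_intros)
  from has_derivative_mult_right[OF this, of "1 / R\<^sup>2"]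
  have "((\<lambda>x. 1 / R\<^sup>2 * ((x - c j) \<bullet> (x - c j))) has_derivative (\<lambda>v. ((2 / R\<^sup>2) *\<^sub>R (x - c j)) \<bullet> v)) (at x)"
  proof (rule has_derivative_eq_rhs)
    show "(\<lambda>v. 1 / R\<^sup>2 * ((x - c j) \<bullet> v + v \<bullet> (x - c j))) = (\<lambda>v. ((2 / R\<^sup>2) *\<^sub>R (x - c j)) \<bullet> v)"
      by (rule ext) (simp only: inner_commute[of _ "x - c j"] inner_scaleR_left, simp)
  qed
  moreover have "\<sigma> j = (\<lambda>x. 1 / R\<^sup>2 * ((x - c j) \<bullet> (x - c j)))"
    unfolding \<sigma>_def power2_norm_eq_inner by simp
  ultimately show "(\<sigma> j has_derivative (\<lambda>v. ((2 / R\<^sup>2) *\<^sub>R (x - c j)) \<bullet> v)) (at x)" by simp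
qed

lemma \<sigma>_diff: "\<sigma> j differentiable (at x)"
  using smooth_on_differentiable[OF smooth_\<sigma>] by blast

lemma smooth_profiles:
  assumes "j \<in> J"
  shows "smooth_on W (\<lambda>x. profile DIM('a) (\<sigma> j x))" "smooth_on W (\<lambda>x. profile' DIM('a) (\<sigma> j x))"
  using \<sigma>_pos[OF assms] U_sub
  by (auto intro!: smooth_on_compose[OF smooth_on_profile smooth_\<sigma>] smooth_on_compose[OF smooth_on_profile' smooth_\<sigma>])

lemma smooth_z: "smooth_on W z"
  unfolding z_def[abs_def] by (intro smooth_on_sum smooth_on_mult smooth_on_const smooth_profiles)

lemma continuous_z: "continuous_on E z"
  unfolding z_def[abs_def] using \<sigma>_pos
  by (intro continuous_intros continuous_on_compose2[OF smooth_on_continuous[OF smooth_on_profile] smooth_on_continuous[OF smooth_\<sigma>]]) auto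

lemma continuous_G: "continuous_on E G"
  unfolding G_def[abs_def] using \<sigma>_pos
  by (intro continuous_intros continuous_on_compose2[OF smooth_on_continuous[OF smooth_on_profile'] smooth_on_continuous[OF smooth_\<sigma>]]) auto

lemma continuous_\<rho>: "continuous_on S \<rho>"
  unfolding \<rho>_def[abs_def]
  by (intro continuous_intros continuous_on_compose2[OF continuous_profile_laplacian[OF dim] smooth_on_continuous[OF smooth_\<sigma>]]) auto

lemma gradient_z: assumes "x \<in> W" shows "gradient z x = G x"
proof -
  have tm: "gradient (\<lambda>x. b j * profile DIM('a) (\<sigma> j x)) x = (2 * b j / R\<^sup>2 * profile' DIM('a) (\<sigma> j x)) *\<^sub>R (x - c j)" if j: "j \<in> J" for j
  proof -
    have s: "\<sigma> j x > 0" using \<sigma>_pos[OF j] assms U_sub by auto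
    have "gradient (\<lambda>x. profile DIM('a) (\<sigma> j x)) x = profile' DIM('a) (\<sigma> j x) *\<^sub>R gradient (\<sigma> j) x"
      by (rule gradient_compose[OF profile_deriv[OF s] \<sigma>_diff])
    moreover have "(\<lambda>x. profile DIM('a) (\<sigma> j x)) differentiable (at x)"
      by (rule smooth_on_differentiable[OF smooth_profiles(1)[OF j] open_W assms])
    ultimately show ?thesis by (simp add: gradient_cmult gradient_\<sigma> ac_simps)
  qed
  have "gradient z x = (\<Sum>j\<in>J. gradient (\<lambda>x. b j * profile DIM('a) (\<sigma> j x)) x)"
    unfolding z_def[abs_def]
    by (rule gradient_sum) (use smooth_on_differentiable[OF _ open_W assms] smooth_on_mult[OF smooth_on_const smooth_profiles(1)] in blast)
  then show ?thesis unfolding G_def using tm by simp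
qed

lemma smooth_G: "smooth_on W (\<lambda>x. G x \<bullet> i)"
  using smooth_on_gradient[OF smooth_z open_W, of i] gradient_z
    smooth_on_cong[OF open_W, of "\<lambda>x. G x \<bullet> i" "\<lambda>x. gradient z x \<bullet> i"] by auto

text \<open>The chain rule for a radial function in terms of the squared radius: summing over the
  coordinates turns the squared components into \<open>\<sigma> j x * R\<^sup>2\<close>, leaving
  exactly the combination named \<open>profile_laplacian\<close>, divided by
  \<open>R\<^sup>2\<close>.\<close>

lemma divergence_G:
  assumes "x \<in> W"
  shows "(\<Sum>i\<in>Basis. gradient (\<lambda>x. G x \<bullet> i) x \<bullet> i) = \<rho> x"
proof -
  have tm: "(\<Sum>i\<in>Basis. gradient (\<lambda>x. (2 * b j / R\<^sup>2) * (profile' DIM('a) (\<sigma> j x) * ((x - c j) \<bullet> i))) x \<bullet> i)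
    = b j / R\<^sup>2 * profile_laplacian DIM('a) (\<sigma> j x)" if j: "j \<in> J" for j
  proof -
    have s: "\<sigma> j x > 0" using \<sigma>_pos[OF j] assms U_sub by auto
    have d1: "(\<lambda>x. profile' DIM('a) (\<sigma> j x)) differentiable (at x)"
      by (rule smooth_on_differentiable[OF smooth_profiles(2)[OF j] open_W assms])
    have g1: "gradient (\<lambda>x. profile' DIM('a) (\<sigma> j x)) x = profile'' DIM('a) (\<sigma> j x) *\<^sub>R ((2 / R\<^sup>2) *\<^sub>R (x - c j))"
      using gradient_compose[OF profile'_deriv[OF s] \<sigma>_diff] by (simp add: gradient_\<sigma>)
    have d2: "(\<lambda>x. (x - c j) \<bullet> i) differentiable (at x)" and g2: "gradient (\<lambda>x. (x - c j) \<bullet> i) x = i" for i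
    proof -
      have "((\<lambda>x. (x - c j) \<bullet> i) has_derivative (\<lambda>v. i \<bullet> v)) (at x)"
        by (auto intro!: derivative_eq_intros simp: inner_commute)
      then show "(\<lambda>x. (x - c j) \<bullet> i) differentiable (at x)" "gradient (\<lambda>x. (x - c j) \<bullet> i) x = i"
        using differentiableI gradient_eqI by blast+
    qed
    have g: "gradient (\<lambda>x. (2 * b j / R\<^sup>2) * (profile' DIM('a) (\<sigma> j x) * ((x - c j) \<bullet> i))) x \<bullet> i
      = (2 * b j / R\<^sup>2) * (profile' DIM('a) (\<sigma> j x) + 2 / R\<^sup>2 * profile'' DIM('a) (\<sigma> j x) * ((x - c j) \<bullet> i)\<^sup>2)" if "i \<in> Basis" for i
      unfolding gradient_cmult[OF differentiable_mult[OF d1 d2]] gradient_mult[OF d1 d2] g1 g2 inner_scaleR_left inner_add_left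
      using that by (simp add: power2_eq_square)
    have n: "(\<Sum>i\<in>Basis. ((x - c j) \<bullet> i)\<^sup>2) = \<sigma> j x * R\<^sup>2"
    proof -
      have "(\<Sum>i\<in>Basis. ((x - c j) \<bullet> i)\<^sup>2) = (x - c j) \<bullet> (x - c j)"
        by (simp only: euclidean_inner[of "x - c j" "x - c j"] power2_eq_square)
      also have "\<dots> = (norm (x - c j))\<^sup>2" by (simp only: power2_norm_eq_inner)
      also have "\<dots> = \<sigma> j x * R\<^sup>2" using R_pos by (simp add: \<sigma>_def)
      finally show ?thesis .
    qed
    have "(\<Sum>i\<in>Basis. gradient (\<lambda>x. (2 * b j / R\<^sup>2) * (profile' DIM('a) (\<sigma> j x) * ((x - c j) \<bullet> i))) x \<bullet> i)
      = (\<Sum>i\<in>(Basis::'a set). (2 * b j / R\<^sup>2) * (profile' DIM('a) (\<sigma> j x) + 2 / R\<^sup>2 * profile'' DIM('a) (\<sigma> j x) * ((x - c j) \<bullet> i)\<^sup>2))"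
      by (rule sum.cong[OF refl g])
    also have "\<dots> = (2 * b j / R\<^sup>2) * (real DIM('a) * profile' DIM('a) (\<sigma> j x) + 2 / R\<^sup>2 * profile'' DIM('a) (\<sigma> j x) * (\<sigma> j x * R\<^sup>2))"
    proof -
      have "(\<Sum>i\<in>(Basis::'a set). A * (P + Q * f i)) = A * (real DIM('a) * P + Q * sum f Basis)" for A P Q and f :: "'a \<Rightarrow> real"
        by (simp add: sum_distrib_left[symmetric] sum.distrib)
      from this[of "2 * b j / R\<^sup>2" "profile' DIM('a) (\<sigma> j x)" "2 / R\<^sup>2 * profile'' DIM('a) (\<sigma> j x)" "\<lambda>i. ((x - c j) \<bullet> i)\<^sup>2"]
      show ?thesis unfolding n .
    qed
    also have "\<dots> = b j / R\<^sup>2 * profile_laplacian DIM('a) (\<sigma> j x)"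
      using s R_pos by (simp add: profile_laplacian_def field_simps)
    finally show ?thesis .
  qed
  have G_i: "(\<lambda>x. G x \<bullet> i) = (\<lambda>x. \<Sum>j\<in>J. (2 * b j / R\<^sup>2) * (profile' DIM('a) (\<sigma> j x) * ((x - c j) \<bullet> i)))" for i
    by (rule ext) (simp add: G_def inner_sum_left mult.assoc)
  have "gradient (\<lambda>x. G x \<bullet> i) x = (\<Sum>j\<in>J. gradient (\<lambda>x. (2 * b j / R\<^sup>2) * (profile' DIM('a) (\<sigma> j x) * ((x - c j) \<bullet> i))) x)" for i
    unfolding G_i
  proof (rule gradient_sum)
    fix j assume "j \<in> J"
    then have "smooth_on W (\<lambda>x. (2 * b j / R\<^sup>2) * (profile' DIM('a) (\<sigma> j x) * ((x - c j) \<bullet> i)))"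
      unfolding inner_diff_left by (intro smooth_on_mult smooth_on_const smooth_profiles smooth_on_diff smooth_on_inner)
    then show "(\<lambda>x. (2 * b j / R\<^sup>2) * (profile' DIM('a) (\<sigma> j x) * ((x - c j) \<bullet> i))) differentiable (at x)"
      by (rule smooth_on_differentiable[OF _ open_W assms])
  qed
  then have "(\<Sum>i\<in>Basis. gradient (\<lambda>x. G x \<bullet> i) x \<bullet> i) =
    (\<Sum>i\<in>Basis. \<Sum>j\<in>J. gradient (\<lambda>x. (2 * b j / R\<^sup>2) * (profile' DIM('a) (\<sigma> j x) * ((x - c j) \<bullet> i))) x \<bullet> i)"
    by (simp only: inner_sum_left)
  also have "\<dots> = (\<Sum>j\<in>J. b j / R\<^sup>2 * profile_laplacian DIM('a) (\<sigma> j x))"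
    by (subst sum.swap) (use tm in simp)
  finally show ?thesis by (simp add: \<rho>_def)
qed

lemma z_term_le:
  assumes "j \<in> J" "x \<in> E"
  shows "0 \<le> b j * profile DIM('a) (\<sigma> j x)" "b j * profile DIM('a) (\<sigma> j x) \<le> 1" "x \<in> W \<Longrightarrow> b j * profile DIM('a) (\<sigma> j x) < 1"
proof -
  note bp = b_pos[OF assms(1)] and al = \<alpha>_bounds[OF assms(1)]
  show "0 \<le> b j * profile DIM('a) (\<sigma> j x)" using bp profile_nonneg[OF dim \<sigma>_pos[OF assms]] by simp
  have "profile DIM('a) (\<sigma> j x) \<le> profile DIM('a) (\<alpha> j)"
    using \<sigma>_ge(1)[OF assms] profile_less[OF dim al] by (cases "\<sigma> j x = \<alpha> j") (auto intro: less_imp_le)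
  then have "b j * profile DIM('a) (\<sigma> j x) \<le> b j * profile DIM('a) (\<alpha> j)" using bp(1) by (simp add: mult_left_mono)
  then show "b j * profile DIM('a) (\<sigma> j x) \<le> 1" using bp(2) by simp
  assume "x \<in> W"
  then have "profile DIM('a) (\<sigma> j x) < profile DIM('a) (\<alpha> j)" using profile_less[OF dim al] \<sigma>_ge(2)[OF assms(1)] by blast
  then have "b j * profile DIM('a) (\<sigma> j x) < b j * profile DIM('a) (\<alpha> j)" using bp(1) by simp
  then show "b j * profile DIM('a) (\<sigma> j x) < 1" using bp(2) by simp
qed

text \<open>Disjointness of the balls of radius R leaves at most one nonzero term, so the bounds for
  one hole pass to \<open>z\<close> without summation.\<close>

lemma z_single:
  assumes "j \<in> J" "x \<in> ball (c j) R"
  shows "z x = b j * profile DIM('a) (\<sigma> j x)"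
proof -
  have "z x = (\<Sum>k\<in>J. if k = j then b j * profile DIM('a) (\<sigma> j x) else 0)"
    unfolding z_def
  proof (rule sum.cong[OF refl])
    fix k assume k: "k \<in> J"
    show "b k * profile DIM('a) (\<sigma> k x) = (if k = j then b j * profile DIM('a) (\<sigma> j x) else 0)"
    proof (cases "k = j")
      case False
      then have "x \<notin> ball (c k) R" using disj[OF assms(1) k] assms(2) by blast
      then have "\<sigma> k x \<ge> 1" using \<sigma>_less_1[of k x] by simp
      then show ?thesis using False by (simp add: profile_0)
    qed simp
  qed
  then show ?thesis using assms(1) fin by simp
qed

lemma z_outside:
  assumes "\<And>j. j \<in> J \<Longrightarrow> x \<notin> ball (c j) R"
  shows "z x = 0"
proof -
  have "profile DIM('a) (\<sigma> j x) = 0" if "j \<in> J" for j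
    using \<sigma>_less_1[of j x] assms[OF that] by (intro profile_0) simp
  then show ?thesis by (simp add: z_def)
qed

lemma z_bounds:
  assumes "x \<in> E"
  shows "0 \<le> z x" "z x \<le> 1" "x \<in> W \<Longrightarrow> z x < 1"
proof -
  show "0 \<le> z x" unfolding z_def using z_term_le(1) assms by (intro sum_nonneg) auto
  consider j where "j \<in> J" "x \<in> ball (c j) R" | "\<And>j. j \<in> J \<Longrightarrow> x \<notin> ball (c j) R" by blast
  note cs = this
  show "z x \<le> 1"
    by (rule cs) (use z_single z_outside z_term_le(2)[OF _ assms] in fastforce)+
  show "z x < 1" if "x \<in> W"
    by (rule cs) (use z_single z_outside z_term_le(3)[OF _ assms that] in fastforce)+
qed

end

section \<open>Testing the perforated problem with the corrector\<close>

context hole_family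
begin

text \<open>\<open>U\<close> is contained in the compact intersection of the closed set
  \<open>E\<close> with a ball. The bound depends on the scale and serves for integrability only,
  never for a limit in \<open>\<epsilon>\<close>.\<close>

lemma bounded_on_U:
  fixes f :: "'a \<Rightarrow> 'b::euclidean_space"
  assumes "continuous_on E f"
  obtains B where "B > 0" "\<And>x. x \<in> U \<Longrightarrow> norm (f x) \<le> B" "f \<in> borel_measurable (lebesgue_on U)" "sqi (lebesgue_on U) f"
proof -
  have "compact (E \<inter> cball 0 r)" using closed_E by (simp add: closed_Int_compact)
  moreover have "continuous_on (E \<inter> cball 0 r) f" using assms continuous_on_subset by blast
  ultimately have "bounded (f ` (E \<inter> cball 0 r))" using compact_continuous_image compact_imp_bounded by blast
  then obtain B where B: "B > 0" "\<And>y. y \<in> f ` (E \<inter> cball 0 r) \<Longrightarrow> norm y \<le> B"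
    unfolding bounded_pos by blast
  have sub: "U \<subseteq> E \<inter> cball 0 r" using U_sub \<Omega>_ball by blast
  have m: "f \<in> borel_measurable (lebesgue_on U)"
    using continuous_on_subset[OF assms, of U] sub by (intro continuous_imp_measurable_on_sets_lebesgue) auto
  have le: "norm (f x) \<le> B" if "x \<in> U" for x using B(2) that sub by blast
  show ?thesis by (rule that[OF B(1) le m sqi_bounded[OF U_sets(1) bounded_U(1) m le]])
qed

text \<open>Since \<open>z = 1\<close> on the boundaries of the holes, the set where
  \<open>1 - z\<close> is at least \<open>1 / Suc n\<close> keeps away from them; this is what gives
  compact support inside \<open>U\<close>.\<close>

lemma cut_test_function:
  assumes \<phi>: "\<phi> \<in> test_functions \<Omega>"
  defines "\<eta> \<equiv> \<lambda>n x. if x \<in> W then smooth_cut (Suc n) (1 - z x) * \<phi> x else 0"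
  shows "\<eta> n \<in> test_functions U"
    and "x \<in> W \<Longrightarrow> gradient (\<eta> n) x = smooth_cut (Suc n) (1 - z x) *\<^sub>R gradient \<phi> x
      - (deriv (smooth_cut (Suc n)) (1 - z x) * \<phi> x) *\<^sub>R G x"
proof -
  obtain K where K: "compact K" "K \<subseteq> \<Omega>" "\<And>x. x \<notin> K \<Longrightarrow> \<phi> x = 0" using \<phi> test_functionsE by metis
  obtain B where B: "\<And>n t. t < 1 / real (Suc n) \<Longrightarrow> smooth_cut (Suc n) t = 0" by (rule smooth_cut_props) blast
  \<comment> \<open>Closed because \<open>z\<close> is continuous on the closed set
    \<open>E\<close>, and contained in \<open>W\<close> because at the boundary of a hole
    \<open>z\<close> equals 1.\<close>
  define K' where "K' = K \<inter> (E \<inter> z -` {..1 - 1 / real (Suc n)})"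
  have "closed (E \<inter> z -` {..1 - 1 / real (Suc n)})"
    by (rule continuous_closed_preimage[OF continuous_z closed_E]) simp
  then have K'_compact: "compact K'" unfolding K'_def using K(1) by (rule compact_Int_closed[rotated])
  have K'_W: "K' \<subseteq> W"
  proof
    fix x assume x: "x \<in> K'"
    show "x \<in> W" unfolding W_def
    proof (clarify, rule ccontr)
      fix j assume j: "j \<in> J" and "\<not> a j < norm (x - c j)"
      then have e: "norm (x - c j) = a j" using x unfolding K'_def E_def by force
      then have "\<sigma> j x = \<alpha> j" by (simp add: \<sigma>_def \<alpha>_def)
      moreover have "x \<in> ball (c j) R" using e a_le[OF j] R_pos by (simp add: dist_norm norm_minus_commute)
      ultimately have "z x = 1" using z_single[OF j] b_pos(2)[OF j] by simp
      then show False using x unfolding K'_def by simp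
    qed
  qed
  have zero: "\<eta> n x = 0" if "x \<notin> K'" for x
  proof (cases "x \<in> W \<and> x \<in> K")
    case True
    then have "1 - z x < 1 / real (Suc n)" using that U_sub unfolding K'_def by auto
    then show ?thesis using B by (simp add: \<eta>_def)
  next
    case False
    then show ?thesis using K(3)[of x] by (auto simp: \<eta>_def)
  qed
  have sW: "smooth_on W (\<lambda>x. smooth_cut (Suc n) (1 - z x))"
    by (rule smooth_on_compose[OF smooth_on_smooth_cut]) (auto intro!: smooth_on_diff smooth_z)
  have "smooth_on W (\<lambda>x. smooth_cut (Suc n) (1 - z x) * \<phi> x)"
    by (rule smooth_on_mult[OF sW smooth_on_subset[OF test_smooth[OF \<phi>]]]) simp
  then have "smooth_on W (\<eta> n)"
    using smooth_on_cong[OF open_W, of "\<eta> n" "\<lambda>x. smooth_cut (Suc n) (1 - z x) * \<phi> x"] by (simp add: \<eta>_def)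
  moreover have oK: "open (- K')" using K'_compact compact_imp_closed by blast
  moreover have "smooth_on (- K') (\<eta> n)"
    using smooth_on_cong[OF oK, of "\<eta> n" "\<lambda>x. 0"] zero by simp
  \<comment> \<open>Smooth on \<open>W\<close> by composition and on the complement of
    \<open>K'\<close> as the zero function. These two open sets cover the space, so the definition
    by cases does no harm.\<close>
  ultimately have "smooth_on (W \<union> - K') (\<eta> n)" using smooth_on_Un open_W by blast
  moreover have "W \<union> - K' = UNIV" using K'_W by blast
  ultimately have "smooth_on UNIV (\<eta> n)" by simp
  then show "\<eta> n \<in> test_functions U"
    using K'_compact zero K(2) K'_W unfolding U_eq by (intro test_functionsI[of _ K']) (auto simp: K'_def)
  show "gradient (\<eta> n) x = smooth_cut (Suc n) (1 - z x) *\<^sub>R gradient \<phi> x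
      - (deriv (smooth_cut (Suc n)) (1 - z x) * \<phi> x) *\<^sub>R G x" if x: "x \<in> W" for x
  proof -
    have "gradient (\<eta> n) x = gradient (\<lambda>x. smooth_cut (Suc n) (1 - z x) * \<phi> x) x"
      by (rule gradient_cong[OF open_W x]) (simp add: \<eta>_def)
    also have "\<dots> = smooth_cut (Suc n) (1 - z x) *\<^sub>R gradient \<phi> x + \<phi> x *\<^sub>R gradient (\<lambda>x. smooth_cut (Suc n) (1 - z x)) x"
      by (rule gradient_mult[OF smooth_on_differentiable[OF sW open_W x] test_differentiable[OF \<phi>]])
    also have "gradient (\<lambda>x. smooth_cut (Suc n) (1 - z x)) x = deriv (smooth_cut (Suc n)) (1 - z x) *\<^sub>R gradient (\<lambda>x. 1 - z x) x"
    proof (rule gradient_compose)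
      show "(smooth_cut (Suc n) has_real_derivative deriv (smooth_cut (Suc n)) (1 - z x)) (at (1 - z x))"
        using smooth_on_realD(1)[OF smooth_on_smooth_cut] by simp
      show "(\<lambda>x. 1 - z x) differentiable (at x)"
        by (intro smooth_on_differentiable[OF _ open_W x] smooth_on_diff smooth_z smooth_on_const)
    qed
    also have "gradient (\<lambda>x. 1 - z x) x = - G x"
      using gradient_diff[of "\<lambda>_. 1" x z] smooth_on_differentiable[OF smooth_z open_W x] gradient_z[OF x] by simp
    finally show ?thesis by (simp add: mult.commute)
  qed
qed

text \<open>This is the weak equation tested with \<open>(1 - z) \<phi>\<close>. On \<open>U\<close>
  one has \<open>z < 1\<close> strictly, so at each point the cut versions are eventually exact, and
  the uniform derivative bound gives a dominating constant.\<close>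

lemma weak_identity_corrected:
  assumes g: "sqi (lebesgue_on U) g" and f: "sqi (lebesgue_on U) f" and \<phi>: "\<phi> \<in> test_functions \<Omega>"
    and weak: "\<And>\<eta>. \<eta> \<in> test_functions U \<Longrightarrow> (LINT x|lebesgue_on U. g x \<bullet> gradient \<eta> x) = (LINT x|lebesgue_on U. f x * \<eta> x)"
  shows "(LINT x|lebesgue_on U. g x \<bullet> ((1 - z x) *\<^sub>R gradient \<phi> x - \<phi> x *\<^sub>R G x)) = (LINT x|lebesgue_on U. f x * ((1 - z x) * \<phi> x))"
proof -
  let ?M = "lebesgue_on U"
  define \<eta> where "\<eta> n x = (if x \<in> W then smooth_cut (Suc n) (1 - z x) * \<phi> x else 0)" for n x
  have \<eta>_test: "\<eta> n \<in> test_functions U" for n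
    using cut_test_function(1)[OF \<phi>, of n] by (simp add: \<eta>_def[abs_def])
  have \<eta>_grad: "gradient (\<eta> n) x = smooth_cut (Suc n) (1 - z x) *\<^sub>R gradient \<phi> x
      - (deriv (smooth_cut (Suc n)) (1 - z x) * \<phi> x) *\<^sub>R G x" if "x \<in> W" for n x
    using cut_test_function(2)[OF \<phi> that, of n] by (simp add: \<eta>_def[abs_def])
  obtain C where C: "C > 0" "\<And>n t. \<bar>deriv (smooth_cut n) t\<bar> \<le> C" "\<And>n t. \<bar>smooth_cut n t\<bar> \<le> \<bar>t\<bar>"
    "\<And>t. t > 0 \<Longrightarrow> \<forall>\<^sub>F n in sequentially. smooth_cut (Suc n) t = t \<and> deriv (smooth_cut (Suc n)) t = 1"
    by (rule smooth_cut_props) blast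
  obtain B where B: "B > 0" "\<And>x. \<bar>\<phi> x\<bar> \<le> B" "\<And>x. norm (gradient \<phi> x) \<le> B" using test_bounded[OF \<phi>] by metis
  obtain BG where BG: "BG > 0" "\<And>x. x \<in> U \<Longrightarrow> norm (G x) \<le> BG" and [measurable]: "G \<in> borel_measurable ?M"
    by (rule bounded_on_U[OF continuous_G]) blast
  have [measurable]: "z \<in> borel_measurable ?M" by (rule bounded_on_U[OF continuous_z]) blast
  have [measurable]: "\<phi> \<in> borel_measurable ?M" "gradient \<phi> \<in> borel_measurable ?M"
    "\<eta> n \<in> borel_measurable ?M" "gradient (\<eta> n) \<in> borel_measurable ?M" for n
    using borel_imp_lebesgue_on test_measurable test_gradient_measurable \<phi> \<eta>_test by blast+
  have zU: "0 \<le> z x" "z x < 1" if "x \<in> U" for x using z_bounds[of x] that U_sub by auto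
  have one: "\<bar>smooth_cut n (1 - z x)\<bar> \<le> 1" if "x \<in> U" for n x
    using C(3)[of n "1 - z x"] zU[OF that] by simp
  have ev: "\<forall>\<^sub>F n in sequentially. smooth_cut (Suc n) (1 - z x) = 1 - z x \<and> deriv (smooth_cut (Suc n)) (1 - z x) = 1" if "x \<in> U" for x
    by (rule C(4)) (use zU[OF that] in simp)
  have const: "sqi ?M (\<lambda>x. K)" for K :: real
    by (rule sqi_bounded[OF U_sets(1) bounded_U(1), where B = "\<bar>K\<bar>"]) auto
  have U1: "x \<in> W" if "x \<in> U" for x using that U_sub by blast
  have gb: "norm (s *\<^sub>R gradient \<phi> x - (t * \<phi> x) *\<^sub>R G x) \<le> B + C * B * BG" if x: "x \<in> U" and s: "\<bar>s\<bar> \<le> 1" and t: "\<bar>t\<bar> \<le> C" for s t x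
  proof -
    have "norm (s *\<^sub>R gradient \<phi> x) \<le> 1 * B" unfolding norm_scaleR using s B by (intro mult_mono) auto
    moreover have "norm ((t * \<phi> x) *\<^sub>R G x) \<le> (C * B) * BG"
      unfolding norm_scaleR abs_mult using t B BG(1) BG(2)[OF x] C(1) by (intro mult_mono) auto
    ultimately show ?thesis using norm_triangle_ineq4[of "s *\<^sub>R gradient \<phi> x" "(t * \<phi> x) *\<^sub>R G x"] by linarith
  qed
  \<comment> \<open>Lets the estimate \<open>gb\<close> cover the limit gradient too, whose
    coefficient is 1 in place of a derivative of the cut.\<close>
  have C1: "C \<ge> 1"
  proof -
    obtain N where "\<forall>n\<ge>N. smooth_cut (Suc n) 1 = 1 \<and> deriv (smooth_cut (Suc n)) 1 = 1"
      using C(4)[of 1] by (auto simp: eventually_sequentially)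
    then show ?thesis using C(2)[of "Suc N" 1] by simp
  qed
  have L1: "(\<lambda>n. LINT x|?M. gradient (\<eta> n) x \<bullet> g x) \<longlonglongrightarrow> (LINT x|?M. ((1 - z x) *\<^sub>R gradient \<phi> x - \<phi> x *\<^sub>R G x) \<bullet> g x)"
  proof (rule nrm2_limit_inner[OF test_sqi(2)[OF \<eta>_test U_sets(1)] _ g])
    have b: "norm ((1 - z x) *\<^sub>R gradient \<phi> x - \<phi> x *\<^sub>R G x) \<le> B + C * B * BG" if "x \<in> U" for x
      using gb[OF that, of "1 - z x" 1] zU[OF that] C1 by simp
    show "sqi ?M (\<lambda>x. (1 - z x) *\<^sub>R gradient \<phi> x - \<phi> x *\<^sub>R G x)"
      by (rule sqi_bounded[OF U_sets(1) bounded_U(1) _ b]) measurable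
    show "(\<lambda>n. nrm2 ?M (\<lambda>x. (1 - z x) *\<^sub>R gradient \<phi> x - \<phi> x *\<^sub>R G x - gradient (\<eta> n) x)) \<longlonglongrightarrow> 0"
    proof (rule nrm2_dominated_convergence[OF _ _ const[of "B + C * B * BG"]])
      show "AE x in ?M. (\<lambda>n. gradient (\<eta> n) x) \<longlonglongrightarrow> (1 - z x) *\<^sub>R gradient \<phi> x - \<phi> x *\<^sub>R G x"
      proof (rule AE_I2)
        fix x assume "x \<in> space ?M"
        then have x: "x \<in> U" by simp
        show "(\<lambda>n. gradient (\<eta> n) x) \<longlonglongrightarrow> (1 - z x) *\<^sub>R gradient \<phi> x - \<phi> x *\<^sub>R G x"
          by (rule tendsto_eventually) (use ev[OF x] in \<open>eventually_elim, simp add: \<eta>_grad[OF U1[OF x]]\<close>)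
      qed
      have pos: "0 \<le> B + C * B * BG" using B(1) C(1) BG(1) by simp
      show "AE x in ?M. norm (gradient (\<eta> n) x) \<le> norm (B + C * B * BG)" for n
      proof (rule AE_I2)
        fix x assume "x \<in> space ?M"
        then have x: "x \<in> U" by simp
        show "norm (gradient (\<eta> n) x) \<le> norm (B + C * B * BG)"
          unfolding \<eta>_grad[OF U1[OF x]] using gb[OF x one[OF x] C(2)] pos by simp
      qed
      show "AE x in ?M. norm ((1 - z x) *\<^sub>R gradient \<phi> x - \<phi> x *\<^sub>R G x) \<le> norm (B + C * B * BG)"
        using b pos by (intro AE_I2) simp
    qed measurable
  qed
  have L2: "(\<lambda>n. LINT x|?M. \<eta> n x * f x) \<longlonglongrightarrow> (LINT x|?M. ((1 - z x) * \<phi> x) * f x)"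
  proof -
    have bz: "\<bar>(1 - z x) * \<phi> x\<bar> \<le> B" if "x \<in> U" for x
    proof -
      have "\<bar>1 - z x\<bar> * \<bar>\<phi> x\<bar> \<le> 1 * B" using zU[OF that] B by (intro mult_mono) auto
      then show ?thesis by (simp add: abs_mult)
    qed
    have "(\<lambda>n. LINT x|?M. \<eta> n x \<bullet> f x) \<longlonglongrightarrow> (LINT x|?M. ((1 - z x) * \<phi> x) \<bullet> f x)"
    proof (rule nrm2_limit_inner[OF test_sqi(1)[OF \<eta>_test U_sets(1)] _ f])
      show "sqi ?M (\<lambda>x. (1 - z x) * \<phi> x)"
        by (rule sqi_bounded[OF U_sets(1) bounded_U(1), where B = B]) (use bz in auto)
      show "(\<lambda>n. nrm2 ?M (\<lambda>x. (1 - z x) * \<phi> x - \<eta> n x)) \<longlonglongrightarrow> 0"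
      proof (rule nrm2_dominated_convergence[OF _ _ const[of B]])
        show "AE x in ?M. (\<lambda>n. \<eta> n x) \<longlonglongrightarrow> (1 - z x) * \<phi> x"
        proof (rule AE_I2)
          fix x assume "x \<in> space ?M"
          then have x: "x \<in> U" by simp
          show "(\<lambda>n. \<eta> n x) \<longlonglongrightarrow> (1 - z x) * \<phi> x"
            by (rule tendsto_eventually) (use ev[OF x] in \<open>eventually_elim, simp add: \<eta>_def U1[OF x]\<close>)
        qed
        show "AE x in ?M. norm (\<eta> n x) \<le> norm B" for n
        proof (rule AE_I2)
          fix x assume "x \<in> space ?M"
          then have x: "x \<in> U" by simp
          have "\<bar>smooth_cut (Suc n) (1 - z x)\<bar> * \<bar>\<phi> x\<bar> \<le> 1 * B" using one[OF x] B by (intro mult_mono) auto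
          then show "norm (\<eta> n x) \<le> norm B" using B(1) by (simp add: \<eta>_def abs_mult)
        qed
        show "AE x in ?M. norm ((1 - z x) * \<phi> x) \<le> norm B"
          using bz B(1) by (intro AE_I2) simp
      qed measurable
    qed
    then show ?thesis by simp
  qed
  have "(LINT x|?M. gradient (\<eta> n) x \<bullet> g x) = (LINT x|?M. \<eta> n x * f x)" for n
    using weak[OF \<eta>_test[of n]] by (simp only: inner_commute mult.commute)
  with L1 L2 have "(LINT x|?M. ((1 - z x) *\<^sub>R gradient \<phi> x - \<phi> x *\<^sub>R G x) \<bullet> g x) = (LINT x|?M. ((1 - z x) * \<phi> x) * f x)"
    using LIMSEQ_unique by simp
  then show ?thesis by (simp only: inner_commute[of "g _"] mult.commute[of "f _"])
qed

text \<open>The divergence of \<open>\<psi> (\<phi> G - z \<nabla>\<phi>)\<close> integrates to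
  zero. Subtracting \<open>z \<nabla>\<phi>\<close> is the point: the two terms
  \<open>\<psi> G \<bullet> \<nabla>\<phi>\<close> arising from the product rule cancel, so in the
  terms that multiply the function \<open>\<psi>\<close> the gradient of \<open>z\<close> no longer
  occurs.\<close>

lemma corrector_by_parts:
  assumes \<psi>: "\<psi> \<in> test_functions U" and \<phi>: "\<phi> \<in> test_functions \<Omega>"
  shows "(LINT x|lebesgue_on U. gradient \<psi> x \<bullet> (\<phi> x *\<^sub>R G x - z x *\<^sub>R gradient \<phi> x) + \<psi> x * (\<phi> x * \<rho> x - z x * laplacian \<phi> x)) = 0"
proof -
  let ?M = "lebesgue_on U"
  obtain K where K: "compact K" "K \<subseteq> U" "\<And>x. x \<notin> K \<Longrightarrow> \<psi> x = 0" using \<psi> test_functionsE by metis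
  define F where "F i x = \<psi> x * (\<phi> x * (G x \<bullet> i) - z x * (gradient \<phi> x \<bullet> i))" for i x
  note s\<phi> = test_smooth[OF \<phi>] test_smooth[OF test_gradient[OF \<phi>]]
  have sW: "smooth_on W (\<lambda>x. \<phi> x * (G x \<bullet> i))" "smooth_on W (\<lambda>x. z x * (gradient \<phi> x \<bullet> i))" for i
    by (intro smooth_on_mult smooth_G smooth_z smooth_on_subset[OF s\<phi>(1)] smooth_on_subset[OF s\<phi>(2)] subset_UNIV)+
  have F_test: "F i \<in> test_functions U" for i
  proof (rule test_functionsI[OF _ K(1,2)])
    have oK: "open (- K)" using K(1) compact_imp_closed by blast
    have "smooth_on W (F i)"
      unfolding F_def by (intro smooth_on_mult[OF smooth_on_subset[OF test_smooth[OF \<psi>]]] smooth_on_diff sW subset_UNIV)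
    moreover have "smooth_on (- K) (F i)"
      using smooth_on_cong[OF oK, of "F i" "\<lambda>x. 0"] K(3) by (simp add: F_def)
    ultimately have "smooth_on (W \<union> - K) (F i)" by (rule smooth_on_Un[OF open_W oK])
    moreover have "W \<union> - K = UNIV" using K(2) U_sub by blast
    ultimately show "smooth_on UNIV (F i)" by simp
    show "F i x = 0" if "x \<notin> K" for x using K(3)[OF that] by (simp add: F_def)
  qed
  have F_grad: "gradient (F i) x \<bullet> i = (gradient \<psi> x \<bullet> i) * (\<phi> x * (G x \<bullet> i) - z x * (gradient \<phi> x \<bullet> i))
      + \<psi> x * (\<phi> x * (gradient (\<lambda>x. G x \<bullet> i) x \<bullet> i) - z x * (gradient (\<lambda>x. gradient \<phi> x \<bullet> i) x \<bullet> i))" if x: "x \<in> U" for i x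
  proof -
    have xW: "x \<in> W" using x U_sub by blast
    note dW = smooth_on_differentiable[OF _ open_W xW]
    note d\<phi> = test_differentiable[OF \<phi>] test_differentiable[OF test_gradient[OF \<phi>]]
    have "gradient (F i) x = \<psi> x *\<^sub>R gradient (\<lambda>x. \<phi> x * (G x \<bullet> i) - z x * (gradient \<phi> x \<bullet> i)) x
        + (\<phi> x * (G x \<bullet> i) - z x * (gradient \<phi> x \<bullet> i)) *\<^sub>R gradient \<psi> x"
      unfolding F_def by (rule gradient_mult[OF test_differentiable[OF \<psi>] dW[OF smooth_on_diff[OF sW]]])
    also have "gradient (\<lambda>x. \<phi> x * (G x \<bullet> i) - z x * (gradient \<phi> x \<bullet> i)) x
      = gradient (\<lambda>x. \<phi> x * (G x \<bullet> i)) x - gradient (\<lambda>x. z x * (gradient \<phi> x \<bullet> i)) x"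
      by (rule gradient_diff[OF dW[OF sW(1)] dW[OF sW(2)]])
    also have "gradient (\<lambda>x. \<phi> x * (G x \<bullet> i)) x = \<phi> x *\<^sub>R gradient (\<lambda>x. G x \<bullet> i) x + (G x \<bullet> i) *\<^sub>R gradient \<phi> x"
      by (rule gradient_mult[OF d\<phi>(1) dW[OF smooth_G]])
    also have "gradient (\<lambda>x. z x * (gradient \<phi> x \<bullet> i)) x = z x *\<^sub>R gradient (\<lambda>x. gradient \<phi> x \<bullet> i) x + (gradient \<phi> x \<bullet> i) *\<^sub>R gradient z x"
      by (rule gradient_mult[OF dW[OF smooth_z] d\<phi>(2)])
    finally have e: "gradient (F i) x = \<psi> x *\<^sub>R (\<phi> x *\<^sub>R gradient (\<lambda>x. G x \<bullet> i) x + (G x \<bullet> i) *\<^sub>R gradient \<phi> x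
        - (z x *\<^sub>R gradient (\<lambda>x. gradient \<phi> x \<bullet> i) x + (gradient \<phi> x \<bullet> i) *\<^sub>R gradient z x))
        + (\<phi> x * (G x \<bullet> i) - z x * (gradient \<phi> x \<bullet> i)) *\<^sub>R gradient \<psi> x" .
    show ?thesis
      unfolding e gradient_z[OF xW] inner_add_left inner_diff_left inner_scaleR_left by (simp add: algebra_simps)
  qed
  \<comment> \<open>Integration by parts against the constant 1 says that a partial derivative of a
    test function has integral 0.\<close>
  have i0: "integrable ?M (\<lambda>x. gradient (F i) x \<bullet> i)" "(LINT x|?M. gradient (F i) x \<bullet> i) = 0" for i
    using integration_by_parts(1,2)[OF F_test[of i] smooth_on_const[of UNIV 1] U_sets(1), of i] by simp_all
  have "(LINT x|?M. gradient \<psi> x \<bullet> (\<phi> x *\<^sub>R G x - z x *\<^sub>R gradient \<phi> x) + \<psi> x * (\<phi> x * \<rho> x - z x * laplacian \<phi> x))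
    = (LINT x|?M. (\<Sum>i\<in>Basis. gradient (F i) x \<bullet> i))"
  proof (rule Bochner_Integration.integral_cong[OF refl])
    fix x assume "x \<in> space ?M"
    then have x: "x \<in> U" "x \<in> W" using U_sub by auto
    have "(\<Sum>i\<in>Basis. gradient (F i) x \<bullet> i) =
      (\<Sum>i\<in>Basis. (gradient \<psi> x \<bullet> i) * ((\<phi> x *\<^sub>R G x - z x *\<^sub>R gradient \<phi> x) \<bullet> i))
      + \<psi> x * (\<phi> x * (\<Sum>i\<in>Basis. gradient (\<lambda>x. G x \<bullet> i) x \<bullet> i) - z x * (\<Sum>i\<in>Basis. gradient (\<lambda>x. gradient \<phi> x \<bullet> i) x \<bullet> i))"
      unfolding F_grad[OF x(1)] sum_distrib_left sum_subtractf[symmetric] sum.distrib[symmetric]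
      by (simp add: inner_diff_left)
    then show "gradient \<psi> x \<bullet> (\<phi> x *\<^sub>R G x - z x *\<^sub>R gradient \<phi> x) + \<psi> x * (\<phi> x * \<rho> x - z x * laplacian \<phi> x)
      = (\<Sum>i\<in>Basis. gradient (F i) x \<bullet> i)"
      unfolding divergence_G[OF x(2)] laplacian_def[symmetric]
        euclidean_inner[of "gradient \<psi> x" "\<phi> x *\<^sub>R G x - z x *\<^sub>R gradient \<phi> x"] by (rule sym)
  qed
  also have "\<dots> = 0" using i0 by simp
  finally show ?thesis .
qed

text \<open>Two exact identities are combined so that the term with \<open>G\<close> drops out. Each
  remaining error contains \<open>z\<close> undifferentiated, hence is controlled by its L2 norm;
  the integral of \<open>g \<bullet> (z \<nabla>\<phi>)\<close> occurs in both identities, which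
  explains the factor 2.\<close>

lemma corrector_estimate:
  assumes p: "H10_pair U u g" and f: "sqi (lebesgue_on U) f" and \<phi>: "\<phi> \<in> test_functions \<Omega>"
    and weak: "\<And>\<eta>. \<eta> \<in> test_functions U \<Longrightarrow> (LINT x|lebesgue_on U. g x \<bullet> gradient \<eta> x) = (LINT x|lebesgue_on U. f x * \<eta> x)"
    and B: "\<And>x. \<bar>\<phi> x\<bar> \<le> B" "\<And>x. norm (gradient \<phi> x) \<le> B" "\<And>x. \<bar>laplacian \<phi> x\<bar> \<le> B"
  shows "\<bar>(LINT x|lebesgue_on U. g x \<bullet> gradient \<phi> x) + (LINT x|lebesgue_on U. u x * (\<phi> x * \<rho> x)) - (LINT x|lebesgue_on U. f x * \<phi> x)\<bar>
    \<le> B * (2 * nrm2 (lebesgue_on U) g + nrm2 (lebesgue_on U) u + nrm2 (lebesgue_on U) f) * nrm2 (lebesgue_on U) z"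
proof -
  let ?M = "lebesgue_on U"
  note s = H10_pair_sqi[OF p]
  have sz: "sqi ?M z" and mz [measurable]: "z \<in> borel_measurable ?M"
    by (rule bounded_on_U[OF continuous_z], blast)+
  have sG: "sqi ?M G" and [measurable]: "G \<in> borel_measurable ?M"
    by (rule bounded_on_U[OF continuous_G], blast)+
  have s\<rho>: "sqi ?M \<rho>" by (rule bounded_on_U[OF continuous_\<rho>]) blast
  have [measurable]: "\<phi> \<in> borel_measurable ?M" "gradient \<phi> \<in> borel_measurable ?M" "laplacian \<phi> \<in> borel_measurable ?M"
    using borel_imp_lebesgue_on test_measurable test_gradient_measurable \<phi> test_laplacian by blast+
  have z\<phi>: "sqi ?M (\<lambda>x. z x *\<^sub>R gradient \<phi> x)" "nrm2 ?M (\<lambda>x. z x *\<^sub>R gradient \<phi> x) \<le> B * nrm2 ?M z"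
  proof -
    have b: "AE x in ?M. norm (z x *\<^sub>R gradient \<phi> x) \<le> B * norm (z x)"
      using B(2) by (intro AE_I2) (simp add: mult.commute[of "\<bar>_\<bar>"] mult_right_mono)
    show "sqi ?M (\<lambda>x. z x *\<^sub>R gradient \<phi> x)" by (rule sqi_dominated[OF sz _ b]) measurable
    have "0 \<le> B" using B(1)[of undefined] by linarith
    then show "nrm2 ?M (\<lambda>x. z x *\<^sub>R gradient \<phi> x) \<le> B * nrm2 ?M z" by (intro nrm2_mono[OF sz _ b]) measurable
  qed
  have zL: "sqi ?M (\<lambda>x. z x * laplacian \<phi> x)" "nrm2 ?M (\<lambda>x. z x * laplacian \<phi> x) \<le> B * nrm2 ?M z"
    using sqi_bounded_mult_real[OF sz _ B(3)] by (simp_all add: mult.commute)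
  have zf: "sqi ?M (\<lambda>x. z x * \<phi> x)" "nrm2 ?M (\<lambda>x. z x * \<phi> x) \<le> B * nrm2 ?M z"
    using sqi_bounded_mult_real[OF sz _ B(1)] by (simp_all add: mult.commute)
  have \<phi>G: "sqi ?M (\<lambda>x. \<phi> x *\<^sub>R G x)" by (rule sqi_bounded_mult(1)[OF sG _ B(1)]) measurable
  have \<phi>\<rho>: "sqi ?M (\<lambda>x. \<phi> x * \<rho> x)" by (rule sqi_bounded_mult_real(1)[OF s\<rho> _ B(1)]) measurable
  note t = test_sqi[OF \<phi> U_sets(1)]
  define I1 where "I1 = (LINT x|?M. g x \<bullet> gradient \<phi> x)"
  define I2 where "I2 = (LINT x|?M. g x \<bullet> (z x *\<^sub>R gradient \<phi> x))"
  define I3 where "I3 = (LINT x|?M. g x \<bullet> (\<phi> x *\<^sub>R G x))"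
  define Ru where "Ru = (LINT x|?M. u x * (\<phi> x * \<rho> x))"
  define Lu where "Lu = (LINT x|?M. u x * (z x * laplacian \<phi> x))"
  define Jf where "Jf = (LINT x|?M. f x * \<phi> x)"
  define Jz where "Jz = (LINT x|?M. f x * (z x * \<phi> x))"
  note i = sqi_inner[OF s(2) t(2)] sqi_inner[OF s(2) z\<phi>(1)] sqi_inner[OF s(2) \<phi>G]
    sqi_mult[OF s(1) \<phi>\<rho>] sqi_mult[OF s(1) zL(1)] sqi_mult[OF f t(1)] sqi_mult[OF f zf(1)]
  have A: "I1 - I2 - I3 = Jf - Jz"
  proof -
    have "I1 - I2 - I3 = (LINT x|?M. g x \<bullet> gradient \<phi> x - g x \<bullet> (z x *\<^sub>R gradient \<phi> x) - g x \<bullet> (\<phi> x *\<^sub>R G x))"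
      unfolding I1_def I2_def I3_def using i(1-3) by simp
    also have "\<dots> = (LINT x|?M. g x \<bullet> ((1 - z x) *\<^sub>R gradient \<phi> x - \<phi> x *\<^sub>R G x))"
      by (simp only: inner_diff_right scaleR_left_diff_distrib scaleR_one)
    also have "\<dots> = (LINT x|?M. f x * ((1 - z x) * \<phi> x))"
      by (rule weak_identity_corrected[OF s(2) f \<phi> weak])
    also have "\<dots> = (LINT x|?M. f x * \<phi> x - f x * (z x * \<phi> x))"
      by (simp only: left_diff_distrib right_diff_distrib mult_1)
    also have "\<dots> = Jf - Jz" unfolding Jf_def Jz_def using i(6,7) by simp
    finally show ?thesis .
  qed
  \<comment> \<open>\<open>corrector_by_parts\<close> for the approximants of the solution, passed
    to the limit. Together with \<open>A\<close> this gives
    \<open>I1 + Ru - Jf = 2 I2 + Lu - Jz\<close>.\<close>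
  have Bp: "I3 - I2 + (Ru - Lu) = 0"
  proof -
    obtain \<psi> where \<psi>: "\<And>n::nat. \<psi> n \<in> test_functions U"
      "(\<lambda>n. nrm2 ?M (\<lambda>x. u x - \<psi> n x)) \<longlonglongrightarrow> 0" "(\<lambda>n. nrm2 ?M (\<lambda>x. g x - gradient (\<psi> n) x)) \<longlonglongrightarrow> 0"
      using H10_pairE[OF p] by blast
    note lim = H10_pair_limit_inner[OF U_sets(1) p \<psi>]
    have "(\<lambda>n. (LINT x|?M. gradient (\<psi> n) x \<bullet> (\<phi> x *\<^sub>R G x)) - (LINT x|?M. gradient (\<psi> n) x \<bullet> (z x *\<^sub>R gradient \<phi> x))
      + ((LINT x|?M. \<psi> n x * (\<phi> x * \<rho> x)) - (LINT x|?M. \<psi> n x * (z x * laplacian \<phi> x)))) \<longlonglongrightarrow> I3 - I2 + (Ru - Lu)"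
      unfolding I3_def I2_def Ru_def Lu_def
      by (intro tendsto_add tendsto_diff lim \<phi>G z\<phi> \<phi>\<rho> zL)
    moreover have "(LINT x|?M. gradient (\<psi> n) x \<bullet> (\<phi> x *\<^sub>R G x)) - (LINT x|?M. gradient (\<psi> n) x \<bullet> (z x *\<^sub>R gradient \<phi> x))
      + ((LINT x|?M. \<psi> n x * (\<phi> x * \<rho> x)) - (LINT x|?M. \<psi> n x * (z x * laplacian \<phi> x))) = 0" for n
    proof -
      note st = test_sqi[OF \<psi>(1)[of n] U_sets(1)]
      have "(LINT x|?M. gradient (\<psi> n) x \<bullet> (\<phi> x *\<^sub>R G x)) - (LINT x|?M. gradient (\<psi> n) x \<bullet> (z x *\<^sub>R gradient \<phi> x))
        + ((LINT x|?M. \<psi> n x * (\<phi> x * \<rho> x)) - (LINT x|?M. \<psi> n x * (z x * laplacian \<phi> x)))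
        = (LINT x|?M. (gradient (\<psi> n) x \<bullet> (\<phi> x *\<^sub>R G x) - gradient (\<psi> n) x \<bullet> (z x *\<^sub>R gradient \<phi> x))
          + (\<psi> n x * (\<phi> x * \<rho> x) - \<psi> n x * (z x * laplacian \<phi> x)))"
        using sqi_inner[OF st(2) \<phi>G] sqi_inner[OF st(2) z\<phi>(1)] sqi_mult[OF st(1) \<phi>\<rho>] sqi_mult[OF st(1) zL(1)]
        by simp
      also have "\<dots> = 0"
        using corrector_by_parts[OF \<psi>(1)[of n] \<phi>] by (simp only: inner_diff_right right_diff_distrib)
      finally show ?thesis .
    qed
    ultimately show ?thesis by (simp add: LIMSEQ_const_iff)
  qed
  have b1: "\<bar>I2\<bar> \<le> nrm2 ?M g * (B * nrm2 ?M z)"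
    unfolding I2_def using nrm2_Cauchy_Schwarz[OF s(2) z\<phi>(1)] mult_left_mono[OF z\<phi>(2) nrm2_nonneg[of ?M g]] by linarith
  have b2: "\<bar>Lu\<bar> \<le> nrm2 ?M u * (B * nrm2 ?M z)"
    unfolding Lu_def using nrm2_Cauchy_Schwarz_real[OF s(1) zL(1)] mult_left_mono[OF zL(2) nrm2_nonneg[of ?M u]] by linarith
  have b3: "\<bar>Jz\<bar> \<le> nrm2 ?M f * (B * nrm2 ?M z)"
    unfolding Jz_def using nrm2_Cauchy_Schwarz_real[OF f zf(1)] mult_left_mono[OF zf(2) nrm2_nonneg[of ?M f]] by linarith
  have "\<bar>I1 + Ru - Jf\<bar> \<le> 2 * (nrm2 ?M g * (B * nrm2 ?M z)) + nrm2 ?M u * (B * nrm2 ?M z) + nrm2 ?M f * (B * nrm2 ?M z)"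
    using A Bp b1 b2 b3 by linarith
  also have "\<dots> = B * (2 * nrm2 ?M g + nrm2 ?M u + nrm2 ?M f) * nrm2 ?M z" by (simp add: algebra_simps)
  finally show ?thesis unfolding I1_def Ru_def Jf_def .
qed

end

section \<open>Cell averages of oscillating densities\<close>

text \<open>The L1 norm \<open>\<theta> h\<close> of the increment is subadditive in h by
  translation invariance, so \<open>\<theta> h\<close> is at most n times
  \<open>\<theta> (h / n)\<close>, and the latter converges to the integral of the directional
  derivative. No integration along segments is involved.\<close>

lemma integral_lborel_translation_abs:
  fixes v :: "'a::euclidean_space \<Rightarrow> real"
  assumes v: "v \<in> test_functions X"
  shows "integrable lborel (\<lambda>x. \<bar>v (x + h) - v x\<bar>)"
    and "(LINT x|lborel. \<bar>v (x + h) - v x\<bar>) \<le> norm h * (LINT x|lborel. norm (gradient v x))"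
proof -
  note [measurable] = test_measurable[OF v] test_gradient_measurable[OF v]
  obtain K where K: "compact K" "\<And>x. x \<notin> K \<Longrightarrow> v x = 0" using v test_functionsE by metis
  obtain \<rho> where \<rho>: "\<And>x. x \<in> K \<Longrightarrow> norm x \<le> \<rho>" using compact_imp_bounded[OF K(1)] by (auto simp: bounded_iff)
  have v_int: "integrable lborel v" by (rule compact_support_integrable[OF test_continuous[OF v] K])
  have g_int: "integrable lborel (gradient v)"
    by (rule compact_support_integrable[OF test_continuous_gradient[OF v] K(1)])
      (rule gradient_eq_0_outside[OF compact_imp_closed[OF K(1)] K(2)])
  have tr_int: "integrable lborel (\<lambda>x. v (x + h))" for h
    using integral_lborel_translation(2)[of v h] v_int by simp
  have int: "integrable lborel (\<lambda>x. \<bar>v (x + h) - v x\<bar>)" for h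
    using tr_int[of h] v_int by simp
  show "integrable lborel (\<lambda>x. \<bar>v (x + h) - v x\<bar>)" by (rule int)
  define \<theta> where "\<theta> h = (LINT x|lborel. \<bar>v (x + h) - v x\<bar>)" for h
  have sub: "\<theta> (h + k) \<le> \<theta> h + \<theta> k" for h k
  proof -
    have i: "integrable lborel (\<lambda>x. \<bar>v (x + k + h) - v (x + k)\<bar>)"
      using integral_lborel_translation(2)[of "\<lambda>x. \<bar>v (x + h) - v x\<bar>" k] int by simp
    have "\<theta> (h + k) \<le> (LINT x|lborel. \<bar>v (x + k + h) - v (x + k)\<bar> + \<bar>v (x + k) - v x\<bar>)"
      unfolding \<theta>_def
    proof (rule integral_mono)
      show "integrable lborel (\<lambda>x. \<bar>v (x + k + h) - v (x + k)\<bar> + \<bar>v (x + k) - v x\<bar>)"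
        using i int[of k] by (rule Bochner_Integration.integrable_add)
      show "\<bar>v (x + (h + k)) - v x\<bar> \<le> \<bar>v (x + k + h) - v (x + k)\<bar> + \<bar>v (x + k) - v x\<bar>" for x
      proof -
        have "v (x + (h + k)) = v (x + k + h)" by (simp add: ac_simps)
        then show ?thesis by linarith
      qed
    qed (rule int)
    also have "\<dots> = (LINT x|lborel. \<bar>v (x + k + h) - v (x + k)\<bar>) + \<theta> k"
      unfolding \<theta>_def using int i by simp
    also have "(LINT x|lborel. \<bar>v (x + k + h) - v (x + k)\<bar>) = \<theta> h"
      unfolding \<theta>_def using integral_lborel_translation(1)[of "\<lambda>x. \<bar>v (x + h) - v x\<bar>" k] by simp
    finally show ?thesis .
  qed
  have mult: "\<theta> (real n *\<^sub>R h) \<le> real n * \<theta> h" for n h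
  proof (induction n)
    case 0
    then show ?case by (simp add: \<theta>_def)
  next
    case (Suc n)
    have "\<theta> (real (Suc n) *\<^sub>R h) = \<theta> (real n *\<^sub>R h + h)" by (simp add: algebra_simps)
    also have "\<dots> \<le> real n * \<theta> h + \<theta> h" using sub[of "real n *\<^sub>R h" h] Suc by linarith
    finally show ?case by (simp add: algebra_simps)
  qed
  define t where "t n = inverse (real (Suc n))" for n
  have t: "t n > 0" "t n \<le> 1" for n by (auto simp: t_def field_simps)
  have t0: "t \<longlonglongrightarrow> 0" unfolding t_def by (rule LIMSEQ_inverse_real_of_nat)
  obtain B where B: "B > 0" "\<And>x. norm (gradient v x) \<le> B" using test_bounded[OF v] by metis
  define s where "s n x = \<bar>v (x + t n *\<^sub>R h) - v x\<bar> / t n" for n x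
  have [measurable]: "s n \<in> borel_measurable borel" for n unfolding s_def by measurable
  have lim: "(\<lambda>n. LINT x|lborel. s n x) \<longlonglongrightarrow> (LINT x|lborel. \<bar>gradient v x \<bullet> h\<bar>)"
  proof (rule integral_dominated_convergence)
    show "integrable lborel (\<lambda>x. (B * norm h) * indicator (cball 0 (\<rho> + norm h)) x :: real)"
      by (intro integrable_mult_right integrable_real_indicator) (auto simp: emeasure_lborel_cball_finite[unfolded infinity_ennreal_def])
    show "AE x in lborel. (\<lambda>n. s n x) \<longlonglongrightarrow> \<bar>gradient v x \<bullet> h\<bar>"
    proof (rule AE_I2)
      fix x
      have "((\<lambda>e. (v (x + e *\<^sub>R h) - v x) / e) \<longlongrightarrow> gradient v x \<bullet> h) (at 0)"
        using has_derivative_directional[OF test_differentiable[OF v], of x h] by (simp add: has_field_derivative_iff)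
      then have "(\<lambda>n. (v (x + t n *\<^sub>R h) - v x) / t n) \<longlonglongrightarrow> gradient v x \<bullet> h"
        by (rule filterlim_compose) (use t0 t in \<open>auto simp: filterlim_at intro!: always_eventually less_imp_neq[symmetric]\<close>)
      from tendsto_rabs[OF this] show "(\<lambda>n. s n x) \<longlonglongrightarrow> \<bar>gradient v x \<bullet> h\<bar>"
        unfolding s_def using t by (simp add: abs_of_pos)
    qed
    show "AE x in lborel. norm (s n x) \<le> (B * norm h) * indicator (cball 0 (\<rho> + norm h)) x" for n
    proof (rule AE_I2)
      fix x
      have b: "\<bar>s n x\<bar> \<le> B * norm h"
      proof -
        have "\<bar>v (x + t n *\<^sub>R h) - v x\<bar> \<le> B * (t n * norm h)"
          using gradient_Lipschitz[OF test_differentiable[OF v] B(2), of "x + t n *\<^sub>R h" x] t[of n] by simp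
        then show ?thesis using t[of n] by (simp add: s_def divide_le_eq ac_simps)
      qed
      show "norm (s n x) \<le> (B * norm h) * indicator (cball 0 (\<rho> + norm h)) x"
      proof (cases "norm x \<le> \<rho> + norm h")
        case False
        have "norm (t n *\<^sub>R h) \<le> norm h" using t[of n] by (simp add: mult_left_le_one_le)
        then have "norm (x + t n *\<^sub>R h) > \<rho>"
          using False norm_triangle_ineq4[of "x + t n *\<^sub>R h" "t n *\<^sub>R h"] by simp
        moreover have "norm x > \<rho>" using False norm_ge_zero[of h] by linarith
        ultimately have "v (x + t n *\<^sub>R h) = 0" "v x = 0" using K(2) \<rho> by (meson not_le)+
        then show ?thesis using False by (simp add: s_def)
      qed (use b in auto)
    qed
  qed measurable
  have "\<theta> h \<le> (LINT x|lborel. s n x)" for n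
  proof -
    have "\<theta> h = \<theta> (real (Suc n) *\<^sub>R (t n *\<^sub>R h))" by (simp add: t_def)
    also have "\<dots> \<le> real (Suc n) * \<theta> (t n *\<^sub>R h)" by (rule mult)
    also have "\<dots> = (LINT x|lborel. s n x)"
      unfolding s_def \<theta>_def by (simp add: t_def divide_inverse mult.commute)
    finally show ?thesis .
  qed
  then have "\<theta> h \<le> (LINT x|lborel. \<bar>gradient v x \<bullet> h\<bar>)"
    using lim by (intro LIMSEQ_le_const) auto
  also have "\<dots> \<le> (LINT x|lborel. norm h * norm (gradient v x))"
  proof (rule integral_mono)
    show "\<bar>gradient v x \<bullet> h\<bar> \<le> norm h * norm (gradient v x)" for x
      using Cauchy_Schwarz_ineq2[of "gradient v x" h] by (simp add: mult.commute)
  qed (use g_int in auto)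
  finally show "(LINT x|lborel. \<bar>v (x + h) - v x\<bar>) \<le> norm h * (LINT x|lborel. norm (gradient v x))"
    by (simp add: \<theta>_def)
qed

text \<open>Not divided by the volume of the ball: the volume appears explicitly in the integral
  bound below.\<close>

definition oscillation :: "real \<Rightarrow> ('a::euclidean_space \<Rightarrow> real) \<Rightarrow> 'a \<Rightarrow> real" where
  "oscillation \<delta> v y = (LINT h|lborel. indicator (ball 0 \<delta>) h * \<bar>v (y + h) - v y\<bar>)"

text \<open>Exchanging the integrals leaves, for each displacement h, the translation estimate with
  \<open>norm h < \<delta>\<close>, to be integrated over a ball.\<close>

lemma oscillation_integral:
  fixes v :: "'a::euclidean_space \<Rightarrow> real"
  assumes v: "v \<in> test_functions X" and \<delta>: "\<delta> > 0"
  shows "integrable lborel (\<lambda>h. indicator (ball 0 \<delta>) h * \<bar>v (y + h) - v y\<bar>)"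
    and "integrable lborel (oscillation \<delta> v)"
    and "(LINT y|lborel. oscillation \<delta> v y) \<le> measure lborel (ball (0::'a) \<delta>) * \<delta> * (LINT x|lborel. norm (gradient v x))"
proof -
  note [measurable] = test_measurable[OF v]
  have [measurable]: "ball (0::'a) \<delta> \<in> sets borel" by simp
  let ?D = "LINT x|lborel. norm (gradient v x)"
  let ?f = "\<lambda>y h. indicator (ball 0 \<delta>) h * \<bar>v (y + h) - v y\<bar>"
  obtain B where B: "\<And>x. \<bar>v x\<bar> \<le> B" using test_bounded[OF v] by metis
  have ball_int: "integrable lborel (\<lambda>h. c * indicator (ball (0::'a) \<delta>) h :: real)" for c
    by (intro integrable_mult_right integrable_real_indicator) (auto simp: emeasure_lborel_ball_finite[unfolded infinity_ennreal_def])
  show int: "integrable lborel (?f y)" for y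
  proof (rule Bochner_Integration.integrable_bound[OF ball_int[of "2 * B"]])
    show "AE h in lborel. norm (?f y h) \<le> norm (2 * B * indicator (ball 0 \<delta>) h)"
    proof (rule AE_I2)
      fix h
      have "\<bar>v (y + h) - v y\<bar> \<le> 2 * B" using B[of "y + h"] B[of y] by linarith
      then show "norm (?f y h) \<le> norm (2 * B * indicator (ball 0 \<delta>) h)" by (auto simp: indicator_def)
    qed
  qed measurable
  have [measurable]: "oscillation \<delta> v \<in> borel_measurable lborel"
    unfolding oscillation_def[abs_def] by measurable
  have osc_nonneg: "0 \<le> oscillation \<delta> v y" for y unfolding oscillation_def by (intro integral_nonneg_AE) auto
  have D0: "0 \<le> ?D" by simp
  have "(\<integral>\<^sup>+y. ennreal (oscillation \<delta> v y) \<partial>lborel) = (\<integral>\<^sup>+y. \<integral>\<^sup>+h. ennreal (?f y h) \<partial>lborel \<partial>lborel)"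
    unfolding oscillation_def using int by (subst nn_integral_eq_integral) auto
  also have "\<dots> = (\<integral>\<^sup>+h. \<integral>\<^sup>+y. ennreal (?f y h) \<partial>lborel \<partial>lborel)"
    by (rule lborel_pair.Fubini'[symmetric]) measurable
  also have "\<dots> \<le> (\<integral>\<^sup>+h. ennreal (\<delta> * ?D * indicator (ball (0::'a) \<delta>) h) \<partial>lborel)"
  proof (rule nn_integral_mono)
    fix h :: 'a
    have i: "integrable lborel (\<lambda>y. ?f y h)" using integral_lborel_translation_abs(1)[OF v, of h] by simp
    have "(\<integral>\<^sup>+y. ennreal (?f y h) \<partial>lborel) = ennreal (LINT y|lborel. ?f y h)"
      by (rule nn_integral_eq_integral[OF i]) auto
    also have "(LINT y|lborel. ?f y h) = indicator (ball 0 \<delta>) h * (LINT y|lborel. \<bar>v (y + h) - v y\<bar>)" by simp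
    also have "\<dots> \<le> \<delta> * ?D * indicator (ball 0 \<delta>) h"
    proof (cases "h \<in> ball 0 \<delta>")
      case True
      then have "norm h * ?D \<le> \<delta> * ?D" using D0 by (intro mult_right_mono) auto
      then show ?thesis using integral_lborel_translation_abs(2)[OF v, of h] True by simp
    qed simp
    finally show "(\<integral>\<^sup>+y. ennreal (?f y h) \<partial>lborel) \<le> ennreal (\<delta> * ?D * indicator (ball 0 \<delta>) h)"
      by (simp add: ennreal_leI)
  qed
  also have "\<dots> = ennreal (LINT h|lborel. \<delta> * ?D * indicator (ball (0::'a) \<delta>) h)"
    using \<delta> D0 by (intro nn_integral_eq_integral ball_int) auto
  also have "(LINT h|lborel. \<delta> * ?D * indicator (ball (0::'a) \<delta>) h) = measure lborel (ball (0::'a) \<delta>) * \<delta> * ?D"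
    by simp
  finally have nn: "(\<integral>\<^sup>+y. ennreal (oscillation \<delta> v y) \<partial>lborel) \<le> ennreal (measure lborel (ball (0::'a) \<delta>) * \<delta> * ?D)" .
  show oi: "integrable lborel (oscillation \<delta> v)"
  proof (rule integrableI_bounded)
    have "(\<integral>\<^sup>+y. ennreal (norm (oscillation \<delta> v y)) \<partial>lborel) = (\<integral>\<^sup>+y. ennreal (oscillation \<delta> v y) \<partial>lborel)"
      using osc_nonneg by simp
    also have "\<dots> < \<infinity>" using nn by (simp add: order.strict_trans1)
    finally show "(\<integral>\<^sup>+y. ennreal (norm (oscillation \<delta> v y)) \<partial>lborel) < \<infinity>" .
  qed measurable
  have "ennreal (LINT y|lborel. oscillation \<delta> v y) \<le> ennreal (measure lborel (ball (0::'a) \<delta>) * \<delta> * ?D)"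
    using nn osc_nonneg by (subst nn_integral_eq_integral[OF oi, symmetric]) auto
  then show "(LINT y|lborel. oscillation \<delta> v y) \<le> measure lborel (ball (0::'a) \<delta>) * \<delta> * ?D"
    using \<delta> D0 by (subst (asm) ennreal_le_iff) auto
qed

text \<open>For y in a cell, replacing v by \<open>v y\<close> under the density costs at most
  \<open>\<beta>\<close> times the oscillation at y. Averaging over y in the cell produces the cell
  average of v, and disjointness sums the errors into one global integral. Only the diameter of a
  cell is used: cells may be disconnected or irregular, so a Poincare inequality inside a cell would
  not be at hand.\<close>

lemma cell_average_estimate:
  fixes v :: "'a::euclidean_space \<Rightarrow> real" and T :: "'i \<Rightarrow> 'a set" and \<rho> :: "'i \<Rightarrow> 'a \<Rightarrow> real"
  assumes v: "v \<in> test_functions X" and \<delta>: "\<delta> > 0" and I: "finite I"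
    and T: "\<And>i. i \<in> I \<Longrightarrow> T i \<in> lmeasurable" "\<And>i. i \<in> I \<Longrightarrow> measure lebesgue (T i) = \<tau>" "\<tau> > 0"
    and disj: "disjoint_family_on T I"
    and diam: "\<And>i x y. i \<in> I \<Longrightarrow> x \<in> T i \<Longrightarrow> y \<in> T i \<Longrightarrow> dist x y < \<delta>"
    and \<rho>: "\<And>i. i \<in> I \<Longrightarrow> integrable lborel (\<rho> i)" "\<And>i x. i \<in> I \<Longrightarrow> \<bar>\<rho> i x\<bar> \<le> \<beta>"
      "\<And>i x. i \<in> I \<Longrightarrow> x \<notin> T i \<Longrightarrow> \<rho> i x = 0" "\<And>i. i \<in> I \<Longrightarrow> (LINT x|lborel. \<rho> i x) = m"
    and \<beta>: "\<beta> \<ge> 0"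
  shows "\<bar>(\<Sum>i\<in>I. LINT x|lborel. \<rho> i x * v x) - m / \<tau> * (\<Sum>i\<in>I. LINT y|lebesgue. indicator (T i) y * v y)\<bar>
    \<le> \<beta> / \<tau> * (measure lborel (ball (0::'a) \<delta>) * \<delta> * (LINT x|lborel. norm (gradient v x)))"
proof -
  let ?O = "oscillation \<delta> v"
  note [measurable] = test_measurable[OF v]
  obtain B where B: "\<And>x. \<bar>v x\<bar> \<le> B" using test_bounded[OF v] by metis
  have O_nonneg: "0 \<le> ?O y" for y unfolding oscillation_def by (intro integral_nonneg_AE) auto
  have v_leb: "integrable lebesgue v"
  proof -
    obtain K where K: "compact K" "\<And>x. x \<notin> K \<Longrightarrow> v x = 0" using v test_functionsE by metis
    have "integrable lborel v" by (rule compact_support_integrable[OF test_continuous[OF v] K])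
    then show ?thesis by (subst integrable_completion) auto
  qed
  have O_leb: "integrable lebesgue ?O" "(LINT y|lebesgue. ?O y) = (LINT y|lborel. ?O y)"
    using oscillation_integral(2)[OF v \<delta>] by (auto simp: integrable_completion integral_completion)
  have cell: "\<bar>(LINT x|lborel. \<rho> i x * v x) - m / \<tau> * (LINT y|lebesgue. indicator (T i) y * v y)\<bar>
      \<le> \<beta> / \<tau> * (LINT y|lebesgue. indicator (T i) y * ?O y)" if i: "i \<in> I" for i
  proof -
    have [measurable]: "\<rho> i \<in> borel_measurable borel" using \<rho>(1)[OF i] by auto
    have \<rho>v: "integrable lborel (\<lambda>x. \<rho> i x * v x)"
    proof (rule Bochner_Integration.integrable_bound[OF integrable_mult_right[of B lborel "\<rho> i"]])
      show "AE x in lborel. norm (\<rho> i x * v x) \<le> norm (B * \<rho> i x)"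
      proof (rule AE_I2)
        fix x
        have "\<bar>\<rho> i x\<bar> * \<bar>v x\<bar> \<le> \<bar>\<rho> i x\<bar> * \<bar>B\<bar>" using B[of x] by (intro mult_left_mono) auto
        then show "norm (\<rho> i x * v x) \<le> norm (B * \<rho> i x)" by (simp add: abs_mult mult.commute)
      qed
    qed (use \<rho>(1)[OF i] in auto)
    let ?a = "LINT x|lborel. \<rho> i x * v x"
    have pt: "\<bar>?a - m * v y\<bar> \<le> \<beta> * ?O y" if y: "y \<in> T i" for y
    proof -
      have d: "integrable lborel (\<lambda>x. \<rho> i x * (v x - v y))"
        using \<rho>v \<rho>(1)[OF i] by (simp add: right_diff_distrib)
      have "?a - m * v y = (LINT x|lborel. \<rho> i x * (v x - v y))"
        using \<rho>v \<rho>(1)[OF i] \<rho>(4)[OF i] by (simp add: right_diff_distrib)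
      \<comment> \<open>Recentring at y makes the displacement the variable of integration; inside
        the cell it is shorter than \<open>\<delta>\<close>.\<close>
      also have "\<dots> = (LINT h|lborel. \<rho> i (h + y) * (v (h + y) - v y))"
        using integral_lborel_translation(1)[of "\<lambda>x. \<rho> i x * (v x - v y)" y] by simp
      also have "\<bar>\<dots>\<bar> \<le> (LINT h|lborel. \<bar>\<rho> i (h + y) * (v (h + y) - v y)\<bar>)" by simp
      also have "\<dots> \<le> (LINT h|lborel. \<beta> * (indicator (ball 0 \<delta>) h * \<bar>v (y + h) - v y\<bar>))"
      proof (rule integral_mono)
        show "integrable lborel (\<lambda>h. \<bar>\<rho> i (h + y) * (v (h + y) - v y)\<bar>)"
          using integral_lborel_translation(2)[of "\<lambda>x. \<rho> i x * (v x - v y)" y] d by simp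
        show "integrable lborel (\<lambda>h. \<beta> * (indicator (ball 0 \<delta>) h * \<bar>v (y + h) - v y\<bar>))"
          by (intro integrable_mult_right oscillation_integral(1)[OF v \<delta>])
        fix h
        show "\<bar>\<rho> i (h + y) * (v (h + y) - v y)\<bar> \<le> \<beta> * (indicator (ball 0 \<delta>) h * \<bar>v (y + h) - v y\<bar>)"
        proof (cases "h + y \<in> T i")
          case True
          then have "norm h < \<delta>" using diam[OF i True y] by (simp add: dist_norm)
          then show ?thesis using \<rho>(2)[OF i, of "h + y"] by (simp add: abs_mult add.commute mult_right_mono)
        next
          case False
          then show ?thesis using \<rho>(3)[OF i False] \<beta> by simp
        qed
      qed
      also have "\<dots> = \<beta> * ?O y" by (simp add: oscillation_def)
      finally show ?thesis .
    qed
    have Ti: "T i \<in> sets lebesgue" "emeasure lebesgue (T i) < \<infinity>" using T(1)[OF i] by (auto simp: fmeasurable_def)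
    have iT: "integrable lebesgue (\<lambda>y. indicator (T i) y * f y)" if "integrable lebesgue f" for f :: "'a \<Rightarrow> real"
      using integrable_mult_indicator[OF Ti(1) that] by simp
    have i1: "integrable lebesgue (\<lambda>y. indicator (T i) y * k :: real)" for k
      using integrable_mult_left[OF integrable_real_indicator[OF Ti]] by simp
    have "\<bar>\<tau> * ?a - m * (LINT y|lebesgue. indicator (T i) y * v y)\<bar> = \<bar>LINT y|lebesgue. indicator (T i) y * ?a - m * (indicator (T i) y * v y)\<bar>"
    proof -
      have "(LINT y|lebesgue. indicator (T i) y * ?a) = (LINT y|lebesgue. indicator (T i) y) * ?a"
        by (rule integral_mult_left_zero)
      also have "(LINT y|lebesgue. indicator (T i) y :: real) = \<tau>"
        using T(2)[OF i] by simp
      finally have e: "(LINT y|lebesgue. indicator (T i) y * ?a) = \<tau> * ?a" .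
      show ?thesis
        unfolding Bochner_Integration.integral_diff[OF i1[of ?a] integrable_mult_right[OF iT[OF v_leb], of m]] e
        by simp
    qed
    also have "\<dots> \<le> (LINT y|lebesgue. \<bar>indicator (T i) y * ?a - m * (indicator (T i) y * v y)\<bar>)" by simp
    also have "\<dots> \<le> (LINT y|lebesgue. \<beta> * (indicator (T i) y * ?O y))"
    proof (rule integral_mono)
      show "integrable lebesgue (\<lambda>y. \<bar>indicator (T i) y * ?a - m * (indicator (T i) y * v y)\<bar>)"
        using i1[of ?a] iT[OF v_leb] by simp
      show "integrable lebesgue (\<lambda>y. \<beta> * (indicator (T i) y * ?O y))" using iT[OF O_leb(1)] by simp
      fix y
      show "\<bar>indicator (T i) y * ?a - m * (indicator (T i) y * v y)\<bar> \<le> \<beta> * (indicator (T i) y * ?O y)"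
        using pt[of y] by (cases "y \<in> T i") auto
    qed
    also have "\<dots> = \<beta> * (LINT y|lebesgue. indicator (T i) y * ?O y)" by simp
    finally have "\<bar>\<tau> * ?a - m * (LINT y|lebesgue. indicator (T i) y * v y)\<bar> / \<tau> \<le> \<beta> * (LINT y|lebesgue. indicator (T i) y * ?O y) / \<tau>"
      using T(3) by (intro divide_right_mono) auto
    moreover have "\<bar>\<tau> * ?a - m * (LINT y|lebesgue. indicator (T i) y * v y)\<bar> / \<tau> = \<bar>?a - m / \<tau> * (LINT y|lebesgue. indicator (T i) y * v y)\<bar>"
    proof -
      have "?a - m / \<tau> * (LINT y|lebesgue. indicator (T i) y * v y) = (\<tau> * ?a - m * (LINT y|lebesgue. indicator (T i) y * v y)) / \<tau>"
        using T(3) by (simp add: field_simps)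
      then show ?thesis using T(3) by (simp only: abs_divide abs_of_pos)
    qed
    ultimately show ?thesis by simp
  qed
  have "\<bar>(\<Sum>i\<in>I. LINT x|lborel. \<rho> i x * v x) - m / \<tau> * (\<Sum>i\<in>I. LINT y|lebesgue. indicator (T i) y * v y)\<bar>
    = \<bar>\<Sum>i\<in>I. (LINT x|lborel. \<rho> i x * v x) - m / \<tau> * (LINT y|lebesgue. indicator (T i) y * v y)\<bar>"
    by (simp add: sum_subtractf sum_distrib_left)
  also have "\<dots> \<le> (\<Sum>i\<in>I. \<bar>(LINT x|lborel. \<rho> i x * v x) - m / \<tau> * (LINT y|lebesgue. indicator (T i) y * v y)\<bar>)"
    by (rule sum_abs)
  also have "\<dots> \<le> (\<Sum>i\<in>I. \<beta> / \<tau> * (LINT y|lebesgue. indicator (T i) y * ?O y))" by (rule sum_mono[OF cell])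
  also have "\<dots> = \<beta> / \<tau> * (\<Sum>i\<in>I. LINT y|lebesgue. indicator (T i) y * ?O y)" by (simp add: sum_distrib_left)
  also have "\<dots> \<le> \<beta> / \<tau> * (LINT y|lborel. ?O y)"
  proof (rule mult_left_mono)
    have iT: "integrable lebesgue (\<lambda>y. indicator (T i) y * ?O y)" if "i \<in> I" for i
      using integrable_mult_indicator[of "T i" lebesgue ?O] T(1)[OF that] O_leb by auto
    have "(\<Sum>i\<in>I. LINT y|lebesgue. indicator (T i) y * ?O y) = (LINT y|lebesgue. (\<Sum>i\<in>I. indicator (T i) y * ?O y))"
      using iT by simp
    also have "\<dots> \<le> (LINT y|lebesgue. ?O y)"
    proof (rule integral_mono)
      show "integrable lebesgue (\<lambda>y. \<Sum>i\<in>I. indicator (T i) y * ?O y)" using iT by simp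
      fix y
      have "(\<Sum>i\<in>I. indicator (T i) y * ?O y) = (\<Sum>i\<in>I. indicator (T i) y) * ?O y" by (simp add: sum_distrib_right)
      also have "(\<Sum>i\<in>I. indicator (T i) y :: real) = indicator (\<Union>i\<in>I. T i) y"
        using indicator_UN_disjoint[OF I disj] by metis
      also have "indicator (\<Union>i\<in>I. T i) y * ?O y \<le> ?O y" using O_nonneg by (simp add: indicator_def)
      finally show "(\<Sum>i\<in>I. indicator (T i) y * ?O y) \<le> ?O y" .
    qed (rule O_leb)
    finally show "(\<Sum>i\<in>I. LINT y|lebesgue. indicator (T i) y * ?O y) \<le> (LINT y|lborel. ?O y)" by (simp add: O_leb)
  qed (use \<beta> T(3) in simp)
  also have "\<dots> \<le> \<beta> / \<tau> * (measure lborel (ball (0::'a) \<delta>) * \<delta> * (LINT x|lborel. norm (gradient v x)))"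
    using oscillation_integral(3)[OF v \<delta>] \<beta> T(3) by (intro mult_left_mono) auto
  finally show ?thesis .
qed

section \<open>Smallness of the corrector and of the holes\<close>

context hole_family
begin

text \<open>Shrinking the disjoint balls by the factor \<open>\<theta>\<close> scales their total
  volume by \<open>\<theta>^d\<close>. The radius \<open>r'\<close> leaves room for balls that stick
  out of \<open>\<Omega>\<close>.\<close>

lemma sum_ball_measures:
  assumes r': "\<And>j. j \<in> J \<Longrightarrow> ball (c j) R \<subseteq> cball 0 r'" and \<theta>: "0 < \<theta>"
  shows "(\<Sum>j\<in>J. measure lborel (ball (c j) (\<theta> * R))) \<le> \<theta> ^ DIM('a) * measure lborel (cball (0::'a) r')"
proof -
  have "measure lborel (ball (c j) (\<theta> * R)) = \<theta> ^ DIM('a) * measure lborel (ball (c j) R)" for j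
    using \<theta> R_pos content_ball_conv_unit_ball[of "\<theta> * R" "c j"] content_ball_conv_unit_ball[of R "c j"]
    by (simp add: power_mult_distrib mult.assoc)
  then have "(\<Sum>j\<in>J. measure lborel (ball (c j) (\<theta> * R))) = \<theta> ^ DIM('a) * (\<Sum>j\<in>J. measure lborel (ball (c j) R))"
    by (simp add: sum_distrib_left)
  also have "(\<Sum>j\<in>J. measure lborel (ball (c j) R)) = measure lborel (\<Union>j\<in>J. ball (c j) R)"
  proof (rule measure_finite_Union[symmetric, OF fin])
    show "disjoint_family_on (\<lambda>j. ball (c j) R) J" using disj by (simp add: disjoint_family_on_def)
    show "emeasure lborel (ball (c i) R) \<noteq> \<infinity>" for i
      using emeasure_lborel_ball_finite[of "c i" R] by simp
  qed auto
  also have "\<theta> ^ DIM('a) * \<dots> \<le> \<theta> ^ DIM('a) * measure lborel (cball (0::'a) r')"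
  proof (rule mult_left_mono)
    have "(\<Union>j\<in>J. ball (c j) R) \<subseteq> cball 0 r'" using r' by blast
    then show "measure lborel (\<Union>j\<in>J. ball (c j) R) \<le> measure lborel (cball (0::'a) r')"
      using fin by (intro measure_mono_fmeasurable) (auto simp: fmeasurable_def emeasure_lborel_cball_finite[unfolded infinity_ennreal_def])
  qed (use \<theta> in simp)
  finally show ?thesis .
qed

text \<open>Off the balls of radius \<open>\<theta> R\<close> the corrector is at most its height at
  that distance, hence at most \<open>\<tau>\<close>; on them it is at most 1, but their total
  volume is of order \<open>\<theta>^d\<close>. The holes lie in the same balls, closed, which gives
  the second bound.\<close>

lemma corrector_small:
  assumes r': "\<And>j. j \<in> J \<Longrightarrow> ball (c j) R \<subseteq> cball 0 r'"
    and \<theta>: "0 < \<theta>" "\<theta> \<le> 1/2" and a\<theta>: "\<And>j. j \<in> J \<Longrightarrow> a j \<le> \<theta> * R"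
    and \<tau>: "\<tau> \<ge> 0" "\<And>j. j \<in> J \<Longrightarrow> b j * profile DIM('a) (\<theta>\<^sup>2) \<le> \<tau>"
  shows "(nrm2 (lebesgue_on U) z)\<^sup>2 \<le> \<tau>\<^sup>2 * measure lborel (cball (0::'a) r) + \<theta> ^ DIM('a) * measure lborel (cball (0::'a) r')"
    and "measure lebesgue (\<Omega> - U) \<le> \<theta> ^ DIM('a) * measure lborel (cball (0::'a) r')"
proof -
  define S where "S = (\<Union>j\<in>J. ball (c j) (\<theta> * R))"
  have S_meas: "S \<in> lmeasurable" unfolding S_def using fin by (intro fmeasurable.finite_UN) auto
  have "measure lebesgue S \<le> (\<Sum>j\<in>J. measure lebesgue (ball (c j) (\<theta> * R)))"
    unfolding S_def using fin by (intro measure_UNION_le) auto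
  also have "\<dots> \<le> \<theta> ^ DIM('a) * measure lborel (cball (0::'a) r')"
    using sum_ball_measures[OF r' \<theta>(1)] by simp
  finally have mS: "measure lebesgue S \<le> \<theta> ^ DIM('a) * measure lborel (cball (0::'a) r')" by simp
  have zS: "(z x)\<^sup>2 \<le> \<tau>\<^sup>2 + indicator S x" if x: "x \<in> U" for x
  proof -
    have xE: "x \<in> E" using x U_sub by blast
    note zb = z_bounds(1,2)[OF xE]
    show ?thesis
    proof (cases "x \<in> S")
      case True
      have "(z x)\<^sup>2 \<le> 1" using zb by (simp add: power_le_one)
      then show ?thesis using True by (simp add: add_increasing)
    next
      case False
      have "z x \<le> \<tau>"
      proof (cases "\<exists>j\<in>J. x \<in> ball (c j) R")
        case True
        then obtain j where j: "j \<in> J" "x \<in> ball (c j) R" by blast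
        have "norm (x - c j) \<ge> \<theta> * R" using False j(1) unfolding S_def by (auto simp: dist_norm norm_minus_commute[of "c j"])
        then have "(norm (x - c j))\<^sup>2 \<ge> (\<theta> * R)\<^sup>2" using \<theta> R_pos by (intro power_mono) auto
        then have s: "\<sigma> j x \<ge> \<theta>\<^sup>2" unfolding \<sigma>_def using R_pos by (simp add: le_divide_eq power_mult_distrib)
        have "\<theta>\<^sup>2 \<le> (1/2)\<^sup>2" using \<theta> by (intro power_mono) auto
        then have t: "0 < \<theta>\<^sup>2" "\<theta>\<^sup>2 \<le> 1/4" using \<theta> by (auto simp: power2_eq_square)
        have "profile DIM('a) (\<sigma> j x) \<le> profile DIM('a) (\<theta>\<^sup>2)"
          using s profile_less[OF dim t] by (cases "\<sigma> j x = \<theta>\<^sup>2") (auto intro: less_imp_le)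
        then have "b j * profile DIM('a) (\<sigma> j x) \<le> b j * profile DIM('a) (\<theta>\<^sup>2)" using b_pos(1)[OF j(1)] by simp
        then show ?thesis using z_single[OF j] \<tau>(2)[OF j(1)] by simp
      next
        case False
        then show ?thesis using z_outside \<tau>(1) by auto
      qed
      then have "(z x)\<^sup>2 \<le> \<tau>\<^sup>2" using zb by (intro power_mono) auto
      then show ?thesis using False by simp
    qed
  qed
  have sz: "sqi (lebesgue_on U) z" by (rule bounded_on_U[OF continuous_z]) blast
  have U_lm: "U \<in> lmeasurable" using bounded_set_imp_lmeasurable[OF bounded_U(1)] by simp
  have "(nrm2 (lebesgue_on U) z)\<^sup>2 = (LINT x|lebesgue. indicator U x *\<^sub>R (norm (z x))\<^sup>2)"
    unfolding nrm2_power2 by (simp add: integral_restrict_space)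
  also have "\<dots> \<le> (LINT x|lebesgue. \<tau>\<^sup>2 * indicator U x + indicator S x)"
  proof (rule integral_mono)
    show "integrable lebesgue (\<lambda>x. indicator U x *\<^sub>R (norm (z x))\<^sup>2)"
      using sz unfolding sqi_def by (simp add: integrable_restrict_space)
    show "integrable lebesgue (\<lambda>x. \<tau>\<^sup>2 * indicator U x + indicator S x :: real)"
      using U_lm S_meas by (intro Bochner_Integration.integrable_add integrable_mult_right integrable_real_indicator)
        (auto simp: fmeasurable_def)
    show "indicator U x *\<^sub>R (norm (z x))\<^sup>2 \<le> \<tau>\<^sup>2 * indicator U x + indicator S x" for x
      using zS[of x] by (cases "x \<in> U") auto
  qed
  also have "\<dots> = \<tau>\<^sup>2 * measure lebesgue U + measure lebesgue S"
  proof -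
    have "integrable lebesgue (indicator U :: 'a \<Rightarrow> real)" "integrable lebesgue (indicator S :: 'a \<Rightarrow> real)"
      using U_lm S_meas by (auto simp: fmeasurable_def)
    then show ?thesis by simp
  qed
  also have "\<dots> \<le> \<tau>\<^sup>2 * measure lebesgue (cball (0::'a) r) + \<theta> ^ DIM('a) * measure lborel (cball (0::'a) r')"
    using mS U_sub \<Omega>_ball U_lm by (intro add_mono mult_left_mono measure_mono_fmeasurable) auto
  finally show "(nrm2 (lebesgue_on U) z)\<^sup>2 \<le> \<tau>\<^sup>2 * measure lborel (cball (0::'a) r) + \<theta> ^ DIM('a) * measure lborel (cball (0::'a) r')"
    by simp
  have "\<Omega> - U \<subseteq> (\<Union>j\<in>J. cball (c j) (\<theta> * R))"
    unfolding U_def using a\<theta> by fastforce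
  then have "measure lebesgue (\<Omega> - U) \<le> measure lebesgue (\<Union>j\<in>J. cball (c j) (\<theta> * R))"
    using fin open_\<Omega> open_U by (intro measure_mono_fmeasurable fmeasurable.finite_UN) auto
  also have "\<dots> \<le> (\<Sum>j\<in>J. measure lebesgue (cball (c j) (\<theta> * R)))"
    using fin by (intro measure_UNION_le) auto
  also have "\<dots> = (\<Sum>j\<in>J. measure lebesgue (ball (c j) (\<theta> * R)))"
    using content_cball_conv_ball[where 'a = 'a] by simp
  also have "\<dots> \<le> \<theta> ^ DIM('a) * measure lborel (cball (0::'a) r')"
    using sum_ball_measures[OF r' \<theta>(1)] by simp
  finally show "measure lebesgue (\<Omega> - U) \<le> \<theta> ^ DIM('a) * measure lborel (cball (0::'a) r')" by simp
qed

end

section \<open>Tilings\<close>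

text \<open>\<open>\<Lambda>\<close> need not be a lattice and \<open>A\<close> has no regularity
  beyond measurability and boundedness. The arguments about cells rest on volume, diameter and
  disjointness.\<close>

locale tiling =
  fixes A \<Lambda> :: "'a::euclidean_space set"
  assumes A_sets: "A \<in> sets lebesgue" and A_bounded: "bounded A" and countable_\<Lambda>: "countable \<Lambda>"
    and disj_translates: "disjoint_family_on (\<lambda>i. (\<lambda>y. y + i) ` A) \<Lambda>"
    and cover_translates: "(\<Union>i\<in>\<Lambda>. (\<lambda>y. y + i) ` A) = UNIV"
begin

text \<open>The summand 1 makes the diameter bound \<open>\<epsilon> * \<kappa>\<close> strict, as
  \<open>cell_average_estimate\<close> demands.\<close>

definition \<kappa> :: real where "\<kappa> = diameter A + 1"

lemma \<kappa>_pos: "\<kappa> > 0"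
  using diameter_ge_0[OF A_bounded] by (simp add: \<kappa>_def)

lemma cell_eq: "cell A \<epsilon> i = (\<lambda>y. \<epsilon> *\<^sub>R y + \<epsilon> *\<^sub>R i) ` A"
  by (simp add: cell_def scaleR_add_right)

lemma measure_cell: "\<epsilon> > 0 \<Longrightarrow> measure lebesgue (cell A \<epsilon> i) = \<epsilon> ^ DIM('a) * measure lebesgue A"
  unfolding cell_eq by (subst measure_lebesgue_affine) auto

lemma cell_lmeasurable:
  assumes "\<epsilon> > 0"
  shows "cell A \<epsilon> i \<in> lmeasurable"
proof (rule bounded_set_imp_lmeasurable)
  have "bounded ((\<lambda>y. \<epsilon> *\<^sub>R y) ` A)" using A_bounded by (rule bounded_scaling)
  then have "bounded ((\<lambda>y. \<epsilon> *\<^sub>R i + y) ` ((\<lambda>y. \<epsilon> *\<^sub>R y) ` A))" by (rule bounded_translation)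
  then show "bounded (cell A \<epsilon> i)" unfolding cell_eq image_image by (simp add: add.commute)
  have t: "(\<lambda>y. i + y) ` A \<in> sets lebesgue" using A_sets by (rule lebesgue_sets_translation)
  have "cell A \<epsilon> i = (\<lambda>x. (1 / \<epsilon>) *\<^sub>R x) -` ((\<lambda>y. i + y) ` A) \<inter> space lebesgue"
  proof -
    have "x \<in> cell A \<epsilon> i \<longleftrightarrow> (1 / \<epsilon>) *\<^sub>R x \<in> (\<lambda>y. i + y) ` A" for x
    proof
      assume "x \<in> cell A \<epsilon> i"
      then obtain y where "y \<in> A" "x = \<epsilon> *\<^sub>R (y + i)" by (auto simp: cell_def)
      then show "(1 / \<epsilon>) *\<^sub>R x \<in> (\<lambda>y. i + y) ` A" using assms by (auto simp: add.commute)
    next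
      assume "(1 / \<epsilon>) *\<^sub>R x \<in> (\<lambda>y. i + y) ` A"
      then obtain y where y: "y \<in> A" "(1 / \<epsilon>) *\<^sub>R x = i + y" by auto
      then have "\<epsilon> *\<^sub>R ((1 / \<epsilon>) *\<^sub>R x) = \<epsilon> *\<^sub>R (y + i)" by (simp add: add.commute)
      then have "x = \<epsilon> *\<^sub>R (y + i)" using assms by simp
      then show "x \<in> cell A \<epsilon> i" using y(1) by (auto simp: cell_def)
    qed
    then show ?thesis by auto
  qed
  also have "\<dots> \<in> sets lebesgue"
    using lebesgue_measurable_scaling[of "1 / \<epsilon>"] t by (rule measurable_sets)
  finally show "cell A \<epsilon> i \<in> sets lebesgue" .
qed

text \<open>Countably many translates of a null set cannot cover the space.\<close>

lemma measure_A_pos: "measure lebesgue A > 0"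
proof (rule ccontr)
  assume "\<not> measure lebesgue A > 0"
  then have 0: "measure lebesgue A = 0" using measure_nonneg[of lebesgue A] by linarith
  have "A \<in> lmeasurable" using bounded_set_imp_lmeasurable[OF A_bounded A_sets] .
  then have "negligible A" using 0 negligible_iff_measure by blast
  then have "negligible ((\<lambda>y. y + i) ` A)" for i
    using negligible_translation[of A i] by (simp add: add.commute)
  then have "negligible (\<Union>i\<in>\<Lambda>. (\<lambda>y. y + i) ` A)"
    using countable_\<Lambda> by (intro negligible_countable_Union) auto
  then show False using cover_translates by simp
qed

lemma cell_disjoint:
  assumes "\<epsilon> > 0" "i \<in> \<Lambda>" "j \<in> \<Lambda>" "i \<noteq> j"
  shows "cell A \<epsilon> i \<inter> cell A \<epsilon> j = {}"
proof (rule ccontr)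
  assume "cell A \<epsilon> i \<inter> cell A \<epsilon> j \<noteq> {}"
  then obtain w where w: "w \<in> cell A \<epsilon> i" "w \<in> cell A \<epsilon> j" by blast
  obtain y where y: "y \<in> A" "w = \<epsilon> *\<^sub>R (y + i)" using w(1) unfolding cell_def by blast
  obtain y' where y': "y' \<in> A" "w = \<epsilon> *\<^sub>R (y' + j)" using w(2) unfolding cell_def by blast
  have "y + i = y' + j" using y(2) y'(2) assms(1) by simp
  then have "y + i \<in> (\<lambda>y. y + i) ` A \<inter> (\<lambda>y. y + j) ` A"
    using imageI[OF y(1), of "\<lambda>y. y + i"] imageI[OF y'(1), of "\<lambda>y. y + j"] by simp
  then show False using disj_translates assms unfolding disjoint_family_on_def by blast
qed

lemma cell_cover:
  assumes "\<epsilon> > 0"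
  obtains i where "i \<in> \<Lambda>" "x \<in> cell A \<epsilon> i"
proof -
  have "(1 / \<epsilon>) *\<^sub>R x \<in> (\<Union>i\<in>\<Lambda>. (\<lambda>y. y + i) ` A)" unfolding cover_translates by simp
  then obtain i y where i: "i \<in> \<Lambda>" and y: "y \<in> A" "(1 / \<epsilon>) *\<^sub>R x = y + i" by auto
  then have "\<epsilon> *\<^sub>R ((1 / \<epsilon>) *\<^sub>R x) = \<epsilon> *\<^sub>R (y + i)" by simp
  then have "x = \<epsilon> *\<^sub>R (y + i)" using assms by simp
  then have "x \<in> cell A \<epsilon> i" using y(1) by (auto simp: cell_def)
  with i that show ?thesis by blast
qed

lemma cell_dist:
  assumes "\<epsilon> > 0" "x \<in> cell A \<epsilon> i" "y \<in> cell A \<epsilon> i"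
  shows "dist x y < \<epsilon> * \<kappa>"
proof -
  obtain p q where pq: "p \<in> A" "q \<in> A" "x = \<epsilon> *\<^sub>R (p + i)" "y = \<epsilon> *\<^sub>R (q + i)" using assms by (auto simp: cell_def)
  have "dist p q < \<kappa>" using diameter_bounded_bound[OF A_bounded pq(1,2)] by (simp add: \<kappa>_def)
  moreover have "x - y = \<epsilon> *\<^sub>R (p - q)" using pq by (simp add: algebra_simps)
  then have "dist x y = \<epsilon> * dist p q" using assms(1) by (simp add: dist_norm)
  ultimately show ?thesis using assms(1) by simp
qed

text \<open>Volume counting: the cells meeting a bounded set are disjoint, have equal positive
  volume and lie in a slightly larger ball.\<close>

lemma finite_cells:
  assumes \<epsilon>: "\<epsilon> > 0" and S: "S \<subseteq> cball 0 r"
  shows "finite {i \<in> \<Lambda>. cell A \<epsilon> i \<inter> S \<noteq> {}}"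
proof -
  let ?I = "{i \<in> \<Lambda>. cell A \<epsilon> i \<inter> S \<noteq> {}}"
  let ?B = "cball (0::'a) (r + \<epsilon> * \<kappa>)"
  let ?\<tau> = "\<epsilon> ^ DIM('a) * measure lebesgue A"
  have \<tau>: "?\<tau> > 0" using \<epsilon> measure_A_pos by simp
  have sub: "cell A \<epsilon> i \<subseteq> ?B" if i: "i \<in> ?I" for i
  proof
    fix x assume x: "x \<in> cell A \<epsilon> i"
    obtain y where y: "y \<in> cell A \<epsilon> i" "y \<in> S" using i by blast
    have "norm y \<le> r" using y S by auto
    moreover have "dist x y < \<epsilon> * \<kappa>" by (rule cell_dist[OF \<epsilon> x y(1)])
    ultimately show "x \<in> ?B" using norm_triangle_ineq[of "x - y" y] by (simp add: dist_norm)
  qed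
  have bd: "card G \<le> nat \<lceil>measure lebesgue ?B / ?\<tau>\<rceil>" if G: "G \<subseteq> ?I" "finite G" for G
  proof -
    have "real (card G) * ?\<tau> = (\<Sum>i\<in>G. measure lebesgue (cell A \<epsilon> i))"
      by (simp add: measure_cell[OF \<epsilon>])
    also have "\<dots> = measure lebesgue (\<Union>i\<in>G. cell A \<epsilon> i)"
    proof (rule measure_finite_Union[symmetric, OF G(2)])
      show "disjoint_family_on (cell A \<epsilon>) G"
        using G(1) cell_disjoint[OF \<epsilon>] by (auto simp: disjoint_family_on_def subset_iff)
      show "cell A \<epsilon> ` G \<subseteq> sets lebesgue" using fmeasurableD[OF cell_lmeasurable[OF \<epsilon>]] by blast
      show "emeasure lebesgue (cell A \<epsilon> i) \<noteq> \<infinity>" for i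
        using fmeasurableD2[OF cell_lmeasurable[OF \<epsilon>, of i]] by simp
    qed
    also have "\<dots> \<le> measure lebesgue ?B"
    proof (rule measure_mono_fmeasurable)
      show "(\<Union>i\<in>G. cell A \<epsilon> i) \<subseteq> ?B" using sub G(1) by blast
      show "(\<Union>i\<in>G. cell A \<epsilon> i) \<in> sets lebesgue"
        using G(2) fmeasurableD[OF cell_lmeasurable[OF \<epsilon>]] by (intro sets.finite_UN) auto
    qed simp
    finally have "real (card G) \<le> measure lebesgue ?B / ?\<tau>" using \<tau> by (simp add: pos_le_divide_eq)
    then show ?thesis by linarith
  qed
  show ?thesis using finite_if_finite_subsets_card_bdd[of ?I] bd by blast
qed

end

section \<open>Asymptotics of the capacities\<close>

text \<open>The logarithm is homogeneous only up to an additive constant. Differences remove it and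
  give one scaling law for all dimensions.\<close>

lemma fund_sol_scale:
  assumes "d \<ge> 2" "s > 0" "R > 0"
  shows "fund_sol d (s / R\<^sup>2) - fund_sol d 1 = R ^ (d - 2) * (fund_sol d s - fund_sol d (R\<^sup>2))"
proof (cases "d = 2")
  case True
  then show ?thesis using assms by (simp add: fund_sol_def ln_div)
next
  case False
  have e: "R ^ (d - 2) * (R\<^sup>2) powr (1 - real d / 2) = 1"
  proof -
    have "R\<^sup>2 = R powr 2" using assms(3) powr_realpow[of R 2] by simp
    then have "(R\<^sup>2) powr (1 - real d / 2) = R powr (2 - real d)" by (simp add: powr_powr algebra_simps)
    moreover have "R ^ (d - 2) = R powr real (d - 2)" using powr_realpow[OF assms(3), of "d - 2"] by simp
    moreover have "real (d - 2) + (2 - real d) = 0" using assms(1) by (simp add: of_nat_diff)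
    ultimately show ?thesis using assms(3) by (simp only: powr_add[symmetric]) simp
  qed
  have p: "(R\<^sup>2) powr (1 - real d / 2) > 0" using assms by simp
  have "(s / R\<^sup>2) powr (1 - real d / 2) = s powr (1 - real d / 2) / (R\<^sup>2) powr (1 - real d / 2)"
    using assms by (simp add: powr_divide)
  also have "\<dots> = s powr (1 - real d / 2) * R ^ (d - 2)"
    using e p by (simp add: divide_eq_eq ac_simps)
  finally have q: "(s / R\<^sup>2) powr (1 - real d / 2) = s powr (1 - real d / 2) * R ^ (d - 2)" .
  have "fund_sol d (s / R\<^sup>2) - fund_sol d 1 = (s powr (1 - real d / 2) * R ^ (d - 2) - R ^ (d - 2) * (R\<^sup>2) powr (1 - real d / 2)) / (real d - 2)"
    using False unfolding fund_sol_def e q by (simp add: diff_divide_distrib)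
  also have "\<dots> = R ^ (d - 2) * (fund_sol d s - fund_sol d (R\<^sup>2))"
    using False unfolding fund_sol_def by (simp add: diff_divide_distrib algebra_simps)
  finally show ?thesis .
qed

text \<open>The second limit concerns the charge of one hole without the factor \<open>S_d\<close>,
  divided by \<open>\<epsilon>^d\<close>. By scaling the powers of R cancel, and
  \<open>\<epsilon>^(-d) / (\<Phi>(a\<^sup>2) - \<Phi>(R\<^sup>2))\<close> remains, with
  \<open>\<Phi>\<close> the fundamental solution and \<open>R = C \<epsilon>\<close>. The outer
  value is negligible. The inner value is \<open>- ln a\<close> for d = 2 and
  \<open>a^(2-d) / (d-2)\<close> otherwise, whence the factor d - 2.\<close>

lemma capacity_asymptotics:
  fixes a :: "real \<Rightarrow> real" and \<mu> C :: real and d :: nat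
  assumes d: "d \<ge> 2" and C: "C > 0"
    and a_pos: "\<And>\<epsilon>. \<epsilon> > 0 \<Longrightarrow> a \<epsilon> > 0" and a_less: "\<forall>\<^sub>F \<epsilon> in at_right 0. a \<epsilon> < C * \<epsilon>"
    and \<mu>: "\<mu> \<ge> 0"
    and two: "d = 2 \<Longrightarrow> ((\<lambda>\<epsilon>. inverse (\<epsilon>\<^sup>2) * inverse (- ln (a \<epsilon>))) \<longlongrightarrow> \<mu>) (at_right 0)"
    and three: "d \<ge> 3 \<Longrightarrow> ((\<lambda>\<epsilon>. inverse (\<epsilon> ^ d) * a \<epsilon> ^ (d - 2)) \<longlongrightarrow> \<mu>) (at_right 0)"
  shows "((\<lambda>\<epsilon>. a \<epsilon> / \<epsilon>) \<longlongrightarrow> 0) (at_right 0)"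
    and "((\<lambda>\<epsilon>. (C * \<epsilon>) ^ (d - 2) / \<epsilon> ^ d / profile d ((a \<epsilon>)\<^sup>2 / (C * \<epsilon>)\<^sup>2))
      \<longlongrightarrow> (if d = 2 then \<mu> else (real d - 2) * \<mu>)) (at_right 0)"
proof -
  let ?\<mu> = "if d = 2 then \<mu> else (real d - 2) * \<mu>"
  have pos: "\<forall>\<^sub>F \<epsilon> in at_right (0::real). \<epsilon> > 0" by (simp add: eventually_at_right_less)
  \<comment> \<open>The crude comparison of a logarithm with a power that settles dimension
    2.\<close>
  have nl: "- ln y \<le> inverse y" if "y > 0" for y :: real
    using ln_le_minus_one[of "inverse y"] that by (simp add: ln_inverse)
  have id0: "((\<lambda>\<epsilon>. \<epsilon>) \<longlongrightarrow> 0) (at_right (0::real))" by (rule tendsto_ident_at)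
  have ev_lt: "\<forall>\<^sub>F \<epsilon> in at_right 0. \<epsilon> < e" if "e > 0" for e :: real
    using order_tendstoD(2)[OF id0 that] .
  have lim: "((\<lambda>\<epsilon>. inverse (\<epsilon> ^ d) / fund_sol d ((a \<epsilon>)\<^sup>2)) \<longlongrightarrow> ?\<mu>) (at_right 0)"
  proof (cases "d = 2")
    case True
    have "\<forall>\<^sub>F \<epsilon> in at_right 0. inverse (\<epsilon>\<^sup>2) * inverse (- ln (a \<epsilon>)) = inverse (\<epsilon> ^ d) / fund_sol d ((a \<epsilon>)\<^sup>2)"
      using pos
    proof eventually_elim
      case (elim \<epsilon>)
      then have a: "a \<epsilon> > 0" using a_pos by blast
      have "fund_sol d ((a \<epsilon>)\<^sup>2) = - ln (a \<epsilon>)" using True ln_realpow[of "a \<epsilon>" 2] by (simp add: fund_sol_def)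
      then show ?case using True by (simp only: divide_inverse)
    qed
    from tendsto_cong[OF this] two[OF True] True show ?thesis by simp
  next
    case False
    then have d3: "d \<ge> 3" using d by simp
    have "\<forall>\<^sub>F \<epsilon> in at_right 0. (real d - 2) * (inverse (\<epsilon> ^ d) * a \<epsilon> ^ (d - 2)) = inverse (\<epsilon> ^ d) / fund_sol d ((a \<epsilon>)\<^sup>2)"
      using pos
    proof eventually_elim
      case (elim \<epsilon>)
      then have a: "a \<epsilon> > 0" using a_pos by blast
      have "((a \<epsilon>)\<^sup>2) powr (1 - real d / 2) = (a \<epsilon> powr 2) powr (1 - real d / 2)" using a by (simp add: powr_realpow)
      also have "\<dots> = a \<epsilon> powr (- real (d - 2))" using d3 by (simp add: powr_powr of_nat_diff algebra_simps)
      also have "\<dots> = inverse (a \<epsilon> ^ (d - 2))" using a by (simp add: powr_minus powr_realpow)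
      finally have "fund_sol d ((a \<epsilon>)\<^sup>2) = inverse (a \<epsilon> ^ (d - 2)) / (real d - 2)"
        using False by (simp only: fund_sol_def if_False)
      then show ?case
        by (simp only: divide_inverse inverse_mult_distrib inverse_inverse_eq ac_simps)
    qed
    from tendsto_cong[OF this] tendsto_mult_left[OF three[OF d3], of "real d - 2"] False show ?thesis by simp
  qed
  \<comment> \<open>The holes are of smaller order than the cells. For d = 2 the hypothesis gives
    \<open>1 \<le> (\<mu> + 1) \<epsilon>\<^sup>2 (- ln a)\<close>, and bounding the logarithm by
    1/a yields \<open>a \<le> (\<mu> + 1) \<epsilon>\<^sup>2\<close>; the summand 1 provides a
    strict upper bound for the limit. For larger d, \<open>(a/\<epsilon>)^(d-2)\<close> is the
    convergent quantity times \<open>\<epsilon>\<^sup>2\<close>.\<close>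
  show a0: "((\<lambda>\<epsilon>. a \<epsilon> / \<epsilon>) \<longlongrightarrow> 0) (at_right 0)"
  proof (cases "d = 2")
    case True
    have "\<forall>\<^sub>F \<epsilon> in at_right 0. inverse (\<epsilon>\<^sup>2) * inverse (- ln (a \<epsilon>)) < \<mu> + 1"
      using order_tendstoD(2)[OF two[OF True], of "\<mu> + 1"] by simp
    moreover have "1 / C > 0" using C by simp
    note ev_lt[OF this]
    ultimately have le: "\<forall>\<^sub>F \<epsilon> in at_right 0. a \<epsilon> / \<epsilon> \<le> (\<mu> + 1) * \<epsilon>"
      using pos a_less
    proof eventually_elim
      case (elim \<epsilon>)
      have a: "a \<epsilon> > 0" using a_pos elim by blast
      have "C * \<epsilon> < 1" using elim C by (simp add: field_simps)
      then have "a \<epsilon> < 1" using elim by linarith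
      then have l: "- ln (a \<epsilon>) > 0" using a by (simp add: ln_less_zero)
      have "1 \<le> (\<mu> + 1) * e * t" if "inverse e * inverse t < \<mu> + 1" "e > 0" "t > 0" for e t
      proof -
        have "inverse e * inverse t * (e * t) \<le> (\<mu> + 1) * (e * t)"
          using that by (intro mult_right_mono) auto
        then show ?thesis using that by (simp add: field_simps)
      qed
      from this[OF elim(1) _ l] have "1 \<le> (\<mu> + 1) * \<epsilon>\<^sup>2 * (- ln (a \<epsilon>))" using elim by simp
      moreover have "- ln (a \<epsilon>) \<le> inverse (a \<epsilon>)"
        by (rule nl[OF a])
      then have "(\<mu> + 1) * \<epsilon>\<^sup>2 * (- ln (a \<epsilon>)) \<le> (\<mu> + 1) * \<epsilon>\<^sup>2 * inverse (a \<epsilon>)"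
        using \<mu> by (intro mult_left_mono) auto
      ultimately have "1 \<le> (\<mu> + 1) * \<epsilon>\<^sup>2 * inverse (a \<epsilon>)" by linarith
      then have "a \<epsilon> \<le> (\<mu> + 1) * \<epsilon>\<^sup>2" using a by (simp add: field_simps)
      then show ?case using elim by (simp add: divide_le_eq power2_eq_square mult.assoc)
    qed
    have ge: "\<forall>\<^sub>F \<epsilon> in at_right 0. 0 \<le> a \<epsilon> / \<epsilon>"
      using pos by eventually_elim (use a_pos in \<open>simp add: less_imp_le\<close>)
    show ?thesis
      by (rule tendsto_sandwich[OF ge le tendsto_const]) (use tendsto_mult_right_zero[OF id0] in simp)
  next
    case False
    then have d3: "d \<ge> 3" using d by simp
    have "((\<lambda>\<epsilon>. inverse (\<epsilon> ^ d) * a \<epsilon> ^ (d - 2) * \<epsilon>\<^sup>2) \<longlongrightarrow> \<mu> * 0\<^sup>2) (at_right 0)"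
      by (intro tendsto_intros three d3 id0)
    moreover have "\<forall>\<^sub>F \<epsilon> in at_right 0. inverse (\<epsilon> ^ d) * a \<epsilon> ^ (d - 2) * \<epsilon>\<^sup>2 = (a \<epsilon> / \<epsilon>) ^ (d - 2)"
      using pos
    proof eventually_elim
      case (elim \<epsilon>)
      have "\<epsilon> ^ ((d - 2) + 2) = \<epsilon> ^ (d - 2) * \<epsilon>\<^sup>2" by (rule power_add)
      moreover have "(d - 2) + 2 = d" using d3 by simp
      ultimately have e: "\<epsilon> ^ d = \<epsilon> ^ (d - 2) * \<epsilon>\<^sup>2" by (simp only:)
      have "inverse (P * e2) * y * e2 = y / P" if "e2 \<noteq> 0" for P y e2 :: real
        using that by (simp add: divide_inverse)
      from this[of "\<epsilon>\<^sup>2"] show ?case unfolding e power_divide using elim by simp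
    qed
    ultimately have l: "((\<lambda>\<epsilon>. (a \<epsilon> / \<epsilon>) ^ (d - 2)) \<longlongrightarrow> 0) (at_right 0)"
      using tendsto_cong by fastforce
    show ?thesis
    proof (rule tendstoI)
      fix e :: real assume e: "e > 0"
      have "\<forall>\<^sub>F \<epsilon> in at_right 0. (a \<epsilon> / \<epsilon>) ^ (d - 2) < e ^ (d - 2)"
        using order_tendstoD(2)[OF l, of "e ^ (d - 2)"] e by simp
      with pos show "\<forall>\<^sub>F \<epsilon> in at_right 0. dist (a \<epsilon> / \<epsilon>) 0 < e"
      proof eventually_elim
        case (elim \<epsilon>)
        have "a \<epsilon> / \<epsilon> < e"
          by (rule power_less_imp_less_base[of "a \<epsilon> / \<epsilon>" "d - 2" e]) (use elim e in auto)
        moreover have "0 < a \<epsilon> / \<epsilon>" using a_pos elim by simp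
        ultimately show ?case by simp
      qed
    qed
  qed
  \<comment> \<open>The value at the outer radius is negligible on the scale
    \<open>\<epsilon>^(-d)\<close>: at most \<open>\<epsilon> / C\<close> after multiplication for d
    = 2, a constant times \<open>\<epsilon>\<^sup>2\<close> otherwise.\<close>
  have fs0: "((\<lambda>\<epsilon>. fund_sol d ((C * \<epsilon>)\<^sup>2) * \<epsilon> ^ d) \<longlongrightarrow> 0) (at_right 0)"
  proof (cases "d = 2")
    case True
    have c: "1 / C > 0" using C by simp
    have "\<forall>\<^sub>F \<epsilon> in at_right 0. norm (fund_sol d ((C * \<epsilon>)\<^sup>2) * \<epsilon> ^ d) \<le> \<epsilon> / C"
      using pos ev_lt[OF c]
    proof eventually_elim
      case (elim \<epsilon>)
      have R: "C * \<epsilon> > 0" "C * \<epsilon> < 1" using elim C by (auto simp: field_simps)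
      have "fund_sol d ((C * \<epsilon>)\<^sup>2) = - ln (C * \<epsilon>)" using True ln_realpow[of "C * \<epsilon>" 2] by (simp add: fund_sol_def)
      moreover have "- ln (C * \<epsilon>) \<ge> 0" using R by (simp add: ln_less_zero less_imp_le)
      moreover have "- ln (C * \<epsilon>) \<le> inverse (C * \<epsilon>)"
        by (rule nl[OF R(1)])
      then have "- ln (C * \<epsilon>) * \<epsilon>\<^sup>2 \<le> inverse (C * \<epsilon>) * \<epsilon>\<^sup>2" by (rule mult_right_mono) simp
      moreover have "inverse (C * \<epsilon>) * \<epsilon>\<^sup>2 = \<epsilon> / C" using elim C by (simp add: field_simps power2_eq_square)
      ultimately show ?case using True by (simp add: abs_mult)
    qed
    then show ?thesis
      by (rule Lim_null_comparison) (use tendsto_divide[OF id0 tendsto_const[of C]] C in simp)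
  next
    case False
    have "\<forall>\<^sub>F \<epsilon> in at_right 0. (C\<^sup>2) powr (1 - real d / 2) / (real d - 2) * \<epsilon>\<^sup>2 = fund_sol d ((C * \<epsilon>)\<^sup>2) * \<epsilon> ^ d"
      using pos
    proof eventually_elim
      case (elim \<epsilon>)
      have "((C * \<epsilon>)\<^sup>2) powr (1 - real d / 2) = (C\<^sup>2) powr (1 - real d / 2) * (\<epsilon>\<^sup>2) powr (1 - real d / 2)"
        by (simp add: power_mult_distrib powr_mult)
      moreover have "(\<epsilon>\<^sup>2) powr (1 - real d / 2) * \<epsilon> ^ d = \<epsilon>\<^sup>2"
      proof -
        have "(\<epsilon>\<^sup>2) powr (1 - real d / 2) * \<epsilon> ^ d = (\<epsilon> powr 2) powr (1 - real d / 2) * \<epsilon> powr (real d)"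
          using elim by (simp add: powr_realpow)
        also have "\<dots> = \<epsilon> powr 2" by (simp add: powr_powr powr_add[symmetric] algebra_simps)
        also have "\<dots> = \<epsilon>\<^sup>2" using elim by (simp add: powr_realpow)
        finally show ?thesis .
      qed
      ultimately show ?case using False by (simp add: fund_sol_def)
    qed
    moreover have "((\<lambda>\<epsilon>. (C\<^sup>2) powr (1 - real d / 2) / (real d - 2) * \<epsilon>\<^sup>2) \<longlongrightarrow> (C\<^sup>2) powr (1 - real d / 2) / (real d - 2) * 0\<^sup>2) (at_right 0)"
      by (intro tendsto_intros id0)
    ultimately show ?thesis using tendsto_cong by fastforce
  qed
  \<comment> \<open>Factoring out the inner value leaves 1 minus the quotient of outer and inner
    value. The powers of \<open>\<epsilon>\<close> are inserted so that both factors of this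
    quotient have known limits.\<close>
  have ratio: "((\<lambda>\<epsilon>. 1 - (fund_sol d ((C * \<epsilon>)\<^sup>2) * \<epsilon> ^ d) * (inverse (\<epsilon> ^ d) / fund_sol d ((a \<epsilon>)\<^sup>2))) \<longlongrightarrow> 1 - 0 * ?\<mu>) (at_right 0)"
    by (intro tendsto_diff tendsto_mult fs0 lim tendsto_const)
  have L: "((\<lambda>\<epsilon>. (inverse (\<epsilon> ^ d) / fund_sol d ((a \<epsilon>)\<^sup>2)) / (1 - (fund_sol d ((C * \<epsilon>)\<^sup>2) * \<epsilon> ^ d) * (inverse (\<epsilon> ^ d) / fund_sol d ((a \<epsilon>)\<^sup>2)))) \<longlongrightarrow> ?\<mu> / (1 - 0 * ?\<mu>)) (at_right 0)"
    by (rule tendsto_divide[OF lim ratio]) simp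
  \<comment> \<open>Below this threshold \<open>a \<le> C \<epsilon> / 2\<close> gives a < 1, so in
    dimension 2 the logarithm in the denominator does not vanish.\<close>
  have a1: "2 / C > 0" using C by simp
  have small: "\<forall>\<^sub>F \<epsilon> in at_right 0. a \<epsilon> / \<epsilon> < C / 2"
    using order_tendstoD(2)[OF a0, of "C / 2"] C by simp
  have "\<forall>\<^sub>F \<epsilon> in at_right 0. (inverse (\<epsilon> ^ d) / fund_sol d ((a \<epsilon>)\<^sup>2)) / (1 - (fund_sol d ((C * \<epsilon>)\<^sup>2) * \<epsilon> ^ d) * (inverse (\<epsilon> ^ d) / fund_sol d ((a \<epsilon>)\<^sup>2)))
      = (C * \<epsilon>) ^ (d - 2) / \<epsilon> ^ d / profile d ((a \<epsilon>)\<^sup>2 / (C * \<epsilon>)\<^sup>2)"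
    using pos small ev_lt[OF a1]
  proof eventually_elim
    case (elim \<epsilon>)
    have a: "a \<epsilon> > 0" using a_pos elim by blast
    have R: "C * \<epsilon> > 0" using C elim by simp
    have a_le: "a \<epsilon> \<le> (C * \<epsilon>) / 2" using elim by (simp add: field_simps)
    have "(a \<epsilon>)\<^sup>2 \<le> ((C * \<epsilon>) / 2)\<^sup>2" using a a_le by (intro power_mono) auto
    then have q: "(a \<epsilon>)\<^sup>2 / (C * \<epsilon>)\<^sup>2 \<le> 1/4" using R by (simp add: divide_le_eq power_divide)
    have p: "profile d ((a \<epsilon>)\<^sup>2 / (C * \<epsilon>)\<^sup>2) = (C * \<epsilon>) ^ (d - 2) * (fund_sol d ((a \<epsilon>)\<^sup>2) - fund_sol d ((C * \<epsilon>)\<^sup>2))"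
      unfolding profile_small[OF q] using fund_sol_scale[OF d _ R, of "(a \<epsilon>)\<^sup>2"] a by simp
    have "a \<epsilon> < 1" using a_le elim C by (simp add: field_simps)
    then have X: "fund_sol d ((a \<epsilon>)\<^sup>2) \<noteq> 0"
      using a d ln_realpow[of "a \<epsilon>" 2] by (auto simp: fund_sol_def)
    have gen: "(inverse E / X) / (1 - (Y * E) * (inverse E / X)) = Q / E / (Q * (X - Y))"
      if "X \<noteq> 0" "E \<noteq> 0" "Q \<noteq> 0" for X Y E Q :: real
    proof -
      have "1 - (Y * E) * (inverse E / X) = (X - Y) / X" using that by (simp add: field_simps)
      then show ?thesis using that by (simp add: divide_inverse)
    qed
    show ?case unfolding p by (rule gen[OF X]) (use elim R C in simp_all)
  qed
  from tendsto_cong[OF this] L show "((\<lambda>\<epsilon>. (C * \<epsilon>) ^ (d - 2) / \<epsilon> ^ d / profile d ((a \<epsilon>)\<^sup>2 / (C * \<epsilon>)\<^sup>2)) \<longlongrightarrow> ?\<mu>) (at_right 0)"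
    by simp
qed

section \<open>Homogenization\<close>

lemma integral_lebesgue_on_subset:
  fixes h :: "'a::euclidean_space \<Rightarrow> 'b::euclidean_space"
  assumes "U \<in> sets lebesgue" "W \<in> sets lebesgue" "U \<subseteq> W"
    "\<And>x. x \<in> U \<Longrightarrow> h0 x = h x" "\<And>x. x \<in> W - U \<Longrightarrow> h0 x = 0"
  shows "(LINT x|lebesgue_on W. h0 x) = (LINT x|lebesgue_on U. h x)"
proof -
  have "indicator W x *\<^sub>R h0 x = indicator U x *\<^sub>R h x" for x
    using assms(3-5) by (auto simp: indicator_def)
  then show ?thesis using assms(1,2) by (simp add: integral_restrict_space)
qed

lemma sqi_subset:
  fixes f :: "'a::euclidean_space \<Rightarrow> 'b::euclidean_space"
  assumes "U \<in> sets lebesgue" "W \<in> sets lebesgue" "U \<subseteq> W" "sqi (lebesgue_on W) f"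
  shows "sqi (lebesgue_on U) f" "nrm2 (lebesgue_on U) f \<le> nrm2 (lebesgue_on W) f"
proof -
  have m: "f \<in> borel_measurable (lebesgue_on U)"
    using measurable_restrict_mono[OF sqi_measurable[OF assms(4)] assms(3)] .
  have i: "integrable lebesgue (\<lambda>x. indicator W x *\<^sub>R (norm (f x))\<^sup>2)"
    using assms(4) assms(2) by (simp add: sqi_def integrable_restrict_space)
  have eq: "indicator U x *\<^sub>R (indicator W x *\<^sub>R (norm (f x))\<^sup>2) = indicator U x *\<^sub>R (norm (f x))\<^sup>2" for x
    using assms(3) by (auto simp: indicator_def)
  have i2: "integrable lebesgue (\<lambda>x. indicator U x *\<^sub>R (norm (f x))\<^sup>2)"
    using integrable_mult_indicator[OF assms(1) i] unfolding eq .
  then show "sqi (lebesgue_on U) f" using m assms(1) by (simp add: sqi_def integrable_restrict_space)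
  have "(LINT x|lebesgue_on U. (norm (f x))\<^sup>2) \<le> (LINT x|lebesgue_on W. (norm (f x))\<^sup>2)"
  proof -
    have "(LINT x|lebesgue. indicator U x *\<^sub>R (norm (f x))\<^sup>2) \<le> (LINT x|lebesgue. indicator W x *\<^sub>R (norm (f x))\<^sup>2)"
      using assms(3) by (intro integral_mono i i2) (auto simp: indicator_def)
    then show ?thesis using assms(1,2) by (simp add: integral_restrict_space)
  qed
  then show "nrm2 (lebesgue_on U) f \<le> nrm2 (lebesgue_on W) f" unfolding nrm2_def by (rule real_sqrt_le_mono)
qed

text \<open>The solution is tested with itself through its approximating sequence, and Poincare
  absorbs the function into the gradient.\<close>

lemma energy_estimate:
  assumes U: "U \<in> sets lebesgue" "U \<subseteq> cball 0 r" "r \<ge> 0" and p: "H10_pair U u g" and f: "sqi (lebesgue_on U) f"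
    and weak: "\<And>\<eta>. \<eta> \<in> test_functions U \<Longrightarrow> (LINT x|lebesgue_on U. g x \<bullet> gradient \<eta> x) = (LINT x|lebesgue_on U. f x * \<eta> x)"
  shows "nrm2 (lebesgue_on U) g \<le> 2 * r * nrm2 (lebesgue_on U) f"
proof -
  let ?M = "lebesgue_on U"
  note s = H10_pair_sqi[OF p]
  obtain \<phi> where \<phi>: "\<And>n::nat. \<phi> n \<in> test_functions U"
    "(\<lambda>n. nrm2 ?M (\<lambda>x. u x - \<phi> n x)) \<longlonglongrightarrow> 0" "(\<lambda>n. nrm2 ?M (\<lambda>x. g x - gradient (\<phi> n) x)) \<longlonglongrightarrow> 0"
    using H10_pairE[OF p] by blast
  note l = H10_pair_limit_inner[OF U(1) p \<phi>]
  have "(LINT x|?M. gradient (\<phi> n) x \<bullet> g x) = (LINT x|?M. \<phi> n x * f x)" for n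
    using weak[OF \<phi>(1)[of n]] by (simp only: inner_commute mult.commute)
  then have "(LINT x|?M. g x \<bullet> g x) = (LINT x|?M. u x * f x)"
    using LIMSEQ_unique[OF l(2)[OF s(2)]] l(1)[OF f] by simp
  then have "(nrm2 ?M g)\<^sup>2 = (LINT x|?M. u x * f x)" by (simp add: nrm2_power2 power2_norm_eq_inner)
  also have "\<dots> \<le> nrm2 ?M u * nrm2 ?M f" using nrm2_Cauchy_Schwarz_real[OF s(1) f] by linarith
  also have "\<dots> \<le> (2 * r * nrm2 ?M g) * nrm2 ?M f" by (intro mult_right_mono Poincare[OF U p]) simp
  finally have "nrm2 ?M g * nrm2 ?M g \<le> nrm2 ?M g * (2 * r * nrm2 ?M f)" by (simp add: power2_eq_square ac_simps)
  then show ?thesis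
    using nrm2_nonneg[of ?M g] nrm2_nonneg[of ?M f] U(3)
    by (cases "nrm2 ?M g = 0") (auto simp: mult_le_cancel_left)
qed

text \<open>The cone over the unit sphere is the closed unit ball without its centre.\<close>

lemma sphere_area_sphere:
  "sphere_area (sphere (0::'a::euclidean_space) 1) = DIM('a) * measure lborel (ball (0::'a) 1)"
proof -
  have "{t *\<^sub>R y |t y. 0 < t \<and> t \<le> 1 \<and> y \<in> sphere (0::'a) 1} = cball 0 1 - {0}"
  proof (intro set_eqI iffI)
    fix w :: 'a assume "w \<in> {t *\<^sub>R y |t y. 0 < t \<and> t \<le> 1 \<and> y \<in> sphere (0::'a) 1}"
    then obtain t and y :: 'a where "0 < t" "t \<le> 1" "norm y = 1" "w = t *\<^sub>R y" by auto
    then show "w \<in> cball 0 1 - {0}" by auto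
  next
    fix w :: 'a assume w: "w \<in> cball 0 1 - {0}"
    then have "w = norm w *\<^sub>R ((1 / norm w) *\<^sub>R w) \<and> 0 < norm w \<and> norm w \<le> 1 \<and> (1 / norm w) *\<^sub>R w \<in> sphere 0 1" by auto
    then show "w \<in> {t *\<^sub>R y |t y. 0 < t \<and> t \<le> 1 \<and> y \<in> sphere (0::'a) 1}" by blast
  qed
  moreover have "measure lebesgue (cball (0::'a) 1 - {0}) = measure lebesgue (cball (0::'a) 1)"
    by (rule measure_Diff_null_set) auto
  ultimately show ?thesis
    using content_cball_conv_ball[of "0::'a" 1] by (simp add: sphere_area_def)
qed

locale perforation = tiling A \<Lambda> for A \<Lambda> :: "'a::euclidean_space set" +
  fixes \<Omega> :: "'a set" and f :: "'a \<Rightarrow> real" and m :: nat and F :: "nat \<Rightarrow> 'a set" and N :: "nat \<Rightarrow> nat"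
    and C :: real and x :: "real \<Rightarrow> 'a \<Rightarrow> nat \<Rightarrow> 'a" and a :: "real \<Rightarrow> nat \<Rightarrow> real" and \<mu> :: "nat \<Rightarrow> real" and r :: real
  assumes dim: "DIM('a) \<ge> 2" and open_\<Omega>: "open \<Omega>" and \<Omega>_ball: "\<Omega> \<subseteq> cball 0 r" and r_nonneg: "r \<ge> 0"
    and f: "sqi (lebesgue_on \<Omega>) f"
    and F_null: "\<And>k. k \<in> {1..m} \<Longrightarrow> F k \<in> null_boundary_sets" and F_disj: "disjoint_family_on F {1..m}"
    and C_pos: "C > 0"
    and balls: "\<forall>\<^sub>F \<epsilon> in at_right 0. \<forall>k\<in>{1..m}. \<forall>i\<in>inner_cells A \<Lambda> \<epsilon> (F k).
           disjoint_family_on (\<lambda>j. ball (x \<epsilon> i j) (C * \<epsilon>)) {1..N k} \<and>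
           (\<forall>j\<in>{1..N k}. ball (x \<epsilon> i j) (C * \<epsilon>) \<subseteq> cell A \<epsilon> i)"
    and a_pos: "\<And>\<epsilon> k. \<epsilon> > 0 \<Longrightarrow> k \<in> {1..m} \<Longrightarrow> a \<epsilon> k > 0"
    and a_less: "\<forall>\<^sub>F \<epsilon> in at_right 0. \<forall>k\<in>{1..m}. a \<epsilon> k < C * \<epsilon>"
    and \<mu>_nonneg: "\<And>k. k \<in> {1..m} \<Longrightarrow> \<mu> k \<ge> 0"
    and two: "\<And>k. DIM('a) = 2 \<Longrightarrow> k \<in> {1..m} \<Longrightarrow>
           ((\<lambda>\<epsilon>. inverse (\<epsilon>\<^sup>2) * inverse (- ln (a \<epsilon> k))) \<longlongrightarrow> \<mu> k) (at_right 0)"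
    and three: "\<And>k. DIM('a) \<ge> 3 \<Longrightarrow> k \<in> {1..m} \<Longrightarrow>
           ((\<lambda>\<epsilon>. inverse (\<epsilon> ^ DIM('a)) * a \<epsilon> k ^ (DIM('a) - 2)) \<longlongrightarrow> \<mu> k) (at_right 0)"
begin

definition area :: real where "area = DIM('a) * measure lborel (ball (0::'a) 1)"
text \<open>Charge of one hole of type k, without the factor \<open>S_d\<close>, relative to
  \<open>\<epsilon>^d\<close>. With \<open>N k\<close> holes in a cell of volume
  \<open>\<epsilon>^d |A|\<close> this makes \<open>\<gamma>\<close> the mean charge density of an
  inner cell.\<close>

definition \<beta> :: "nat \<Rightarrow> real \<Rightarrow> real" where
  "\<beta> k \<epsilon> = (C * \<epsilon>) ^ (DIM('a) - 2) / \<epsilon> ^ DIM('a) / profile DIM('a) ((a \<epsilon> k)\<^sup>2 / (C * \<epsilon>)\<^sup>2)"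
definition \<gamma> :: "nat \<Rightarrow> real \<Rightarrow> real" where
  "\<gamma> k \<epsilon> = N k * \<beta> k \<epsilon> * area / measure lebesgue A"
text \<open>Restricting to cells that meet \<open>\<Omega>\<close> makes the family of holes finite;
  by \<open>perforated_eq\<close> the perforated set does not change.\<close>

definition I :: "real \<Rightarrow> nat \<Rightarrow> 'a set" where
  "I \<epsilon> k = {i \<in> inner_cells A \<Lambda> \<epsilon> (F k). cell A \<epsilon> i \<inter> \<Omega> \<noteq> {}}"
definition J :: "real \<Rightarrow> (nat \<times> 'a \<times> nat) set" where
  "J \<epsilon> = (SIGMA k:{1..m}. I \<epsilon> k \<times> {1..N k})"
definition centre :: "real \<Rightarrow> nat \<times> 'a \<times> nat \<Rightarrow> 'a" where "centre \<epsilon> = (\<lambda>(k, i, j). x \<epsilon> i j)"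
definition radius :: "real \<Rightarrow> nat \<times> 'a \<times> nat \<Rightarrow> real" where "radius \<epsilon> = (\<lambda>(k, i, j). a \<epsilon> k)"
definition covered :: "real \<Rightarrow> nat \<Rightarrow> 'a set" where
  "covered \<epsilon> k = (\<Union>i\<in>inner_cells A \<Lambda> \<epsilon> (F k). cell A \<epsilon> i)"
definition V\<epsilon> :: "real \<Rightarrow> 'a \<Rightarrow> real" where
  "V\<epsilon> \<epsilon> y = (\<Sum>k=1..m. \<gamma> k \<epsilon> * indicator (covered \<epsilon> k) y)"
definition V :: "'a \<Rightarrow> real" where
  "V y = mu_const A * (\<Sum>k=1..m. \<mu> k * real (N k) * indicator (F k) y)"
text \<open>What holds for all small \<open>\<epsilon>\<close>. The bound by half of
  \<open>C \<epsilon>\<close> follows from \<open>a / \<epsilon> \<rightarrow> 0\<close>, and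
  \<open>\<epsilon> \<le> 1\<close> confines all relevant cells to one ball.\<close>

definition good :: "real \<Rightarrow> bool" where
  "good \<epsilon> \<longleftrightarrow> 0 < \<epsilon> \<and> \<epsilon> \<le> 1 \<and> (\<forall>k\<in>{1..m}. a \<epsilon> k \<le> C * \<epsilon> / 2) \<and>
    (\<forall>k\<in>{1..m}. \<forall>i\<in>inner_cells A \<Lambda> \<epsilon> (F k).
           disjoint_family_on (\<lambda>j. ball (x \<epsilon> i j) (C * \<epsilon>)) {1..N k} \<and>
           (\<forall>j\<in>{1..N k}. ball (x \<epsilon> i j) (C * \<epsilon>) \<subseteq> cell A \<epsilon> i))"

abbreviation "T \<epsilon> \<equiv> holes A \<Lambda> m F N x a \<epsilon>"

lemma \<Omega>_sets [simp]: "\<Omega> \<in> sets lebesgue" using open_\<Omega> by auto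

lemma bounded_\<Omega>: "bounded \<Omega>" using bounded_subset[OF bounded_cball \<Omega>_ball] .

lemma capacity:
  assumes "k \<in> {1..m}"
  shows "((\<lambda>\<epsilon>. a \<epsilon> k / \<epsilon>) \<longlongrightarrow> 0) (at_right 0)"
    and "(\<beta> k \<longlongrightarrow> (if DIM('a) = 2 then \<mu> k else (real DIM('a) - 2) * \<mu> k)) (at_right 0)"
proof -
  have "\<forall>\<^sub>F \<epsilon> in at_right 0. a \<epsilon> k < C * \<epsilon>" using a_less by eventually_elim (use assms in blast)
  note c = capacity_asymptotics[OF dim C_pos a_pos[OF _ assms] this \<mu>_nonneg[OF assms] two[OF _ assms] three[OF _ assms]]
  show "((\<lambda>\<epsilon>. a \<epsilon> k / \<epsilon>) \<longlongrightarrow> 0) (at_right 0)" by (rule c(1))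
  show "(\<beta> k \<longlongrightarrow> (if DIM('a) = 2 then \<mu> k else (real DIM('a) - 2) * \<mu> k)) (at_right 0)"
    unfolding \<beta>_def[abs_def] by (rule c(2))
qed

lemma eventually_pos: "\<forall>\<^sub>F \<epsilon> in at_right (0::real). \<epsilon> > 0" by (simp add: eventually_at_right_less)

lemma eventually_small_radius:
  assumes "\<theta> > 0"
  shows "\<forall>\<^sub>F \<epsilon> in at_right 0. \<forall>k\<in>{1..m}. a \<epsilon> k \<le> \<theta> * (C * \<epsilon>)"
proof (rule eventually_ball_finite)
  show "\<forall>k\<in>{1..m}. \<forall>\<^sub>F \<epsilon> in at_right 0. a \<epsilon> k \<le> \<theta> * (C * \<epsilon>)"
  proof
    fix k assume "k \<in> {1..m}"
    then have "\<forall>\<^sub>F \<epsilon> in at_right 0. a \<epsilon> k / \<epsilon> < \<theta> * C"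
      using order_tendstoD(2)[OF capacity(1), of k "\<theta> * C"] assms C_pos by simp
    with eventually_pos show "\<forall>\<^sub>F \<epsilon> in at_right 0. a \<epsilon> k \<le> \<theta> * (C * \<epsilon>)"
      by eventually_elim (simp add: divide_less_eq mult.assoc less_imp_le)
  qed
qed simp

lemma eventually_good: "\<forall>\<^sub>F \<epsilon> in at_right 0. good \<epsilon>"
proof -
  have "\<forall>\<^sub>F \<epsilon> in at_right (0::real). \<epsilon> < 1"
    using order_tendstoD(2)[OF tendsto_ident_at, of "0::real" 1 "{0<..}"] by simp
  moreover have "\<forall>\<^sub>F \<epsilon> in at_right 0. \<forall>k\<in>{1..m}. a \<epsilon> k \<le> 1/2 * (C * \<epsilon>)"
    by (rule eventually_small_radius) simp
  ultimately show ?thesis using eventually_pos balls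
    unfolding good_def by eventually_elim simp
qed

lemma I_inner: "i \<in> I \<epsilon> k \<Longrightarrow> i \<in> inner_cells A \<Lambda> \<epsilon> (F k) \<and> i \<in> \<Lambda> \<and> cell A \<epsilon> i \<subseteq> F k"
  by (auto simp: I_def inner_cells_def)

lemma finite_I: "\<epsilon> > 0 \<Longrightarrow> finite (I \<epsilon> k)"
  by (rule finite_subset[OF _ finite_cells[OF _ \<Omega>_ball]]) (auto simp: I_def inner_cells_def)

lemma ball_in_cell:
  assumes "good \<epsilon>" "(k, i, j) \<in> J \<epsilon>"
  shows "ball (x \<epsilon> i j) (C * \<epsilon>) \<subseteq> cell A \<epsilon> i" "i \<in> \<Lambda>" "cell A \<epsilon> i \<subseteq> F k" "k \<in> {1..m}" "j \<in> {1..N k}" "i \<in> I \<epsilon> k"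
proof -
  show k: "k \<in> {1..m}" and j: "j \<in> {1..N k}" and i: "i \<in> I \<epsilon> k" using assms(2) by (auto simp: J_def)
  show "i \<in> \<Lambda>" "cell A \<epsilon> i \<subseteq> F k" using I_inner[OF i] by auto
  show "ball (x \<epsilon> i j) (C * \<epsilon>) \<subseteq> cell A \<epsilon> i" using assms(1) k j I_inner[OF i] unfolding good_def by blast
qed

text \<open>Balls of different cells are separated by the cells. Within one cell k is determined, so
  the triples differ in j and the given disjointness applies.\<close>

lemma hole_family_good:
  assumes g: "good \<epsilon>"
  shows "hole_family \<Omega> (J \<epsilon>) (centre \<epsilon>) (radius \<epsilon>) (C * \<epsilon>) r"
proof
  have \<epsilon>: "\<epsilon> > 0" using g by (simp add: good_def)
  show "2 \<le> DIM('a)" "open \<Omega>" "\<Omega> \<subseteq> cball 0 r" "0 \<le> r" by (fact dim open_\<Omega> \<Omega>_ball r_nonneg)+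
  show "finite (J \<epsilon>)" unfolding J_def using finite_I[OF \<epsilon>] by auto
  show "0 < C * \<epsilon>" using C_pos \<epsilon> by simp
  show "0 < radius \<epsilon> t" "radius \<epsilon> t \<le> C * \<epsilon> / 2" if "t \<in> J \<epsilon>" for t
    using that g a_pos[OF \<epsilon>] by (auto simp: J_def radius_def good_def)
  show "ball (centre \<epsilon> t) (C * \<epsilon>) \<inter> ball (centre \<epsilon> t') (C * \<epsilon>) = {}" if t: "t \<in> J \<epsilon>" "t' \<in> J \<epsilon>" "t \<noteq> t'" for t t'
  proof -
    obtain k i j where e: "t = (k, i, j)" by (cases t) auto
    obtain k' i' j' where e': "t' = (k', i', j')" by (cases t') auto
    note b = ball_in_cell[OF g t(1)[unfolded e]] and b' = ball_in_cell[OF g t(2)[unfolded e']]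
    show ?thesis
    proof (cases "i = i'")
      case False
      then show ?thesis using cell_disjoint[OF \<epsilon> b(2) b'(2)] b(1) b'(1) by (auto simp: centre_def e e')
    next
      case True
      \<comment> \<open>A nonempty cell cannot lie in two disjoint sets \<open>F k\<close> and
        \<open>F k'\<close>, so k is determined by i.\<close>
      have "cell A \<epsilon> i \<noteq> {}" using b(6) by (auto simp: I_def)
      then have "k = k'" using F_disj b(3,4) b'(3,4) True unfolding disjoint_family_on_def by blast
      then have "j \<noteq> j'" using t(3) e e' True by simp
      moreover have "disjoint_family_on (\<lambda>j. ball (x \<epsilon> i j) (C * \<epsilon>)) {1..N k}"
        using g b(4) I_inner[OF b(6)] unfolding good_def by blast
      ultimately show ?thesis using b(5) b'(5) \<open>k = k'\<close> True unfolding disjoint_family_on_def by (simp add: centre_def e e')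
    qed
  qed
qed

text \<open>A point of \<open>\<Omega>\<close> in a hole also lies in the surrounding cell, so that
  cell meets \<open>\<Omega>\<close> and is among the selected ones.\<close>

lemma perforated_eq:
  assumes g: "good \<epsilon>"
  shows "\<Omega> - T \<epsilon> = \<Omega> - (\<Union>t\<in>J \<epsilon>. cball (centre \<epsilon> t) (radius \<epsilon> t))"
proof -
  have \<epsilon>: "\<epsilon> > 0" using g by (simp add: good_def)
  have "y \<in> T \<epsilon> \<longleftrightarrow> y \<in> (\<Union>t\<in>J \<epsilon>. cball (centre \<epsilon> t) (radius \<epsilon> t))" if y: "y \<in> \<Omega>" for y
  proof
    assume "y \<in> T \<epsilon>"
    then obtain k i j where k: "k \<in> {1..m}" "i \<in> inner_cells A \<Lambda> \<epsilon> (F k)" "j \<in> {1..N k}" "y \<in> cball (x \<epsilon> i j) (a \<epsilon> k)"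
      by (auto simp: holes_def)
    have "a \<epsilon> k \<le> C * \<epsilon> / 2" using g k(1) by (simp add: good_def)
    then have "a \<epsilon> k < C * \<epsilon>" using mult_pos_pos[OF C_pos \<epsilon>] by linarith
    then have "y \<in> ball (x \<epsilon> i j) (C * \<epsilon>)" using k(4) by auto
    moreover have "ball (x \<epsilon> i j) (C * \<epsilon>) \<subseteq> cell A \<epsilon> i" using g k(1-3) by (simp add: good_def)
    ultimately have "y \<in> cell A \<epsilon> i" by blast
    then have "(k, i, j) \<in> J \<epsilon>" using k y by (auto simp: J_def I_def)
    then show "y \<in> (\<Union>t\<in>J \<epsilon>. cball (centre \<epsilon> t) (radius \<epsilon> t))"
      using k(4) by (intro UN_I[of "(k, i, j)"]) (auto simp: centre_def radius_def)
  next
    assume "y \<in> (\<Union>t\<in>J \<epsilon>. cball (centre \<epsilon> t) (radius \<epsilon> t))"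
    then obtain k i j where kij: "(k, i, j) \<in> J \<epsilon>" "y \<in> cball (x \<epsilon> i j) (a \<epsilon> k)" by (auto simp: centre_def radius_def)
    have "i \<in> inner_cells A \<Lambda> \<epsilon> (F k)" using I_inner[OF ball_in_cell(6)[OF g kij(1)]] by blast
    then show "y \<in> T \<epsilon>" unfolding holes_def
      using ball_in_cell(4,5)[OF g kij(1)] kij(2) by (intro UN_I[of k] UN_I[of i] UN_I[of j])
  qed
  then show ?thesis by blast
qed

lemma covered_sets: "\<epsilon> > 0 \<Longrightarrow> covered \<epsilon> k \<in> sets lebesgue"
  unfolding covered_def using fmeasurableD[OF cell_lmeasurable] countable_subset[OF _ countable_\<Lambda>, of "inner_cells A \<Lambda> \<epsilon> (F k)"]
  by (intro sets.countable_UN') (auto simp: inner_cells_def)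

lemma V\<epsilon>_props:
  assumes "\<epsilon> > 0"
  shows "V\<epsilon> \<epsilon> \<in> borel_measurable lebesgue" "\<bar>V\<epsilon> \<epsilon> y\<bar> \<le> (\<Sum>k=1..m. \<bar>\<gamma> k \<epsilon>\<bar>)"
proof -
  show "V\<epsilon> \<epsilon> \<in> borel_measurable lebesgue"
    unfolding V\<epsilon>_def[abs_def] using covered_sets[OF assms] by (intro borel_measurable_sum borel_measurable_times) auto
  have "\<bar>V\<epsilon> \<epsilon> y\<bar> \<le> (\<Sum>k=1..m. \<bar>\<gamma> k \<epsilon> * indicator (covered \<epsilon> k) y\<bar>)" unfolding V\<epsilon>_def by (rule sum_abs)
  also have "\<dots> \<le> (\<Sum>k=1..m. \<bar>\<gamma> k \<epsilon>\<bar>)" by (intro sum_mono) (auto simp: indicator_def)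
  finally show "\<bar>V\<epsilon> \<epsilon> y\<bar> \<le> (\<Sum>k=1..m. \<bar>\<gamma> k \<epsilon>\<bar>)" .
qed

text \<open>A bound fixed once, so that \<open>\<eta>\<close> below is a function of
  \<open>\<epsilon>\<close> alone.\<close>

definition Mb :: real where "Mb = (SOME B. B > 0 \<and> (\<forall>s. \<bar>profile_laplacian DIM('a) s\<bar> \<le> B))"

lemma Mb: "Mb > 0" "\<bar>profile_laplacian DIM('a) s\<bar> \<le> Mb"
proof -
  have "\<exists>B. B > 0 \<and> (\<forall>s. \<bar>profile_laplacian DIM('a) s\<bar> \<le> B)" using profile_laplacian_bounded[OF dim] by metis
  from someI_ex[OF this] show "Mb > 0" "\<bar>profile_laplacian DIM('a) s\<bar> \<le> Mb" unfolding Mb_def by auto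
qed

text \<open>The constant of \<open>cell_average_estimate\<close> for diameter
  \<open>\<epsilon> \<kappa>\<close>, cell volume \<open>\<epsilon>^d |A|\<close> and densities
  bounded by \<open>\<beta> k \<epsilon> Mb / C^d\<close>, added over the holes of a cell. The ball
  of radius \<open>\<epsilon> \<kappa>\<close> cancels \<open>\<epsilon>^d\<close>, and one factor
  \<open>\<epsilon>\<close> survives.\<close>

definition \<eta> :: "real \<Rightarrow> real" where
  "\<eta> \<epsilon> = (\<Sum>k=1..m. real (N k) * \<beta> k \<epsilon>) * (Mb * measure lborel (ball (0::'a) 1) * \<kappa> ^ (DIM('a) + 1) / (C ^ DIM('a) * measure lebesgue A)) * \<epsilon>"

text \<open>For fixed k and j each selected cell carries exactly one density, supported in it and of
  the same integral everywhere, so the abstract cell estimate applies once for each pair (k,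
  j).\<close>

lemma density_estimate_test:
  assumes g: "good \<epsilon>" and v: "v \<in> test_functions \<Omega>"
  shows "\<bar>(LINT y|lebesgue_on \<Omega>. hole_family.\<rho> (J \<epsilon>) (centre \<epsilon>) (radius \<epsilon>) (C * \<epsilon>) y * v y) - (LINT y|lebesgue_on \<Omega>. V\<epsilon> \<epsilon> y * v y)\<bar>
    \<le> \<eta> \<epsilon> * (LINT y|lborel. norm (gradient v y))"
proof -
  interpret h: hole_family \<Omega> "J \<epsilon>" "centre \<epsilon>" "radius \<epsilon>" "C * \<epsilon>" r by (rule hole_family_good[OF g])
  have \<epsilon>: "\<epsilon> > 0" using g by (simp add: good_def)
  let ?R = "C * \<epsilon>" and ?d = "DIM('a)" and ?D = "LINT y|lborel. norm (gradient v y)"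
  have R: "?R > 0" using C_pos \<epsilon> by simp
  note [measurable] = test_measurable[OF v]
  define bb where "bb k = \<beta> k \<epsilon> / C ^ ?d" for k
  define q where "q k i j y = bb k * profile_laplacian ?d ((norm (y - x \<epsilon> i j))\<^sup>2 / ?R\<^sup>2)" for k i j y
  \<comment> \<open>All powers of \<open>\<epsilon>\<close> cancel: the Laplacian of the corrector
    has height \<open>\<beta> k \<epsilon> / C^d\<close>, which stays bounded as
    \<open>\<epsilon>\<close> tends to 0.\<close>
  have bb: "h.b (k, i, j) / ?R\<^sup>2 = bb k" for k i j
  proof -
    have "?R ^ ((?d - 2) + 2) = ?R ^ (?d - 2) * ?R\<^sup>2" by (rule power_add)
    moreover have "(?d - 2) + 2 = ?d" using dim by simp
    ultimately have e: "?R ^ (?d - 2) * ?R\<^sup>2 = C ^ ?d * \<epsilon> ^ ?d" by (simp only: power_mult_distrib)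
    have hb: "h.b (k, i, j) = 1 / profile ?d ((a \<epsilon> k)\<^sup>2 / ?R\<^sup>2)"
      unfolding h.b_def h.\<alpha>_def unfolding radius_def by simp
    have gen: "p / r2 = rd / e / pp / c" if "rd * r2 = c * e" "e \<noteq> 0" "c \<noteq> 0" "r2 \<noteq> 0" "p = 1 / pp" for p r2 rd e pp c :: real
    proof -
      have f: "rd / (c * e) = 1 / r2" using that(1-4) by (simp add: frac_eq_eq)
      have "rd / e / pp / c = (1 / pp) * (rd / (c * e))" by (simp add: ac_simps)
      also have "\<dots> = p / r2" unfolding f that(5) by simp
      finally show ?thesis by (rule sym)
    qed
    show ?thesis
      unfolding bb_def \<beta>_def by (rule gen[OF e _ _ _ hb]) (use C_pos \<epsilon> in simp_all)
  qed
  have bb_pos: "bb k > 0" if "k \<in> {1..m}" for k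
  proof -
    have ak: "a \<epsilon> k > 0" "a \<epsilon> k \<le> ?R / 2" using a_pos[OF \<epsilon> that] g that by (auto simp: good_def)
    have "(a \<epsilon> k)\<^sup>2 \<le> (?R / 2)\<^sup>2" using ak by (intro power_mono) auto
    then have le: "(a \<epsilon> k)\<^sup>2 / ?R\<^sup>2 \<le> 1/4" using R by (simp add: divide_le_eq power_divide)
    have "(a \<epsilon> k)\<^sup>2 / ?R\<^sup>2 > 0" by (intro divide_pos_pos zero_less_power ak(1) R)
    then have "profile ?d ((a \<epsilon> k)\<^sup>2 / ?R\<^sup>2) > 0" by (rule profile_pos[OF dim _ le])
    then show ?thesis unfolding bb_def \<beta>_def using C_pos \<epsilon> by simp
  qed
  have q_int: "integrable lborel (q k i j)" for k i j
    unfolding q_def[abs_def] by (intro integrable_mult_right integral_profile_laplacian(1)[OF dim R])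
  have [measurable]: "q k i j \<in> borel_measurable borel" for k i j using q_int[of k i j] by auto
  obtain B where B: "\<And>y. \<bar>v y\<bar> \<le> B" using test_bounded[OF v] by metis
  have qv_int: "integrable lborel (\<lambda>y. q k i j y * v y)" for k i j
  proof (rule Bochner_Integration.integrable_bound[OF integrable_mult_right[of B lborel "q k i j"]])
    show "AE y in lborel. norm (q k i j y * v y) \<le> norm (B * q k i j y)"
    proof (rule AE_I2)
      fix y
      have "\<bar>q k i j y\<bar> * \<bar>v y\<bar> \<le> \<bar>q k i j y\<bar> * \<bar>B\<bar>" using B[of y] by (intro mult_left_mono) auto
      then show "norm (q k i j y * v y) \<le> norm (B * q k i j y)" by (simp add: abs_mult mult.commute)
    qed
  qed (use q_int in auto)
  \<comment> \<open>The sum over cells is moved innermost, the order in which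
    \<open>cell_average_estimate\<close> is applied.\<close>
  have \<rho>_eq: "h.\<rho> y = (\<Sum>k=1..m. \<Sum>j=1..N k. \<Sum>i\<in>I \<epsilon> k. q k i j y)" for y
  proof -
    have "h.\<rho> y = (\<Sum>(k, i, j)\<in>J \<epsilon>. q k i j y)"
      unfolding h.\<rho>_def
    proof (rule sum.cong[OF refl])
      fix t assume "t \<in> J \<epsilon>"
      obtain k i j where t: "t = (k, i, j)" by (cases t) auto
      have "h.\<sigma> (k, i, j) y = (norm (y - x \<epsilon> i j))\<^sup>2 / ?R\<^sup>2" unfolding h.\<sigma>_def unfolding centre_def by simp
      then show "h.b t / ?R\<^sup>2 * profile_laplacian ?d (h.\<sigma> t y) = (case t of (k, i, j) \<Rightarrow> q k i j y)"
        unfolding t bb by (simp only: prod.case q_def)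
    qed
    also have "\<dots> = (\<Sum>k=1..m. \<Sum>(i, j)\<in>I \<epsilon> k \<times> {1..N k}. q k i j y)"
      unfolding J_def using finite_I[OF \<epsilon>] by (subst sum.Sigma) (auto intro!: sum.cong)
    also have "\<dots> = (\<Sum>k=1..m. \<Sum>i\<in>I \<epsilon> k. \<Sum>j=1..N k. q k i j y)" by (simp add: sum.cartesian_product)
    also have "\<dots> = (\<Sum>k=1..m. \<Sum>j=1..N k. \<Sum>i\<in>I \<epsilon> k. q k i j y)" by (intro sum.cong refl sum.swap)
    finally show ?thesis .
  qed
  have L: "(LINT y|lebesgue_on \<Omega>. h.\<rho> y * v y) = (\<Sum>k=1..m. \<Sum>j=1..N k. \<Sum>i\<in>I \<epsilon> k. LINT y|lborel. q k i j y * v y)"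
  proof -
    have "(LINT y|lebesgue_on \<Omega>. h.\<rho> y * v y) = (LINT y|lborel. h.\<rho> y * v y)"
    proof (rule integral_lebesgue_on_lborel[OF \<Omega>_sets])
      show "(\<lambda>y. h.\<rho> y * v y) \<in> borel_measurable borel" unfolding \<rho>_eq by measurable
    qed (simp add: test_outside[OF v])
    also have "\<dots> = (LINT y|lborel. (\<Sum>k=1..m. \<Sum>j=1..N k. \<Sum>i\<in>I \<epsilon> k. q k i j y * v y))"
      unfolding \<rho>_eq by (simp add: sum_distrib_right)
    also have "\<dots> = (\<Sum>k=1..m. \<Sum>j=1..N k. \<Sum>i\<in>I \<epsilon> k. LINT y|lborel. q k i j y * v y)"
      using qv_int by simp
    finally show ?thesis .
  qed
  have v_leb: "integrable lebesgue v"
  proof -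
    obtain K where K: "compact K" "\<And>y. y \<notin> K \<Longrightarrow> v y = 0" using v test_functionsE by metis
    have "integrable lborel v" by (rule compact_support_integrable[OF test_continuous[OF v] K])
    then show ?thesis by (subst integrable_completion) auto
  qed
  have cv_int: "integrable lebesgue (\<lambda>y. indicator (cell A \<epsilon> i) y * v y)" for i
    using integrable_mult_indicator[OF fmeasurableD[OF cell_lmeasurable[OF \<epsilon>]] v_leb] by simp
  let ?X = "\<lambda>k. \<Sum>i\<in>I \<epsilon> k. LINT y|lebesgue. indicator (cell A \<epsilon> i) y * v y"
  \<comment> \<open>Inner cells that do not meet \<open>\<Omega>\<close> belong to
    \<open>covered\<close> but not to \<open>I\<close>; they contribute nothing since v vanishes
    there.\<close>
  have cov: "indicator (covered \<epsilon> k) y * v y = (\<Sum>i\<in>I \<epsilon> k. indicator (cell A \<epsilon> i) y * v y)" for k y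
  proof (cases "y \<in> \<Omega>")
    case True
    have dj: "disjoint_family_on (cell A \<epsilon>) (I \<epsilon> k)"
      unfolding disjoint_family_on_def using cell_disjoint[OF \<epsilon>] I_inner by blast
    have "(\<Sum>i\<in>I \<epsilon> k. indicator (cell A \<epsilon> i) y :: real) = indicator (\<Union>i\<in>I \<epsilon> k. cell A \<epsilon> i) y"
      by (rule indicator_UN_disjoint[OF finite_I[OF \<epsilon>] dj, symmetric])
    also have "\<dots> = indicator (covered \<epsilon> k) y" using True by (auto simp: indicator_def covered_def I_def)
    finally show ?thesis by (simp add: sum_distrib_right[symmetric])
  qed (simp add: test_outside[OF v])
  have Rr: "(LINT y|lebesgue_on \<Omega>. V\<epsilon> \<epsilon> y * v y) = (\<Sum>k=1..m. \<gamma> k \<epsilon> * ?X k)"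
  proof -
    have "(LINT y|lebesgue_on \<Omega>. V\<epsilon> \<epsilon> y * v y) = (LINT y|lebesgue. indicator \<Omega> y *\<^sub>R (V\<epsilon> \<epsilon> y * v y))"
      by (simp add: integral_restrict_space)
    also have "\<dots> = (LINT y|lebesgue. (\<Sum>k=1..m. \<gamma> k \<epsilon> * (\<Sum>i\<in>I \<epsilon> k. indicator (cell A \<epsilon> i) y * v y)))"
    proof (rule Bochner_Integration.integral_cong[OF refl])
      fix y
      have "indicator \<Omega> y *\<^sub>R (V\<epsilon> \<epsilon> y * v y) = V\<epsilon> \<epsilon> y * v y" using test_outside[OF v, of y] by (cases "y \<in> \<Omega>") auto
      also have "\<dots> = (\<Sum>k=1..m. \<gamma> k \<epsilon> * (indicator (covered \<epsilon> k) y * v y))"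
        unfolding V\<epsilon>_def by (simp only: sum_distrib_right mult.assoc)
      finally show "indicator \<Omega> y *\<^sub>R (V\<epsilon> \<epsilon> y * v y) = (\<Sum>k=1..m. \<gamma> k \<epsilon> * (\<Sum>i\<in>I \<epsilon> k. indicator (cell A \<epsilon> i) y * v y))"
        unfolding cov .
    qed
    also have "\<dots> = (\<Sum>k=1..m. \<gamma> k \<epsilon> * ?X k)" using cv_int by simp
    finally show ?thesis .
  qed
  let ?c = "Mb * measure lborel (ball (0::'a) 1) * \<kappa> ^ (?d + 1) / (C ^ ?d * measure lebesgue A)"
  have est: "\<bar>(\<Sum>i\<in>I \<epsilon> k. LINT y|lborel. q k i j y * v y) - \<beta> k \<epsilon> * area / measure lebesgue A * ?X k\<bar> \<le> \<beta> k \<epsilon> * ?c * \<epsilon> * ?D"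
    if k: "k \<in> {1..m}" and j: "j \<in> {1..N k}" for k j
  proof -
    have \<tau>: "\<epsilon> ^ ?d * measure lebesgue A > 0" using \<epsilon> measure_A_pos by simp
    have \<delta>: "\<epsilon> * \<kappa> > 0" using \<epsilon> \<kappa>_pos by simp
    have dj: "disjoint_family_on (cell A \<epsilon>) (I \<epsilon> k)"
      unfolding disjoint_family_on_def using cell_disjoint[OF \<epsilon>] I_inner by blast
    have q0: "q k i j y = 0" if "i \<in> I \<epsilon> k" "y \<notin> cell A \<epsilon> i" for i y
    proof -
      have "(k, i, j) \<in> J \<epsilon>" using k j that by (auto simp: J_def)
      then have "y \<notin> ball (x \<epsilon> i j) ?R" using ball_in_cell(1)[OF g] that by blast
      then have "?R \<le> norm (y - x \<epsilon> i j)" by (simp add: dist_norm norm_minus_commute)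
      then have "?R\<^sup>2 \<le> (norm (y - x \<epsilon> i j))\<^sup>2" using R by (intro power_mono) auto
      then have "1 \<le> (norm (y - x \<epsilon> i j))\<^sup>2 / ?R\<^sup>2"
        by (simp only: le_divide_eq_1_pos[OF zero_less_power[OF R]])
      then have "1/2 < (norm (y - x \<epsilon> i j))\<^sup>2 / ?R\<^sup>2" by linarith
      from profile_laplacian_0[OF dim disjI2[OF this]] show ?thesis unfolding q_def by simp
    qed
    have qi: "(LINT y|lborel. q k i j y) = bb k * (?R ^ ?d * area)" for i
      unfolding q_def using integral_profile_laplacian(2)[OF dim R, of "x \<epsilon> i j"] by (simp add: area_def)
    have "\<bar>(\<Sum>i\<in>I \<epsilon> k. LINT y|lborel. q k i j y * v y) - bb k * (?R ^ ?d * area) / (\<epsilon> ^ ?d * measure lebesgue A) * ?X k\<bar>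
      \<le> bb k * Mb / (\<epsilon> ^ ?d * measure lebesgue A) * (measure lborel (ball (0::'a) (\<epsilon> * \<kappa>)) * (\<epsilon> * \<kappa>) * ?D)"
      by (rule cell_average_estimate[OF v \<delta> finite_I[OF \<epsilon>] cell_lmeasurable[OF \<epsilon>] measure_cell[OF \<epsilon>] \<tau> dj cell_dist[OF \<epsilon>] q_int _ q0 qi])
        (use bb_pos[OF k] Mb in \<open>auto simp: q_def abs_mult mult_left_mono\<close>)
    moreover have "bb k * (?R ^ ?d * area) / (\<epsilon> ^ ?d * measure lebesgue A) = \<beta> k \<epsilon> * area / measure lebesgue A"
      unfolding bb_def using C_pos \<epsilon> by (simp add: power_mult_distrib)
    moreover have "bb k * Mb / (\<epsilon> ^ ?d * measure lebesgue A) * (measure lborel (ball (0::'a) (\<epsilon> * \<kappa>)) * (\<epsilon> * \<kappa>) * ?D) = \<beta> k \<epsilon> * ?c * \<epsilon> * ?D"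
    proof -
      have "measure lborel (ball (0::'a) (\<epsilon> * \<kappa>)) = (\<epsilon> * \<kappa>) ^ ?d * measure lborel (ball (0::'a) 1)"
        using content_ball_conv_unit_ball[of "\<epsilon> * \<kappa>" "0::'a"] \<delta> by simp
      then show ?thesis unfolding bb_def using \<epsilon> by (simp add: power_mult_distrib)
    qed
    ultimately show ?thesis by simp
  qed
  have diff: "(LINT y|lebesgue_on \<Omega>. h.\<rho> y * v y) - (LINT y|lebesgue_on \<Omega>. V\<epsilon> \<epsilon> y * v y)
    = (\<Sum>k=1..m. \<Sum>j=1..N k. (\<Sum>i\<in>I \<epsilon> k. LINT y|lborel. q k i j y * v y) - \<beta> k \<epsilon> * area / measure lebesgue A * ?X k)"
  proof -
    have "\<gamma> k \<epsilon> * ?X k = (\<Sum>j=1..N k. \<beta> k \<epsilon> * area / measure lebesgue A * ?X k)" for k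
      by (simp add: \<gamma>_def)
    then show ?thesis unfolding L Rr by (simp only: sum_subtractf[symmetric])
  qed
  have "\<bar>(LINT y|lebesgue_on \<Omega>. h.\<rho> y * v y) - (LINT y|lebesgue_on \<Omega>. V\<epsilon> \<epsilon> y * v y)\<bar>
    \<le> (\<Sum>k=1..m. \<Sum>j=1..N k. \<beta> k \<epsilon> * ?c * \<epsilon> * ?D)"
    unfolding diff by (rule order.trans[OF sum_abs sum_mono], rule order.trans[OF sum_abs sum_mono], rule est)
  moreover have "(\<Sum>k=1..m. \<Sum>j=1..N k. w k * c * e * D) = (\<Sum>k=1..m. real (N k) * w k) * c * e * D"
    for w :: "nat \<Rightarrow> real" and c e D :: real
    by (simp add: sum_distrib_right mult.assoc)
  ultimately show ?thesis unfolding \<eta>_def by (simp only:)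
qed

end

section \<open>Limits of the potential, the corrector and the averaging error\<close>

context perforation
begin

text \<open>An open set together with a part of a null set, which is measurable by completeness of
  Lebesgue measure.\<close>

lemma F_sets: assumes "k \<in> {1..m}" shows "F k \<in> sets lebesgue"
proof -
  have n: "frontier (F k) \<in> null_sets lebesgue"
    using F_null[OF assms] by (simp add: null_boundary_sets_def null_sets_def borel_closed)
  have "F k = interior (F k) \<union> (F k \<inter> frontier (F k))"
    using interior_subset closure_subset by (auto simp: frontier_def)
  moreover have "F k \<inter> frontier (F k) \<in> sets lebesgue"
    using n by (meson completion.complete2 Int_lower2 null_setsD2 complete_measure.complete2)
  ultimately show ?thesis by (metis borel_open open_interior sets.Un sets_completionI_sets sets_lborel)
qed

lemma V_measurable: "V \<in> borel_measurable lebesgue"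
  unfolding V_def[abs_def] using F_sets
  by (intro borel_measurable_times borel_measurable_sum borel_measurable_const) auto

lemma mu_const_nonneg: "0 \<le> mu_const A"
  unfolding mu_const_def sphere_area_def using dim by auto

lemma V_bounds: "0 \<le> V y" "V y \<le> mu_const A * (\<Sum>k=1..m. \<mu> k * real (N k))"
proof -
  have "0 \<le> \<mu> k * real (N k) * indicator (F k) y \<and> \<mu> k * real (N k) * indicator (F k) y \<le> \<mu> k * real (N k)"
    if "k \<in> {1..m}" for k
    using \<mu>_nonneg[OF that] by (simp add: indicator_def)
  then have "0 \<le> (\<Sum>k=1..m. \<mu> k * real (N k) * indicator (F k) y)"
    "(\<Sum>k=1..m. \<mu> k * real (N k) * indicator (F k) y) \<le> (\<Sum>k=1..m. \<mu> k * real (N k))"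
    by (blast intro: sum_nonneg, blast intro: sum_mono)
  then show "0 \<le> V y" "V y \<le> mu_const A * (\<Sum>k=1..m. \<mu> k * real (N k))"
    unfolding V_def using mu_const_nonneg by (auto intro: mult_nonneg_nonneg mult_left_mono)
qed

lemma \<gamma>_limit:
  assumes "k \<in> {1..m}"
  shows "(\<gamma> k \<longlongrightarrow> mu_const A * (\<mu> k * real (N k))) (at_right 0)"
proof -
  have "((\<lambda>\<epsilon>. N k * \<beta> k \<epsilon> * area / measure lebesgue A) \<longlongrightarrow>
    N k * (if DIM('a) = 2 then \<mu> k else (real DIM('a) - 2) * \<mu> k) * area / measure lebesgue A) (at_right 0)"
    using measure_A_pos by (intro tendsto_intros capacity(2)[OF assms]) simp
  moreover have "N k * (if DIM('a) = 2 then \<mu> k else (real DIM('a) - 2) * \<mu> k) * area / measure lebesgue A = mu_const A * (\<mu> k * real (N k))"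
    unfolding mu_const_def sphere_area_sphere area_def by (simp add: ac_simps)
  ultimately show ?thesis unfolding \<gamma>_def[abs_def] by simp
qed

text \<open>Off the frontiers the indicators of the covered sets are eventually equal to those of
  the \<open>F k\<close>, and the frontiers are null. Dominated convergence is available for
  sequences, hence the passage to a sequence of scales.\<close>

lemma V\<epsilon>_tendsto: "((\<lambda>\<epsilon>. nrm2 (lebesgue_on \<Omega>) (\<lambda>y. V y - V\<epsilon> \<epsilon> y)) \<longlongrightarrow> 0) (at_right 0)"
  unfolding tendsto_at_iff_sequentially comp_def
proof (intro allI impI)
  fix X :: "nat \<Rightarrow> real" assume X: "\<forall>i. X i \<in> {0<..} - {0}" "X \<longlonglongrightarrow> 0"
  then have Xpos: "X n > 0" for n by simp
  have Xr: "filterlim X (at_right 0) sequentially"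
    using X(2) Xpos by (simp add: filterlim_at less_imp_neq[symmetric])
  have lim: "(\<lambda>n. \<gamma> k (X n)) \<longlonglongrightarrow> mu_const A * (\<mu> k * real (N k))" if "k \<in> {1..m}" for k
    by (rule filterlim_compose[OF \<gamma>_limit[OF that] Xr])
  \<comment> \<open>A convergent sequence is bounded from its first term on, which gives a constant
    dominating function for all n.\<close>
  have "\<exists>K. \<forall>n. \<bar>\<gamma> k (X n)\<bar> \<le> K" if "k \<in> {1..m}" for k
    using convergent_imp_Bseq[OF convergentI[OF lim[OF that]]] by (auto simp: Bseq_def)
  then obtain K where K: "\<And>k n. k \<in> {1..m} \<Longrightarrow> \<bar>\<gamma> k (X n)\<bar> \<le> K k" by metis
  define w where "w = (\<Sum>k=1..m. K k) + mu_const A * (\<Sum>k=1..m. \<mu> k * real (N k))"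
  have S0: "0 \<le> mu_const A * (\<Sum>k=1..m. \<mu> k * real (N k))"
    using mu_const_nonneg \<mu>_nonneg by (intro mult_nonneg_nonneg sum_nonneg) auto
  have K0: "0 \<le> (\<Sum>k=1..m. K k)" using K[of _ 0] by (intro sum_nonneg) (meson abs_ge_zero order.trans)
  have b1: "\<bar>V\<epsilon> (X n) y\<bar> \<le> w" for n y
  proof -
    have "\<bar>V\<epsilon> (X n) y\<bar> \<le> (\<Sum>k=1..m. \<bar>\<gamma> k (X n)\<bar>)" by (rule V\<epsilon>_props(2)[OF Xpos])
    also have "\<dots> \<le> (\<Sum>k=1..m. K k)" using K by (intro sum_mono) auto
    finally show ?thesis using S0 by (simp add: w_def)
  qed
  have b2: "\<bar>V y\<bar> \<le> w" for y using V_bounds[of y] K0 by (simp add: w_def)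
  have w0: "0 \<le> w" using S0 K0 by (simp add: w_def)
  have mV: "V \<in> borel_measurable (lebesgue_on \<Omega>)" "V\<epsilon> (X n) \<in> borel_measurable (lebesgue_on \<Omega>)" for n
    using V_measurable V\<epsilon>_props(1)[OF Xpos] by (auto intro: measurable_restrict_space1)
  show "(\<lambda>n. nrm2 (lebesgue_on \<Omega>) (\<lambda>y. V y - V\<epsilon> (X n) y)) \<longlonglongrightarrow> 0"
  proof (rule nrm2_dominated_convergence[OF mV])
    show "sqi (lebesgue_on \<Omega>) (\<lambda>_. w)" by (rule sqi_bounded[OF \<Omega>_sets bounded_\<Omega>, where B = w]) (use w0 in auto)
    have "AE y in lebesgue. \<forall>k\<in>{1..m}. y \<notin> frontier (F k)"
    proof (rule AE_finite_allI)
      fix k assume k: "k \<in> {1..m}"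
      have "frontier (F k) \<in> null_sets lebesgue"
        using F_null[OF k] by (simp add: null_boundary_sets_def null_sets_def borel_closed)
      then show "AE y in lebesgue. y \<notin> frontier (F k)" by (rule AE_not_in)
    qed simp
    then have ae: "AE y in lebesgue_on \<Omega>. \<forall>k\<in>{1..m}. y \<notin> frontier (F k)"
      by (subst AE_restrict_space_iff) (auto elim: eventually_mono)
    show "AE y in lebesgue_on \<Omega>. (\<lambda>n. V\<epsilon> (X n) y) \<longlonglongrightarrow> V y"
      using ae
    proof eventually_elim
      case (elim y)
      have ind: "\<forall>\<^sub>F n in sequentially. indicator (covered (X n) k) y = (indicator (F k) y :: real)" if k: "k \<in> {1..m}" for k
      proof (cases "y \<in> F k")
        case False
        then have "y \<notin> covered (X n) k" for n by (auto simp: covered_def inner_cells_def)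
        then show ?thesis using False by simp
      next
        case True
        \<comment> \<open>Around an interior point there is a ball inside \<open>F k\<close>; once
          cells are smaller than its radius, the cell containing y is an inner cell.\<close>
        then have "y \<in> interior (F k)" using elim k subsetD[OF closure_subset True] unfolding frontier_def by blast
        then obtain e where e: "e > 0" "ball y e \<subseteq> F k" using mem_interior by blast
        have "(\<lambda>n. X n * \<kappa>) \<longlonglongrightarrow> 0" using tendsto_mult_left_zero[OF X(2)] .
        then have "\<forall>\<^sub>F n in sequentially. X n * \<kappa> < e" using order_tendstoD(2) e(1) by blast
        then show ?thesis
        proof eventually_elim
          case (elim n)
          obtain i where i: "i \<in> \<Lambda>" "y \<in> cell A (X n) i" using cell_cover[OF Xpos] by blast
          have "cell A (X n) i \<subseteq> ball y e" using cell_dist[OF Xpos i(2)] elim by fastforce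
          then have "i \<in> inner_cells A \<Lambda> (X n) (F k)" using e(2) i(1) by (auto simp: inner_cells_def)
          then have "y \<in> covered (X n) k" using i(2) unfolding covered_def by blast
          then show ?case using True by simp
        qed
      qed
      have "(\<lambda>n. \<Sum>k=1..m. \<gamma> k (X n) * indicator (covered (X n) k) y) \<longlonglongrightarrow> (\<Sum>k=1..m. mu_const A * (\<mu> k * real (N k)) * indicator (F k) y)"
        by (intro tendsto_sum tendsto_mult lim tendsto_eventually ind)
      moreover have "(\<Sum>k=1..m. mu_const A * (\<mu> k * real (N k)) * indicator (F k) y) = V y"
        unfolding V_def sum_distrib_left by (simp only: mult.assoc)
      ultimately show ?case by (simp only: V\<epsilon>_def)
    qed
    show "AE y in lebesgue_on \<Omega>. norm (V\<epsilon> (X n) y) \<le> norm w" for n using b1 w0 by (intro AE_I2) simp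
    show "AE y in lebesgue_on \<Omega>. norm (V y) \<le> norm w" using b2 w0 by (intro AE_I2) simp
  qed
qed

lemma \<eta>_tendsto: "(\<eta> \<longlongrightarrow> 0) (at_right 0)"
proof -
  let ?c = "Mb * measure lborel (ball (0::'a) 1) * \<kappa> ^ (DIM('a) + 1) / (C ^ DIM('a) * measure lebesgue A)"
  have "((\<lambda>\<epsilon>. (\<Sum>k=1..m. real (N k) * \<beta> k \<epsilon>) * ?c * \<epsilon>) \<longlongrightarrow>
    (\<Sum>k=1..m. real (N k) * (if DIM('a) = 2 then \<mu> k else (real DIM('a) - 2) * \<mu> k)) * ?c * 0) (at_right 0)"
    by (intro tendsto_mult tendsto_sum capacity(2) tendsto_const tendsto_ident_at)
  then show ?thesis unfolding \<eta>_def[abs_def] by simp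
qed

text \<open>Parameters are chosen in the order e, then \<open>\<theta>\<close> and
  \<open>\<tau>\<close>, then \<open>\<epsilon>\<close>: the threshold \<open>\<theta>\<close> is
  fixed while the heights of the correctors tend to 0.\<close>

lemma eventually_corrector_small:
  assumes e: "e > 0"
  shows "\<forall>\<^sub>F \<epsilon> in at_right 0. nrm2 (lebesgue_on (\<Omega> - T \<epsilon>)) (hole_family.z (J \<epsilon>) (centre \<epsilon>) (radius \<epsilon>) (C * \<epsilon>)) \<le> e
    \<and> sqrt (measure lebesgue (\<Omega> - (\<Omega> - T \<epsilon>))) \<le> e"
proof -
  define M0 where "M0 = measure lborel (cball (0::'a) r)"
  define M1 where "M1 = measure lborel (cball (0::'a) (r + \<kappa>))"
  have M: "M0 \<ge> 0" "M1 \<ge> 0" by (auto simp: M0_def M1_def)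
  \<comment> \<open>Half of \<open>e\<^sup>2\<close> is allotted to the bulk and half to the balls
    around the holes. The summand 1 avoids division by zero.\<close>
  define \<tau> where "\<tau> = sqrt (e\<^sup>2 / (2 * (M0 + 1)))"
  have \<tau>: "\<tau> > 0" "\<tau>\<^sup>2 * M0 \<le> e\<^sup>2 / 2"
  proof -
    show "\<tau> > 0" using e M by (simp add: \<tau>_def)
    have "\<tau>\<^sup>2 * M0 = e\<^sup>2 / 2 * (M0 / (M0 + 1))" using M by (simp add: \<tau>_def)
    also have "\<dots> \<le> e\<^sup>2 / 2 * 1" using M by (intro mult_left_mono) auto
    finally show "\<tau>\<^sup>2 * M0 \<le> e\<^sup>2 / 2" by simp
  qed
  define \<theta> where "\<theta> = min (1/2) (e\<^sup>2 / (2 * (M1 + 1)))"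
  have \<theta>: "0 < \<theta>" "\<theta> \<le> 1/2" "\<theta> ^ DIM('a) * M1 \<le> e\<^sup>2 / 2"
  proof -
    show p: "0 < \<theta>" "\<theta> \<le> 1/2" using e M unfolding \<theta>_def by (simp, intro min.cobounded1)
    have "\<theta> ^ DIM('a) \<le> \<theta> ^ 1" using p dim by (intro power_decreasing) auto
    then have "\<theta> ^ DIM('a) * M1 \<le> \<theta> * M1" using M by (simp add: mult_right_mono)
    also have "\<dots> \<le> e\<^sup>2 / (2 * (M1 + 1)) * M1" using M by (intro mult_right_mono) (auto simp: \<theta>_def)
    also have "\<dots> = e\<^sup>2 / 2 * (M1 / (M1 + 1))" by simp
    also have "\<dots> \<le> e\<^sup>2 / 2 * 1" using M by (intro mult_left_mono) auto
    finally show "\<theta> ^ DIM('a) * M1 \<le> e\<^sup>2 / 2" by simp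
  qed
  have "\<forall>\<^sub>F \<epsilon> in at_right 0. \<forall>k\<in>{1..m}. 1 / profile DIM('a) ((a \<epsilon> k)\<^sup>2 / (C * \<epsilon>)\<^sup>2) * profile DIM('a) (\<theta>\<^sup>2) \<le> \<tau>"
  proof (rule eventually_ball_finite)
    show "\<forall>k\<in>{1..m}. \<forall>\<^sub>F \<epsilon> in at_right 0. 1 / profile DIM('a) ((a \<epsilon> k)\<^sup>2 / (C * \<epsilon>)\<^sup>2) * profile DIM('a) (\<theta>\<^sup>2) \<le> \<tau>"
    proof
      fix k assume k: "k \<in> {1..m}"
      let ?l = "if DIM('a) = 2 then \<mu> k else (real DIM('a) - 2) * \<mu> k"
      \<comment> \<open>The height of the corrector equals
        \<open>\<beta> k \<epsilon> * \<epsilon>\<^sup>2 / C^(d-2)\<close>, and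
        \<open>\<beta>\<close> converges, so it tends to 0 like
        \<open>\<epsilon>\<^sup>2\<close>.\<close>
      have "((\<lambda>\<epsilon>. \<beta> k \<epsilon> * \<epsilon>\<^sup>2 / C ^ (DIM('a) - 2) * profile DIM('a) (\<theta>\<^sup>2)) \<longlongrightarrow> ?l * 0\<^sup>2 / C ^ (DIM('a) - 2) * profile DIM('a) (\<theta>\<^sup>2)) (at_right 0)"
        using C_pos by (intro tendsto_intros capacity(2)[OF k]) auto
      then have "\<forall>\<^sub>F \<epsilon> in at_right 0. \<beta> k \<epsilon> * \<epsilon>\<^sup>2 / C ^ (DIM('a) - 2) * profile DIM('a) (\<theta>\<^sup>2) < \<tau>"
        by (rule order_tendstoD(2)) (use \<tau> in simp)
      with eventually_pos show "\<forall>\<^sub>F \<epsilon> in at_right 0. 1 / profile DIM('a) ((a \<epsilon> k)\<^sup>2 / (C * \<epsilon>)\<^sup>2) * profile DIM('a) (\<theta>\<^sup>2) \<le> \<tau>"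
      proof eventually_elim
        case (elim \<epsilon>)
        have "\<epsilon> ^ ((DIM('a) - 2) + 2) = \<epsilon> ^ (DIM('a) - 2) * \<epsilon>\<^sup>2" by (rule power_add)
        moreover have "(DIM('a) - 2) + 2 = DIM('a)" using dim by simp
        ultimately have ed: "\<epsilon> ^ DIM('a) = \<epsilon> ^ (DIM('a) - 2) * \<epsilon>\<^sup>2" by (simp only:)
        have "(c * q) / (q * e2) / pp * e2 / c = 1 / pp" if "c \<noteq> 0" "q \<noteq> 0" "e2 \<noteq> 0" for c q e2 pp :: real
          using that by simp
        then have "\<beta> k \<epsilon> * \<epsilon>\<^sup>2 / C ^ (DIM('a) - 2) = 1 / profile DIM('a) ((a \<epsilon> k)\<^sup>2 / (C * \<epsilon>)\<^sup>2)"
          unfolding \<beta>_def ed power_mult_distrib[of C \<epsilon> "DIM('a) - 2"] using C_pos elim(1) by simp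
        then show ?case using elim(2) by simp
      qed
    qed
  qed simp
  with eventually_good eventually_small_radius[OF \<theta>(1)] show ?thesis
  proof eventually_elim
    case (elim \<epsilon>)
    interpret h: hole_family \<Omega> "J \<epsilon>" "centre \<epsilon>" "radius \<epsilon>" "C * \<epsilon>" r by (rule hole_family_good[OF elim(1)])
    have \<epsilon>: "\<epsilon> > 0" "\<epsilon> \<le> 1" using elim(1) by (auto simp: good_def)
    have hU: "h.U = \<Omega> - T \<epsilon>" unfolding h.U_def perforated_eq[OF elim(1)] ..
    \<comment> \<open>Selected cells may stick out of \<open>\<Omega>\<close>, but by less than
      \<open>\<epsilon> \<kappa> \<le> \<kappa>\<close>; the enclosing ball does not depend on
      \<open>\<epsilon>\<close>.\<close>
    have sub: "ball (centre \<epsilon> t) (C * \<epsilon>) \<subseteq> cball 0 (r + \<kappa>)" if t: "t \<in> J \<epsilon>" for t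
    proof -
      obtain k i j where e: "t = (k, i, j)" by (cases t) auto
      note b = ball_in_cell[OF elim(1) t[unfolded e]]
      obtain y where y: "y \<in> cell A \<epsilon> i" "y \<in> \<Omega>" using b(6) by (auto simp: I_def)
      have "w \<in> cball 0 (r + \<kappa>)" if "w \<in> cell A \<epsilon> i" for w
      proof -
        have "dist w y < \<epsilon> * \<kappa>" by (rule cell_dist[OF \<epsilon>(1) that y(1)])
        also have "\<dots> \<le> \<kappa>" using \<epsilon> \<kappa>_pos by (simp add: mult_left_le_one_le)
        finally have "norm (w - y) < \<kappa>" by (simp add: dist_norm)
        moreover have "norm y \<le> r" using y(2) \<Omega>_ball by auto
        ultimately show ?thesis using norm_triangle_ineq[of "w - y" y] by simp
      qed
      then show ?thesis using b(1) by (auto simp: e centre_def)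
    qed
    have rad: "radius \<epsilon> t \<le> \<theta> * (C * \<epsilon>)" if t: "t \<in> J \<epsilon>" for t
      using t elim(2) by (auto simp: J_def radius_def)
    have bt: "h.b t * profile DIM('a) (\<theta>\<^sup>2) \<le> \<tau>" if t: "t \<in> J \<epsilon>" for t
    proof -
      obtain k i j where e: "t = (k, i, j)" by (cases t) auto
      have "h.b t = 1 / profile DIM('a) ((a \<epsilon> k)\<^sup>2 / (C * \<epsilon>)\<^sup>2)" unfolding h.b_def h.\<alpha>_def unfolding radius_def e by simp
      then show ?thesis using elim(3) ball_in_cell(4)[OF elim(1) t[unfolded e]] by simp
    qed
    note small = h.corrector_small[OF sub \<theta>(1,2) rad less_imp_le[OF \<tau>(1)] bt]
    have "(nrm2 (lebesgue_on h.U) h.z)\<^sup>2 \<le> e\<^sup>2" using small(1) \<tau>(2) \<theta>(3) unfolding M0_def M1_def by linarith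
    then have 1: "nrm2 (lebesgue_on h.U) h.z \<le> e" by (rule power2_le_imp_le) (use e in simp)
    have "measure lebesgue (\<Omega> - h.U) \<le> e\<^sup>2" using small(2) \<theta>(3) zero_le_power2[of e] unfolding M1_def by linarith
    then have "sqrt (measure lebesgue (\<Omega> - h.U)) \<le> sqrt (e\<^sup>2)" by (rule real_sqrt_le_mono)
    then have 2: "sqrt (measure lebesgue (\<Omega> - h.U)) \<le> e" using e by simp
    show ?case using 1 2 unfolding hU by blast
  qed
qed

lemma \<eta>_nonneg:
  assumes \<epsilon>: "\<epsilon> > 0"
  shows "0 \<le> \<eta> \<epsilon>"
proof -
  have "0 \<le> \<beta> k \<epsilon>" if "k \<in> {1..m}" for k
    unfolding \<beta>_def using C_pos \<epsilon> a_pos[OF \<epsilon> that] by (intro divide_nonneg_nonneg profile_nonneg[OF dim]) auto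
  then show ?thesis unfolding \<eta>_def using Mb(1) \<kappa>_pos C_pos \<epsilon>
    by (intro mult_nonneg_nonneg divide_nonneg_nonneg sum_nonneg) auto
qed

text \<open>The test function version is applied to the products \<open>\<psi> n * \<phi>\<close>.
  By the product rule and Cauchy-Schwarz the L1 norm of their gradients is controlled by L2 norms
  that are stable under the approximation of \<open>w\<close>.\<close>

lemma density_estimate:
  assumes g: "good \<epsilon>" and p: "H10_pair \<Omega> w G" and \<phi>: "\<phi> \<in> test_functions \<Omega>"
  shows "\<bar>(LINT y|lebesgue_on \<Omega>. w y * (\<phi> y * hole_family.\<rho> (J \<epsilon>) (centre \<epsilon>) (radius \<epsilon>) (C * \<epsilon>) y)) - (LINT y|lebesgue_on \<Omega>. w y * (\<phi> y * V\<epsilon> \<epsilon> y))\<bar>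
    \<le> \<eta> \<epsilon> * (nrm2 (lebesgue_on \<Omega>) w * nrm2 (lebesgue_on \<Omega>) (gradient \<phi>) + nrm2 (lebesgue_on \<Omega>) \<phi> * nrm2 (lebesgue_on \<Omega>) G)"
proof -
  interpret h: hole_family \<Omega> "J \<epsilon>" "centre \<epsilon>" "radius \<epsilon>" "C * \<epsilon>" r by (rule hole_family_good[OF g])
  let ?M = "lebesgue_on \<Omega>"
  have \<epsilon>: "\<epsilon> > 0" using g by (simp add: good_def)
  obtain B where B: "\<And>y. \<bar>\<phi> y\<bar> \<le> B" using test_bounded[OF \<phi>] by metis
  have m\<phi>: "\<phi> \<in> borel_measurable ?M" by (rule borel_imp_lebesgue_on[OF test_measurable[OF \<phi>]])
  have m\<rho>: "h.\<rho> \<in> borel_measurable ?M"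
    by (intro borel_imp_lebesgue_on borel_measurable_continuous_onI h.continuous_\<rho>)
  have mV: "V\<epsilon> \<epsilon> \<in> borel_measurable ?M" using V\<epsilon>_props(1)[OF \<epsilon>] by (rule measurable_restrict_space1)
  have s\<phi>: "sqi ?M \<phi>" "sqi ?M (gradient \<phi>)" using test_sqi[OF \<phi> \<Omega>_sets] by auto
  have sV: "sqi ?M (\<lambda>y. \<phi> y * V\<epsilon> \<epsilon> y)"
    using sqi_bounded_mult_real(1)[OF s\<phi>(1) mV V\<epsilon>_props(2)[OF \<epsilon>]] by (simp add: mult.commute)
  have "compact (cball (0::'a) r)" by simp
  then have "compact (h.\<rho> ` cball 0 r)" by (rule compact_continuous_image[OF h.continuous_\<rho>])
  then have "bounded (h.\<rho> ` cball 0 r)" by (rule compact_imp_bounded)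
  then obtain K where K: "\<forall>y\<in>h.\<rho> ` cball 0 r. norm y \<le> K" unfolding bounded_iff by (rule exE)
  have "sqi ?M h.\<rho>"
  proof (rule sqi_bounded[OF \<Omega>_sets bounded_\<Omega> m\<rho>])
    fix y assume "y \<in> \<Omega>"
    then show "norm (h.\<rho> y) \<le> K" by (intro bspec[OF K] imageI subsetD[OF \<Omega>_ball])
  qed
  then have s\<rho>: "sqi ?M (\<lambda>y. \<phi> y * h.\<rho> y)" by (rule sqi_bounded_mult_real(1)[OF _ m\<phi> B])
  obtain \<psi> where \<psi>: "\<And>n::nat. \<psi> n \<in> test_functions \<Omega>"
    "(\<lambda>n. nrm2 ?M (\<lambda>x. w x - \<psi> n x)) \<longlonglongrightarrow> 0" "(\<lambda>n. nrm2 ?M (\<lambda>x. G x - gradient (\<psi> n) x)) \<longlonglongrightarrow> 0"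
    using H10_pairE[OF p] by blast
  note sw = H10_pair_sqi[OF p]
  note l = H10_pair_limit_inner(1)[OF \<Omega>_sets p \<psi>]
  have \<eta>0: "0 \<le> \<eta> \<epsilon>" by (rule \<eta>_nonneg[OF \<epsilon>])
  have le: "\<bar>(LINT y|?M. \<psi> n y * (\<phi> y * h.\<rho> y)) - (LINT y|?M. \<psi> n y * (\<phi> y * V\<epsilon> \<epsilon> y))\<bar>
    \<le> \<eta> \<epsilon> * (nrm2 ?M (\<psi> n) * nrm2 ?M (gradient \<phi>) + nrm2 ?M \<phi> * nrm2 ?M (gradient (\<psi> n)))" for n
  proof -
    note s\<psi> = test_sqi[OF \<psi>(1)[of n] \<Omega>_sets]
    \<comment> \<open>The averaging error is linear in the gradient of the product, so no bound on
      second derivatives of the solution is called for.\<close>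
    have v: "(\<lambda>y. \<psi> n y * \<phi> y) \<in> test_functions \<Omega>" by (rule test_mult[OF \<phi> test_smooth[OF \<psi>(1)]])
    have "(LINT y|lborel. norm (gradient (\<lambda>y. \<psi> n y * \<phi> y) y)) = (LINT y|?M. norm (gradient (\<lambda>y. \<psi> n y * \<phi> y) y))"
      by (rule integral_lebesgue_on_lborel[symmetric, OF \<Omega>_sets])
        (use test_gradient_measurable[OF v] test_gradient_outside[OF v] in auto)
    also have "\<dots> \<le> (LINT y|?M. norm (\<psi> n y) * norm (gradient \<phi> y) + norm (\<phi> y) * norm (gradient (\<psi> n) y))"
    proof (rule integral_mono)
      have mg: "gradient (\<lambda>y. \<psi> n y * \<phi> y) y = \<psi> n y *\<^sub>R gradient \<phi> y + \<phi> y *\<^sub>R gradient (\<psi> n) y" for y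
        by (rule gradient_mult[OF test_differentiable[OF \<psi>(1)] test_differentiable[OF \<phi>]])
      show le: "norm (gradient (\<lambda>y. \<psi> n y * \<phi> y) y) \<le> norm (\<psi> n y) * norm (gradient \<phi> y) + norm (\<phi> y) * norm (gradient (\<psi> n) y)" for y
        unfolding mg using norm_triangle_ineq[of "\<psi> n y *\<^sub>R gradient \<phi> y" "\<phi> y *\<^sub>R gradient (\<psi> n) y"] by simp
      show i: "integrable ?M (\<lambda>y. norm (\<psi> n y) * norm (gradient \<phi> y) + norm (\<phi> y) * norm (gradient (\<psi> n) y))"
        by (intro Bochner_Integration.integrable_add sqi_inner_norm s\<psi> s\<phi>)
      have "gradient (\<lambda>y. \<psi> n y * \<phi> y) \<in> borel_measurable ?M" by (rule borel_imp_lebesgue_on[OF test_gradient_measurable[OF v]])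
      then show "integrable ?M (\<lambda>y. norm (gradient (\<lambda>y. \<psi> n y * \<phi> y) y))"
        by (intro Bochner_Integration.integrable_bound[OF i]) (use le in \<open>auto intro!: AE_I2 order.trans[OF le]\<close>)
    qed
    also have "\<dots> \<le> nrm2 ?M (\<psi> n) * nrm2 ?M (gradient \<phi>) + nrm2 ?M \<phi> * nrm2 ?M (gradient (\<psi> n))"
      using sqi_inner_norm[OF s\<psi>(1) s\<phi>(2)] sqi_inner_norm[OF s\<phi>(1) s\<psi>(2)]
        nrm2_Cauchy_Schwarz_norm[OF s\<psi>(1) s\<phi>(2)] nrm2_Cauchy_Schwarz_norm[OF s\<phi>(1) s\<psi>(2)] by simp
    finally have D: "(LINT y|lborel. norm (gradient (\<lambda>y. \<psi> n y * \<phi> y) y)) \<le> nrm2 ?M (\<psi> n) * nrm2 ?M (gradient \<phi>) + nrm2 ?M \<phi> * nrm2 ?M (gradient (\<psi> n))" .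
    have "\<bar>(LINT y|?M. \<psi> n y * (\<phi> y * h.\<rho> y)) - (LINT y|?M. \<psi> n y * (\<phi> y * V\<epsilon> \<epsilon> y))\<bar>
      = \<bar>(LINT y|?M. h.\<rho> y * (\<psi> n y * \<phi> y)) - (LINT y|?M. V\<epsilon> \<epsilon> y * (\<psi> n y * \<phi> y))\<bar>"
      by (simp only: ac_simps)
    also have "\<dots> \<le> \<eta> \<epsilon> * (LINT y|lborel. norm (gradient (\<lambda>y. \<psi> n y * \<phi> y) y))"
      by (rule density_estimate_test[OF g v])
    also have "\<dots> \<le> \<eta> \<epsilon> * (nrm2 ?M (\<psi> n) * nrm2 ?M (gradient \<phi>) + nrm2 ?M \<phi> * nrm2 ?M (gradient (\<psi> n)))"
      by (rule mult_left_mono[OF D \<eta>0])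
    finally show ?thesis .
  qed
  show ?thesis
  proof (rule LIMSEQ_le)
    show "(\<lambda>n. \<bar>(LINT y|?M. \<psi> n y * (\<phi> y * h.\<rho> y)) - (LINT y|?M. \<psi> n y * (\<phi> y * V\<epsilon> \<epsilon> y))\<bar>)
      \<longlonglongrightarrow> \<bar>(LINT y|?M. w y * (\<phi> y * h.\<rho> y)) - (LINT y|?M. w y * (\<phi> y * V\<epsilon> \<epsilon> y))\<bar>"
      by (intro tendsto_rabs tendsto_diff l s\<rho> sV)
    show "(\<lambda>n. \<eta> \<epsilon> * (nrm2 ?M (\<psi> n) * nrm2 ?M (gradient \<phi>) + nrm2 ?M \<phi> * nrm2 ?M (gradient (\<psi> n))))
      \<longlonglongrightarrow> \<eta> \<epsilon> * (nrm2 ?M w * nrm2 ?M (gradient \<phi>) + nrm2 ?M \<phi> * nrm2 ?M G)"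
      by (intro tendsto_mult tendsto_add tendsto_const nrm2_limit_nrm2[OF test_sqi(1)[OF \<psi>(1) \<Omega>_sets] sw(1) \<psi>(2)]
          nrm2_limit_nrm2[OF test_sqi(2)[OF \<psi>(1) \<Omega>_sets] sw(2) \<psi>(3)])
    show "\<exists>K. \<forall>n\<ge>K. \<bar>(LINT y|?M. \<psi> n y * (\<phi> y * h.\<rho> y)) - (LINT y|?M. \<psi> n y * (\<phi> y * V\<epsilon> \<epsilon> y))\<bar>
      \<le> \<eta> \<epsilon> * (nrm2 ?M (\<psi> n) * nrm2 ?M (gradient \<phi>) + nrm2 ?M \<phi> * nrm2 ?M (gradient (\<psi> n)))"
      using le by blast
  qed
qed

end

section \<open>Passing to the limit in the perforated problem\<close>

context perforation
begin

abbreviation "M \<equiv> lebesgue_on \<Omega>"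
abbreviation "form u g \<phi> \<equiv> (LINT y|M. g y \<bullet> gradient \<phi> y) + (LINT y|M. V y * u y * \<phi> y)"

text \<open>All bounds are uniform in \<open>\<epsilon>\<close>: the perforated sets lie in one ball
  of radius r, which determines the Poincare constant, and extension by zero preserves the
  norms.\<close>

lemma perforated_solution:
  assumes g: "good \<epsilon>" and u: "weak_solution (\<Omega> - T \<epsilon>) (\<lambda>_. 0) f u"
  defines "U \<equiv> \<Omega> - T \<epsilon>"
  defines "h \<equiv> weak_gradient U u"
  shows "open U" "U \<in> sets lebesgue" "H10_pair U u h" "sqi (lebesgue_on U) f" "nrm2 (lebesgue_on U) f \<le> nrm2 M f"
    and "\<And>\<phi>. \<phi> \<in> test_functions U \<Longrightarrow> (LINT y|lebesgue_on U. h y \<bullet> gradient \<phi> y) = (LINT y|lebesgue_on U. f y * \<phi> y)"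
    and "nrm2 (lebesgue_on U) h \<le> 2 * r * nrm2 M f" "nrm2 (lebesgue_on U) u \<le> 2 * r * (2 * r * nrm2 M f)"
    and "H10_pair \<Omega> (zero_ext U u) (\<lambda>y. if y \<in> U then h y else 0)"
    and "nrm2 M (zero_ext U u) = nrm2 (lebesgue_on U) u"
    and "nrm2 M (\<lambda>y. if y \<in> U then h y else 0) = nrm2 (lebesgue_on U) h"
proof -
  interpret hf: hole_family \<Omega> "J \<epsilon>" "centre \<epsilon>" "radius \<epsilon>" "C * \<epsilon>" r by (rule hole_family_good[OF g])
  have hU: "hf.U = U" unfolding hf.U_def U_def perforated_eq[OF g] ..
  show o: "open U" using hf.open_U unfolding hU .
  then show s: "U \<in> sets lebesgue" by auto
  have sub: "U \<subseteq> \<Omega>" unfolding U_def by auto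
  then have ball: "U \<subseteq> cball 0 r" using \<Omega>_ball by auto
  note w = u[folded U_def, unfolded weak_solution_def, folded h_def]
  show p: "H10_pair U u h" unfolding h_def by (rule H10_iff(1)[OF o conjunct1[OF w[unfolded h_def]]])
  show fU: "sqi (lebesgue_on U) f" and fle: "nrm2 (lebesgue_on U) f \<le> nrm2 M f"
    by (rule sqi_subset[OF s \<Omega>_sets sub f])+
  show weak: "(LINT y|lebesgue_on U. h y \<bullet> gradient \<phi> y) = (LINT y|lebesgue_on U. f y * \<phi> y)" if "\<phi> \<in> test_functions U" for \<phi>
    using bspec[OF conjunct2[OF w] that] by simp
  have "nrm2 (lebesgue_on U) h \<le> 2 * r * nrm2 (lebesgue_on U) f"
    by (rule energy_estimate[OF s ball r_nonneg p fU weak])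
  also have "\<dots> \<le> 2 * r * nrm2 M f" using r_nonneg by (intro mult_left_mono fle) simp
  finally show hle: "nrm2 (lebesgue_on U) h \<le> 2 * r * nrm2 M f" .
  have "nrm2 (lebesgue_on U) u \<le> 2 * r * nrm2 (lebesgue_on U) h" by (rule Poincare[OF s ball r_nonneg p])
  also have "\<dots> \<le> 2 * r * (2 * r * nrm2 M f)" using r_nonneg by (intro mult_left_mono hle) simp
  finally show "nrm2 (lebesgue_on U) u \<le> 2 * r * (2 * r * nrm2 M f)" .
  show "H10_pair \<Omega> (zero_ext U u) (\<lambda>y. if y \<in> U then h y else 0)" by (rule H10_pair_zero_ext[OF s \<Omega>_sets sub p])
  show "nrm2 M (zero_ext U u) = nrm2 (lebesgue_on U) u"
    by (rule zero_ext_sqi(1)[OF s \<Omega>_sets sub]) (auto simp: zero_ext_def)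
  show "nrm2 M (\<lambda>y. if y \<in> U then h y else 0) = nrm2 (lebesgue_on U) h"
    by (rule zero_ext_sqi(1)[OF s \<Omega>_sets sub]) auto
qed

text \<open>The source is integrated over the perforated set only. The missing part is a product
  with the indicator of the holes, so Cauchy-Schwarz bounds it by the square root of their
  volume.\<close>

lemma source_defect:
  assumes U: "U \<in> sets lebesgue" "U \<subseteq> \<Omega>" and \<phi>: "\<phi> \<in> test_functions \<Omega>" and B: "\<And>y. \<bar>\<phi> y\<bar> \<le> B"
  shows "\<bar>(LINT y|lebesgue_on U. f y * \<phi> y) - (LINT y|M. f y * \<phi> y)\<bar> \<le> nrm2 M f * (B * sqrt (measure lebesgue (\<Omega> - U)))"
proof -
  let ?i = "indicator (\<Omega> - U) :: 'a \<Rightarrow> real"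
  have D: "\<Omega> - U \<in> sets lebesgue" using U by auto
  have fin: "emeasure lebesgue (\<Omega> - U) < \<infinity>"
  proof -
    have "\<Omega> - U \<in> lmeasurable"
      using bounded_set_imp_lmeasurable[OF _ D] bounded_subset[OF bounded_\<Omega>, of "\<Omega> - U"] by blast
    from fmeasurableD2[OF this] show ?thesis by (simp add: top.not_eq_extremum)
  qed
  have si: "sqi M ?i" by (rule indicator_sqi[OF \<Omega>_sets D fin])
  have m\<phi>: "\<phi> \<in> borel_measurable M" by (rule borel_imp_lebesgue_on[OF test_measurable[OF \<phi>]])
  note s\<phi>i = sqi_bounded_mult_real[OF si m\<phi> B]
  have sf\<phi>: "integrable M (\<lambda>y. f y * \<phi> y)" by (rule sqi_mult[OF f test_sqi(1)[OF \<phi> \<Omega>_sets]])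
  have "(LINT y|lebesgue_on U. f y * \<phi> y) = (LINT y|M. f y * \<phi> y - f y * (\<phi> y * ?i y))"
    by (rule integral_lebesgue_on_subset[symmetric, OF U(1) \<Omega>_sets U(2)]) auto
  also have "\<dots> = (LINT y|M. f y * \<phi> y) - (LINT y|M. f y * (\<phi> y * ?i y))"
    by (rule Bochner_Integration.integral_diff[OF sf\<phi> sqi_mult[OF f s\<phi>i(1)]])
  finally have eq: "\<bar>(LINT y|lebesgue_on U. f y * \<phi> y) - (LINT y|M. f y * \<phi> y)\<bar> = \<bar>LINT y|M. f y * (\<phi> y * ?i y)\<bar>"
    by linarith
  have "(nrm2 M ?i)\<^sup>2 = (LINT y|lebesgue_on (\<Omega> - U). 1)"
    unfolding nrm2_power2 by (rule integral_lebesgue_on_subset[OF D \<Omega>_sets]) auto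
  also have "\<dots> = measure lebesgue (\<Omega> - U)" using D by (simp add: measure_restrict_space)
  finally have ni: "nrm2 M ?i = sqrt (measure lebesgue (\<Omega> - U))" by (metis abs_of_nonneg nrm2_nonneg real_sqrt_abs)
  have "\<bar>LINT y|M. f y * (\<phi> y * ?i y)\<bar> \<le> nrm2 M f * nrm2 M (\<lambda>y. \<phi> y * ?i y)"
    by (rule nrm2_Cauchy_Schwarz_real[OF f s\<phi>i(1)])
  also have "\<dots> \<le> nrm2 M f * (B * sqrt (measure lebesgue (\<Omega> - U)))"
    using s\<phi>i(2) unfolding ni by (rule mult_left_mono) simp
  finally show ?thesis unfolding eq .
qed

text \<open>A chain of four replacements: corrected equation, source on \<open>U\<close> by source
  on \<open>\<Omega>\<close>, oscillating density by \<open>V\<epsilon>\<close>, and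
  \<open>V\<epsilon>\<close> by \<open>V\<close>. Each error has an explicit bound in which the
  solution enters only through its uniform norms.\<close>

lemma homogenized_defect:
  assumes g: "good \<epsilon>" and u: "weak_solution (\<Omega> - T \<epsilon>) (\<lambda>_. 0) f u" and \<phi>: "\<phi> \<in> test_functions \<Omega>"
    and B: "B \<ge> 0" "\<And>y. \<bar>\<phi> y\<bar> \<le> B" "\<And>y. norm (gradient \<phi> y) \<le> B" "\<And>y. \<bar>laplacian \<phi> y\<bar> \<le> B"
    and e: "nrm2 (lebesgue_on (\<Omega> - T \<epsilon>)) (hole_family.z (J \<epsilon>) (centre \<epsilon>) (radius \<epsilon>) (C * \<epsilon>)) \<le> e"
      "sqrt (measure lebesgue (\<Omega> - (\<Omega> - T \<epsilon>))) \<le> e"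
  defines "U \<equiv> \<Omega> - T \<epsilon>"
  defines "w \<equiv> zero_ext U u" and "G \<equiv> \<lambda>y. if y \<in> U then weak_gradient U u y else 0"
    and "Cg \<equiv> 2 * r * nrm2 M f"
  shows "\<bar>form w G \<phi> - (LINT y|M. f y * \<phi> y)\<bar>
    \<le> B * (2 * Cg + 2 * r * Cg + 2 * nrm2 M f) * e
      + \<eta> \<epsilon> * (2 * r * Cg * nrm2 M (gradient \<phi>) + nrm2 M \<phi> * Cg)
      + 2 * r * Cg * (B * nrm2 M (\<lambda>y. V y - V\<epsilon> \<epsilon> y))"
proof -
  interpret hf: hole_family \<Omega> "J \<epsilon>" "centre \<epsilon>" "radius \<epsilon>" "C * \<epsilon>" r by (rule hole_family_good[OF g])
  have hU: "hf.U = U" unfolding hf.U_def U_def perforated_eq[OF g] ..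
  have \<epsilon>: "\<epsilon> > 0" using g by (simp add: good_def)
  define h where "h = weak_gradient U u"
  note P = perforated_solution[OF g u, folded U_def, folded h_def]
  note Q = P(9)[folded w_def] P(10)[folded w_def] P(11)
  have G: "G = (\<lambda>y. if y \<in> U then h y else 0)" unfolding G_def h_def ..
  have sub: "U \<subseteq> \<Omega>" unfolding U_def by auto
  have p: "H10_pair \<Omega> w G" using Q(1) unfolding G .
  have nw: "nrm2 M w \<le> 2 * r * Cg" using P(8) Q(2) unfolding Cg_def by simp
  have nG: "nrm2 M G \<le> Cg" using P(7) Q(3) unfolding Cg_def G by simp
  have e0: "0 \<le> e" using e(1) nrm2_nonneg order.trans by blast
  have Cg0: "0 \<le> Cg" using nG nrm2_nonneg order.trans by blast
  note sw = H10_pair_sqi[OF p]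
  have m\<phi>: "\<phi> \<in> borel_measurable M" by (rule borel_imp_lebesgue_on[OF test_measurable[OF \<phi>]])
  have 1: "\<bar>(LINT y|M. G y \<bullet> gradient \<phi> y) + (LINT y|M. w y * (\<phi> y * hf.\<rho> y)) - (LINT y|lebesgue_on U. f y * \<phi> y)\<bar>
    \<le> B * (2 * Cg + 2 * r * Cg + nrm2 M f) * e"
  proof -
    have i1: "(LINT y|M. G y \<bullet> gradient \<phi> y) = (LINT y|lebesgue_on U. h y \<bullet> gradient \<phi> y)"
      by (rule integral_lebesgue_on_subset[OF P(2) \<Omega>_sets sub]) (auto simp: G)
    have i2: "(LINT y|M. w y * (\<phi> y * hf.\<rho> y)) = (LINT y|lebesgue_on U. u y * (\<phi> y * hf.\<rho> y))"
      by (rule integral_lebesgue_on_subset[OF P(2) \<Omega>_sets sub]) (auto simp: w_def zero_ext_def)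
    have "\<bar>(LINT y|lebesgue_on U. h y \<bullet> gradient \<phi> y) + (LINT y|lebesgue_on U. u y * (\<phi> y * hf.\<rho> y)) - (LINT y|lebesgue_on U. f y * \<phi> y)\<bar>
      \<le> B * (2 * nrm2 (lebesgue_on U) h + nrm2 (lebesgue_on U) u + nrm2 (lebesgue_on U) f) * nrm2 (lebesgue_on U) hf.z"
      by (rule hf.corrector_estimate[unfolded hU, OF P(3) P(4) \<phi> P(6) B(2-4)])
    also have "\<dots> \<le> B * (2 * Cg + 2 * r * Cg + nrm2 M f) * e"
      using P(5,7,8) e(1)[folded U_def] B(1) e0 Cg0 r_nonneg unfolding Cg_def[symmetric]
      by (intro mult_mono mult_nonneg_nonneg add_mono mult_left_mono add_nonneg_nonneg) auto
    finally show ?thesis unfolding i1 i2 .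
  qed
  have 2: "\<bar>(LINT y|lebesgue_on U. f y * \<phi> y) - (LINT y|M. f y * \<phi> y)\<bar> \<le> nrm2 M f * (B * e)"
    by (rule order.trans[OF source_defect[OF P(2) sub \<phi> B(2)]])
      (intro mult_left_mono e(2)[folded U_def] B(1) nrm2_nonneg)
  have \<eta>0: "0 \<le> \<eta> \<epsilon>" by (rule \<eta>_nonneg[OF \<epsilon>])
  have 3: "\<bar>(LINT y|M. w y * (\<phi> y * hf.\<rho> y)) - (LINT y|M. w y * (\<phi> y * V\<epsilon> \<epsilon> y))\<bar>
    \<le> \<eta> \<epsilon> * (2 * r * Cg * nrm2 M (gradient \<phi>) + nrm2 M \<phi> * Cg)"
    by (rule order.trans[OF density_estimate[OF g p \<phi>]]) (intro mult_left_mono[OF _ \<eta>0] add_mono mult_right_mono mult_left_mono nw nG nrm2_nonneg)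
  have 4: "\<bar>(LINT y|M. V y * w y * \<phi> y) - (LINT y|M. w y * (\<phi> y * V\<epsilon> \<epsilon> y))\<bar> \<le> 2 * r * Cg * (B * nrm2 M (\<lambda>y. V y - V\<epsilon> \<epsilon> y))"
  proof -
    have mV: "V \<in> borel_measurable M" "V\<epsilon> \<epsilon> \<in> borel_measurable M"
      using V_measurable V\<epsilon>_props(1)[OF \<epsilon>] by (auto intro: measurable_restrict_space1)
    have sV: "sqi M V"
      by (rule sqi_bounded[OF \<Omega>_sets bounded_\<Omega> mV(1), where B = "mu_const A * (\<Sum>k=1..m. \<mu> k * real (N k))"])
        (use V_bounds in \<open>simp only: real_norm_def abs_of_nonneg\<close>)
    have sVe: "sqi M (V\<epsilon> \<epsilon>)"
      by (rule sqi_bounded[OF \<Omega>_sets bounded_\<Omega> mV(2), where B = "\<Sum>k=1..m. \<bar>\<gamma> k \<epsilon>\<bar>"])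
        (use V\<epsilon>_props(2)[OF \<epsilon>] in \<open>simp only: real_norm_def\<close>)
    note d = sqi_bounded_mult_real[OF sV m\<phi> B(2)] sqi_bounded_mult_real[OF sVe m\<phi> B(2)]
      sqi_bounded_mult_real[OF sqi_diff[OF sV sVe] m\<phi> B(2)]
    have "(LINT y|M. V y * w y * \<phi> y) - (LINT y|M. w y * (\<phi> y * V\<epsilon> \<epsilon> y)) = (LINT y|M. w y * (\<phi> y * V y)) - (LINT y|M. w y * (\<phi> y * V\<epsilon> \<epsilon> y))"
      by (simp only: ac_simps)
    also have "\<dots> = (LINT y|M. w y * (\<phi> y * V y) - w y * (\<phi> y * V\<epsilon> \<epsilon> y))"
      by (rule Bochner_Integration.integral_diff[symmetric, OF sqi_mult[OF sw(1) d(1)] sqi_mult[OF sw(1) d(3)]])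
    also have "\<dots> = (LINT y|M. w y * (\<phi> y * (V y - V\<epsilon> \<epsilon> y)))" by (simp only: right_diff_distrib)
    finally have eq: "(LINT y|M. V y * w y * \<phi> y) - (LINT y|M. w y * (\<phi> y * V\<epsilon> \<epsilon> y)) = (LINT y|M. w y * (\<phi> y * (V y - V\<epsilon> \<epsilon> y)))" .
    have "\<bar>LINT y|M. w y * (\<phi> y * (V y - V\<epsilon> \<epsilon> y))\<bar> \<le> nrm2 M w * nrm2 M (\<lambda>y. \<phi> y * (V y - V\<epsilon> \<epsilon> y))"
      by (rule nrm2_Cauchy_Schwarz_real[OF sw(1) d(5)])
    also have "\<dots> \<le> 2 * r * Cg * (B * nrm2 M (\<lambda>y. V y - V\<epsilon> \<epsilon> y))"
      by (rule mult_mono[OF nw d(6)]) (use Cg0 r_nonneg in simp_all)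
    finally show ?thesis unfolding eq .
  qed
  \<comment> \<open>The triangle inequality for the four replacements, stated for plain
    numbers.\<close>
  have fin: "\<bar>p1 + v - f2\<bar> \<le> c1 * e + c3 + c4"
    if "\<bar>p1 + q - f1\<bar> \<le> b1" "\<bar>f1 - f2\<bar> \<le> b2" "\<bar>q - s\<bar> \<le> c3" "\<bar>v - s\<bar> \<le> c4" "b1 + b2 = c1 * e"
    for p1 q f1 f2 s v b1 b2 c1 c3 c4 :: real
    using that by linarith
  show ?thesis
    by (rule fin[OF 1 2 3 4]) (simp add: algebra_simps)
qed

lemma homogenized_limit:
  assumes u: "\<forall>\<^sub>F \<epsilon> in at_right 0. weak_solution (\<Omega> - T \<epsilon>) (\<lambda>_. 0) f (u \<epsilon>)" and \<phi>: "\<phi> \<in> test_functions \<Omega>"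
  shows "((\<lambda>\<epsilon>. form (zero_ext (\<Omega> - T \<epsilon>) (u \<epsilon>))
      (\<lambda>y. if y \<in> \<Omega> - T \<epsilon> then weak_gradient (\<Omega> - T \<epsilon>) (u \<epsilon>) y else 0) \<phi>) \<longlongrightarrow> (LINT y|M. f y * \<phi> y)) (at_right 0)"
proof (rule tendstoI)
  fix e :: real assume e: "e > 0"
  obtain B1 where B1: "B1 > 0" "\<And>y. \<bar>\<phi> y\<bar> \<le> B1" "\<And>y. norm (gradient \<phi> y) \<le> B1" using test_bounded[OF \<phi>] by blast
  obtain B2 where B2: "\<And>y. \<bar>laplacian \<phi> y\<bar> \<le> B2" using test_bounded[OF test_laplacian[OF \<phi>]] by blast
  define B where "B = max B1 B2"
  have B: "B \<ge> 0" "\<And>y. \<bar>\<phi> y\<bar> \<le> B" "\<And>y. norm (gradient \<phi> y) \<le> B" "\<And>y. \<bar>laplacian \<phi> y\<bar> \<le> B"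
    using B1 B2 unfolding B_def by (auto intro: order.trans simp: le_max_iff_disj less_imp_le)
  define Cg where "Cg = 2 * r * nrm2 M f"
  define K where "K = B * (2 * Cg + 2 * r * Cg + 2 * nrm2 M f)"
  have K: "K \<ge> 0" unfolding K_def Cg_def using B(1) r_nonneg by simp
  \<comment> \<open>Half of the tolerance goes to the corrector and the holes, half to averaging and
    to the potential; K may be 0, hence K + 1.\<close>
  define e' where "e' = e / (2 * (K + 1))"
  have e': "e' > 0" "K * e' \<le> e / 2"
  proof -
    show "e' > 0" using e K by (simp add: e'_def)
    have "K * e' = e / 2 * (K / (K + 1))" using K by (simp add: e'_def)
    also have "\<dots> \<le> e / 2 * 1" using K e by (intro mult_left_mono) auto
    finally show "K * e' \<le> e / 2" by simp
  qed
  have "((\<lambda>\<epsilon>. \<eta> \<epsilon> * (2 * r * Cg * nrm2 M (gradient \<phi>) + nrm2 M \<phi> * Cg) + 2 * r * Cg * (B * nrm2 M (\<lambda>y. V y - V\<epsilon> \<epsilon> y)))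
    \<longlongrightarrow> 0 * (2 * r * Cg * nrm2 M (gradient \<phi>) + nrm2 M \<phi> * Cg) + 2 * r * Cg * (B * 0)) (at_right 0)"
    by (intro tendsto_intros \<eta>_tendsto V\<epsilon>_tendsto)
  then have "\<forall>\<^sub>F \<epsilon> in at_right 0. \<eta> \<epsilon> * (2 * r * Cg * nrm2 M (gradient \<phi>) + nrm2 M \<phi> * Cg) + 2 * r * Cg * (B * nrm2 M (\<lambda>y. V y - V\<epsilon> \<epsilon> y)) < e / 2"
    by (rule order_tendstoD(2)) (use e in simp)
  with eventually_good u eventually_corrector_small[OF e'(1)]
  show "\<forall>\<^sub>F \<epsilon> in at_right 0. dist (form (zero_ext (\<Omega> - T \<epsilon>) (u \<epsilon>))
      (\<lambda>y. if y \<in> \<Omega> - T \<epsilon> then weak_gradient (\<Omega> - T \<epsilon>) (u \<epsilon>) y else 0) \<phi>) (LINT y|M. f y * \<phi> y) < e"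
  proof eventually_elim
    case (elim \<epsilon>)
    note d = homogenized_defect[OF elim(1,2) \<phi> B conjunct1[OF elim(3)] conjunct2[OF elim(3)], folded Cg_def, folded K_def]
    show ?case unfolding dist_real_def using d elim(4) e'(2) by linarith
  qed
qed

end

theorem theorem1:
  fixes \<Omega> A \<Lambda> :: "'a::euclidean_space set"
    and f :: "'a \<Rightarrow> real"
    and m :: nat
    and F :: "nat \<Rightarrow> 'a set"
    and N :: "nat \<Rightarrow> nat"
    and C :: real
    and x :: "real \<Rightarrow> 'a \<Rightarrow> nat \<Rightarrow> 'a"
    and a :: "real \<Rightarrow> nat \<Rightarrow> real"
    and \<mu> :: "nat \<Rightarrow> real"
    and u\<epsilon> :: "real \<Rightarrow> 'a \<Rightarrow> real"
  assumes "DIM('a) \<ge> 2"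
    and "open \<Omega>" and "bounded \<Omega>" and "C2_boundary \<Omega>"
    and "f \<in> L2 \<Omega>"
    and "\<And>k. k \<in> {1..m} \<Longrightarrow> F k \<in> null_boundary_sets"
    and "disjoint_family_on F {1..m}"
    and "\<And>k. k \<in> {1..m} \<Longrightarrow> N k > 0"
    and "A \<in> sets lebesgue" and "bounded A"
    and "countable \<Lambda>"
    and "disjoint_family_on (\<lambda>i. (\<lambda>y. y + i) ` A) \<Lambda>"
    and "(\<Union>i\<in>\<Lambda>. (\<lambda>y. y + i) ` A) = UNIV"
    and "C > 0"
    and "\<And>k. k \<in> {1..m} \<Longrightarrow> measure lebesgue A > real (N k) * measure lebesgue (ball (0::'a) C)"
    and "\<forall>\<^sub>F \<epsilon> in at_right 0. \<forall>k\<in>{1..m}. \<forall>i\<in>inner_cells A \<Lambda> \<epsilon> (F k).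
           disjoint_family_on (\<lambda>j. ball (x \<epsilon> i j) (C * \<epsilon>)) {1..N k} \<and>
           (\<forall>j\<in>{1..N k}. ball (x \<epsilon> i j) (C * \<epsilon>) \<subseteq> cell A \<epsilon> i)"
    and "\<And>\<epsilon> k. \<epsilon> > 0 \<Longrightarrow> k \<in> {1..m} \<Longrightarrow> a \<epsilon> k > 0"
    and "\<forall>\<^sub>F \<epsilon> in at_right 0. \<forall>k\<in>{1..m}. a \<epsilon> k < C * \<epsilon>"
    and "\<And>k. k \<in> {1..m} \<Longrightarrow> \<mu> k \<ge> 0"
    and "\<And>k. DIM('a) = 2 \<Longrightarrow> k \<in> {1..m} \<Longrightarrow>
           ((\<lambda>\<epsilon>. inverse (\<epsilon>\<^sup>2) * inverse (- ln (a \<epsilon> k))) \<longlongrightarrow> \<mu> k) (at_right 0)"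
    and "\<And>k. DIM('a) \<ge> 3 \<Longrightarrow> k \<in> {1..m} \<Longrightarrow>
           ((\<lambda>\<epsilon>. inverse (\<epsilon> ^ DIM('a)) * a \<epsilon> k ^ (DIM('a) - 2)) \<longlongrightarrow> \<mu> k) (at_right 0)"
    and "\<forall>\<^sub>F \<epsilon> in at_right 0.
           weak_solution (\<Omega> - holes A \<Lambda> m F N x a \<epsilon>) (\<lambda>_. 0) f (u\<epsilon> \<epsilon>)"
  shows "\<exists>u. weak_solution \<Omega>
               (\<lambda>y. mu_const A * (\<Sum>k=1..m. \<mu> k * real (N k) * indicator (F k) y)) f u \<and>
             weakly_tends_H10 \<Omega>
               (\<lambda>\<epsilon>. zero_ext (\<Omega> - holes A \<Lambda> m F N x a \<epsilon>) (u\<epsilon> \<epsilon>)) u (at_right 0)"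
proof -
  note solutions = assms(22)
  obtain r0 where "\<And>y. y \<in> \<Omega> \<Longrightarrow> norm y \<le> r0" using \<open>bounded \<Omega>\<close> unfolding bounded_iff by blast
  \<comment> \<open>The maximum enforces a nonnegative radius also when \<open>\<Omega>\<close> is
    empty and \<open>r0\<close> is arbitrary.\<close>
  then have ball: "\<Omega> \<subseteq> cball 0 (max 0 r0)" by (auto simp: le_max_iff_disj)
  interpret perforation A \<Lambda> \<Omega> f m F N C x a \<mu> "max 0 r0"
    by unfold_locales (use assms ball in \<open>simp_all add: L2_iff_sqi\<close>)
  interpret H: bounded_potential \<Omega> V "mu_const A * (\<Sum>k=1..m. \<mu> k * real (N k))" "max 0 r0"
    by unfold_locales (use open_\<Omega> ball V_bounds measurable_restrict_space1[OF V_measurable] in auto)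
  have form: "H.bform u g \<phi> (gradient \<phi>) = form u g \<phi>" for u g \<phi> by (rule H.bform_def)
  let ?l = "\<lambda>\<phi>. LINT y|M. f y * \<phi> y"
  \<comment> \<open>The homogenised solution is obtained directly by minimisation, so its existence
    does not depend on extracting limits from the perforated solutions.\<close>
  have "\<exists>u g. H10_pair \<Omega> u g \<and> (\<forall>\<phi>\<in>test_functions \<Omega>. H.bform u g \<phi> (gradient \<phi>) = ?l \<phi>)"
  proof (rule H.Riesz_test[where l = ?l and C = "nrm2 M f * (2 * max 0 r0)"])
    fix \<phi> \<psi> :: "'a \<Rightarrow> real" assume t: "\<phi> \<in> test_functions \<Omega>"
    note i = sqi_mult[OF f test_sqi(1)[OF t \<Omega>_sets]]
    show "?l (\<lambda>y. \<phi> y + \<psi> y) = ?l \<phi> + ?l \<psi>" if "\<psi> \<in> test_functions \<Omega>"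
      using Bochner_Integration.integral_add[OF i sqi_mult[OF f test_sqi(1)[OF that \<Omega>_sets]]] by (simp only: distrib_left)
    have "\<bar>?l \<phi>\<bar> \<le> nrm2 M f * nrm2 M \<phi>" by (rule nrm2_Cauchy_Schwarz_real[OF f test_sqi(1)[OF t \<Omega>_sets]])
    also have "\<dots> \<le> nrm2 M f * (2 * max 0 r0 * nrm2 M (gradient \<phi>))"
      by (intro mult_left_mono Poincare_test[OF \<Omega>_sets ball _ t] nrm2_nonneg) simp
    finally show "\<bar>?l \<phi>\<bar> \<le> nrm2 M f * (2 * max 0 r0) * nrm2 M (gradient \<phi>)" by (simp only: mult.assoc)
  next
    fix c and \<phi> :: "'a \<Rightarrow> real"
    have "?l (\<lambda>y. c * \<phi> y) = (LINT y|M. c * (f y * \<phi> y))" by (simp only: mult.left_commute)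
    then show "?l (\<lambda>y. c * \<phi> y) = c * ?l \<phi>" by simp
  qed
  then obtain u g where p: "H10_pair \<Omega> u g" and eq: "\<And>\<phi>. \<phi> \<in> test_functions \<Omega> \<Longrightarrow> H.bform u g \<phi> (gradient \<phi>) = ?l \<phi>" by blast
  note s = H10_pair_sqi[OF p]
  have "weak_solution \<Omega> V f u"
    unfolding weak_solution_def
  proof (intro conjI ballI)
    show uH: "u \<in> H10 \<Omega>" by (rule H10_iff(2)[OF open_\<Omega> p])
    fix \<phi> assume t: "\<phi> \<in> test_functions \<Omega>"
    note s\<phi> = test_sqi[OF t \<Omega>_sets]
    have sw: "sqi M (weak_gradient \<Omega> u)" by (rule H10_pair_sqi(2)[OF H10_iff(1)[OF open_\<Omega> uH]])
    \<comment> \<open>The equation holds with the gradient of the pair, whereas the notion of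
      solution uses the selected weak gradient; they agree almost everywhere, which suffices under
      the integral.\<close>
    have ae: "AE y in M. weak_gradient \<Omega> u y \<bullet> gradient \<phi> y = g y \<bullet> gradient \<phi> y"
      using H10_iff(3)[OF open_\<Omega> p] by eventually_elim simp
    have gi: "(LINT y|M. weak_gradient \<Omega> u y \<bullet> gradient \<phi> y) = (LINT y|M. g y \<bullet> gradient \<phi> y)"
      by (rule integral_cong_AE[OF _ _ ae]) (auto intro: borel_measurable_integrable sqi_inner sw s(2) s\<phi>(2))
    have "(LINT y|M. weak_gradient \<Omega> u y \<bullet> gradient \<phi> y + V y * u y * \<phi> y)
      = (LINT y|M. weak_gradient \<Omega> u y \<bullet> gradient \<phi> y) + (LINT y|M. V y * u y * \<phi> y)"
      by (rule Bochner_Integration.integral_add[OF H.bform_integrable(1)[OF s(1) sw s\<phi>] H.bform_integrable(2)[OF s(1) sw s\<phi>]])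
    also have "\<dots> = ?l \<phi>" using eq[OF t] unfolding form gi .
    finally show "(LINT y|M. weak_gradient \<Omega> u y \<bullet> gradient \<phi> y + V y * u y * \<phi> y) = ?l \<phi>" .
  qed
  moreover have "weakly_tends_H10 \<Omega> (\<lambda>\<epsilon>. zero_ext (\<Omega> - T \<epsilon>) (u\<epsilon> \<epsilon>)) u (at_right 0)"
  proof (rule H.weakly_tends_H10I[OF _ p])
    show "\<forall>\<^sub>F \<epsilon> in at_right 0. H10_pair \<Omega> (zero_ext (\<Omega> - T \<epsilon>) (u\<epsilon> \<epsilon>))
        (\<lambda>y. if y \<in> \<Omega> - T \<epsilon> then weak_gradient (\<Omega> - T \<epsilon>) (u\<epsilon> \<epsilon>) y else 0) \<and>
      nrm2 M (\<lambda>y. if y \<in> \<Omega> - T \<epsilon> then weak_gradient (\<Omega> - T \<epsilon>) (u\<epsilon> \<epsilon>) y else 0) \<le> 2 * max 0 r0 * nrm2 M f"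
      using eventually_good solutions
    proof eventually_elim
      case (elim \<epsilon>)
      note P = perforated_solution[OF elim]
      show ?case using P(9) P(7) unfolding P(11) by (rule conjI)
    qed
    show "((\<lambda>\<epsilon>. H.bform (zero_ext (\<Omega> - T \<epsilon>) (u\<epsilon> \<epsilon>)) (\<lambda>y. if y \<in> \<Omega> - T \<epsilon> then weak_gradient (\<Omega> - T \<epsilon>) (u\<epsilon> \<epsilon>) y else 0) \<phi> (gradient \<phi>))
      \<longlongrightarrow> H.bform u g \<phi> (gradient \<phi>)) (at_right 0)" if t: "\<phi> \<in> test_functions \<Omega>" for \<phi>
      unfolding eq[OF t] unfolding form by (rule homogenized_limit[OF solutions t])
  qed
  ultimately show ?thesis unfolding V_def[abs_def] by blast
qed

end
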